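(* Let $K$ be a number field unramified above $2$ and let $f(T) = T^2 + c \in K[T]$ be postcritically finite. Then there exists a constant $C = C(K, f) > 0$ such that $\hat h_f(\alpha) \ge C$ for all wandering $\alpha \in K^{\mathrm{cyc,\,unr\ 2}}$.
   Context: Fix an algebraic closure $\overline K$ of the number field $K$. "Unramified above $2$" means every prime ideal of $K$ above $2$ has ramification index $1$ over $2$. The field $K^{\mathrm{cyc,\,unr\ 2}}=\bigcup_{n\ \mathrm{odd}}K(\zeta_n)\subset\overline K$, where $\zeta_n$ is a primitive $n$th root of unity and $n$ runs over odd positive integers. For a polynomial $f\in K[T]$ of degree at least $2$, $f^0(T)=T$ and $f^n$ denotes the $n$-fold iterate. An element $\alpha\in\overline K$ is preperiodic (for $f$) if its forward orbit $\{f^n(\alpha): n\ge 0\}$ is finite, and wandering otherwise. The polynomial $f(T)=T^2+c$ is postcritically finite (PCF) if $0$ is preperiodic for $f$. The canonical (Call--Silverman) height is the unique function $\hat h_f\colon \overline K\to\mathbb R_{\ge 0}$ such that $\hat h_f(f(\alpha))=\deg f\cdot \hat h_f(\alpha)$ for all $\alpha$ and $\hat h_f(\alpha)=h(\alpha)+O(1)$, where $h$ is the absolute logarithmic Weil height. *)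

theory Defs
  imports Complex_Main "HOL-Library.FuncSet" "HOL-Algebra.Algebra"
    "HOL-Algebra.Algebraic_Closure_Type"
begin

text \<open>
  Everything takes place inside one ambient field of characteristic zero, which is a type; number
  fields are subsets of it. In the intended use the ambient type is itself an algebraic closure of
  the number field under consideration, in the sense of the library locale
  \<^locale>\<open>algebraic_closure\<close>, and so has no transcendental elements.
\<close>

abbreviation ambient :: "'a::field ring" where
  "ambient \<equiv> ring_of_type_algebra"


subsection \<open>Number fields, rings of integers, primes\<close>

definition number_field :: "'a::field_char_0 set \<Rightarrow> bool" where
  "number_field L \<longleftrightarrow> subfield L ambient \<and> ring.finite_dimension ambient \<rat> L"

definition nf_degree :: "'a::field_char_0 set \<Rightarrow> nat" where
  "nf_degree L = ring.dim ambient \<rat> L"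

definition integers_of :: "'a::field_char_0 set \<Rightarrow> 'a ring" where
  "integers_of L = ambient\<lparr>carrier := {x \<in> L. algebraic_int x}\<rparr>"

definition finite_places :: "'a::field_char_0 set \<Rightarrow> 'a set set" where
  "finite_places L = {P. primeideal P (integers_of L) \<and> P \<noteq> {0}}"

text \<open>
  For a nonzero integer \<open>x\<close> of \<open>L\<close>, the exponent of \<open>P\<close> in the factorisation of the principal
  ideal generated by \<open>x\<close>. Powers of \<open>P\<close> are taken in the multiplicative monoid of ideals, so that
  the zeroth power is the whole ring.
\<close>
definition int_ord :: "'a::field_char_0 set \<Rightarrow> 'a set \<Rightarrow> 'a \<Rightarrow> nat" where
  "int_ord L P x = (GREATEST k. x \<in> P [^]\<^bsub>ideals_set (integers_of L)\<^esub> (k::nat))"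

text \<open>The \<open>P\<close>-adic valuation of a nonzero element of \<open>L\<close>, written as a fraction of integers.\<close>
definition place_ord :: "'a::field_char_0 set \<Rightarrow> 'a set \<Rightarrow> 'a \<Rightarrow> int" where
  "place_ord L P x = (THE n. \<exists>a b. a \<in> carrier (integers_of L) \<and> b \<in> carrier (integers_of L) \<and>
      a \<noteq> 0 \<and> b \<noteq> 0 \<and> x = a / b \<and> n = int (int_ord L P a) - int (int_ord L P b))"

definition ramification_index :: "'a::field_char_0 set \<Rightarrow> 'a set \<Rightarrow> nat \<Rightarrow> nat" where
  "ramification_index L P p = int_ord L P (of_nat p)"

definition unramified_above :: "'a::field_char_0 set \<Rightarrow> nat \<Rightarrow> bool" where
  "unramified_above L p \<longleftrightarrow>
     (\<forall>P \<in> finite_places L. of_nat p \<in> P \<longrightarrow> ramification_index L P p = 1)"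

definition place_norm :: "'a::field_char_0 set \<Rightarrow> 'a set \<Rightarrow> nat" where
  "place_norm L P = card (carrier (integers_of L Quot P))"


subsection \<open>The absolute logarithmic Weil height\<close>

text \<open>
  Restricting to \<^const>\<open>extensional\<close> functions makes each embedding of \<open>L\<close> into the complex numbers
  be counted exactly once.
\<close>
definition complex_embeddings :: "'a::field_char_0 set \<Rightarrow> ('a \<Rightarrow> complex) set" where
  "complex_embeddings L = ring_hom (ambient\<lparr>carrier := L\<rparr>) ambient \<inter> extensional L"

text \<open>
  The absolute value at \<open>P\<close>, already raised to the local degree: if \<open>|.|\<^sub>v\<close> extends the standard
  \<open>p\<close>-adic absolute value of the rationals, this is \<open>|x|\<^sub>v\<close> to the power \<open>[L\<^sub>v : Q\<^sub>p]\<close>.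
\<close>
definition finite_abs :: "'a::field_char_0 set \<Rightarrow> 'a set \<Rightarrow> 'a \<Rightarrow> real" where
  "finite_abs L P x =
     (if x = 0 then 0 else real (place_norm L P) powr (- real_of_int (place_ord L P x)))"

text \<open>
  The usual sum over all places of \<open>L\<close> of \<open>[L\<^sub>v : Q\<^sub>v] log max(1, |x|\<^sub>v)\<close>, divided by \<open>[L : Q]\<close>. The
  archimedean local degrees are accounted for by summing over embeddings, a complex place being a
  pair of conjugate embeddings; the sum over finite places is restricted to the
  (finitely many) ones with a nonzero contribution.
\<close>
definition height_via :: "'a::field_char_0 set \<Rightarrow> 'a \<Rightarrow> real" where
  "height_via L x =
     ((\<Sum>\<sigma> \<in> complex_embeddings L. ln (max 1 (cmod (\<sigma> x)))) +
      (\<Sum>P \<in> {P \<in> finite_places L. finite_abs L P x > 1}. ln (max 1 (finite_abs L P x))))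
     / real (nf_degree L)"

text \<open>
  The value does not depend on the number field containing \<open>x\<close>; we use the smallest one, which is
  the field generated by \<open>x\<close> over the prime field.
\<close>
definition weil_height :: "'a::field_char_0 \<Rightarrow> real" where
  "weil_height x = height_via (generate_field ambient {x}) x"


subsection \<open>Dynamics\<close>

definition preperiodic :: "'a::field_char_0 Polynomial.poly \<Rightarrow> 'a \<Rightarrow> bool" where
  "preperiodic f x \<longleftrightarrow> finite (range (\<lambda>n::nat. ((Polynomial.poly f) ^^ n) x))"

abbreviation wandering :: "'a::field_char_0 Polynomial.poly \<Rightarrow> 'a \<Rightarrow> bool" where
  "wandering f x \<equiv> \<not> preperiodic f x"

definition unicritical_quadratic :: "'a::field_char_0 \<Rightarrow> 'a Polynomial.poly" where
  "unicritical_quadratic c = [:c, 0, 1:]"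

text \<open>The only critical point of \<open>T\<^sup>2 + c\<close> in the affine line is \<open>0\<close>.\<close>
definition quadratic_PCF :: "'a::field_char_0 \<Rightarrow> bool" where
  "quadratic_PCF c \<longleftrightarrow> preperiodic (unicritical_quadratic c) 0"

definition canonical_height :: "'a::field_char_0 Polynomial.poly \<Rightarrow> 'a \<Rightarrow> real" where
  "canonical_height f = (THE hh.
     (\<forall>x. hh x \<ge> 0) \<and>
     (\<forall>x. hh (Polynomial.poly f x) = real (Polynomial.degree f) * hh x) \<and>
     (\<exists>B. \<forall>x. \<bar>hh x - weil_height x\<bar> \<le> B))"


subsection \<open>Cyclotomic extensions of odd level\<close>

definition primitive_root_of_unity :: "nat \<Rightarrow> 'a::field_char_0 \<Rightarrow> bool" where
  "primitive_root_of_unity n z \<longleftrightarrow> n > 0 \<and> z ^ n = 1 \<and> (\<forall>k. 0 < k \<and> k < n \<longrightarrow> z ^ k \<noteq> 1)"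

definition cyc_unr2 :: "'a::field_char_0 set \<Rightarrow> 'a set" where
  "cyc_unr2 K =
     (\<Union>n \<in> {n. odd n}. \<Union>z \<in> {z. primitive_root_of_unity n z}.
        generate_field ambient (insert z K))"

end

theory Submission
  imports Defs "Jordan_Normal_Form.Char_Poly" "HOL-Computational_Algebra.Computational_Algebra"
begin

text \<open>
  Since 2 is unramified, the ring of integers of \<open>K\<close> modulo 2 is a finite reduced ring, so there is
  \<open>q = 2\<^sup>m\<close> such that \<open>x\<^sup>q = x\<close> in it; for a suitable \<open>m\<close> also \<open>f\<^sup>m(0) = 0\<close> in it, whence
  \<open>f\<^sup>m = T\<^sup>q\<close> modulo 2. Over \<open>L = K(\<zeta>)\<close>, with \<open>\<zeta>\<close> a root of unity of odd order, the map \<open>\<zeta> \<mapsto> \<zeta>\<^sup>q\<close>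
  extends to a homomorphism \<open>\<sigma>\<close> over \<open>K\<close> that is the \<open>q\<close>-th power map modulo 2. Thus \<open>f\<^sup>m(\<alpha>)\<close> and \<open>\<sigma>(\<alpha>)\<close>
  are congruent modulo 2, up to denominators, and each further application of \<open>f = T\<^sup>2 + c\<close> improves the
  congruence by a factor 2, so \<open>f\<^sup>m\<^sup>+\<^sup>k(\<alpha>)\<close> and \<open>\<sigma>(f\<^sup>k(\<alpha>))\<close> are congruent modulo \<open>2\<^sup>k\<^sup>+\<^sup>1\<close>. If they differ, the
  product formula bounds \<open>k log 2\<close> by the sum of their heights, which for a large fixed \<open>k\<close> bounds the
  canonical height of \<open>\<alpha>\<close> from below. If they agree, \<open>\<alpha>\<close> has canonical height 0, and Northcott's
  theorem makes it preperiodic.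

  The Weil height of \<open>x\<close> enters through the Mahler measure of the minimal integer polynomial of \<open>x\<close>: the
  finite places contribute the logarithm of the index of the denominator ideal of \<open>x\<close> in the integers of
  \<open>\<rat>(x)\<close>, and this index is the leading coefficient.
\<close>

hide_const (open) Polynomials.degree Polynomials.lead_coeff UnivPoly.coeff UnivPoly.monom Module.smult
  Divisibility.irreducible Divisibility.prime

section \<open>Algebraic integers\<close>

text \<open>The point \<alpha> need not be integral, so no congruence modulo a power of 2 can be
  stated for it directly. It is replaced by membership of the difference in a multiple of the
  product of the fractional ideals (1, y) and (1, z): the denominators occurring there are those
  that the heights of y and z pay for, and the shape survives T^2 + c with integral c. Postcritical
  finiteness supplies the integrality of c. Unramifiedness makes squaring injective modulo 2; hence
  Frobenius has finite order on the finite residue ring, and the critical orbit is periodic, not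
  merely preperiodic, modulo 2. Uniformity comes from m depending on K and c alone: Frobenius on
  K(\<zeta>) is read off from \<zeta> |-> \<zeta>^q whatever the level is, because an odd level is
  invertible modulo 2. Heights of different elements are compared inside one list of complex
  embeddings of a common field; Newton's identities keep its traces rational, and Gauss's lemma for
  polynomials with algebraic integer coefficients controls the denominators.\<close>

definition zspan :: "'a::field_char_0 set \<Rightarrow> 'a set" where
  "zspan V = {y. \<exists>f. y = (\<Sum>v\<in>V. of_int (f v) * v)}"

lemma zspan_0: "0 \<in> zspan V"
  unfolding zspan_def by (auto intro!: exI[of _ "\<lambda>_. 0"])

lemma zspan_add: "a \<in> zspan V \<Longrightarrow> b \<in> zspan V \<Longrightarrow> a + b \<in> zspan V"
proof -
  assume "a \<in> zspan V" "b \<in> zspan V"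
  then obtain f g where "a = (\<Sum>v\<in>V. of_int (f v) * v)" "b = (\<Sum>v\<in>V. of_int (g v) * v)"
    unfolding zspan_def by auto
  hence "a + b = (\<Sum>v\<in>V. of_int (f v + g v) * v)"
    by (simp add: sum.distrib algebra_simps)
  thus ?thesis unfolding zspan_def by (intro CollectI exI[of _ "\<lambda>v. f v + g v"])
qed

lemma zspan_scale: "a \<in> zspan V \<Longrightarrow> of_int k * a \<in> zspan V"
proof -
  assume "a \<in> zspan V"
  then obtain f where "a = (\<Sum>v\<in>V. of_int (f v) * v)" unfolding zspan_def by auto
  hence "of_int k * a = (\<Sum>v\<in>V. of_int (k * f v) * v)"
    by (simp add: sum_distrib_left algebra_simps)
  thus ?thesis unfolding zspan_def by (intro CollectI exI[of _ "\<lambda>v. k * f v"])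
qed

lemma zspan_minus: "a \<in> zspan V \<Longrightarrow> - a \<in> zspan V"
  using zspan_scale[of a V "-1"] by simp

lemma zspan_sum: "(\<And>i. i \<in> I \<Longrightarrow> g i \<in> zspan V) \<Longrightarrow> sum g I \<in> zspan V"
  by (induction I rule: infinite_finite_induct) (auto intro: zspan_0 zspan_add)

lemma zspan_base: "finite V \<Longrightarrow> v \<in> V \<Longrightarrow> v \<in> zspan V"
proof -
  assume "finite V" "v \<in> V"
  hence "v = (\<Sum>w\<in>V. if w = v then w else 0)" by (simp add: sum.delta)
  also have "\<dots> = (\<Sum>w\<in>V. of_int (if w = v then 1 else 0) * w)" by (rule sum.cong) auto
  finally show "v \<in> zspan V" unfolding zspan_def by (intro CollectI exI[of _ "\<lambda>w. if w = v then 1 else 0"])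
qed

lemma zspan_mult:
  assumes "y \<in> zspan V" "\<And>v. v \<in> V \<Longrightarrow> z * v \<in> zspan W"
  shows "z * y \<in> zspan W"
proof -
  obtain f where y: "y = (\<Sum>v\<in>V. of_int (f v) * v)" using assms(1) unfolding zspan_def by auto
  have "z * y = (\<Sum>v\<in>V. of_int (f v) * (z * v))"
    by (simp add: y sum_distrib_left algebra_simps)
  thus ?thesis using assms(2) by (auto intro!: zspan_sum zspan_scale)
qed

text \<open>A finitely generated Z-module that multiplication by z maps into itself. The element 1
  keeps it nonzero, which the eigenvector argument requires.\<close>

definition stab_lattice :: "'a::field_char_0 \<Rightarrow> 'a set \<Rightarrow> bool" where
  "stab_lattice z V \<longleftrightarrow> finite V \<and> 1 \<in> V \<and> (\<forall>v\<in>V. z * v \<in> zspan V)"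

text \<open>Determinant trick: the elements of V form an eigenvector, with eigenvalue z, of the
  integer matrix of multiplication by z, so z is a root of the monic integral characteristic
  polynomial of that matrix.\<close>

lemma algebraic_int_if_stab_lattice:
  assumes "stab_lattice z V"
  shows "algebraic_int z"
proof -
  have fin: "finite V" and one: "1 \<in> V" and st: "\<forall>v\<in>V. z * v \<in> zspan V"
    using assms by (auto simp: stab_lattice_def)
  from st have "\<forall>v. \<exists>f. v \<in> V \<longrightarrow> z * v = (\<Sum>w\<in>V. of_int (f w) * w)"
    unfolding zspan_def by auto
  then obtain f where f: "\<And>v. v \<in> V \<Longrightarrow> z * v = (\<Sum>w\<in>V. of_int (f v w) * w)" by metis
  define n where "n = card V"
  obtain h where h: "bij_betw h {0..<n} V" using ex_bij_betw_nat_finite[OF fin] unfolding n_def by blast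
  define A :: "int mat" where "A = mat n n (\<lambda>(i,j). f (h i) (h j))"
  let ?A = "map_mat (of_int :: int \<Rightarrow> 'a) A"
  let ?v = "vec n h"
  have A: "A \<in> carrier_mat n n" unfolding A_def by simp
  hence A': "?A \<in> carrier_mat n n" by simp
  have hV: "i < n \<Longrightarrow> h i \<in> V" for i using h by (auto dest: bij_betwE)
  have "?A *\<^sub>v ?v = z \<cdot>\<^sub>v ?v"
  proof (rule eq_vecI)
    fix i assume "i < dim_vec (z \<cdot>\<^sub>v ?v)"
    hence i: "i < n" by simp
    have "(?A *\<^sub>v ?v) $ i = (\<Sum>j = 0..<n. of_int (f (h i) (h j)) * h j)"
      using i by (simp add: A_def scalar_prod_def)
    also have "\<dots> = (\<Sum>w\<in>V. of_int (f (h i) w) * w)"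
      by (rule sum.reindex_bij_betw[OF h, of "\<lambda>w. of_int (f (h i) w) * w"])
    also have "\<dots> = z * h i" using f[OF hV[OF i]] by simp
    finally show "(?A *\<^sub>v ?v) $ i = (z \<cdot>\<^sub>v ?v) $ i" using i by simp
  qed (simp add: A_def)
  moreover have "?v \<noteq> 0\<^sub>v n"
  proof -
    from one h obtain i where i: "i < n" "h i = 1" by (metis atLeastLessThan_iff bij_betw_iff_bijections)
    hence "?v $ i \<noteq> 0\<^sub>v n $ i" by simp
    thus ?thesis by metis
  qed
  ultimately have "eigenvector ?A ?v z" using A' unfolding eigenvector_def by auto
  hence "eigenvalue ?A z" unfolding eigenvalue_def by blast
  hence "poly (char_poly ?A) z = 0" using eigenvalue_root_char_poly[OF A'] by simp
  hence "poly (of_int_poly (char_poly A)) z = 0" by (simp add: of_int_hom.char_poly_hom[OF A])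
  moreover have "monic (char_poly A)" using degree_monic_char_poly[OF A] by auto
  ultimately show ?thesis unfolding algebraic_int_altdef_ipoly by blast
qed

text \<open>The products of two spanning sets carry the actions of both. Iterated, this gives
  finitely many integers one common module, on which their sums and products act as well.\<close>

lemma stab_lattice_mult_set:
  assumes "stab_lattice x V" "finite W" "1 \<in> W"
  shows "stab_lattice x ((\<lambda>(v,w). v * w) ` (V \<times> W))"
    and "stab_lattice x ((\<lambda>(v,w). v * w) ` (W \<times> V))"
proof -
  let ?U = "(\<lambda>(v,w). v * w) ` (V \<times> W)"
  have fin: "finite ?U" using assms by (auto simp: stab_lattice_def)
  have "x * (v * w) \<in> zspan ?U" if "v \<in> V" "w \<in> W" for v w
  proof -
    have "x * v \<in> zspan V" using assms that by (auto simp: stab_lattice_def)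
    hence "w * (x * v) \<in> zspan ?U"
      by (rule zspan_mult) (use fin that in \<open>auto intro!: zspan_base simp: mult.commute\<close>)
    thus ?thesis by (simp add: mult_ac)
  qed
  moreover have "1 \<in> ?U" using assms by (auto simp: stab_lattice_def intro!: image_eqI[of _ _ "(1,1)"])
  ultimately show 1: "stab_lattice x ?U" using fin by (auto simp: stab_lattice_def)
  have "?U = (\<lambda>(v,w). v * w) ` (W \<times> V)" by (auto simp: image_iff mult.commute) (metis mult.commute)+
  thus "stab_lattice x ((\<lambda>(v,w). v * w) ` (W \<times> V))" using 1 by simp
qed

text \<open>Transitivity of integrality: the products z^i v with i < degree p span a stable module,
  since p rewrites z^n through lower powers and its coefficients preserve the span of V.\<close>

lemma stab_lattice_powers:
  assumes mon: "monic p" and root: "poly p z = 0"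
    and st: "\<And>i. stab_lattice (coeff p i) V"
  shows "\<exists>U. stab_lattice z U"
proof -
  define n where "n = degree p"
  have n: "n > 0"
  proof (rule ccontr)
    assume "\<not> n > 0"
    then obtain b where "p = [:b:]" unfolding n_def using degree_eq_zeroE[of p] by auto
    with mon root show False by simp
  qed
  have V: "finite V" "1 \<in> V" using st[of 0] by (auto simp: stab_lattice_def)
  let ?U = "(\<lambda>(i,v). z ^ i * v) ` ({..<n} \<times> V)"
  have fin: "finite ?U" using V by auto
  have zn: "z ^ n = - (\<Sum>i<n. coeff p i * z ^ i)"
  proof -
    have "0 = (\<Sum>i\<le>n. coeff p i * z ^ i)" using root by (simp add: poly_altdef n_def)
    also have "\<dots> = (\<Sum>i<n. coeff p i * z ^ i) + z ^ n"
      using mon by (simp add: n_def lessThan_Suc_atMost[symmetric])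
    finally show ?thesis by (simp add: eq_neg_iff_add_eq_0 add.commute)
  qed
  have "z * (z ^ i * v) \<in> zspan ?U" if i: "i < n" and v: "v \<in> V" for i v
  proof (cases "Suc i < n")
    case True
    have "z * (z ^ i * v) = z ^ Suc i * v" by simp
    moreover have "z ^ Suc i * v \<in> ?U" using True v by (intro image_eqI[of _ _ "(Suc i, v)"]) auto
    ultimately show ?thesis using fin by (metis zspan_base)
  next
    case False
    hence "Suc i = n" using i by simp
    hence "z * (z ^ i * v) = z ^ n * v" by (metis mult.assoc power_Suc)
    also have "\<dots> = (\<Sum>j<n. - (z ^ j * (coeff p j * v)))"
      by (simp add: zn sum_distrib_right sum_distrib_left sum_negf mult_ac)
    also have "\<dots> \<in> zspan ?U"
    proof (rule zspan_sum, rule zspan_minus)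
      fix j assume j: "j \<in> {..<n}"
      have "coeff p j * v \<in> zspan V" using st v by (auto simp: stab_lattice_def)
      thus "z ^ j * (coeff p j * v) \<in> zspan ?U"
        by (rule zspan_mult) (use j fin in \<open>auto intro!: zspan_base\<close>)
    qed
    finally show ?thesis .
  qed
  moreover have "1 \<in> ?U" using n V by (auto intro!: image_eqI[of _ _ "(0,1)"])
  ultimately show ?thesis using fin by (intro exI[of _ ?U]) (auto simp: stab_lattice_def)
qed

lemma stab_lattice_Ints: "x \<in> \<int> \<Longrightarrow> stab_lattice x {1}"
  by (auto simp: stab_lattice_def zspan_def Ints_def)

lemma algebraic_int_iff_stab_lattice: "algebraic_int z \<longleftrightarrow> (\<exists>V. stab_lattice z V)"
  using algebraic_int_if_stab_lattice stab_lattice_powers[of _ z "{1}"]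
  by (metis algebraic_int.cases stab_lattice_Ints)

lemma stab_lattice_common:
  assumes "finite C" "\<And>c. c \<in> C \<Longrightarrow> algebraic_int c"
  shows "\<exists>V. finite V \<and> 1 \<in> V \<and> (\<forall>c\<in>C. stab_lattice c V)"
  using assms
proof (induction C rule: finite_induct)
  case empty
  show ?case by (intro exI[of _ "{1}"]) auto
next
  case (insert x F)
  then obtain V where V: "finite V" "1 \<in> V" "\<forall>c\<in>F. stab_lattice c V" by auto
  obtain W where W: "stab_lattice x W" using insert.prems algebraic_int_iff_stab_lattice by auto
  hence W': "finite W" "1 \<in> W" by (auto simp: stab_lattice_def)
  have "\<forall>c\<in>insert x F. stab_lattice c ((\<lambda>(v,w). v * w) ` (V \<times> W))"
    using stab_lattice_mult_set[OF _ W'] stab_lattice_mult_set[OF W V(1,2)] V by auto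
  thus ?case using V W' by (intro exI[of _ "(\<lambda>(v,w). v * w) ` (V \<times> W)"])
    (auto intro!: image_eqI[of _ _ "(1,1)"])
qed

lemma stab_lattice_add:
  "stab_lattice x V \<Longrightarrow> stab_lattice y V \<Longrightarrow> stab_lattice (x + y) V"
  by (auto simp: stab_lattice_def ring_distribs intro: zspan_add)

lemma stab_lattice_mult:
  "stab_lattice x V \<Longrightarrow> stab_lattice y V \<Longrightarrow> stab_lattice (x * y) V"
  by (auto simp: stab_lattice_def mult.assoc intro: zspan_mult)

lemma algebraic_int_add [intro]:
  fixes x y :: "'a::field_char_0"
  shows "algebraic_int x \<Longrightarrow> algebraic_int y \<Longrightarrow> algebraic_int (x + y)"
  using stab_lattice_common[of "{x,y}"] stab_lattice_add algebraic_int_if_stab_lattice by blast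

lemma algebraic_int_mult [intro]:
  fixes x y :: "'a::field_char_0"
  shows "algebraic_int x \<Longrightarrow> algebraic_int y \<Longrightarrow> algebraic_int (x * y)"
  using stab_lattice_common[of "{x,y}"] stab_lattice_mult algebraic_int_if_stab_lattice by blast

lemma algebraic_int_diff [intro]:
  fixes x y :: "'a::field_char_0"
  shows "algebraic_int x \<Longrightarrow> algebraic_int y \<Longrightarrow> algebraic_int (x - y)"
  using algebraic_int_add[of x "-y"] by auto

lemma algebraic_int_1 [simp, intro]: "algebraic_int (1::'a::field_char_0)"
  by (rule int_imp_algebraic_int) auto

lemma algebraic_int_of_int [simp, intro]: "algebraic_int (of_int k :: 'a::field_char_0)"
  by (rule int_imp_algebraic_int) auto

lemma algebraic_int_power [intro]:
  "algebraic_int (x::'a::field_char_0) \<Longrightarrow> algebraic_int (x ^ n)"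
  by (induction n) auto

lemma algebraic_int_sum [intro]:
  "(\<And>i. i \<in> I \<Longrightarrow> algebraic_int (f i :: 'a::field_char_0)) \<Longrightarrow> algebraic_int (sum f I)"
  by (induction I rule: infinite_finite_induct) auto

lemma algebraic_int_prod [intro]:
  "(\<And>i. i \<in> I \<Longrightarrow> algebraic_int (f i :: 'a::field_char_0)) \<Longrightarrow> algebraic_int (prod f I)"
  by (induction I rule: infinite_finite_induct) auto

section \<open>Polynomials with algebraic integer coefficients, and Gauss's lemma for them\<close>

definition aipoly :: "'a::field_char_0 poly \<Rightarrow> bool" where
  "aipoly p \<longleftrightarrow> (\<forall>i. algebraic_int (coeff p i))"

lemma aipoly_0 [simp]: "aipoly 0" by (simp add: aipoly_def)
lemma aipoly_1 [simp]: "aipoly 1" by (simp add: aipoly_def coeff_1)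
lemma aipoly_add: "aipoly p \<Longrightarrow> aipoly q \<Longrightarrow> aipoly (p + q)" by (auto simp: aipoly_def)
lemma aipoly_diff: "aipoly p \<Longrightarrow> aipoly q \<Longrightarrow> aipoly (p - q)" by (auto simp: aipoly_def)
lemma aipoly_mult: "aipoly p \<Longrightarrow> aipoly q \<Longrightarrow> aipoly (p * q)" by (auto simp: aipoly_def coeff_mult)
lemma aipoly_smult: "algebraic_int a \<Longrightarrow> aipoly q \<Longrightarrow> aipoly (smult a q)" by (auto simp: aipoly_def)
lemma aipoly_monom: "algebraic_int a \<Longrightarrow> aipoly (monom a n)" by (auto simp: aipoly_def coeff_monom)
lemma aipoly_pCons: "algebraic_int a \<Longrightarrow> aipoly p \<Longrightarrow> aipoly (pCons a p)"
  by (auto simp: aipoly_def coeff_pCons split: nat.splits)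
lemma aipoly_prod: "(\<And>i. i \<in> I \<Longrightarrow> aipoly (f i)) \<Longrightarrow> aipoly (prod f I)"
  by (induction I rule: infinite_finite_induct) (auto intro: aipoly_mult)
lemma aipoly_sum: "(\<And>i. i \<in> I \<Longrightarrow> aipoly (f i)) \<Longrightarrow> aipoly (sum f I)"
  by (induction I rule: infinite_finite_induct) (auto intro: aipoly_add)
lemma aipoly_of_int_poly [simp]: "aipoly (of_int_poly p)" by (simp add: aipoly_def)
lemma aipoly_poly: "aipoly p \<Longrightarrow> algebraic_int x \<Longrightarrow> algebraic_int (poly p x)"
  by (auto simp: aipoly_def poly_altdef)

lemma algebraic_int_root_aipoly:
  assumes "aipoly p" "monic p" "poly p z = 0"
  shows "algebraic_int z"
proof -
  have "finite (range (coeff p))"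
  proof -
    have "range (coeff p) \<subseteq> insert 0 (coeff p ` {..degree p})" using le_degree by fastforce
    thus ?thesis using finite_subset by blast
  qed
  from stab_lattice_common[OF this] obtain V where "\<forall>i. stab_lattice (coeff p i) V"
    using assms(1) by (auto simp: aipoly_def)
  thus ?thesis using stab_lattice_powers[OF assms(2,3)] algebraic_int_if_stab_lattice by blast
qed

text \<open>Multiplying g(x) = 0 by a^(n-1) turns it into a monic equation for a x; \<open>h\<close>
  is the polynomial of that equation.\<close>

lemma algebraic_int_lead_times_root:
  assumes g: "aipoly g" "poly g x = 0" and a: "a = lead_coeff g"
  shows "algebraic_int (a * x)"
proof (cases "degree g = 0")
  case True
  then obtain b where "g = [:b:]" by (metis degree_eq_zeroE)
  thus ?thesis using g a by auto
next
  case False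
  define n where "n = degree g"
  have n: "n > 0" using False by (simp add: n_def)
  define h where "h = monom 1 n + (\<Sum>i<n. monom (coeff g i * a ^ (n - 1 - i)) i)"
  have ch: "coeff h j = (if j = n then 1 else if j < n then coeff g j * a ^ (n - 1 - j) else 0)" for j
    by (auto simp: h_def coeff_sum coeff_monom)
  have deg: "degree h = n"
    by (rule antisym) (auto simp: ch intro!: degree_le le_degree)
  have "aipoly h"
    using g unfolding aipoly_def ch a by auto
  moreover have "monic h" by (simp add: deg ch)
  moreover have "poly h (a * x) = 0"
  proof -
    have "poly h (a * x) = (\<Sum>j\<le>n. coeff h j * (a * x) ^ j)" by (simp add: poly_altdef deg)
    also have "\<dots> = (\<Sum>j\<le>n. a ^ (n - 1) * (coeff g j * x ^ j))"
    proof (rule sum.cong[OF refl])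
      fix j assume j: "j \<in> {..n}"
      show "coeff h j * (a * x) ^ j = a ^ (n - 1) * (coeff g j * x ^ j)"
      proof (cases "j = n")
        case True
        have "(a * x) ^ n = a ^ (n - 1) * (a * x ^ n)" using n
          by (cases n) (auto simp: power_mult_distrib)
        thus ?thesis using True a by (simp add: ch n_def)
      next
        case False
        hence "a ^ (n - 1) = a ^ (n - 1 - j) * a ^ j" using j by (simp add: power_add[symmetric])
        thus ?thesis using False j by (simp add: ch power_mult_distrib)
      qed
    qed
    also have "\<dots> = a ^ (n - 1) * poly g x" by (simp add: poly_altdef n_def sum_distrib_left)
    finally show ?thesis using g by simp
  qed
  ultimately show ?thesis by (rule algebraic_int_root_aipoly)
qed

text \<open>Gauss's lemma for a linear factor whose root may have denominators. The leading
  coefficient a and a x are both integral, so (T - x) a T^n has integral coefficients and can be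
  subtracted, which lowers the degree of q.\<close>

lemma aipoly_divide_linear:
  assumes "aipoly ([:-x, 1:] * q)"
  shows "aipoly q"
  using assms
proof (induction "degree q" arbitrary: q rule: less_induct)
  case (less q)
  show ?case
  proof (cases "q = 0")
    case False
    define a n where "a = lead_coeff q" and "n = degree q"
    define g where "g = [:-x, 1:] * q"
    have lead: "a = lead_coeff g" unfolding g_def lead_coeff_mult a_def by simp
    have ax: "algebraic_int (a * x)"
    proof (rule algebraic_int_lead_times_root)
      show "aipoly g" using less.prems by (simp only: g_def)
      show "poly g x = 0" by (simp add: g_def)
    qed (rule lead)
    have ai: "algebraic_int a" unfolding lead using less.prems by (simp only: aipoly_def g_def)
    define q' where "q' = q - monom a n"
    have "[:-x, 1:] * monom a n = monom a (Suc n) - monom (a * x) n"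
      by (rule poly_eqI) (auto simp: coeff_pCons coeff_monom mult.commute split: nat.split)
    hence g': "[:-x, 1:] * q' = g - (monom a (Suc n) - monom (a * x) n)"
      by (simp only: q'_def g_def right_diff_distrib)
    have aig: "aipoly ([:-x, 1:] * q')" unfolding g'
      using less.prems ax ai unfolding g_def by (intro aipoly_diff aipoly_monom)
    have "aipoly q'"
    proof (cases "n = 0")
      case True
      then obtain b where "q = [:b:]" using degree_eq_zeroE[of q] n_def by auto
      hence "q' = 0" by (simp add: q'_def a_def n_def monom_0)
      thus ?thesis by simp
    next
      case False
      have "degree q' < n"
      proof -
        have "degree q' \<le> n" unfolding q'_def
          by (rule degree_diff_le) (auto simp: n_def degree_monom_le)
        moreover have "coeff q' n = 0" by (simp add: q'_def a_def n_def)
        ultimately show ?thesis using False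
          by (cases "degree q' = n") auto
      qed
      thus ?thesis using less.hyps aig by (simp add: n_def)
    qed
    hence "aipoly (q' + monom a n)" using ai by (intro aipoly_add aipoly_monom)
    thus ?thesis by (simp add: q'_def)
  qed simp
qed

lemma aipoly_subproduct:
  assumes "finite I" "aipoly (smult A (\<Prod>i\<in>I. [:- x i, 1:]))" "S \<subseteq> I"
  shows "aipoly (smult A (\<Prod>i\<in>S. [:- x i, 1:]))"
proof -
  have "finite (I - S)" using assms(1) by simp
  moreover have "aipoly (smult A (\<Prod>i\<in>S \<union> T. [:- x i, 1:])) \<Longrightarrow> aipoly (smult A (\<Prod>i\<in>S. [:- x i, 1:]))"
    if "finite T" "T \<inter> S = {}" for T
    using that
  proof (induction T rule: finite_induct)
    case (insert t T)
    have fin: "finite S" using assms finite_subset by blast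
    have "(\<Prod>i\<in>S \<union> insert t T. [:- x i, 1:]) = [:- x t, 1:] * (\<Prod>i\<in>S \<union> T. [:- x i, 1:])"
      using insert fin by (simp add: prod.insert)
    hence "aipoly ([:- x t, 1:] * smult A (\<Prod>i\<in>S \<union> T. [:- x i, 1:]))"
      using insert.prems by simp
    hence "aipoly (smult A (\<Prod>i\<in>S \<union> T. [:- x i, 1:]))" by (rule aipoly_divide_linear)
    thus ?case using insert by auto
  qed simp
  ultimately show ?thesis using assms(2,3)
    by (metis Diff_disjoint Un_Diff_cancel inf_commute sup.absorb2)
qed

text \<open>Up to sign this number is the constant term of a partial product, which keeps integral
  coefficients because linear factors can be divided out one by one.\<close>

lemma algebraic_int_subproduct:
  assumes "finite I" "aipoly (smult A (\<Prod>i\<in>I. [:- x i, 1:]))" "S \<subseteq> I"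
  shows "algebraic_int (A * (\<Prod>i\<in>S. x i))"
proof -
  have "algebraic_int (coeff (smult A (\<Prod>i\<in>S. [:- x i, 1:])) 0)"
    using aipoly_subproduct[OF assms] by (simp add: aipoly_def)
  also have "coeff (smult A (\<Prod>i\<in>S. [:- x i, 1:])) 0 = A * (\<Prod>i\<in>S. - x i)"
    by (simp only: poly_0_coeff_0[symmetric] poly_smult poly_prod) simp
  also have "\<dots> = (-1) ^ card S * (A * (\<Prod>i\<in>S. x i))"
    by (simp add: prod_uminus)
  finally show ?thesis by (cases "even (card S)") auto
qed

text \<open>Slice the exponents into layers: the l-th layer collects the indices with l <
  \<open>k i\<close>. Every layer is a product over a subset and absorbs one factor A, and there are
  m layers.\<close>

lemma algebraic_int_power_product:
  assumes "finite I" "aipoly (smult A (\<Prod>i\<in>I. [:- x i, 1:]))" "\<And>i. i \<in> I \<Longrightarrow> k i \<le> m"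
  shows "algebraic_int (A ^ m * (\<Prod>i\<in>I. x i ^ k i))"
proof -
  have "A ^ m * (\<Prod>i\<in>I. x i ^ k i) = (\<Prod>l<m. A * (\<Prod>i\<in>{i\<in>I. l < k i}. x i))"
  proof -
    have "(\<Prod>l<m. \<Prod>i\<in>{i\<in>I. l < k i}. x i) = (\<Prod>l<m. \<Prod>i\<in>I. if l < k i then x i else 1)"
      using assms(1) by (simp add: prod.inter_filter)
    also have "\<dots> = (\<Prod>i\<in>I. \<Prod>l<m. if l < k i then x i else 1)" by (rule prod.swap)
    also have "\<dots> = (\<Prod>i\<in>I. x i ^ k i)"
    proof (rule prod.cong[OF refl])
      fix i assume "i \<in> I"
      hence "{..<m} \<inter> {l. l < k i} = {..<k i}" using assms(3) by fastforce
      thus "(\<Prod>l<m. if l < k i then x i else 1) = x i ^ k i"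
        by (simp add: prod.If_cases)
    qed
    finally show ?thesis by (simp only: prod.distrib prod_constant card_lessThan)
  qed
  also have "algebraic_int \<dots>"
    by (rule algebraic_int_prod, rule algebraic_int_subproduct[OF assms(1,2)]) blast
  finally show ?thesis .
qed

text \<open>The elementary substitute for multiplicativity of content: clearing the denominator of
  \<open>\<Prod>(T - x\<^sub>i)\<close> clears it in every product of polynomial expressions in the \<open>x\<^sub>i\<close>.\<close>
lemma aipoly_norm:
  assumes "finite I" "aipoly (smult A (\<Prod>i\<in>I. [:- x i, 1:]))"
    and "\<And>i k. i \<in> I \<Longrightarrow> k \<le> m \<Longrightarrow> aipoly (u i k)"
  shows "aipoly (smult (A ^ m) (\<Prod>i\<in>I. \<Sum>k\<le>m. smult (x i ^ k) (u i k)))"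
proof -
  have "(\<Prod>i\<in>I. \<Sum>k\<le>m. smult (x i ^ k) (u i k)) =
        (\<Sum>f\<in>PiE I (\<lambda>_. {..m}). \<Prod>i\<in>I. smult (x i ^ f i) (u i (f i)))"
    using assms(1) by (intro prod_sum_PiE) auto
  also have "\<dots> = (\<Sum>f\<in>PiE I (\<lambda>_. {..m}). smult (\<Prod>i\<in>I. x i ^ f i) (\<Prod>i\<in>I. u i (f i)))"
    by (simp add: prod_smult)
  also have "smult (A ^ m) \<dots> = (\<Sum>f\<in>PiE I (\<lambda>_. {..m}). smult (A ^ m * (\<Prod>i\<in>I. x i ^ f i)) (\<Prod>i\<in>I. u i (f i)))"
    by (simp add: smult_sum2)
  also have "aipoly \<dots>"
    by (intro aipoly_sum aipoly_smult aipoly_prod algebraic_int_power_product[OF assms(1,2)] assms(3))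
       (auto simp: PiE_def Pi_def)
  finally show ?thesis .
qed

lemma algebraic_int_norm:
  assumes "finite I" "aipoly (smult A (\<Prod>i\<in>I. [:- x i, 1:]))"
    and "\<And>i k. i \<in> I \<Longrightarrow> k \<le> m \<Longrightarrow> algebraic_int (u i k)"
  shows "algebraic_int (A ^ m * (\<Prod>i\<in>I. \<Sum>k\<le>m. u i k * x i ^ k))"
proof -
  have "aipoly (smult (A ^ m) (\<Prod>i\<in>I. \<Sum>k\<le>m. smult (x i ^ k) [:u i k:]))"
    by (intro aipoly_norm[OF assms(1,2)]) (simp add: aipoly_pCons assms(3))
  hence "algebraic_int (coeff (smult (A ^ m) (\<Prod>i\<in>I. \<Sum>k\<le>m. smult (x i ^ k) [:u i k:])) 0)"
    unfolding aipoly_def by blast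
  also have "coeff (smult (A ^ m) (\<Prod>i\<in>I. \<Sum>k\<le>m. smult (x i ^ k) [:u i k:])) 0 =
      poly (smult (A ^ m) (\<Prod>i\<in>I. \<Sum>k\<le>m. smult (x i ^ k) [:u i k:])) 0"
    by (rule poly_0_coeff_0[symmetric])
  also have "\<dots> = A ^ m * (\<Prod>i\<in>I. \<Sum>k\<le>m. u i k * x i ^ k)"
    by (simp only: poly_smult poly_prod poly_sum) (simp add: mult.commute)
  finally show ?thesis .
qed

lemma algebraic_int_square_imp:
  assumes "algebraic_int ((x::'a::field_char_0) ^ 2)"
  shows "algebraic_int x"
proof (rule algebraic_int_root_aipoly)
  show "aipoly [:- (x^2), 0, 1:]"
    using assms by (intro aipoly_pCons aipoly_0 algebraic_int_minus algebraic_int_0 algebraic_int_1)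
  show "monic [:- (x^2), 0, 1:]"
    by simp
  show "poly [:- (x^2), 0, 1:] x = 0"
    by (simp add: power2_eq_square)
qed

section \<open>Polynomials over a subring\<close>

text \<open>Rings and fields are subsets of one type, so that they can be enlarged inside a
  proof.\<close>

locale sring =
  fixes S :: "'a::field_char_0 set"
  assumes zero [simp]: "0 \<in> S" and one [simp]: "1 \<in> S"
    and add: "x \<in> S \<Longrightarrow> y \<in> S \<Longrightarrow> x + y \<in> S"
    and mult: "x \<in> S \<Longrightarrow> y \<in> S \<Longrightarrow> x * y \<in> S"
    and minus: "x \<in> S \<Longrightarrow> - x \<in> S"
begin

lemma diff: "x \<in> S \<Longrightarrow> y \<in> S \<Longrightarrow> x - y \<in> S"
  using add[of x "-y"] minus[of y] by simp

lemma sum: "(\<And>i. i \<in> I \<Longrightarrow> f i \<in> S) \<Longrightarrow> sum f I \<in> S"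
  by (induction I rule: infinite_finite_induct) (simp_all add: add)

lemma prod: "(\<And>i. i \<in> I \<Longrightarrow> f i \<in> S) \<Longrightarrow> prod f I \<in> S"
  by (induction I rule: infinite_finite_induct) (simp_all add: mult)

lemma power: "x \<in> S \<Longrightarrow> x ^ n \<in> S"
  by (induction n) (simp_all add: mult)

lemma of_nat [simp]: "of_nat n \<in> S"
  by (induction n) (simp_all add: add)

lemma of_int [simp]: "of_int n \<in> S"
  by (cases n rule: int_diff_cases) (simp add: diff)

end

locale sfield = sring +
  assumes inverse: "x \<in> S \<Longrightarrow> inverse x \<in> S"
begin

lemma divide: "x \<in> S \<Longrightarrow> y \<in> S \<Longrightarrow> x / y \<in> S"
  using mult[of x "inverse y"] inverse[of y] by (simp add: field_simps)

lemma Rats: "x \<in> \<rat> \<Longrightarrow> x \<in> S"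
  by (elim Rats_cases') (simp add: divide)

end

lemma sfield_Rats: "sfield (\<rat> :: 'a::field_char_0 set)"
  by unfold_locales auto

section \<open>Division with remainder and minimal polynomials over a subring\<close>

definition polyover :: "'a::field_char_0 set \<Rightarrow> 'a poly \<Rightarrow> bool" where
  "polyover S p \<longleftrightarrow> (\<forall>i. coeff p i \<in> S)"

context sring
begin

lemma polyover_0 [simp]: "polyover S 0" by (simp add: polyover_def)
lemma polyover_1 [simp]: "polyover S 1" by (simp add: polyover_def coeff_1)
lemma polyover_add: "polyover S p \<Longrightarrow> polyover S q \<Longrightarrow> polyover S (p + q)"
  by (simp add: polyover_def add)
lemma polyover_diff: "polyover S p \<Longrightarrow> polyover S q \<Longrightarrow> polyover S (p - q)"
  by (simp add: polyover_def diff)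
lemma polyover_minus: "polyover S p \<Longrightarrow> polyover S (- p)"
  by (simp add: polyover_def minus)
lemma polyover_mult: "polyover S p \<Longrightarrow> polyover S q \<Longrightarrow> polyover S (p * q)"
  unfolding polyover_def coeff_mult by (intro allI sum mult) simp_all
lemma polyover_monom: "a \<in> S \<Longrightarrow> polyover S (monom a n)"
  by (simp add: polyover_def coeff_monom)
lemma polyover_pCons: "a \<in> S \<Longrightarrow> polyover S p \<Longrightarrow> polyover S (pCons a p)"
  by (simp add: polyover_def coeff_pCons split: nat.splits)
lemma polyover_smult: "a \<in> S \<Longrightarrow> polyover S p \<Longrightarrow> polyover S (smult a p)"
  by (simp add: polyover_def mult)
lemma polyover_of_int_poly [simp]: "polyover S (of_int_poly p)"
  by (simp add: polyover_def)
lemma poly_in: "polyover S p \<Longrightarrow> x \<in> S \<Longrightarrow> poly p x \<in> S"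
  unfolding polyover_def poly_altdef by (intro sum mult power) simp_all

lemma polyover_divmod:
  assumes "polyover S g" "monic g" "polyover S p"
  shows "\<exists>q r. polyover S q \<and> polyover S r \<and> p = g * q + r \<and> (r = 0 \<or> degree r < degree g)"
  using assms(3)
proof (induction "degree p" arbitrary: p rule: less_induct)
  case (less p)
  show ?case
  proof (cases "p = 0 \<or> degree p < degree g")
    case True
    thus ?thesis using less.prems by (intro exI[of _ 0] exI[of _ p]) simp
  next
    case False
    define m where "m = monom (lead_coeff p) (degree p - degree g)"
    have m: "polyover S m" unfolding m_def
      using less.prems by (intro polyover_monom) (simp add: polyover_def)
    define p' where "p' = p - g * m"
    have p': "polyover S p'" unfolding p'_def
      by (intro polyover_diff polyover_mult less.prems assms m)
    have dm: "degree (g * m) = degree p"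
      using False assms(2) by (subst degree_mult_eq) (auto simp: m_def degree_monom_eq)
    have lc: "coeff (g * m) (degree p) = lead_coeff p"
      using dm assms(2) lead_coeff_mult[of g m] False by (simp add: m_def degree_monom_eq)
    show ?thesis
    proof (cases "p' = 0")
      case True
      hence "p = g * m + 0" by (simp add: p'_def)
      thus ?thesis using m polyover_0 by blast
    next
      case nz: False
      have "degree p' \<le> degree p" unfolding p'_def using dm by (intro degree_diff_le) auto
      moreover have "coeff p' (degree p) = 0" using lc by (simp add: p'_def)
      moreover have "degree p' \<noteq> degree p"
        using \<open>coeff p' (degree p) = 0\<close> nz by (metis leading_coeff_0_iff)
      ultimately have "degree p' < degree p" by simp
      from less.hyps[OF this p'] obtain q r where
        "polyover S q" "polyover S r" "p' = g * q + r" "r = 0 \<or> degree r < degree g" by blast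
      moreover from this have "p = g * (q + m) + r" by (simp add: p'_def algebra_simps)
      ultimately show ?thesis using m polyover_add by blast
    qed
  qed
qed

end

text \<open>Divisibility with a quotient over S stands in for irreducibility: it is what makes a map
  defined through polynomial expressions in x independent of the expression.\<close>

definition minpoly_over :: "'a::field_char_0 set \<Rightarrow> 'a \<Rightarrow> 'a poly \<Rightarrow> bool" where
  "minpoly_over S x g \<longleftrightarrow> polyover S g \<and> monic g \<and> poly g x = 0 \<and>
     (\<forall>p. polyover S p \<and> poly p x = 0 \<longrightarrow> (\<exists>q. polyover S q \<and> p = g * q))"

lemma (in sfield) minpoly_over_exists:
  assumes "polyover S p" "p \<noteq> 0" "poly p x = 0"
  shows "\<exists>g. minpoly_over S x g"
proof -
  define Q where "Q = (\<lambda>d. \<exists>p. polyover S p \<and> p \<noteq> 0 \<and> poly p x = 0 \<and> degree p = d)"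
  have "Q (degree p)" using assms by (auto simp: Q_def)
  hence "Q (LEAST d. Q d)" by (rule LeastI)
  then obtain g0 where g0: "polyover S g0" "g0 \<noteq> 0" "poly g0 x = 0" "degree g0 = (LEAST d. Q d)"
    by (auto simp: Q_def)
  define g where "g = smult (inverse (lead_coeff g0)) g0"
  have lc: "lead_coeff g0 \<noteq> 0" "lead_coeff g0 \<in> S" using g0(1,2) by (simp_all add: polyover_def)
  have dg: "degree g = degree g0" using lc by (simp add: g_def)
  have g: "polyover S g" "monic g" "poly g x = 0" "degree g = (LEAST d. Q d)"
  proof -
    show "polyover S g" unfolding g_def by (intro polyover_smult inverse lc g0)
    show "monic g" unfolding dg using lc by (simp add: g_def)
    show "poly g x = 0" using g0 by (simp add: g_def)
    show "degree g = (LEAST d. Q d)" using dg g0 by simp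
  qed
  have "\<exists>q. polyover S q \<and> p = g * q" if p: "polyover S p" "poly p x = 0" for p
  proof -
    obtain q r where qr: "polyover S q" "polyover S r" "p = g * q + r" "r = 0 \<or> degree r < degree g"
      using polyover_divmod[OF g(1,2) p(1)] by blast
    have "poly r x = 0" using p g qr(3) by simp
    hence "r = 0 \<or> Q (degree r)" using qr by (auto simp: Q_def)
    hence "r = 0" using qr(4) g(4) not_less_Least by metis
    thus ?thesis using qr by auto
  qed
  thus ?thesis using g unfolding minpoly_over_def by blast
qed

lemma minpoly_over_degree: "minpoly_over S x g \<Longrightarrow> degree g > 0"
proof (rule ccontr)
  assume g: "minpoly_over S x g" and "\<not> degree g > 0"
  then obtain b where b: "g = [:b:]" using degree_eq_zeroE[of g] by auto
  thus False using g unfolding minpoly_over_def b by auto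
qed

section \<open>Newton's identities\<close>

text \<open>The recursion expressing the k-th power sum through coefficients; \<open>r k\<close> is
  meant as the coefficient of X^k in \<Prod>(1 - x X). Being a formula in r with integer
  coefficients, it stays in any subring and commutes with ring homomorphisms.\<close>

function newton :: "(nat \<Rightarrow> 'a::field_char_0) \<Rightarrow> nat \<Rightarrow> 'a" where
  "newton r k = - of_nat k * r k - (\<Sum>j\<in>{1..<k}. r j * newton r (k - j))"
  by auto
termination by (relation "measure snd") auto

declare newton.simps [simp del]

lemma (in sring) newton_in: "(\<And>k. r k \<in> S) \<Longrightarrow> newton r k \<in> S"
proof (induction k rule: less_induct)
  case (less k)
  have "r j * newton r (k - j) \<in> S" if "j \<in> {1..<k}" for j
    using that less by (intro mult) auto
  hence "(\<Sum>j\<in>{1..<k}. r j * newton r (k - j)) \<in> S" by (rule sum)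
  moreover have "- of_nat k * r k \<in> S" using less.prems by (intro mult minus of_nat)
  ultimately show ?case by (subst newton.simps) (rule diff)
qed

definition mset_fps :: "'a::field_char_0 multiset \<Rightarrow> 'a fps" where
  "mset_fps M = (\<Prod>x\<in>#M. 1 - fps_const x * fps_X)"

definition pow_fps :: "'a::field_char_0 multiset \<Rightarrow> 'a fps" where
  "pow_fps M = Abs_fps (\<lambda>k. if k = 0 then 0 else (\<Sum>x\<in>#M. x ^ k))"

lemma pow_fps_single: "(1 - fps_const x * fps_X) * pow_fps {#x#} = fps_const x * fps_X"
proof (rule fps_ext)
  fix k
  have "(1 - fps_const x * fps_X) * pow_fps {#x#} = pow_fps {#x#} - fps_const x * (fps_X * pow_fps {#x#})"
    by (simp add: left_diff_distrib mult.assoc)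
  thus "((1 - fps_const x * fps_X) * pow_fps {#x#}) $ k = (fps_const x * fps_X) $ k"
    by (cases k; cases "k - 1") (auto simp: pow_fps_def)
qed

text \<open>This is the logarithmic derivative of \<Prod>(1 - x X): each factor contributes x X / (1
  - x X), the generating series of the powers of x. Newton's identities are its
  coefficients.\<close>

lemma mset_fps_log_deriv: "- fps_X * fps_deriv (mset_fps M) = mset_fps M * pow_fps M"
proof (induction M)
  case empty
  have "pow_fps {#} = (0::'a fps)" by (rule fps_ext) (simp add: pow_fps_def)
  thus ?case by (simp add: mset_fps_def)
next
  case (add x M)
  let ?u = "1 - fps_const x * fps_X"
  have p: "pow_fps (add_mset x M) = pow_fps {#x#} + pow_fps M"
    by (rule fps_ext) (simp add: pow_fps_def)
  have m: "mset_fps (add_mset x M) = ?u * mset_fps M" by (simp add: mset_fps_def)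
  have "- fps_X * fps_deriv (mset_fps (add_mset x M)) =
      ?u * (- fps_X * fps_deriv (mset_fps M)) + (fps_const x * fps_X) * mset_fps M"
    unfolding m by (simp add: algebra_simps)
  also have "\<dots> = ?u * (mset_fps M * pow_fps M) + (?u * pow_fps {#x#}) * mset_fps M"
    unfolding add.IH pow_fps_single ..
  also have "\<dots> = mset_fps (add_mset x M) * pow_fps (add_mset x M)"
    unfolding p m by (simp add: algebra_simps)
  finally show ?case .
qed

lemma mset_fps_0: "mset_fps M $ 0 = 1"
  by (induction M) (simp_all add: mset_fps_def)

lemma newton_identity:
  assumes "k > 0"
  shows "- of_nat k * mset_fps M $ k = (\<Sum>j\<in>{0..<k}. mset_fps M $ j * (\<Sum>x\<in>#M. x ^ (k - j)))"
proof -
  have "- of_nat k * mset_fps M $ k = (- fps_X * fps_deriv (mset_fps M)) $ k"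
    using assms by (cases k) (simp_all add: mult.assoc ring_distribs)
  also have "\<dots> = (\<Sum>j=0..k. mset_fps M $ j * pow_fps M $ (k - j))"
    unfolding mset_fps_log_deriv by (simp add: fps_mult_nth)
  also have "{0..k} = insert k {0..<k}" by auto
  also have "(\<Sum>j\<in>insert k {0..<k}. mset_fps M $ j * pow_fps M $ (k - j)) =
      (\<Sum>j\<in>{0..<k}. mset_fps M $ j * pow_fps M $ (k - j))"
    by (simp add: pow_fps_def)
  also have "\<dots> = (\<Sum>j\<in>{0..<k}. mset_fps M $ j * (\<Sum>x\<in>#M. x ^ (k - j)))"
    by (rule sum.cong) (auto simp: pow_fps_def)
  finally show ?thesis .
qed

lemma newton_power_sum:
  assumes "k > 0"
  shows "(\<Sum>x\<in>#M. x ^ k) = newton (\<lambda>k. mset_fps M $ k) k"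
  using assms
proof (induction k rule: less_induct)
  case (less k)
  have split: "(\<Sum>j\<in>{0..<k}. F j) = F 0 + (\<Sum>j\<in>{1..<k}. F j)" for F :: "nat \<Rightarrow> 'a"
    using less.prems by (simp add: sum.atLeast_Suc_lessThan)
  hence "- of_nat k * mset_fps M $ k = (\<Sum>x\<in>#M. x ^ k) + (\<Sum>j\<in>{1..<k}. mset_fps M $ j * (\<Sum>x\<in>#M. x ^ (k - j)))"
    using newton_identity[OF less.prems, of M] by (simp only: split mset_fps_0 mult_1 diff_zero)
  also have "(\<Sum>j\<in>{1..<k}. mset_fps M $ j * (\<Sum>x\<in>#M. x ^ (k - j))) =
     (\<Sum>j\<in>{1..<k}. mset_fps M $ j * newton (\<lambda>k. mset_fps M $ k) (k - j))"
    by (rule sum.cong) (use less.IH in auto)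
  finally show ?case by (subst newton.simps) (simp add: algebra_simps)
qed

text \<open>Newton's identity solved for the coefficient; the division by k stays in S because S is
  a field of characteristic 0.\<close>

lemma (in sfield) mset_fps_in:
  assumes "\<And>k. k > 0 \<Longrightarrow> (\<Sum>x\<in>#M. x ^ k) \<in> S"
  shows "mset_fps M $ k \<in> S"
proof (induction k rule: less_induct)
  case (less k)
  show ?case
  proof (cases "k = 0")
    case True thus ?thesis by (simp add: mset_fps_0)
  next
    case False
    hence "mset_fps M $ k = - (\<Sum>j\<in>{0..<k}. mset_fps M $ j * (\<Sum>x\<in>#M. x ^ (k - j))) / of_nat k"
    proof -
      have "m = - s / of_nat k" if "- of_nat k * m = s" for m s :: 'a
        using that False by (auto simp: field_simps)
      thus ?thesis using newton_identity[of k M] False by blast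
    qed
    also have "\<dots> \<in> S" using less assms by (intro divide minus sum mult) auto
    finally show ?thesis .
  qed
qed

lemma degree_prod_mset_linear [simp]: "degree (\<Prod>x\<in>#M. [:- x, 1 :: 'a::field_char_0:]) = size M"
  and monic_prod_mset_linear: "monic (\<Prod>x\<in>#M. [:- x, 1 :: 'a::field_char_0:])"
proof -
  have "degree (\<Prod>x\<in>#M. [:- x, 1 :: 'a:]) = size M \<and> monic (\<Prod>x\<in>#M. [:- x, 1 :: 'a:])"
  proof (induction M)
    case (add x M)
    let ?p = "\<Prod>x\<in>#M. [:- x, 1 :: 'a:]"
    have "?p \<noteq> 0" using add by (metis coeff_0 zero_neq_one)
    hence "degree ([:- x, 1:] * ?p) = Suc (degree ?p)" by (subst degree_mult_eq) auto
    moreover have "lead_coeff ([:- x, 1:] * ?p) = 1"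
      unfolding lead_coeff_mult using conjunct2[OF add.IH] by simp
    ultimately show ?case using add by (simp del: mult_pCons_left)
  qed simp
  thus "degree (\<Prod>x\<in>#M. [:- x, 1 :: 'a:]) = size M" "monic (\<Prod>x\<in>#M. [:- x, 1 :: 'a:])" by auto
qed

lemma fps_reflect_prod_mset: "fps_of_poly (reflect_poly (\<Prod>x\<in>#M. [:- x, 1:])) = mset_fps M"
proof (induction M)
  case (add x M)
  have "reflect_poly [:- x, 1:] = [:1, - x:]" by (cases "x = 0") (simp_all add: reflect_poly_def)
  moreover have "fps_of_poly [:1, - x:] = 1 - fps_const x * fps_X"
    by (simp add: fps_of_poly_pCons mult.commute fps_const_neg[symmetric] del: fps_const_neg)
  ultimately show ?case using add
    by (simp add: mset_fps_def reflect_poly_mult fps_of_poly_mult del: mult_pCons_left)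
qed (simp add: mset_fps_def)

lemma mset_fps_coeff:
  "mset_fps M $ k = (if k > size M then 0 else coeff (\<Prod>x\<in>#M. [:- x, 1:]) (size M - k))"
  unfolding fps_reflect_prod_mset[symmetric] by (simp add: coeff_reflect_poly)

lemma (in sfield) polyover_if_power_sums:
  assumes "\<And>k. k > 0 \<Longrightarrow> (\<Sum>x\<in>#M. x ^ k) \<in> S"
  shows "polyover S (\<Prod>x\<in>#M. [:- x, 1:])"
  unfolding polyover_def
proof
  fix i
  show "coeff (\<Prod>x\<in>#M. [:- x, 1:]) i \<in> S"
  proof (cases "i \<le> size M")
    case True
    hence "coeff (\<Prod>x\<in>#M. [:- x, 1:]) i = mset_fps M $ (size M - i)" by (simp add: mset_fps_coeff)
    thus ?thesis using mset_fps_in[OF assms] by simp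
  next
    case False
    thus ?thesis by (simp add: coeff_eq_0)
  qed
qed

section \<open>Traces as expressions in coefficients\<close>

definition pow_trace :: "'a::field_char_0 poly \<Rightarrow> nat \<Rightarrow> 'a" where
  "pow_trace g k = (if k = 0 then of_nat (degree g)
     else newton (\<lambda>k. if k > degree g then 0 else coeff g (degree g - k)) k)"

text \<open>For the minimal polynomial g of x this is the trace of p(x). Computing it from the
  coefficients of g and p alone puts it into the base field and lets embeddings pass through
  it.\<close>

definition poly_trace :: "'a::field_char_0 poly \<Rightarrow> 'a poly \<Rightarrow> 'a" where
  "poly_trace g p = (\<Sum>i\<le>degree p. coeff p i * pow_trace g i)"

lemma pow_trace: "g = (\<Prod>x\<in>#M. [:- x, 1:]) \<Longrightarrow> (\<Sum>x\<in>#M. x ^ k) = pow_trace g k"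
  by (cases "k = 0") (simp_all add: pow_trace_def newton_power_sum mset_fps_coeff cong: if_cong)

lemma poly_trace:
  assumes "g = (\<Prod>x\<in>#M. [:- x, 1:])"
  shows "(\<Sum>x\<in>#M. poly p x) = poly_trace g p"
proof -
  have "(\<Sum>x\<in>#M. poly p x) = (\<Sum>i\<le>degree p. coeff p i * (\<Sum>x\<in>#M. x ^ i))"
    by (induction M) (simp_all add: poly_altdef sum.distrib ring_distribs)
  thus ?thesis by (simp add: poly_trace_def pow_trace[OF assms])
qed

lemma (in sring) poly_trace_in: "polyover S g \<Longrightarrow> polyover S p \<Longrightarrow> poly_trace g p \<in> S"
  unfolding poly_trace_def pow_trace_def polyover_def
  by (intro sum mult) (auto intro!: newton_in)

section \<open>Ring homomorphisms on subfields\<close>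

text \<open>The map is total and, apart from its values at 0 and 1, constrained on S only, so that
  one function can be restricted to subfields without change of type.\<close>

definition hom_on :: "'a::field_char_0 set \<Rightarrow> ('a \<Rightarrow> 'b::field_char_0) \<Rightarrow> bool" where
  "hom_on S \<phi> \<longleftrightarrow> \<phi> 0 = 0 \<and> \<phi> 1 = 1 \<and>
     (\<forall>x\<in>S. \<forall>y\<in>S. \<phi> (x + y) = \<phi> x + \<phi> y \<and> \<phi> (x * y) = \<phi> x * \<phi> y)"

lemma hom_on_subset: "hom_on S \<phi> \<Longrightarrow> T \<subseteq> S \<Longrightarrow> hom_on T \<phi>"
  unfolding hom_on_def by blast

locale hom_sring = sring S for S :: "'a::field_char_0 set" +
  fixes \<phi> :: "'a \<Rightarrow> 'b::field_char_0"
  assumes hom: "hom_on S \<phi>"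
begin

lemma hom_0 [simp]: "\<phi> 0 = 0" and hom_1 [simp]: "\<phi> 1 = 1"
  using hom by (auto simp: hom_on_def)
lemma hom_add: "x \<in> S \<Longrightarrow> y \<in> S \<Longrightarrow> \<phi> (x + y) = \<phi> x + \<phi> y"
  using hom by (auto simp: hom_on_def)
lemma hom_mult: "x \<in> S \<Longrightarrow> y \<in> S \<Longrightarrow> \<phi> (x * y) = \<phi> x * \<phi> y"
  using hom by (auto simp: hom_on_def)
lemma hom_minus: "x \<in> S \<Longrightarrow> \<phi> (- x) = - \<phi> x"
  using hom_add[of x "-x"] minus[of x] by (simp add: eq_neg_iff_add_eq_0 add.commute)
lemma hom_diff: "x \<in> S \<Longrightarrow> y \<in> S \<Longrightarrow> \<phi> (x - y) = \<phi> x - \<phi> y"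
  using hom_add[of x "-y"] hom_minus[of y] minus[of y] by simp
lemma hom_power: "x \<in> S \<Longrightarrow> \<phi> (x ^ n) = \<phi> x ^ n"
  by (induction n) (simp_all add: hom_mult power)
lemma hom_sum: "(\<And>i. i \<in> I \<Longrightarrow> f i \<in> S) \<Longrightarrow> \<phi> (\<Sum>i\<in>I. f i) = (\<Sum>i\<in>I. \<phi> (f i))"
  by (induction I rule: infinite_finite_induct) (simp_all add: hom_add sum)
lemma hom_of_nat [simp]: "\<phi> (of_nat n) = of_nat n"
  by (induction n) (simp_all add: hom_add)
lemma hom_of_int [simp]: "\<phi> (of_int n) = of_int n"
  by (cases n rule: int_diff_cases) (simp add: hom_diff)

lemma coeff_map_hom [simp]: "coeff (map_poly \<phi> p) i = \<phi> (coeff p i)"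
  by (simp add: coeff_map_poly)

lemma map_hom_of_int_poly [simp]: "map_poly \<phi> (of_int_poly p) = of_int_poly p"
  by (rule poly_eqI) simp

lemma map_hom_add: "polyover S p \<Longrightarrow> polyover S q \<Longrightarrow> map_poly \<phi> (p + q) = map_poly \<phi> p + map_poly \<phi> q"
  by (rule poly_eqI) (simp add: polyover_def hom_add)

lemma map_hom_mult: "polyover S p \<Longrightarrow> polyover S q \<Longrightarrow> map_poly \<phi> (p * q) = map_poly \<phi> p * map_poly \<phi> q"
  by (rule poly_eqI) (simp add: polyover_def coeff_mult hom_sum hom_mult mult)

lemma degree_map_hom_monic: "monic g \<Longrightarrow> degree (map_poly \<phi> g) = degree g"
  and monic_map_hom: "monic g \<Longrightarrow> monic (map_poly \<phi> g)"
proof -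
  assume g: "monic g"
  show d: "degree (map_poly \<phi> g) = degree g"
    by (rule antisym[OF degree_map_poly_le le_degree]) (simp add: g)
  show "monic (map_poly \<phi> g)" by (simp add: d g)
qed

lemma hom_poly: "polyover S p \<Longrightarrow> x \<in> S \<Longrightarrow> \<phi> (poly p x) = poly (map_poly \<phi> p) (\<phi> x)"
proof (induction p)
  case (pCons a p)
  have a: "a \<in> S" using pCons.prems(1) by (metis polyover_def coeff_pCons_0)
  have p: "polyover S p" using pCons.prems(1) by (metis polyover_def coeff_pCons_Suc)
  have "\<phi> (poly (pCons a p) x) = \<phi> a + \<phi> x * \<phi> (poly p x)"
    using a poly_in[OF p pCons.prems(2)] pCons.prems(2) by (simp add: hom_add hom_mult mult)
  also have "\<dots> = poly (map_poly \<phi> (pCons a p)) (\<phi> x)"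
    using pCons p by (simp add: map_poly_pCons)
  finally show ?case .
qed simp

lemma hom_newton: "(\<And>k. r k \<in> S) \<Longrightarrow> \<phi> (newton r k) = newton (\<lambda>k. \<phi> (r k)) k"
proof (induction k rule: less_induct)
  case (less k)
  have "\<phi> (newton r k) = - of_nat k * \<phi> (r k) - (\<Sum>j\<in>{1..<k}. \<phi> (r j) * \<phi> (newton r (k - j)))"
    by (subst newton.simps)
       (simp add: less.prems newton_in mult minus sum hom_diff hom_mult hom_minus hom_sum)
  also have "(\<Sum>j\<in>{1..<k}. \<phi> (r j) * \<phi> (newton r (k - j))) = (\<Sum>j\<in>{1..<k}. \<phi> (r j) * newton (\<lambda>k. \<phi> (r k)) (k - j))"
    by (rule sum.cong) (use less in auto)
  finally show ?case by (subst newton.simps) simp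
qed

lemma hom_poly_trace:
  assumes "polyover S g" "monic g" "polyover S p"
  shows "\<phi> (poly_trace g p) = poly_trace (map_poly \<phi> g) (map_poly \<phi> p)"
proof -
  have pt: "pow_trace g k \<in> S" for k
    unfolding pow_trace_def using assms by (auto intro!: newton_in simp: polyover_def)
  have hpt: "\<phi> (pow_trace g k) = pow_trace (map_poly \<phi> g) k" for k
    using assms(1,2) unfolding pow_trace_def
    by (auto simp: degree_map_hom_monic polyover_def hom_newton intro!: arg_cong[of _ _ "\<lambda>r. newton r k"])
  have "\<phi> (poly_trace g p) = (\<Sum>i\<le>degree p. \<phi> (coeff p i) * pow_trace (map_poly \<phi> g) i)"
    unfolding poly_trace_def using pt assms(3)
    by (subst hom_sum) (auto simp: polyover_def hpt hom_mult mult)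
  also have "\<dots> = (\<Sum>i\<le>degree (map_poly \<phi> p). \<phi> (coeff p i) * pow_trace (map_poly \<phi> g) i)"
    by (rule sum.mono_neutral_right)
       (use degree_map_poly_le[of \<phi> p] in \<open>auto simp: coeff_map_hom[symmetric] coeff_eq_0 simp del: coeff_map_hom\<close>)
  finally show ?thesis by (simp add: poly_trace_def)
qed

end

locale hom_sfield = sfield S + hom_sring S \<phi> for S :: "'a::field_char_0 set" and \<phi> :: "'a \<Rightarrow> 'b::field_char_0"
begin

lemma hom_inverse: "x \<in> S \<Longrightarrow> \<phi> (inverse x) = inverse (\<phi> x)"
  using hom_mult[of x "inverse x"] inverse[of x]
  by (cases "x = 0") (auto simp: inverse_unique)

lemma hom_divide: "x \<in> S \<Longrightarrow> y \<in> S \<Longrightarrow> \<phi> (x / y) = \<phi> x / \<phi> y"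
  by (simp add: divide_inverse hom_mult hom_inverse inverse)

lemma hom_eq_0_iff: "x \<in> S \<Longrightarrow> \<phi> x = 0 \<longleftrightarrow> x = 0"
  using hom_mult[of x "inverse x"] inverse[of x] by (cases "x = 0") auto

lemma hom_of_rat [simp]: "\<phi> (of_rat q) = of_rat q"
proof -
  obtain a b where "quotient_of q = (a, b)" by force
  hence "q = of_int a / of_int b" by (rule quotient_of_div)
  thus ?thesis by (simp add: of_rat_divide hom_divide)
qed

lemma hom_algebraic_int:
  assumes "algebraic_int x" "x \<in> S" shows "algebraic_int (\<phi> x)"
proof -
  obtain p where p: "poly (of_int_poly p) x = 0" "monic p"
    using assms unfolding algebraic_int_altdef_ipoly by blast
  have "poly (of_int_poly p) (\<phi> x) = 0"
    using hom_poly[of "of_int_poly p" x] p assms(2) by simp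
  thus ?thesis using p unfolding algebraic_int_altdef_ipoly by blast
qed

end

section \<open>Simple extensions and the extension of homomorphisms to them\<close>

definition adjoin :: "'a::field_char_0 set \<Rightarrow> 'a \<Rightarrow> 'a set" where
  "adjoin S x = {poly p x | p. polyover S p}"

lemma (in sring) sring_adjoin: "sring (adjoin S x)"
proof
  show "0 \<in> adjoin S x" unfolding adjoin_def using polyover_0 poly_0 by (metis (mono_tags) mem_Collect_eq)
  show "1 \<in> adjoin S x" unfolding adjoin_def using polyover_1 poly_1 by (metis (mono_tags) mem_Collect_eq)
  fix a b assume "a \<in> adjoin S x" "b \<in> adjoin S x"
  then obtain p q where "polyover S p" "polyover S q" "a = poly p x" "b = poly q x" by (auto simp: adjoin_def)
  thus "a + b \<in> adjoin S x" "a * b \<in> adjoin S x" "- a \<in> adjoin S x"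
    unfolding adjoin_def using polyover_add[of p q] polyover_mult[of p q] polyover_minus[of p]
    by (metis (mono_tags) mem_Collect_eq poly_add poly_mult poly_minus)+
qed

lemma (in sring) subset_adjoin: "S \<subseteq> adjoin S x"
proof
  fix a assume "a \<in> S"
  thus "a \<in> adjoin S x" unfolding adjoin_def
    by (intro CollectI exI[of _ "[:a:]"]) (simp add: polyover_pCons)
qed

lemma (in sring) in_adjoin: "x \<in> adjoin S x"
  unfolding adjoin_def by (intro CollectI exI[of _ "[:0, 1:]"]) (simp add: polyover_pCons)

lemma (in sring) adjoin_subset: "S \<subseteq> T \<Longrightarrow> x \<in> T \<Longrightarrow> sring T \<Longrightarrow> adjoin S x \<subseteq> T"
proof
  fix y assume T: "S \<subseteq> T" "x \<in> T" "sring T" and "y \<in> adjoin S x"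
  then obtain p where p: "polyover S p" "y = poly p x" by (auto simp: adjoin_def)
  hence "polyover T p" using T by (auto simp: polyover_def)
  thus "y \<in> T" unfolding p(2) using T by (intro sring.poly_in)
qed

lemma algebraic_imp_int_poly: "algebraic (x::'a::field_char_0) \<Longrightarrow> \<exists>p. p \<noteq> 0 \<and> poly (of_int_poly p) x = 0"
  by (elim algebraicE') blast

text \<open>The inverse of an algebraic number is a rational polynomial in it.\<close>
lemma sfield_if_algebraic:
  assumes "sring R" "\<rat> \<subseteq> R" "\<And>x. x \<in> R \<Longrightarrow> algebraic x"
  shows "sfield R"
proof -
  interpret sring R by fact
  have "inverse y \<in> R" if y: "y \<in> R" for y
  proof (cases "y = 0")
    case False
    define Q where "Q = (\<lambda>d. \<exists>p. p \<noteq> 0 \<and> poly (of_int_poly p) y = 0 \<and> degree p = d)"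
    have "\<exists>d. Q d" using algebraic_imp_int_poly[OF assms(3)[OF y]] by (auto simp: Q_def)
    hence "Q (LEAST d. Q d)" by (metis LeastI)
    then obtain p where p: "p \<noteq> 0" "poly (of_int_poly p) y = 0" "degree p = (LEAST d. Q d)"
      by (auto simp: Q_def)
    obtain a q where aq: "p = pCons a q" by (cases p)
    have rel: "of_int a + y * poly (of_int_poly q) y = 0" using p(2) aq by (simp add: of_int_hom.map_poly_pCons_hom)
    have "a \<noteq> 0"
    proof
      assume a: "a = 0"
      hence "q \<noteq> 0" "poly (of_int_poly q) y = 0" using p aq rel False by auto
      hence "Q (degree q)" by (auto simp: Q_def)
      hence "degree p \<le> degree q" unfolding p(3) by (rule Least_le)
      thus False using aq \<open>q \<noteq> 0\<close> by simp
    qed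
    have "y * (- (poly (of_int_poly q) y / of_int a)) = 1"
      using rel \<open>a \<noteq> 0\<close> by (simp add: minus_divide_left neg_eq_iff_add_eq_0 add.commute del: minus_divide_left[symmetric])
    hence "inverse y = - (poly (of_int_poly q) y * of_rat (1 / of_int a))"
      by (simp add: inverse_unique of_rat_divide)
    also have "\<dots> \<in> R" using assms(2)
      by (intro minus mult poly_in polyover_of_int_poly y) auto
    finally show ?thesis .
  qed simp
  thus ?thesis by unfold_locales
qed

text \<open>The extension of \<phi> to S[x] that sends x to r. The chosen representing polynomial
  does not matter as soon as r is a root of the image of the minimal polynomial of x.\<close>

definition hom_ext :: "'a::field_char_0 set \<Rightarrow> 'a \<Rightarrow> ('a \<Rightarrow> 'b::field_char_0) \<Rightarrow> 'b \<Rightarrow> 'a \<Rightarrow> 'b" where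
  "hom_ext S x \<phi> r y = poly (map_poly \<phi> (SOME p. polyover S p \<and> poly p x = y)) r"

context hom_sring
begin

lemma hom_ext_poly:
  assumes g: "minpoly_over S x g" and r: "poly (map_poly \<phi> g) r = 0" and p: "polyover S p"
  shows "hom_ext S x \<phi> r (poly p x) = poly (map_poly \<phi> p) r"
proof -
  let ?q = "SOME q. polyover S q \<and> poly q x = poly p x"
  have q: "polyover S ?q \<and> poly ?q x = poly p x" by (rule someI[of _ p]) (use p in auto)
  hence "polyover S (?q - p)" "poly (?q - p) x = 0" using p by (auto intro: polyover_diff)
  then obtain h where h: "polyover S h" "?q - p = g * h" using g unfolding minpoly_over_def by blast
  have gS: "polyover S g" using g by (simp add: minpoly_over_def)
  have "?q = p + g * h" using h(2) by (simp add: algebra_simps)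
  hence "map_poly \<phi> ?q = map_poly \<phi> p + map_poly \<phi> g * map_poly \<phi> h"
    using p h(1) gS by (metis map_hom_add map_hom_mult polyover_mult)
  thus ?thesis using r by (simp add: hom_ext_def)
qed

lemma hom_on_hom_ext:
  assumes g: "minpoly_over S x g" and r: "poly (map_poly \<phi> g) r = 0"
  shows "hom_on (adjoin S x) (hom_ext S x \<phi> r)"
proof -
  note e = hom_ext_poly[OF g r]
  have "hom_ext S x \<phi> r 0 = 0" "hom_ext S x \<phi> r 1 = 1"
    using e[of 0] e[of 1] by (auto simp: map_poly_1)
  moreover have "hom_ext S x \<phi> r (poly p x + poly q x) = hom_ext S x \<phi> r (poly p x) + hom_ext S x \<phi> r (poly q x)"
    "hom_ext S x \<phi> r (poly p x * poly q x) = hom_ext S x \<phi> r (poly p x) * hom_ext S x \<phi> r (poly q x)"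
    if "polyover S p" "polyover S q" for p q
    using e[of "p + q"] e[of "p * q"] e[of p] e[of q] that
    by (simp_all add: polyover_add polyover_mult map_hom_add map_hom_mult)
  ultimately show ?thesis unfolding hom_on_def adjoin_def by blast
qed

lemma hom_ext_base:
  assumes g: "minpoly_over S x g" and r: "poly (map_poly \<phi> g) r = 0" and a: "a \<in> S"
  shows "hom_ext S x \<phi> r a = \<phi> a"
  using hom_ext_poly[OF g r, of "[:a:]"] a by (cases "a = 0") (simp_all add: polyover_pCons map_poly_pCons)

lemma hom_ext_gen:
  assumes g: "minpoly_over S x g" and r: "poly (map_poly \<phi> g) r = 0"
  shows "hom_ext S x \<phi> r x = r"
  using hom_ext_poly[OF g r, of "[:0, 1:]"] by (simp add: polyover_pCons map_poly_pCons)

end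

section \<open>Conjugate families\<close>

text \<open>A nonempty list of embeddings with rational traces. It plays the role of the set of all complex
  embeddings of a number field, but needs no control of its size or of multiplicities.\<close>
definition conj_family :: "'a::field_char_0 set \<Rightarrow> ('a \<Rightarrow> complex) list \<Rightarrow> bool" where
  "conj_family S E \<longleftrightarrow> sfield S \<and> E \<noteq> [] \<and> (\<forall>s\<in>set E. hom_on S s) \<and>
     (\<forall>y\<in>S. (\<Sum>s\<leftarrow>E. s y) \<in> \<rat>)"

lemma inv_of_rat [simp]: "inv_into UNIV of_rat (of_rat q :: 'a::field_char_0) = q"
  by (rule inv_f_f) (auto simp: inj_on_def)

text \<open>Start of the induction: the rational numbers inside the type are transported to the
  complex numbers by inverting \<open>of_rat\<close>.\<close>

lemma conj_family_Rats: "conj_family (\<rat> :: 'a::field_char_0 set) [\<lambda>y. of_rat (inv_into UNIV of_rat y)]"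
proof -
  have "hom_on (\<rat> :: 'a set) (\<lambda>y. of_rat (inv_into UNIV of_rat y))"
    unfolding hom_on_def
  proof (intro conjI ballI)
    show "of_rat (inv_into UNIV of_rat (0::'a)) = 0" using inv_of_rat[of 0, where 'a = 'a] by simp
    show "of_rat (inv_into UNIV of_rat (1::'a)) = 1" using inv_of_rat[of 1, where 'a = 'a] by simp
    fix x y :: 'a assume "x \<in> \<rat>" "y \<in> \<rat>"
    then obtain a b where "x = of_rat a" "y = of_rat b" by (auto elim!: Rats_cases)
    thus "of_rat (inv_into UNIV of_rat (x + y)) = of_rat (inv_into UNIV of_rat x) + of_rat (inv_into UNIV of_rat y)"
      "of_rat (inv_into UNIV of_rat (x * y)) = of_rat (inv_into UNIV of_rat x) * of_rat (inv_into UNIV of_rat y)"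
      by (simp_all add: of_rat_add[symmetric] of_rat_mult[symmetric] del: of_rat_add of_rat_mult)
  qed
  thus ?thesis by (simp add: conj_family_def sfield_Rats)
qed

text \<open>Every embedding s is extended by all roots of the image of the minimal polynomial. The
  new trace of y is the sum over s of s applied to the relative trace of y, which lies in S; hence
  it is a trace of the old family and rational.\<close>

lemma conj_family_adjoin:
  fixes S :: "'a::field_char_0 set"
  assumes alg: "\<And>x::'a. algebraic x" and fam: "conj_family S E"
  shows "\<exists>E'. conj_family (adjoin S x) E'"
proof -
  interpret sfield S using fam by (simp add: conj_family_def)
  obtain p where p: "p \<noteq> 0" "poly (of_int_poly p) x = 0" using algebraic_imp_int_poly[OF alg] by blast
  hence "\<exists>g. minpoly_over S x g" by (intro minpoly_over_exists[of "of_int_poly p"]) auto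
  then obtain g where g: "minpoly_over S x g" by blast
  have gS: "polyover S g" "monic g" using g by (auto simp: minpoly_over_def)
  \<comment> \<open>Roots are listed with multiplicity, so that sums over \<open>R s\<close> are the
    symmetric sums that \<open>poly_trace\<close> computes.\<close>
  have "\<forall>s::'a \<Rightarrow> complex. \<exists>rs. mset rs = proots (map_poly s g)" using ex_mset by blast
  then obtain R where R: "\<And>s::'a \<Rightarrow> complex. mset (R s) = proots (map_poly s g)" by metis
  define E' where "E' = concat (map (\<lambda>s. map (hom_ext S x s) (R s)) E)"
  have hom: "hom_sring S s" if "s \<in> set E" for s
    using that fam by (auto simp: conj_family_def hom_sring_def hom_sring_axioms_def sring_axioms)
  have nz: "map_poly s g \<noteq> 0" if "s \<in> set E" for s
    using hom_sring.monic_map_hom[OF hom[OF that] gS(2)] by auto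
  have root: "poly (map_poly s g) r = 0" if "s \<in> set E" "r \<in> set (R s)" for s r
  proof -
    have "r \<in># proots (map_poly s g)" using that R by (metis set_mset_mset)
    thus ?thesis using nz[OF that(1)] by simp
  qed
  have split: "map_poly s g = (\<Prod>r\<in>#mset (R s). [:- r, 1:])" if "s \<in> set E" for s
    using complex_poly_decompose_multiset[of "map_poly s g"] hom_sring.monic_map_hom[OF hom[OF that] gS(2)]
    unfolding R by simp
  have ne: "E' \<noteq> []"
  proof -
    obtain s where s: "s \<in> set E" using fam by (cases E) (auto simp: conj_family_def)
    have "size (mset (R s)) = degree g" unfolding R
      using hom_sring.degree_map_hom_monic[OF hom[OF s] gS(2)] by (simp add: size_proots_complex)
    hence "R s \<noteq> []" using minpoly_over_degree[OF g] by auto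
    thus ?thesis using s by (auto simp: E'_def)
  qed
  have homs: "hom_on (adjoin S x) t" if "t \<in> set E'" for t
    using that hom_sring.hom_on_hom_ext[OF hom g root] by (auto simp: E'_def)
  have tr: "(\<Sum>t\<leftarrow>E'. t y) \<in> \<rat>" if y: "y \<in> adjoin S x" for y
  proof -
    obtain p where p: "polyover S p" "y = poly p x" using y by (auto simp: adjoin_def)
    have "(\<Sum>t\<leftarrow>E'. t y) = (\<Sum>s\<leftarrow>E. \<Sum>r\<leftarrow>R s. hom_ext S x s r y)"
      unfolding E'_def by (induction E) (simp_all add: o_def)
    also have "\<dots> = (\<Sum>s\<leftarrow>E. s (poly_trace g p))"
    proof (rule arg_cong[of _ _ sum_list], rule map_cong[OF refl])
      fix s assume s: "s \<in> set E"
      have "(\<Sum>r\<leftarrow>R s. hom_ext S x s r y) = (\<Sum>r\<leftarrow>R s. poly (map_poly s p) r)"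
        by (rule arg_cong[of _ _ sum_list], rule map_cong[OF refl])
           (simp add: p hom_sring.hom_ext_poly[OF hom[OF s] g root[OF s]])
      also have "\<dots> = (\<Sum>r\<in>#mset (R s). poly (map_poly s p) r)" by (simp only: mset_map[symmetric] sum_mset_sum_list)
      also have "\<dots> = poly_trace (map_poly s g) (map_poly s p)" by (rule poly_trace[OF split[OF s]])
      also have "\<dots> = s (poly_trace g p)"
        by (rule hom_sring.hom_poly_trace[OF hom[OF s] gS p(1), symmetric])
      finally show "(\<Sum>r\<leftarrow>R s. hom_ext S x s r y) = s (poly_trace g p)" .
    qed
    also have "\<dots> \<in> \<rat>" using fam poly_trace_in[OF gS(1) p(1)] by (auto simp: conj_family_def)
    finally show ?thesis .
  qed
  have "sfield (adjoin S x)"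
    using sring_adjoin subset_adjoin Rats alg by (intro sfield_if_algebraic) blast+
  thus ?thesis using ne homs tr unfolding conj_family_def by blast
qed

lemma conj_family_exists:
  assumes alg: "\<And>x::'a::field_char_0. algebraic x" and "finite (B :: 'a set)"
  shows "\<exists>S E. conj_family S E \<and> B \<subseteq> S"
  using assms(2)
proof (induction B rule: finite_induct)
  case empty
  show ?case using conj_family_Rats by blast
next
  case (insert x B)
  then obtain S E where SE: "conj_family S E" "B \<subseteq> S" by blast
  interpret sfield S using SE by (simp add: conj_family_def)
  obtain E' where "conj_family (adjoin S x) E'" using conj_family_adjoin[OF alg SE(1)] by blast
  thus ?case using SE subset_adjoin in_adjoin by blast
qed

text \<open>Power sums of the conjugates of y are traces of powers of y, so Newton's identities give
  rational coefficients.\<close>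

lemma polyover_Rats_conj_family:
  assumes "conj_family S E" "y \<in> S"
  shows "polyover \<rat> (\<Prod>r\<in>#mset (map (\<lambda>s. s y) E). [:- r, 1:])"
proof (rule sfield.polyover_if_power_sums[OF sfield_Rats])
  fix k :: nat
  interpret sfield S using assms by (simp add: conj_family_def)
  have "(\<Sum>r\<in>#mset (map (\<lambda>s. s y) E). r ^ k) = (\<Sum>s\<leftarrow>E. s y ^ k)"
    by (simp only: mset_map[symmetric] sum_mset_sum_list map_map o_def)
  also have "\<dots> = (\<Sum>s\<leftarrow>E. s (y ^ k))"
  proof (rule arg_cong[of _ _ sum_list], rule map_cong[OF refl])
    fix s assume "s \<in> set E"
    hence "hom_sring S s"
      using assms by (auto simp: conj_family_def hom_sring_def hom_sring_axioms_def sring_axioms)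
    thus "s y ^ k = s (y ^ k)" using assms(2) by (simp add: hom_sring.hom_power)
  qed
  also have "\<dots> \<in> \<rat>" using assms power by (auto simp: conj_family_def)
  finally show "(\<Sum>r\<in>#mset (map (\<lambda>s. s y) E). r ^ k) \<in> \<rat>" .
qed

section \<open>Minimal integer polynomials and the Mahler height\<close>

lemma primitive_dvd_smult:
  fixes m G :: "int poly"
  assumes "content m = 1" "c \<noteq> 0" "m dvd smult c G"
  shows "m dvd G"
proof -
  have "fract_poly m dvd fract_poly (smult c G)" using assms(3) by (rule fract_poly_dvd)
  hence "fract_poly m dvd smult (to_fract c) (fract_poly G)" by (simp add: fract_poly_smult)
  hence "fract_poly m dvd fract_poly G" using assms(2) by (simp add: dvd_smult_iff)
  thus ?thesis using assms(1) by (rule fract_poly_dvdD)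
qed

text \<open>Take an integer polynomial of least degree vanishing at x and make it primitive.
  Pseudo-division leaves a remainder that vanishes at x, hence is 0 by minimality, and Gauss's lemma
  removes the scalar that pseudo-division introduces.\<close>

lemma int_minpoly_exists:
  assumes "algebraic (x::'a::field_char_0)"
  shows "\<exists>m::int poly. irreducible m \<and> lead_coeff m > 0 \<and> content m = 1 \<and> poly (of_int_poly m) x = 0 \<and>
    (\<forall>G. poly (of_int_poly G) x = 0 \<longrightarrow> m dvd G)"
proof -
  define Q where "Q = (\<lambda>d. \<exists>p. p \<noteq> 0 \<and> poly (of_int_poly p) x = 0 \<and> degree p = d)"
  have "\<exists>d. Q d" using algebraic_imp_int_poly[OF assms] by (auto simp: Q_def)
  hence "Q (LEAST d. Q d)" by (metis LeastI)
  then obtain p where p: "p \<noteq> 0" "poly (of_int_poly p) x = 0" "degree p = (LEAST d. Q d)"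
    by (auto simp: Q_def)
  define p1 where "p1 = primitive_part p"
  define m where "m = (if lead_coeff p1 > 0 then p1 else - p1)"
  have p_eq: "p = smult (content p) p1" by (simp add: p1_def)
  have cp: "content p \<noteq> 0" using p(1) by simp
  have p1: "p1 \<noteq> 0" "content p1 = 1" "degree p1 = degree p" using p(1) by (simp_all add: p1_def)
  have "of_int_poly p = smult (of_int (content p)) (of_int_poly p1 :: 'a poly)"
    by (subst p_eq) (simp add: of_int_hom.map_poly_hom_smult)
  hence p1x: "poly (of_int_poly p1) x = 0" using p(2) cp by simp
  have m: "lead_coeff m > 0" "content m = 1" "poly (of_int_poly m) x = 0" "degree m = (LEAST d. Q d)" "m \<noteq> 0"
  proof -
    have "lead_coeff p1 \<noteq> 0" using p1(1) by simp
    thus "lead_coeff m > 0" by (auto simp: m_def)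
    have "content (- p1) = content (smult (-1) p1)" by simp
    also have "\<dots> = 1" using p1(2) by (simp only: content_smult) simp
    finally show "content m = 1" using p1(2) by (simp add: m_def)
    show "poly (of_int_poly m) x = 0" using p1x by (simp add: m_def hom_distribs)
    show "degree m = (LEAST d. Q d)" using p1 p(3) by (simp add: m_def)
    show "m \<noteq> 0" using p1 by (simp add: m_def)
  qed
  have dvd: "m dvd G" if G: "poly (of_int_poly G) x = 0" for G
  proof -
    obtain a q where aq: "a \<noteq> 0" "smult a G = m * q + pseudo_mod G m" using pseudo_mod(1)[OF m(5)] by blast
    have "of_int_poly (smult a G) = of_int_poly m * of_int_poly q + (of_int_poly (pseudo_mod G m) :: 'a poly)"
      unfolding aq(2) by (simp add: hom_distribs)
    hence "smult (of_int a) (of_int_poly G) = of_int_poly m * of_int_poly q + (of_int_poly (pseudo_mod G m) :: 'a poly)"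
      by (simp add: hom_distribs)
    from arg_cong[OF this, of "\<lambda>p. poly p x"]
    have "poly (of_int_poly (pseudo_mod G m)) x = 0" using m(3) G by simp
    hence "pseudo_mod G m = 0 \<or> Q (degree (pseudo_mod G m))" by (auto simp: Q_def)
    hence "pseudo_mod G m = 0" using pseudo_mod(2)[OF m(5), of G] not_less_Least[of _ Q] m(4) by metis
    hence "m dvd smult a G" using aq by simp
    thus ?thesis using primitive_dvd_smult m(2) aq(1) by blast
  qed
  have "irreducible m"
  proof (rule Factorial_Ring.irreducibleI)
    show "m \<noteq> 0" by (rule m)
    show "\<not> m dvd 1"
    proof
      assume "m dvd 1"
      then obtain k where "1 = m * k" by (elim dvdE)
      hence "(1::'a poly) = of_int_poly m * of_int_poly k"
        by (metis of_int_poly_hom.hom_one of_int_poly_hom.hom_mult)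
      from arg_cong[OF this, of "\<lambda>p. poly p x"] show False using m(3) by simp
    qed
    fix a b assume ab: "m = a * b"
    hence "of_int_poly m = of_int_poly a * (of_int_poly b :: 'a poly)" by (simp add: hom_distribs)
    from arg_cong[OF this, of "\<lambda>p. poly p x"] have "poly (of_int_poly a) x = 0 \<or> poly (of_int_poly b) x = 0"
      using m(3) by simp
    thus "a dvd 1 \<or> b dvd 1"
    proof
      assume "poly (of_int_poly a) x = 0"
      hence "m dvd a" by (rule dvd)
      then obtain k where "a = m * k" by (elim dvdE)
      hence "a = a * b * k" by (metis ab)
      hence "a * (b * k) = a * 1" by (simp add: mult.assoc)
      hence "b * k = 1" using m(5) ab by (simp only: mult_cancel_left) simp
      thus ?thesis by (metis dvd_triv_left)
    next
      assume "poly (of_int_poly b) x = 0"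
      hence "m dvd b" by (rule dvd)
      then obtain k where "b = m * k" by (elim dvdE)
      hence "b = a * b * k" by (metis ab)
      hence "b * (a * k) = b * 1" by (simp add: mult_ac)
      hence "a * k = 1" using m(5) ab by (simp only: mult_cancel_left) simp
      thus ?thesis by (metis dvd_triv_left)
    qed
  qed
  thus ?thesis using m dvd by blast
qed

definition min_int_poly :: "'a::field_char_0 \<Rightarrow> int poly" where
  "min_int_poly x = (SOME m. irreducible m \<and> lead_coeff m > 0 \<and> content m = 1 \<and> poly (of_int_poly m) x = 0 \<and>
    (\<forall>G. poly (of_int_poly G) x = 0 \<longrightarrow> m dvd G))"

context
  fixes x :: "'a::field_char_0"
  assumes alg: "algebraic x"
begin

lemma min_int_poly:
  shows min_int_poly_irreducible: "irreducible (min_int_poly x)"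
    and min_int_poly_lead: "lead_coeff (min_int_poly x) > 0"
    and min_int_poly_content: "content (min_int_poly x) = 1"
    and min_int_poly_root: "poly (of_int_poly (min_int_poly x)) x = 0"
    and min_int_poly_dvd: "\<And>G. poly (of_int_poly G) x = 0 \<Longrightarrow> min_int_poly x dvd G"
  using someI_ex[OF int_minpoly_exists[OF alg]] unfolding min_int_poly_def[symmetric] by blast+

lemma min_int_poly_nz: "min_int_poly x \<noteq> 0"
  using min_int_poly_lead by auto

lemma min_int_poly_degree: "degree (min_int_poly x) > 0"
proof (rule ccontr)
  assume "\<not> ?thesis"
  then obtain b where b: "min_int_poly x = [:b:]" using degree_eq_zeroE[of "min_int_poly x"] by auto
  have "of_int_poly [:b:] = [:of_int b :: 'a:]" by (cases "b = 0") (simp_all add: map_poly_pCons)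
  thus False using min_int_poly_root min_int_poly_nz b by simp
qed

end

lemma min_int_poly_unique:
  fixes x :: "'a::field_char_0"
  assumes "irreducible F" "lead_coeff F > 0" "poly (of_int_poly F) x = 0"
  shows "min_int_poly x = F" and "algebraic x"
proof -
  have "F \<noteq> 0" using assms by auto
  thus alg: "algebraic x" using assms(3) by (intro algebraicI'[of "of_int_poly F"]) auto
  obtain k where k: "F = min_int_poly x * k" using min_int_poly_dvd[OF alg assms(3)] by (elim dvdE)
  hence "k dvd 1" using assms(1) min_int_poly_irreducible[OF alg]
    by (metis Factorial_Ring.irreducibleD Factorial_Ring.irreducible_not_unit)
  then obtain c where c: "k = [:c:]" "c dvd 1" by (auto simp: is_unit_poly_iff)
  have "lead_coeff F = lead_coeff (min_int_poly x) * c" using k c by (simp add: lead_coeff_mult)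
  hence "c > 0" using assms(2) min_int_poly_lead[OF alg] by (metis zero_less_mult_pos)
  hence "c = 1" using c(2) by simp
  thus "min_int_poly x = F" using k c by simp
qed

text \<open>The source of the Galois invariance of heights: \<open>ht\<close> depends on its
  argument only through this polynomial.\<close>

lemma (in hom_sfield) min_int_poly_hom:
  assumes "algebraic x" "x \<in> S"
  shows "min_int_poly (\<phi> x) = min_int_poly x"
proof (rule min_int_poly_unique)
  show "poly (of_int_poly (min_int_poly x)) (\<phi> x) = 0"
    using hom_poly[of "of_int_poly (min_int_poly x)" x] min_int_poly_root[OF assms(1)] assms(2) by simp
qed (use min_int_poly[OF assms(1)] in blast)+

section \<open>Mahler measure and height\<close>

definition log_mahler :: "complex poly \<Rightarrow> real" where
  "log_mahler p = ln (cmod (lead_coeff p)) + (\<Sum>r\<in>#proots p. ln (max 1 (cmod r)))"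

lemma log_mahler_mult: "p \<noteq> 0 \<Longrightarrow> q \<noteq> 0 \<Longrightarrow> log_mahler (p * q) = log_mahler p + log_mahler q"
  by (simp add: log_mahler_def lead_coeff_mult norm_mult ln_mult proots_mult)

lemma log_mahler_power: "p \<noteq> 0 \<Longrightarrow> log_mahler (p ^ k) = k * log_mahler p"
proof (induction k)
  case 0 thus ?case by (simp add: log_mahler_def)
next
  case (Suc k) thus ?case by (simp add: log_mahler_mult algebra_simps)
qed

lemma proots_prod_linear [simp]: "proots (\<Prod>x\<in>#M. [:- x, 1 :: 'a::field_char_0:]) = M"
proof (induction M)
  case (add x M)
  have "(\<Prod>x\<in>#M. [:- x, 1 :: 'a:]) \<noteq> 0" using monic_prod_mset_linear[of M] by (metis coeff_0 zero_neq_one)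
  thus ?case using add by (simp add: proots_mult proots_linear_factor del: mult_pCons_left)
qed simp

lemma log_mahler_linear:
  assumes "a \<noteq> 0"
  shows "log_mahler (smult a (\<Prod>x\<in>#M. [:- x, 1:])) = ln (cmod a) + (\<Sum>r\<in>#M. ln (max 1 (cmod r)))"
  using assms monic_prod_mset_linear[of M] by (simp add: log_mahler_def)

definition ht :: "'a::field_char_0 \<Rightarrow> real" where
  "ht x = log_mahler (of_int_poly (min_int_poly x)) / degree (min_int_poly x)"

lemma ln_max_nonneg: "ln (max 1 (t::real)) \<ge> 0"
  by (rule ln_ge_zero) simp

lemma log_mahler_int_nonneg: "lead_coeff (F::int poly) > 0 \<Longrightarrow> log_mahler (of_int_poly F) \<ge> 0"
proof -
  assume l: "lead_coeff F > 0"
  have "ln (cmod (lead_coeff (of_int_poly F))) \<ge> 0"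
    by (rule ln_ge_zero) (use l in simp)
  moreover have "(\<Sum>r\<in>#M. ln (max 1 (cmod r))) \<ge> 0" for M
    by (induction M) (simp_all add: ln_max_nonneg)
  ultimately show ?thesis by (simp add: log_mahler_def)
qed

lemma ht_nonneg: "algebraic x \<Longrightarrow> ht x \<ge> 0"
  unfolding ht_def by (intro divide_nonneg_nonneg log_mahler_int_nonneg min_int_poly_lead) auto

text \<open>Each root of G has F as its minimal polynomial, so F can be split off repeatedly. In the
  application G comes from a characteristic polynomial, and the exponent is the multiplicity with
  which a list of embeddings repeats the conjugates.\<close>

lemma int_poly_power_of_irreducible:
  fixes F G :: "int poly"
  assumes F: "irreducible F" "lead_coeff F > 0"
    and "content G = 1" "lead_coeff G > 0"
    and "\<And>r::complex. poly (of_int_poly G) r = 0 \<Longrightarrow> poly (of_int_poly F) r = 0"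
  shows "\<exists>k. G = F ^ k"
  using assms(3-)
proof (induction "degree G" arbitrary: G rule: less_induct)
  case (less G)
  show ?case
  proof (cases "degree G = 0")
    case True
    then obtain c where c: "G = [:c:]" by (elim degree_eq_zeroE)
    hence "c = 1" using less.prems(1,2) by (cases "c = 0") auto
    hence "G = F ^ 0" using c by simp
    thus ?thesis by blast
  next
    case False
    hence "\<not> constant (poly (of_int_poly G :: complex poly))" by (simp add: constant_degree)
    then obtain r :: complex where r: "poly (of_int_poly G) r = 0"
      using fundamental_theorem_of_algebra by blast
    have Fr: "min_int_poly r = F" "algebraic r"
      using min_int_poly_unique[OF F less.prems(3)[OF r]] by auto
    obtain H where H: "G = F * H" using min_int_poly_dvd[OF Fr(2) r] Fr(1) by (auto elim: dvdE)
    have dF: "degree F > 0" using min_int_poly_degree[OF Fr(2)] Fr(1) by simp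
    have nz: "F \<noteq> 0" "H \<noteq> 0" using H less.prems(2) by auto
    have "degree G = degree F + degree H" using H nz by (simp add: degree_mult_eq)
    hence "degree H < degree G" using dF by simp
    moreover have "content H = 1"
    proof -
      have "content F * content H = 1" using less.prems(1) H by (simp add: content_mult)
      moreover have "content H \<ge> 0" by (metis normalize_content normalize_int_def abs_ge_zero)
      ultimately show ?thesis by (metis dvd_triv_right zdvd1_eq abs_of_nonneg)
    qed
    moreover have "lead_coeff H > 0"
      using less.prems(2) F(2) unfolding H lead_coeff_mult by (metis zero_less_mult_pos)
    moreover have "poly (of_int_poly F) r = 0" if "poly (of_int_poly H) r = 0" for r :: complex
      using that less.prems(3)[of r] by (simp add: H hom_distribs)
    ultimately obtain k where "H = F ^ k" using less.hyps by blast
    hence "G = F ^ Suc k" using H by simp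
    thus ?thesis by blast
  qed
qed

section \<open>Denominators of characteristic polynomials\<close>

lemma int_bezout:
  fixes a :: "nat \<Rightarrow> int"
  shows "\<exists>f. (\<Sum>j<n. f j * a j) = Gcd (a ` {..<n})"
proof (induction n)
  case (Suc n)
  then obtain f where f: "(\<Sum>j<n. f j * a j) = Gcd (a ` {..<n})" by blast
  obtain u v where uv: "u * a n + v * Gcd (a ` {..<n}) = gcd (a n) (Gcd (a ` {..<n}))"
    using bezout_int by blast
  have "(\<Sum>j<Suc n. (if j = n then u else v * f j) * a j) = (\<Sum>j<n. v * (f j * a j)) + u * a n"
    by (simp add: mult.assoc)
  also have "\<dots> = gcd (a n) (Gcd (a ` {..<n}))"
    unfolding sum_distrib_left[symmetric] f using uv by simp
  also have "\<dots> = Gcd (a ` {..<Suc n})" by (simp add: lessThan_Suc)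
  finally show ?case by (intro exI[of _ "\<lambda>j. if j = n then u else v * f j"])
qed simp

text \<open>This is how primitivity is exploited: a property of the multiples of all coefficients by
  one number passes to the number itself.\<close>

lemma primitive_bezout:
  fixes G :: "int poly"
  assumes "content G = 1"
  shows "\<exists>f. (\<Sum>j\<le>degree G. f j * coeff G j) = 1"
proof -
  let ?g = "Gcd (coeff G ` {..<Suc (degree G)})"
  have "?g dvd coeff G j" for j
    by (cases "j \<le> degree G") (auto simp: coeff_eq_0 intro: Gcd_dvd)
  hence "[:?g:] dvd G" by (simp add: const_poly_dvd_iff)
  hence "?g dvd content G" by (simp add: const_poly_dvd_iff_dvd_content)
  hence "?g = 1" using assms by simp
  thus ?thesis using int_bezout[where a = "coeff G" and n = "Suc (degree G)"]
    by (simp only: lessThan_Suc_atMost)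
qed

lemma clear_denominators:
  fixes P :: "'a::field_char_0 poly"
  assumes "polyover \<rat> P"
  shows "\<exists>(c::int) G. c > 0 \<and> smult (of_int c) P = of_int_poly G"
  using assms
proof (induction P)
  case 0
  show ?case by (intro exI[of _ 1] exI[of _ 0]) simp
next
  case (pCons a P)
  have a: "a \<in> \<rat>" using pCons.prems by (metis polyover_def coeff_pCons_0)
  have "polyover \<rat> P" using pCons.prems by (metis polyover_def coeff_pCons_Suc)
  then obtain c G where cG: "c > (0::int)" "smult (of_int c) P = of_int_poly G" using pCons.IH by blast
  obtain u v where uv: "v > 0" "a = of_int u / of_int v"
    using a by (elim Rats_cases') blast
  have "smult (of_int (c * v)) (pCons a P) = pCons (of_int (c * u)) (smult (of_int v) (smult (of_int c) P))"
    using uv by (simp add: mult.commute)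
  also have "\<dots> = of_int_poly (pCons (c * u) (smult v G))"
    unfolding cG by (simp add: hom_distribs)
  finally show ?case using cG(1) uv(1) by (intro exI[of _ "c * v"]) auto
qed

text \<open>The characteristic polynomial of y. It is indexed by positions in the list because
  \<open>aipoly_norm\<close> and its relatives speak of families over a finite index set.\<close>

definition conj_poly :: "('a \<Rightarrow> complex) list \<Rightarrow> 'a \<Rightarrow> complex poly" where
  "conj_poly E y = (\<Prod>i<length E. [:- (E ! i) y, 1:])"

lemma conj_poly_mset: "conj_poly E y = (\<Prod>r\<in>#mset (map (\<lambda>s. s y) E). [:- r, 1:])"
proof -
  have "(\<Prod>r\<in>#mset (map (\<lambda>s. s y) E). [:- r, 1:]) = prod_list (map (\<lambda>s. [:- s y, 1:]) E)"
    by (simp only: mset_map[symmetric] prod_mset_prod_list map_map o_def)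
  also have "\<dots> = conj_poly E y"
    unfolding conj_poly_def by (subst prod.list_conv_set_nth) (simp add: atLeast0LessThan)
  finally show ?thesis ..
qed

lemma sum_mset_map_nth: "(\<Sum>r\<in>#mset (map f E). g r) = (\<Sum>i<length E. g (f (E ! i)))"
proof -
  have "(\<Sum>r\<in>#mset (map f E). g r) = sum_list (map (\<lambda>s. g (f s)) E)"
    by (simp only: mset_map[symmetric] sum_mset_sum_list map_map o_def)
  also have "\<dots> = (\<Sum>i<length E. g (f (E ! i)))"
    by (subst sum.list_conv_set_nth) (simp add: atLeast0LessThan)
  finally show ?thesis .
qed

lemma conj_family_sfield: "conj_family S E \<Longrightarrow> sfield S"
  by (simp add: conj_family_def)

lemma conj_family_hom: "conj_family S E \<Longrightarrow> i < length E \<Longrightarrow> hom_sfield S (E ! i)"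
  by (auto simp: conj_family_def hom_sfield_def hom_sring_def hom_sring_axioms_def sfield_def)

text \<open>A plays the role of the norm of the denominator ideal of y, read off from the primitive
  integral multiple of the characteristic polynomial.\<close>

definition conj_den :: "('a \<Rightarrow> complex) list \<Rightarrow> 'a \<Rightarrow> int \<Rightarrow> bool" where
  "conj_den E y A \<longleftrightarrow> A > 0 \<and> (\<exists>G. content G = 1 \<and> smult (of_int A) (conj_poly E y) = of_int_poly G)"

text \<open>The primitive integral multiple G of the characteristic polynomial is a power of the
  minimal polynomial, since it has no other roots; comparing degrees and logarithmic Mahler measures
  gives the formula. Heights of several elements thus become sums over one common list E.\<close>

lemma conj_family_height:
  fixes y :: "'a::field_char_0"
  assumes fam: "conj_family S E" and y: "y \<in> S" "algebraic y"
  shows "\<exists>A. conj_den E y A \<and>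
    length E * ht y = ln (of_int A) + (\<Sum>i<length E. ln (max 1 (cmod ((E ! i) y))))"
    and "degree (min_int_poly y) \<le> length E"
proof -
  let ?P = "conj_poly E y" and ?F = "min_int_poly y"
  have lE: "length E > 0" using fam by (simp add: conj_family_def)
  have mon: "monic ?P" "degree ?P = length E" unfolding conj_poly_mset
    by (rule monic_prod_mset_linear) (simp only: degree_prod_mset_linear, simp)
  have "polyover \<rat> ?P" unfolding conj_poly_mset by (rule polyover_Rats_conj_family[OF fam y(1)])
  then obtain c H where cH: "c > (0::int)" "smult (of_int c) ?P = of_int_poly H"
    using clear_denominators by blast
  define G where "G = primitive_part H"
  have H: "H = smult (content H) G" by (simp add: G_def)
  have "lead_coeff (of_int_poly H :: complex poly) = of_int c"
    unfolding cH(2)[symmetric] using mon by simp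
  hence lH: "lead_coeff H = c" by (simp add: of_int_hom.degree_map_poly_hom)
  hence Hnz: "H \<noteq> 0" using cH by auto
  have chp: "content H > 0"
  proof -
    have "content H \<ge> 0" by (metis normalize_content normalize_int_def abs_ge_zero)
    moreover have "content H \<noteq> 0" using Hnz by simp
    ultimately show ?thesis by (metis less_le)
  qed
  have cG: "content G = 1" using Hnz by (simp add: G_def)
  have lG: "content H * lead_coeff G = c" using lH H by (metis lead_coeff_smult)
  hence lG0: "lead_coeff G > 0" using cH(1) chp by (metis zero_less_mult_pos)
  hence Gnz: "G \<noteq> 0" by (metis leading_coeff_0_iff less_irrefl)
  have "smult (of_int (content H)) (of_int_poly G) = smult (of_int (content H)) (smult (of_int (lead_coeff G)) ?P)"
  proof -
    have "smult (of_int (content H)) (of_int_poly G) = (of_int_poly H :: complex poly)"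
      by (subst (2) H) (simp add: hom_distribs)
    also have "\<dots> = smult (of_int (content H * lead_coeff G)) ?P" unfolding lG cH(2)[symmetric] ..
    finally show ?thesis by simp
  qed
  from arg_cong[OF this, of "smult (inverse (of_int (content H)))"]
  have GP: "smult (of_int (lead_coeff G)) ?P = of_int_poly G" using chp Hnz by (simp add: mult.assoc[symmetric])
  have roots: "poly (of_int_poly ?F) r = 0" if r: "poly (of_int_poly G) r = 0" for r :: complex
  proof -
    have "poly ?P r = 0" using r lG0 Gnz unfolding GP[symmetric] by simp
    then obtain i where i: "i < length E" "r = (E ! i) y" by (auto simp: conj_poly_def poly_prod)
    interpret hom_sfield S "E ! i" by (rule conj_family_hom[OF fam i(1)])
    show ?thesis using hom_poly[of "of_int_poly ?F" y] min_int_poly_root[OF y(2)] y(1) i by simp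
  qed
  obtain k where k: "G = ?F ^ k"
    using int_poly_power_of_irreducible[OF min_int_poly_irreducible[OF y(2)] min_int_poly_lead[OF y(2)] cG lG0 roots]
    by blast
  have nz: "?F \<noteq> 0" by (rule min_int_poly_nz[OF y(2)])
  have "degree (of_int_poly G :: complex poly) = length E" unfolding GP[symmetric] using Gnz mon by simp
  hence deg: "length E = k * degree ?F"
    by (simp add: of_int_hom.degree_map_poly_hom k degree_power_eq nz mult.commute)
  hence k0: "k > 0" using lE by (cases k) auto
  show "degree ?F \<le> length E" using deg k0 by simp
  have "log_mahler (of_int_poly G) = k * log_mahler (of_int_poly ?F)"
    unfolding k using nz by (simp add: of_int_poly_hom.hom_power log_mahler_power)
  hence "length E * ht y = log_mahler (of_int_poly G)"
    using deg min_int_poly_degree[OF y(2)] by (simp add: ht_def)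
  also have "\<dots> = ln (of_int (lead_coeff G)) + (\<Sum>i<length E. ln (max 1 (cmod ((E ! i) y))))"
    unfolding GP[symmetric] conj_poly_mset using lG0
    by (subst log_mahler_linear) (simp_all only: sum_mset_map_nth, simp_all add: Gnz)
  finally show "\<exists>A. conj_den E y A \<and>
    length E * ht y = ln (of_int A) + (\<Sum>i<length E. ln (max 1 (cmod ((E ! i) y))))"
    using lG0 cG GP unfolding conj_den_def by blast
qed

lemma conj_den_aipoly: "conj_den E y A \<Longrightarrow> aipoly (smult (of_int A) (conj_poly E y))"
  unfolding conj_den_def by auto

lemma conj_family_const_rational:
  assumes "conj_family S E" "y \<in> S"
  shows "(\<Prod>i<length E. (E ! i) y) \<in> \<rat>"
proof -
  have "coeff (conj_poly E y) 0 \<in> \<rat>"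
    using polyover_Rats_conj_family[OF assms] unfolding conj_poly_mset polyover_def by blast
  also have "coeff (conj_poly E y) 0 = poly (conj_poly E y) 0" by (rule poly_0_coeff_0[symmetric])
  also have "\<dots> = (-1) ^ length E * (\<Prod>i<length E. (E ! i) y)"
    by (simp add: conj_poly_def poly_prod prod_uminus)
  finally show ?thesis by (cases "even (length E)") auto
qed

text \<open>If c clears the characteristic polynomial, then c times the j-th coefficient of the
  primitive polynomial G is \<open>A * m j\<close> with an integer \<open>m j\<close>. A Bezout
  combination of the coefficients of G then exhibits c as a multiple of A.\<close>

lemma conj_den_dvd:
  assumes fam: "conj_family S E" and y: "y \<in> S" and A: "conj_den E y A"
    and c: "aipoly (smult (of_int c) (conj_poly E y))"
  shows "A dvd c"
proof -
  let ?P = "conj_poly E y"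
  obtain G where G: "content G = 1" "smult (of_int A) ?P = of_int_poly G" using A by (auto simp: conj_den_def)
  have "polyover \<rat> ?P" unfolding conj_poly_mset by (rule polyover_Rats_conj_family[OF fam y])
  hence "of_int c * coeff ?P j \<in> \<rat>" for j unfolding polyover_def by (intro Rats_mult) auto
  moreover have "algebraic_int (of_int c * coeff ?P j)" for j using c by (auto simp: aipoly_def)
  ultimately have "of_int c * coeff ?P j \<in> \<int>" for j using rational_algebraic_int_is_int by blast
  hence "\<forall>j. \<exists>m. of_int c * coeff ?P j = of_int m" by (auto elim!: Ints_cases)
  then obtain m where m: "\<And>j. of_int c * coeff ?P j = of_int (m j)" by metis
  obtain f where f: "(\<Sum>j\<le>degree G. f j * coeff G j) = 1" using primitive_bezout[OF G(1)] by blast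
  have "of_int (c * coeff G j) = (of_int (A * m j) :: complex)" for j
  proof -
    have "of_int (coeff G j) = of_int A * coeff ?P j" using arg_cong[OF G(2), of "\<lambda>p. coeff p j"] by simp
    thus ?thesis using m[of j] by (simp add: mult_ac)
  qed
  hence cG: "c * coeff G j = A * m j" for j by (simp only: of_int_eq_iff)
  have "c = (\<Sum>j\<le>degree G. f j * (c * coeff G j))"
    using arg_cong[OF f, of "\<lambda>x. c * x"] by (simp add: sum_distrib_left mult_ac)
  also have "\<dots> = A * (\<Sum>j\<le>degree G. f j * m j)"
    unfolding cG by (simp add: sum_distrib_left mult_ac)
  finally show ?thesis by simp
qed

text \<open>The expansion behind \<open>aipoly_norm\<close>, with integrality of the scaled
  monomials as a hypothesis, so that the scaling factor B may be a square root.\<close>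

lemma aipoly_expand:
  assumes "finite I" "\<And>f. f \<in> PiE I (\<lambda>_. {..m}) \<Longrightarrow> algebraic_int (B * (\<Prod>i\<in>I. x i ^ f i))"
    and "\<And>i k. i \<in> I \<Longrightarrow> k \<le> m \<Longrightarrow> aipoly (u i k)"
  shows "aipoly (smult B (\<Prod>i\<in>I. \<Sum>k\<le>m. smult (x i ^ k) (u i k)))"
proof -
  have "(\<Prod>i\<in>I. \<Sum>k\<le>m. smult (x i ^ k) (u i k)) =
        (\<Sum>f\<in>PiE I (\<lambda>_. {..m}). \<Prod>i\<in>I. smult (x i ^ f i) (u i (f i)))"
    using assms(1) by (intro prod_sum_PiE) auto
  also have "\<dots> = (\<Sum>f\<in>PiE I (\<lambda>_. {..m}). smult (\<Prod>i\<in>I. x i ^ f i) (\<Prod>i\<in>I. u i (f i)))"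
    by (simp add: prod_smult)
  also have "smult B \<dots> = (\<Sum>f\<in>PiE I (\<lambda>_. {..m}). smult (B * (\<Prod>i\<in>I. x i ^ f i)) (\<Prod>i\<in>I. u i (f i)))"
    by (simp add: smult_sum2)
  also have "aipoly \<dots>"
    by (intro aipoly_sum aipoly_smult aipoly_prod assms(2,3)) (auto simp: PiE_def Pi_def)
  finally show ?thesis .
qed

section \<open>Heights under quadratic maps\<close>

text \<open>Finite places see x^2 + c and x^2 alike when c is integral, so the denominator is
  exactly squared. That B divides A^2 is \<open>aipoly_norm\<close>; for the converse a square root
  w of B is shown to clear the characteristic polynomial of x.\<close>

lemma conj_den_quadratic:
  assumes fam: "conj_family S E" and x: "x \<in> S" and c: "c \<in> S" "algebraic_int c"
    and A: "conj_den E x A" and B: "conj_den E (x\<^sup>2 + c) B"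
  shows "B = A\<^sup>2"
proof -
  interpret sfield S using fam by (rule conj_family_sfield)
  define I where "I = {..<length E}"
  define xx where "xx i = (E ! i) x" for i
  define cc where "cc i = (E ! i) c" for i
  have fin: "finite I" by (simp add: I_def)
  have yS: "x\<^sup>2 + c \<in> S" using x c by (intro add power)
  have Y: "(E ! i) (x\<^sup>2 + c) = xx i ^ 2 + cc i" and C: "algebraic_int (cc i)" if "i \<in> I" for i
  proof -
    interpret hom_sfield S "E ! i" by (rule conj_family_hom[OF fam]) (use that in \<open>simp add: I_def\<close>)
    show "(E ! i) (x\<^sup>2 + c) = xx i ^ 2 + cc i" using x c by (simp add: xx_def cc_def hom_add hom_power power)
    show "algebraic_int (cc i)" unfolding cc_def by (rule hom_algebraic_int) (use c in auto)
  qed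
  have Px: "conj_poly E x = (\<Prod>i\<in>I. [:- xx i, 1:])" by (simp add: conj_poly_def I_def xx_def)
  have Py: "conj_poly E (x\<^sup>2 + c) = (\<Prod>i\<in>I. [:- (xx i ^ 2 + cc i), 1:])"
    unfolding conj_poly_def I_def[symmetric] by (rule prod.cong[OF refl]) (simp add: Y)
  have aix: "aipoly (smult (of_int A) (\<Prod>i\<in>I. [:- xx i, 1:]))" using conj_den_aipoly[OF A] by (simp only: Px)
  have aiy: "aipoly (smult (of_int B) (\<Prod>i\<in>I. [:- (xx i ^ 2 + cc i), 1:]))"
    using conj_den_aipoly[OF B] by (simp only: Py)
  have B0: "B > 0" and A0: "A > 0" using A B by (auto simp: conj_den_def)
  have "B dvd A\<^sup>2"
  proof (rule conj_den_dvd[OF fam yS B])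
    \<comment> \<open>The coefficients of T - (x^2 + c) as a polynomial in x: T - c, 0 and
      -1.\<close>
    let ?u = "\<lambda>i k. if k = 0 then [:- cc i, 1:] else if k = 1 then 0 else [:- 1:]"
    have "aipoly (smult (of_int A ^ 2) (\<Prod>i\<in>I. \<Sum>k\<le>2. smult (xx i ^ k) (?u i k)))"
      by (rule aipoly_norm[OF fin aix]) (auto intro!: aipoly_pCons simp: C simp del: aipoly_def)
    also have "(\<Prod>i\<in>I. \<Sum>k\<le>2. smult (xx i ^ k) (?u i k)) = (\<Prod>i\<in>I. [:- (xx i ^ 2 + cc i), 1:])"
      by (rule prod.cong[OF refl]) (simp add: numeral_2_eq_2)
    finally show "aipoly (smult (of_int (A\<^sup>2)) (conj_poly E (x\<^sup>2 + c)))" by (simp add: Py)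
  qed
  moreover have "A\<^sup>2 dvd B"
  proof -
    define w where "w = csqrt (of_int B)"
    have w2: "w * w = of_int B" unfolding w_def power2_eq_square[symmetric] by (rule power2_csqrt)
    \<comment> \<open>The square of this number is B times a product of factors 1 or x_i^2 = y_i -
      c_i. These are of degree at most 1 in the conjugates y_i of x^2 + c, so one factor B makes the
      product integral.\<close>
    have mon: "algebraic_int (w * (\<Prod>i\<in>I. xx i ^ f i))" if f: "f \<in> PiE I (\<lambda>_. {..1})" for f
    proof (rule algebraic_int_square_imp)
      have f01: "f i = 0 \<or> f i = 1" if "i \<in> I" for i using f that by (force simp: PiE_def Pi_def)
      let ?u = "\<lambda>i k. if f i = 0 then (if k = 0 then 1 else 0) else (if k = 0 then - cc i else 1)"
      have "algebraic_int (of_int B ^ 1 * (\<Prod>i\<in>I. \<Sum>k\<le>1. ?u i k * (xx i ^ 2 + cc i) ^ k))"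
        by (rule algebraic_int_norm[OF fin aiy]) (simp add: C)
      also have "(\<Prod>i\<in>I. \<Sum>k\<le>1. ?u i k * (xx i ^ 2 + cc i) ^ k) = (\<Prod>i\<in>I. (xx i ^ f i)\<^sup>2)"
      proof (rule prod.cong[OF refl])
        fix i assume "i \<in> I"
        from f01[OF this] show "(\<Sum>k\<le>1. ?u i k * (xx i ^ 2 + cc i) ^ k) = (xx i ^ f i)\<^sup>2"
          by (elim disjE) simp_all
      qed
      also have "of_int B ^ 1 * (\<Prod>i\<in>I. (xx i ^ f i)\<^sup>2) = (w * (\<Prod>i\<in>I. xx i ^ f i))\<^sup>2"
        by (simp add: power2_eq_square prod.distrib w2[symmetric] mult_ac)
      finally show "algebraic_int ((w * (\<Prod>i\<in>I. xx i ^ f i))\<^sup>2)" .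
    qed
    let ?v = "\<lambda>(i::nat) k. if k = 0 then [:0, 1:] else [:- 1:]"
    have "aipoly (smult w (\<Prod>i\<in>I. \<Sum>k\<le>1. smult (xx i ^ k) (?v i k)))"
      by (rule aipoly_expand[OF fin mon]) (auto intro!: aipoly_pCons)
    also have "(\<Prod>i\<in>I. \<Sum>k\<le>1. smult (xx i ^ k) (?v i k)) = conj_poly E x"
      unfolding Px by (rule prod.cong[OF refl]) simp
    finally have wP: "algebraic_int (w * coeff (conj_poly E x) j)" for j by (simp add: aipoly_def)
    obtain G where G: "content G = 1" "smult (of_int A) (conj_poly E x) = of_int_poly G"
      using A by (auto simp: conj_den_def)
    have cG: "of_int (coeff G j) = of_int A * coeff (conj_poly E x) j" for j
      using arg_cong[OF G(2), of "\<lambda>p. coeff p j"] by simp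
    obtain f where f: "(\<Sum>j\<le>degree G. f j * coeff G j) = 1" using primitive_bezout[OF G(1)] by blast
    \<comment> \<open>The Bezout combination evaluates this integral number to w / A, so B / A^2 =
      z^2 is both integral and rational.\<close>
    define z where "z = (\<Sum>j\<le>degree G. of_int (f j) * (w * coeff (conj_poly E x) j))"
    have "of_int A * z = w * of_int (\<Sum>j\<le>degree G. f j * coeff G j)"
      by (simp add: z_def sum_distrib_left cG mult_ac)
    hence "of_int A * z = w" by (simp add: f)
    hence Bz: "of_int B = of_int (A\<^sup>2) * z\<^sup>2"
      using w2 by (metis mult.assoc mult.left_commute of_int_power power2_eq_square)
    have "algebraic_int (z\<^sup>2)" unfolding z_def by (intro algebraic_int_power algebraic_int_sum algebraic_int_mult wP algebraic_int_of_int)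
    moreover have "z\<^sup>2 \<in> \<rat>"
    proof -
      have "z\<^sup>2 = of_int B / of_int (A\<^sup>2)" using Bz A0 by (simp add: field_simps)
      thus ?thesis by simp
    qed
    ultimately obtain k where "z\<^sup>2 = of_int k" using rational_algebraic_int_is_int by (metis Ints_cases)
    hence "of_int B = (of_int (A\<^sup>2 * k) :: complex)" using Bz by simp
    hence "B = A\<^sup>2 * k" by (simp only: of_int_eq_iff)
    thus ?thesis by simp
  qed
  ultimately show ?thesis using B0 A0 by (intro zdvd_antisym_nonneg) auto
qed

lemma abs_ln_max_quadratic:
  fixes x c :: complex
  assumes "cmod c \<le> R"
  shows "\<bar>ln (max 1 (cmod (x\<^sup>2 + c))) - 2 * ln (max 1 (cmod x))\<bar> \<le> ln (1 + R)"
proof -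
  have R: "R \<ge> 0" using assms norm_ge_zero order_trans by blast
  define a b where "a = max 1 (cmod (x\<^sup>2 + c))" and "b = (max 1 (cmod x))\<^sup>2"
  have a1: "a \<ge> 1" and b1: "b \<ge> 1" by (simp_all add: a_def b_def)
  have xb: "(cmod x)\<^sup>2 \<le> b" unfolding b_def by (intro power_mono) auto
  have "cmod (x\<^sup>2 + c) \<le> (cmod x)\<^sup>2 + R" using norm_triangle_ineq[of "x\<^sup>2" c] assms by (simp add: norm_power)
  also have "\<dots> \<le> b + R * b" using xb mult_left_mono[OF b1 R] by simp
  finally have "cmod (x\<^sup>2 + c) \<le> (1 + R) * b" by (simp add: algebra_simps)
  moreover have "1 \<le> (1 + R) * b" using R b1 mult_mono[of 1 "1+R" 1 b] by simp
  ultimately have ab: "a \<le> (1 + R) * b" by (simp add: a_def)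
  have "(cmod x)\<^sup>2 \<le> cmod (x\<^sup>2 + c) + R"
    using norm_triangle_ineq4[of "x\<^sup>2 + c" c] assms by (simp add: norm_power)
  also have "\<dots> \<le> a + R * a" using mult_left_mono[OF a1 R] by (intro add_mono) (simp_all add: a_def)
  finally have "(cmod x)\<^sup>2 \<le> (1 + R) * a" by (simp add: algebra_simps)
  moreover have "1 \<le> (1 + R) * a" using R a1 mult_mono[of 1 "1+R" 1 a] by simp
  ultimately have ba: "b \<le> (1 + R) * a" by (auto simp: b_def max_def)
  have "ln a \<le> ln (1 + R) + ln b" "ln b \<le> ln (1 + R) + ln a"
    using ab ba a1 b1 R ln_le_cancel_iff[of a "(1+R)*b"] ln_le_cancel_iff[of b "(1+R)*a"]
    by (simp_all add: ln_mult)
  moreover have "ln b = 2 * ln (max 1 (cmod x))" by (simp add: b_def ln_realpow)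
  ultimately show ?thesis by (simp add: a_def)
qed

text \<open>By \<open>conj_den_quadratic\<close> the finite places cancel. Only the archimedean
  error remains, and it is controlled by the conjugates of c.\<close>

lemma ht_quadratic:
  fixes c :: "'a::field_char_0"
  assumes alg: "\<And>x::'a. algebraic x" and c: "algebraic_int c"
  shows "\<exists>B. \<forall>x. \<bar>ht (x\<^sup>2 + c) - 2 * ht x\<bar> \<le> B"
proof -
  \<comment> \<open>All conjugates of c are roots of its minimal polynomial, so the bound R on these
    roots depends neither on x nor on the family chosen for x.\<close>
  let ?Z = "{r::complex. poly (of_int_poly (min_int_poly c)) r = 0}"
  have "finite ?Z" by (rule poly_roots_finite) (use min_int_poly_nz[OF alg] in simp)
  hence "finite (cmod ` ?Z)" by simp
  then obtain R where R: "\<And>r. r \<in> ?Z \<Longrightarrow> cmod r \<le> R"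
    by (metis (no_types, lifting) bdd_above_def bdd_above_finite imageI)
  have "\<bar>ht (x\<^sup>2 + c) - 2 * ht x\<bar> \<le> ln (1 + R)" for x
  proof -
    obtain S E where SE: "conj_family S E" "{x, c} \<subseteq> S" using conj_family_exists[OF alg, of "{x,c}"] by auto
    interpret sfield S using SE by (simp add: conj_family_sfield)
    define n where "n = length E"
    have n: "n > 0" using SE by (simp add: n_def conj_family_def)
    have xS: "x \<in> S" "c \<in> S" "x\<^sup>2 + c \<in> S" using SE by (auto intro: add power)
    obtain A where A: "conj_den E x A" "n * ht x = ln (of_int A) + (\<Sum>i<n. ln (max 1 (cmod ((E ! i) x))))"
      using conj_family_height(1)[OF SE(1) xS(1) alg] n_def by blast
    obtain B where B: "conj_den E (x\<^sup>2 + c) B"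
      "n * ht (x\<^sup>2 + c) = ln (of_int B) + (\<Sum>i<n. ln (max 1 (cmod ((E ! i) (x\<^sup>2 + c)))))"
      using conj_family_height(1)[OF SE(1) xS(3) alg] n_def by blast
    have "B = A\<^sup>2" by (rule conj_den_quadratic[OF SE(1) xS(1,2) c A(1) B(1)])
    hence "ln (of_int B) = 2 * ln (of_int A :: real)" using A(1) by (simp add: conj_den_def ln_realpow)
    moreover have "n * (ht (x\<^sup>2 + c) - 2 * ht x) = n * ht (x\<^sup>2 + c) - 2 * (n * ht x)"
      by (simp add: algebra_simps)
    ultimately have "n * (ht (x\<^sup>2 + c) - 2 * ht x) =
        (\<Sum>i<n. ln (max 1 (cmod ((E ! i) (x\<^sup>2 + c)))) - 2 * ln (max 1 (cmod ((E ! i) x))))"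
      unfolding A(2) B(2) by (simp add: sum_subtractf sum_distrib_left ring_distribs)
    also have "\<bar>\<dots>\<bar> \<le> (\<Sum>i<n. ln (1 + R))"
    proof (rule order_trans[OF sum_abs], rule sum_mono)
      fix i assume "i \<in> {..<n}"
      then interpret h: hom_sfield S "E ! i" using conj_family_hom[OF SE(1)] by (simp add: n_def)
      have "poly (of_int_poly (min_int_poly c)) ((E ! i) c) = 0"
        using h.hom_poly[of "of_int_poly (min_int_poly c)" c] min_int_poly_root[OF alg] xS by simp
      hence "cmod ((E ! i) c) \<le> R" using R by simp
      moreover have "(E ! i) (x\<^sup>2 + c) = ((E ! i) x)\<^sup>2 + (E ! i) c"
        using xS by (simp add: h.hom_add h.hom_power power)
      ultimately show "\<bar>ln (max 1 (cmod ((E ! i) (x\<^sup>2 + c)))) - 2 * ln (max 1 (cmod ((E ! i) x)))\<bar> \<le> ln (1 + R)"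
        using abs_ln_max_quadratic by simp
    qed
    finally show ?thesis using n by (simp add: abs_mult)
  qed
  thus ?thesis by blast
qed

section \<open>The product formula inequality\<close>

text \<open>Liouville's argument. The norm of \<beta> is a nonzero rational number, and the
  denominators A and B of y and z clear it, because \<beta> has degree at most 1 in each of y and z
  with integral coefficients; so A B times the norm is at least 1 in absolute value. On the other
  hand M \<beta> = y - z bounds each conjugate of \<beta> by 2 max(1, |y|) max(1, |z|) / M, taken at
  the same embedding.\<close>

lemma height_inequality:
  fixes y z :: "'a::field_char_0"
  assumes alg: "\<And>x::'a. algebraic x" and ne: "y \<noteq> z" and M: "M > (0::int)"
    and o: "\<And>k l. algebraic_int (b k l)"
    and eq: "y - z = of_int M * (\<Sum>k\<le>(1::nat). (\<Sum>l\<le>(1::nat). b k l * z ^ l) * y ^ k)"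
  shows "ln (of_int M) \<le> ln 2 + ht y + ht z"
proof -
  define T where "T = {y, z} \<union> (\<lambda>(k,l). b k l) ` ({..1} \<times> {..1})"
  have "finite T" by (simp add: T_def)
  then obtain S E where SE: "conj_family S E" "T \<subseteq> S" using conj_family_exists[OF alg] by blast
  interpret sfield S using SE by (simp add: conj_family_sfield)
  define n where "n = length E"
  define I where "I = {..<n}"
  have fin: "finite I" by (simp add: I_def)
  have n: "n > 0" using SE by (simp add: n_def conj_family_def)
  have yS: "y \<in> S" "z \<in> S" using SE by (auto simp: T_def)
  have bS: "b k l \<in> S" if "k \<le> 1" "l \<le> 1" for k l using SE(2) that by (force simp: T_def)
  define \<beta> where "\<beta> = (\<Sum>k\<le>(1::nat). (\<Sum>l\<le>(1::nat). b k l * z ^ l) * y ^ k)"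
  have \<beta>S: "\<beta> \<in> S" unfolding \<beta>_def using bS yS by (intro sum mult power) auto
  have \<beta>0: "\<beta> \<noteq> 0" using eq ne by (auto simp: \<beta>_def)
  obtain A where A: "conj_den E y A" "n * ht y = ln (of_int A) + (\<Sum>i<n. ln (max 1 (cmod ((E ! i) y))))"
    using conj_family_height(1)[OF SE(1) yS(1) alg] n_def by blast
  obtain B where B: "conj_den E z B" "n * ht z = ln (of_int B) + (\<Sum>i<n. ln (max 1 (cmod ((E ! i) z))))"
    using conj_family_height(1)[OF SE(1) yS(2) alg] n_def by blast
  have A0: "A > 0" "B > 0" using A B by (auto simp: conj_den_def)
  have hom: "hom_sfield S (E ! i)" if "i \<in> I" for i
    using that conj_family_hom[OF SE(1)] by (simp add: I_def n_def)
  have h\<beta>: "(E ! i) \<beta> = (\<Sum>k\<le>1. (\<Sum>l\<le>1. (E ! i) (b k l) * (E ! i) z ^ l) * (E ! i) y ^ k)" if "i \<in> I" for i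
  proof -
    interpret h: hom_sfield S "E ! i" by (rule hom[OF that])
    show ?thesis unfolding \<beta>_def using bS yS
      by (subst h.hom_sum) (auto simp: h.hom_mult h.hom_power h.hom_add power mult add)
  qed
  have hb: "algebraic_int ((E ! i) (b k l))" if "i \<in> I" "k \<le> 1" "l \<le> 1" for i k l
    using hom_sfield.hom_algebraic_int[OF hom[OF that(1)] o bS[OF that(2,3)]] .
  define N where "N = (\<Prod>i\<in>I. (E ! i) \<beta>)"
  have "algebraic_int (of_int B * of_int A * N)"
  proof -
    have aiy: "aipoly (smult (of_int A) (\<Prod>i\<in>I. [:- (E ! i) y, 1:]))"
      using conj_den_aipoly[OF A(1)] by (simp only: conj_poly_def I_def n_def)
    have aiz: "aipoly (smult (of_int B) (\<Prod>i\<in>I. [:- (E ! i) z, 1:]))"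
      using conj_den_aipoly[OF B(1)] by (simp only: conj_poly_def I_def n_def)
    have N: "N = (\<Sum>f\<in>PiE I (\<lambda>_. {..1}). \<Prod>i\<in>I. (\<Sum>l\<le>1. (E ! i) (b (f i) l) * (E ! i) z ^ l) * (E ! i) y ^ f i)"
    proof -
      have "N = (\<Prod>i\<in>I. \<Sum>k\<le>1. (\<Sum>l\<le>1. (E ! i) (b k l) * (E ! i) z ^ l) * (E ! i) y ^ k)"
        unfolding N_def by (rule prod.cong[OF refl h\<beta>])
      also have "\<dots> = (\<Sum>f\<in>PiE I (\<lambda>_. {..1}). \<Prod>i\<in>I. (\<Sum>l\<le>1. (E ! i) (b (f i) l) * (E ! i) z ^ l) * (E ! i) y ^ f i)"
        using fin by (intro prod_sum_PiE) auto
      finally show ?thesis .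
    qed
    \<comment> \<open>Expanding in the powers of y separates the variables: for each choice function
      f the z-part needs one factor B and the y-part one factor A.\<close>
    have "of_int B * of_int A * N = (\<Sum>f\<in>PiE I (\<lambda>_. {..1}).
        (of_int B ^ 1 * (\<Prod>i\<in>I. \<Sum>l\<le>1. (E ! i) (b (f i) l) * (E ! i) z ^ l)) * (of_int A ^ 1 * (\<Prod>i\<in>I. (E ! i) y ^ f i)))"
      unfolding N sum_distrib_left prod.distrib by (rule sum.cong[OF refl]) (simp only: power_one_right mult_ac)
    also have "algebraic_int \<dots>"
    proof (rule algebraic_int_sum, rule algebraic_int_mult)
      fix f assume f: "f \<in> PiE I (\<lambda>_. {..1::nat})"
      hence f1: "f i \<le> 1" if "i \<in> I" for i using that by (auto simp: PiE_def Pi_def)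
      show "algebraic_int (of_int B ^ 1 * (\<Prod>i\<in>I. \<Sum>l\<le>1. (E ! i) (b (f i) l) * (E ! i) z ^ l))"
        by (rule algebraic_int_norm[OF fin aiz]) (rule hb, assumption, rule f1)
      show "algebraic_int (of_int A ^ 1 * (\<Prod>i\<in>I. (E ! i) y ^ f i))"
        by (rule algebraic_int_power_product[OF fin aiy f1])
    qed
    finally show ?thesis .
  qed
  moreover have "N \<in> \<rat>" unfolding N_def I_def n_def by (rule conj_family_const_rational[OF SE(1) \<beta>S])
  hence "of_int B * of_int A * N \<in> \<rat>" by (intro Rats_mult) auto
  ultimately have "of_int B * of_int A * N \<in> \<int>" by (rule rational_algebraic_int_is_int)
  then obtain m where m: "of_int B * of_int A * N = of_int m" by (elim Ints_cases)
  have E\<beta>0: "(E ! i) \<beta> \<noteq> 0" if "i \<in> I" for i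
    using hom_sfield.hom_eq_0_iff[OF hom[OF that] \<beta>S] \<beta>0 by simp
  hence "N \<noteq> 0" using fin by (simp add: N_def)
  hence "m \<noteq> 0" using m A0 by auto
  hence "1 \<le> cmod (of_int m)" by simp
  hence one: "1 \<le> of_int B * of_int A * (\<Prod>i\<in>I. cmod ((E ! i) \<beta>))"
    unfolding m[symmetric] norm_mult N_def prod_norm[symmetric] using A0 by simp
  let ?Y = "\<lambda>i. max 1 (cmod ((E ! i) y))" and ?Z = "\<lambda>i. max 1 (cmod ((E ! i) z))"
  have "of_int M * cmod ((E ! i) \<beta>) \<le> 2 * ?Y i * ?Z i" if "i \<in> I" for i
  proof -
    interpret h: hom_sfield S "E ! i" by (rule hom[OF that])
    have "(E ! i) y - (E ! i) z = of_int M * (E ! i) \<beta>"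
      using h.hom_diff[OF yS] h.hom_mult[OF of_int \<beta>S, of M] eq by (simp add: \<beta>_def)
    hence "of_int M * cmod ((E ! i) \<beta>) = cmod ((E ! i) y - (E ! i) z)" using M by (simp add: norm_mult)
    also have "\<dots> \<le> cmod ((E ! i) y) + cmod ((E ! i) z)" by (rule norm_triangle_ineq4)
    also have "\<dots> \<le> ?Y i * ?Z i + ?Y i * ?Z i"
    proof (rule add_mono)
      show "cmod ((E ! i) y) \<le> ?Y i * ?Z i" using mult_mono[of "cmod ((E ! i) y)" "?Y i" 1 "?Z i"] by simp
      show "cmod ((E ! i) z) \<le> ?Y i * ?Z i" using mult_mono[of 1 "?Y i" "cmod ((E ! i) z)" "?Z i"] by simp
    qed
    finally show ?thesis by simp
  qed
  hence "(\<Prod>i\<in>I. of_int M * cmod ((E ! i) \<beta>)) \<le> (\<Prod>i\<in>I. 2 * ?Y i * ?Z i)"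
    using M by (intro prod_mono) auto
  hence "of_int M ^ n * (\<Prod>i\<in>I. cmod ((E ! i) \<beta>)) \<le> (\<Prod>i\<in>I. 2 * ?Y i * ?Z i)"
    by (simp add: prod.distrib I_def)
  hence "of_int B * of_int A * (of_int M ^ n * (\<Prod>i\<in>I. cmod ((E ! i) \<beta>))) \<le> of_int B * of_int A * (\<Prod>i\<in>I. 2 * ?Y i * ?Z i)"
    using A0 by (intro mult_left_mono) auto
  moreover have "real_of_int M ^ n \<le> of_int B * of_int A * (of_int M ^ n * (\<Prod>i\<in>I. cmod ((E ! i) \<beta>)))"
  proof -
    have "real_of_int M ^ n * 1 \<le> of_int M ^ n * (of_int B * of_int A * (\<Prod>i\<in>I. cmod ((E ! i) \<beta>)))"
      using M by (intro mult_left_mono one) auto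
    also have "\<dots> = of_int B * of_int A * (of_int M ^ n * (\<Prod>i\<in>I. cmod ((E ! i) \<beta>)))"
      by (simp only: mult_ac)
    finally show ?thesis by simp
  qed
  ultimately have "real_of_int M ^ n \<le> of_int B * of_int A * (\<Prod>i\<in>I. 2 * ?Y i * ?Z i)"
    by (rule order_trans[rotated])
  hence "ln (real_of_int M ^ n) \<le> ln (of_int B * of_int A * (\<Prod>i\<in>I. 2 * ?Y i * ?Z i))"
    using M A0 by (intro ln_mono) auto
  also have "\<dots> = ln (of_int B) + ln (of_int A) + (\<Sum>i\<in>I. ln 2 + ln (?Y i) + ln (?Z i))"
  proof -
    have pos: "2 * ?Y i * ?Z i > 0" for i by (intro mult_pos_pos) auto
    have "(\<Prod>i\<in>I. 2 * ?Y i * ?Z i) > 0" by (intro prod_pos) (rule pos)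
    moreover have lnp: "ln (prod g I) = (\<Sum>i\<in>I. ln (g i))" if g: "\<And>i. g i > 0" for g :: "nat \<Rightarrow> real"
      using fin
    proof (induction I rule: finite_induct)
      case (insert i F)
      have "prod g F > 0" using g by (intro prod_pos) simp
      moreover have "ln (a * b) = ln a + ln b" if "a > 0" "b > 0" for a b :: real using that by (simp add: ln_mult)
      ultimately have "ln (g i * prod g F) = ln (g i) + ln (prod g F)" using g[of i] by blast
      thus ?case using insert by simp
    qed simp
    from lnp[OF pos] have "ln (\<Prod>i\<in>I. 2 * ?Y i * ?Z i) = (\<Sum>i\<in>I. ln (2 * ?Y i * ?Z i))" .
    moreover have "\<dots> = (\<Sum>i\<in>I. ln 2 + ln (?Y i) + ln (?Z i))"
    proof (rule sum.cong[OF refl])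
      fix i
      have "?Y i > 0" "?Z i > 0" by auto
      thus "ln (2 * ?Y i * ?Z i) = ln 2 + ln (?Y i) + ln (?Z i)" by (subst ln_mult, simp, simp, subst ln_mult) simp_all
    qed
    ultimately show ?thesis using A0 by (simp add: ln_mult)
  qed
  also have "\<dots> = n * ln 2 + n * ht y + n * ht z"
    unfolding A(2) B(2) by (simp add: sum.distrib I_def)
  finally have "n * ln (real_of_int M) \<le> n * (ln 2 + ht y + ht z)"
    using M by (simp add: ln_realpow ring_distribs)
  thus ?thesis using n by simp
qed

section \<open>Northcott's theorem\<close>

text \<open>A further factor T - r multiplies a common bound on the coefficients by at most 1 + |r|,
  which is at most 2 max(1, |r|).\<close>

lemma norm_coeff_prod_linear_le:
  "cmod (coeff (\<Prod>r\<in>#M. [:- r, 1:]) k) \<le> 2 ^ size M * (\<Prod>r\<in>#M. max 1 (cmod r))"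
proof (induction M arbitrary: k)
  case empty
  show ?case by (simp add: coeff_1)
next
  case (add r M)
  let ?p = "\<Prod>r\<in>#M. [:- r, 1:]" and ?m = "\<Prod>r\<in>#M. max 1 (cmod r)"
  have m: "0 \<le> 2 ^ size M * ?m" using order_trans[OF norm_ge_zero add.IH[of 0]] .
  have "coeff ([:- r, 1:] * ?p) k = (case k of 0 \<Rightarrow> 0 | Suc j \<Rightarrow> coeff ?p j) - r * coeff ?p k"
    by (simp add: coeff_pCons split: nat.split)
  hence "cmod (coeff ([:- r, 1:] * ?p) k) \<le> cmod (case k of 0 \<Rightarrow> 0 | Suc j \<Rightarrow> coeff ?p j) + cmod r * cmod (coeff ?p k)"
    by (metis norm_mult norm_triangle_ineq4)
  also have "\<dots> \<le> 2 ^ size M * ?m + max 1 (cmod r) * (2 ^ size M * ?m)"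
  proof (rule add_mono)
    show "cmod (case k of 0 \<Rightarrow> 0 | Suc j \<Rightarrow> coeff ?p j) \<le> 2 ^ size M * ?m"
      using add.IH m by (cases k) simp_all
    show "cmod r * cmod (coeff ?p k) \<le> max 1 (cmod r) * (2 ^ size M * ?m)"
      by (intro mult_mono add.IH) auto
  qed
  also have "\<dots> \<le> max 1 (cmod r) * (2 ^ size M * ?m) + max 1 (cmod r) * (2 ^ size M * ?m)"
    using mult_right_mono[OF _ m, of 1 "max 1 (cmod r)"] by simp
  finally show ?case by (simp add: mult_ac)
qed

lemma exp_sum_mset_ln_max: "exp (\<Sum>r\<in>#M. ln (max 1 (cmod r))) = (\<Prod>r\<in>#M. max 1 (cmod r))"
proof (induction M)
  case (add r M)
  have "exp (ln (max 1 (cmod r))) = max 1 (cmod r)" by (rule exp_ln) simp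
  thus ?case using add by (simp only: image_mset_add_mset sum_mset.add_mset prod_mset.add_mset exp_add)
qed simp

lemma norm_coeff_le_mahler:
  fixes p :: "complex poly"
  assumes "p \<noteq> 0"
  shows "cmod (coeff p k) \<le> 2 ^ degree p * exp (log_mahler p)"
proof -
  let ?a = "lead_coeff p" and ?M = "proots p"
  have p: "p = smult ?a (\<Prod>r\<in>#?M. [:- r, 1:])" by (rule complex_poly_decompose_multiset[symmetric])
  have "cmod (coeff p k) = cmod ?a * cmod (coeff (\<Prod>r\<in>#?M. [:- r, 1:]) k)"
    using arg_cong[OF p, of "\<lambda>q. cmod (coeff q k)"] by (simp only: coeff_smult norm_mult)
  also have "\<dots> \<le> cmod ?a * (2 ^ size ?M * (\<Prod>r\<in>#?M. max 1 (cmod r)))"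
    by (intro mult_left_mono norm_coeff_prod_linear_le) simp
  also have "\<dots> = 2 ^ degree p * exp (log_mahler p)"
    using assms by (simp add: log_mahler_def exp_add exp_sum_mset_ln_max size_proots_complex)
  finally show ?thesis .
qed

lemma finite_int_polys_bounded: "finite {F::int poly. degree F \<le> d \<and> (\<forall>i. \<bar>coeff F i\<bar> \<le> C)}"
proof (rule finite_subset)
  show "{F::int poly. degree F \<le> d \<and> (\<forall>i. \<bar>coeff F i\<bar> \<le> C)} \<subseteq>
      Poly ` {xs. set xs \<subseteq> {- C..C} \<and> length xs \<le> Suc d}"
  proof
    fix F :: "int poly" assume F: "F \<in> {F. degree F \<le> d \<and> (\<forall>i. \<bar>coeff F i\<bar> \<le> C)}"
    have "set (coeffs F) \<subseteq> {- C..C}"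
    proof
      fix a assume "a \<in> set (coeffs F)"
      then obtain i where "a = coeff F i" by (auto simp: coeffs_def split: if_splits)
      moreover have "\<bar>coeff F i\<bar> \<le> C" using F by blast
      ultimately show "a \<in> {- C..C}" by auto
    qed
    moreover have "length (coeffs F) \<le> Suc d" using F by (auto simp: coeffs_def)
    ultimately show "F \<in> Poly ` {xs. set xs \<subseteq> {- C..C} \<and> length xs \<le> Suc d}"
      by (intro image_eqI[of _ _ "coeffs F"]) auto
  qed
  show "finite (Poly ` {xs. set xs \<subseteq> {- C..C} \<and> length xs \<le> Suc d})"
    by (intro finite_imageI finite_lists_length_le) simp
qed

text \<open>Bounded degree and height bound the Mahler measure, and with it all coefficients of the
  minimal polynomial, which leaves finitely many polynomials.\<close>

lemma northcott:
  assumes alg: "\<And>x::'a::field_char_0. algebraic x"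
  shows "finite {x::'a. degree (min_int_poly x) \<le> d \<and> ht x \<le> B}"
proof -
  \<comment> \<open>\<open>max 0 B\<close> keeps the product with the degree monotone even for
    negative B.\<close>
  define C where "C = \<lceil>2 ^ d * exp (real d * max 0 B)\<rceil>"
  let ?P = "{F::int poly. degree F \<le> d \<and> (\<forall>i. \<bar>coeff F i\<bar> \<le> C)}"
  have "{x::'a. degree (min_int_poly x) \<le> d \<and> ht x \<le> B} \<subseteq>
      (\<Union>F\<in>?P - {0}. {x. poly (of_int_poly F) x = 0})"
  proof
    fix x :: 'a assume x: "x \<in> {x. degree (min_int_poly x) \<le> d \<and> ht x \<le> B}"
    let ?F = "min_int_poly x"
    let ?G = "of_int_poly ?F :: complex poly"
    have nz: "?F \<noteq> 0" by (rule min_int_poly_nz[OF alg])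
    have dF: "degree ?F > 0" by (rule min_int_poly_degree[OF alg])
    have "log_mahler ?G = degree ?F * ht x" using dF by (simp add: ht_def)
    also have "\<dots> \<le> d * max 0 B" using x ht_nonneg[OF alg, of x] by (intro mult_mono) auto
    finally have lm: "log_mahler ?G \<le> d * max 0 B" .
    have "\<bar>coeff ?F i\<bar> \<le> C" for i
    proof -
      have "real_of_int \<bar>coeff ?F i\<bar> = cmod (coeff ?G i)" by simp
      also have "\<dots> \<le> 2 ^ degree ?G * exp (log_mahler ?G)" using nz by (intro norm_coeff_le_mahler) simp
      also have "\<dots> \<le> 2 ^ d * exp (d * max 0 B)"
        using x lm by (intro mult_mono power_increasing) (auto simp: of_int_hom.degree_map_poly_hom)
      also have "\<dots> \<le> of_int C" unfolding C_def by (rule le_of_int_ceiling)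
      finally show ?thesis by (simp only: of_int_le_iff)
    qed
    hence "?F \<in> ?P - {0}" using x nz by blast
    thus "x \<in> (\<Union>F\<in>?P - {0}. {x. poly (of_int_poly F) x = 0})"
      using min_int_poly_root[OF alg, of x] by blast
  qed
  moreover have "finite (\<Union>F\<in>?P - {0}. {x::'a. poly (of_int_poly F) x = 0})"
    using finite_int_polys_bounded by (intro finite_UN_I) (auto intro!: poly_roots_finite)
  ultimately show ?thesis by (rule finite_subset)
qed

section \<open>Canonical heights\<close>

lemma pow2_bounded_nonpos:
  assumes "\<And>n::nat. 2 ^ n * t \<le> (C::real)"
  shows "t \<le> 0"
proof (rule ccontr)
  assume t: "\<not> t \<le> 0"
  obtain n where "C / t < 2 ^ n" using real_arch_pow[of 2 "C / t"] by auto
  hence "C < 2 ^ n * t" using t by (simp add: field_simps)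
  thus False using assms[of n] by simp
qed

text \<open>Tate's telescoping limit: hh x is the limit of h(f^n x) / 2^n, written as h x plus a
  series dominated by a geometric one with sum B. It is nonnegative because it is at least -B on the
  whole orbit and doubles along it.\<close>

lemma canonical_height_construction:
  fixes h :: "'a \<Rightarrow> real" and f :: "'a \<Rightarrow> 'a"
  assumes B: "\<And>x. \<bar>h (f x) - 2 * h x\<bar> \<le> B" and nn: "\<And>x. h x \<ge> 0"
  shows "\<exists>hh. (\<forall>x. hh x \<ge> 0) \<and> (\<forall>x. hh (f x) = 2 * hh x) \<and> (\<forall>x. \<bar>hh x - h x\<bar> \<le> B)"
proof -
  define d where "d x n = (h ((f ^^ Suc n) x) - 2 * h ((f ^^ n) x)) * (1/2) ^ Suc n" for x n
  define hh where "hh x = h x + suminf (d x)" for x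
  have g: "(\<lambda>n. B * (1/2) ^ Suc n) sums (B * 1)"
    by (intro sums_mult power_half_series)
  have db: "norm (d x n) \<le> B * (1/2) ^ Suc n" for x n
    unfolding d_def using B[of "(f ^^ n) x"] by (simp add: abs_mult mult_right_mono)
  have sm: "summable (d x)" for x
    by (rule summable_comparison_test[OF _ sums_summable[OF g]]) (use db in blast)
  have bd: "\<bar>hh x - h x\<bar> \<le> B" for x
  proof -
    have "norm (suminf (d x)) \<le> suminf (\<lambda>n. B * (1/2) ^ Suc n)"
      by (rule norm_suminf_le[OF db sums_summable[OF g]])
    thus ?thesis using sums_unique[OF g] by (simp add: hh_def)
  qed
  have eq: "hh (f x) = 2 * hh x" for x
  proof -
    have "d (f x) n = 2 * d x (Suc n)" for n
      by (simp add: d_def funpow_swap1)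
    hence "suminf (d (f x)) = suminf (\<lambda>n. 2 * d x (Suc n))" by (rule suminf_cong)
    also have "\<dots> = 2 * suminf (\<lambda>n. d x (Suc n))"
      using sm[of x] by (intro suminf_mult) (simp only: summable_Suc_iff)
    also have "suminf (\<lambda>n. d x (Suc n)) = suminf (d x) - d x 0" by (rule suminf_split_head[OF sm])
    finally have "suminf (d (f x)) = 2 * (suminf (d x) - d x 0)" .
    moreover have "2 * d x 0 = h (f x) - 2 * h x" by (simp add: d_def)
    ultimately show ?thesis by (simp add: hh_def)
  qed
  have eqn: "hh ((f ^^ n) x) = 2 ^ n * hh x" for n x
    by (induction n) (simp_all add: eq)
  have "hh x \<ge> 0" for x
  proof -
    have "2 ^ n * (- hh x) \<le> B" for n
      using bd[of "(f ^^ n) x"] nn[of "(f ^^ n) x"] eqn[of n x] by simp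
    hence "- hh x \<le> 0" by (rule pow2_bounded_nonpos)
    thus ?thesis by simp
  qed
  thus ?thesis using eq bd by blast
qed

text \<open>The difference is bounded, yet doubles along orbits.\<close>

lemma canonical_height_unique:
  fixes h h' :: "'a \<Rightarrow> real" and f :: "'a \<Rightarrow> 'a"
  assumes "\<And>x. h (f x) = 2 * h x" "\<And>x. h' (f x) = 2 * h' x" "\<And>x. \<bar>h x - h' x\<bar> \<le> B"
  shows "h = h'"
proof
  fix x
  have e: "h ((f ^^ n) x) = 2 ^ n * h x" "h' ((f ^^ n) x) = 2 ^ n * h' x" for n
    by (induction n) (simp_all add: assms)
  have "2 ^ n * \<bar>h x - h' x\<bar> \<le> B" for n
    using assms(3)[of "(f ^^ n) x"] unfolding e right_diff_distrib[symmetric] by (simp add: abs_mult)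
  hence "\<bar>h x - h' x\<bar> \<le> 0" by (rule pow2_bounded_nonpos)
  thus "h x = h' x" by simp
qed

lemma poly_unicritical [simp]: "poly (unicritical_quadratic c) x = x\<^sup>2 + c"
  by (simp add: unicritical_quadratic_def power2_eq_square)

text \<open>Discharges the definite description: with the Weil height replaced by \<open>ht\<close>,
  existence is the telescoping limit and uniqueness the doubling argument.\<close>

lemma canonical_height_spec:
  fixes c :: "'a::field_char_0"
  assumes alg: "\<And>x::'a. algebraic x" and c: "algebraic_int c"
    and weil: "\<And>x::'a. weil_height x = ht x"
  defines "hh \<equiv> canonical_height (unicritical_quadratic c)"
  shows "\<And>x. hh x \<ge> 0" "\<And>x. hh (x\<^sup>2 + c) = 2 * hh x" "\<exists>B. \<forall>x. \<bar>hh x - ht x\<bar> \<le> B"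
proof -
  let ?f = "unicritical_quadratic c"
  let ?Q = "\<lambda>hh. (\<forall>x. hh x \<ge> 0) \<and>
     (\<forall>x. hh (poly ?f x) = real (degree ?f) * hh x) \<and>
     (\<exists>B. \<forall>x. \<bar>hh x - weil_height x\<bar> \<le> B)"
  have deg: "degree ?f = 2" by (simp add: unicritical_quadratic_def)
  obtain B where B: "\<And>x. \<bar>ht (x\<^sup>2 + c) - 2 * ht x\<bar> \<le> B" using ht_quadratic[OF alg c] by blast
  have "\<exists>hh. (\<forall>x. hh x \<ge> 0) \<and> (\<forall>x. hh (x\<^sup>2 + c) = 2 * hh x) \<and> (\<forall>x. \<bar>hh x - ht x\<bar> \<le> B)"
    using canonical_height_construction[of ht "\<lambda>x. x\<^sup>2 + c", OF B ht_nonneg[OF alg]] by blast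
  then obtain h0 where h0: "?Q h0" unfolding deg weil by auto
  have "?Q (THE hh. ?Q hh)"
  proof (rule theI[of ?Q h0])
    show "?Q h0" by (rule h0)
    fix h1 assume h1: "?Q h1"
    obtain B0 B1 where BB: "\<And>x. \<bar>h0 x - weil_height x\<bar> \<le> B0" "\<And>x. \<bar>h1 x - weil_height x\<bar> \<le> B1"
      using h0 h1 by blast
    show "h1 = h0"
    proof (rule canonical_height_unique)
      show "h1 (poly ?f x) = 2 * h1 x" "h0 (poly ?f x) = 2 * h0 x" for x
        using h0 h1 unfolding deg by auto
      show "\<bar>h1 x - h0 x\<bar> \<le> B0 + B1" for x using BB[of x] by linarith
    qed
  qed
  hence "?Q hh" unfolding hh_def canonical_height_def .
  thus "\<And>x. hh x \<ge> 0" "\<And>x. hh (x\<^sup>2 + c) = 2 * hh x" "\<exists>B. \<forall>x. \<bar>hh x - ht x\<bar> \<le> B"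
    unfolding deg weil by auto
qed

section \<open>Integrality of postcritically finite parameters\<close>

fun crit_orbit_poly :: "nat \<Rightarrow> int poly" where
  "crit_orbit_poly 0 = 0"
| "crit_orbit_poly (Suc n) = (crit_orbit_poly n)\<^sup>2 + [:0, 1:]"

declare crit_orbit_poly.simps(2) [simp del]

lemma crit_orbit_poly_degree: "degree (crit_orbit_poly (Suc n)) = 2 ^ n \<and> monic (crit_orbit_poly (Suc n))"
proof (induction n)
  case 0
  show ?case by (simp add: crit_orbit_poly.simps(2))
next
  case (Suc n)
  let ?p = "crit_orbit_poly (Suc n)"
  have nz: "?p \<noteq> 0" using Suc by auto
  have d: "degree (?p\<^sup>2) = 2 ^ Suc n" using Suc nz by (simp add: degree_power_eq)
  have m: "monic (?p\<^sup>2)" unfolding lead_coeff_power conjunct2[OF Suc] by simp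
  have "degree [:0, 1::int:] < degree (?p\<^sup>2)" unfolding d using one_less_power[of "2::nat" "Suc n"] by simp
  hence "degree (?p\<^sup>2 + [:0, 1:]) = degree (?p\<^sup>2)" "lead_coeff (?p\<^sup>2 + [:0, 1:]) = lead_coeff (?p\<^sup>2)"
    by (simp_all add: degree_add_eq_left coeff_eq_0)
  thus ?case using d m by (simp only: crit_orbit_poly.simps(2)[of "Suc n"])
qed

lemma poly_crit_orbit: 
  fixes c :: "'a::field_char_0"
  shows "poly (of_int_poly (crit_orbit_poly n)) c = ((\<lambda>x. x\<^sup>2 + c) ^^ n) 0"
  by (induction n) (simp_all add: hom_distribs of_int_poly_hom.hom_mult power2_eq_square crit_orbit_poly.simps(2))

lemma preperiodic_iff: "preperiodic (unicritical_quadratic c) x \<longleftrightarrow> finite (range (\<lambda>n. ((\<lambda>x. x\<^sup>2 + c) ^^ n) x))"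
proof -
  have "poly (unicritical_quadratic c) = (\<lambda>x. x\<^sup>2 + c)" by (rule ext) simp
  thus ?thesis by (simp add: preperiodic_def)
qed

text \<open>A coincidence of the iterates i < j of 0 is a polynomial equation for c. It is monic
  because the j-th iterate is monic of degree 2^(j-1) in c and the i-th has smaller degree.\<close>

lemma algebraic_int_PCF:
  fixes c :: "'a::field_char_0"
  assumes "quadratic_PCF c"
  shows "algebraic_int c"
proof -
  have "finite (range (\<lambda>n. ((\<lambda>x. x\<^sup>2 + c) ^^ n) 0))"
    using assms by (simp add: quadratic_PCF_def preperiodic_iff)
  hence "\<not> inj (\<lambda>n. ((\<lambda>x. x\<^sup>2 + c) ^^ n) 0)" using finite_imageD infinite_UNIV_nat by blast
  then obtain k l where kl: "k \<noteq> l" "((\<lambda>x. x\<^sup>2 + c) ^^ k) 0 = ((\<lambda>x. x\<^sup>2 + c) ^^ l) 0"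
    unfolding inj_def by blast
  define i j where "i = min k l" and "j = max k l"
  have ij: "i < j" "((\<lambda>x. x\<^sup>2 + c) ^^ i) 0 = ((\<lambda>x. x\<^sup>2 + c) ^^ j) 0"
    using kl by (auto simp: i_def j_def min_def max_def)
  obtain j' where j: "j = Suc j'" using ij(1) by (cases j) auto
  let ?p = "crit_orbit_poly j" and ?q = "crit_orbit_poly i"
  have dp: "degree ?p = 2 ^ j'" "monic ?p" using crit_orbit_poly_degree[of j'] j by auto
  have dq: "degree ?q < degree ?p"
  proof (cases i)
    case (Suc i')
    hence "degree ?q = 2 ^ i'" using crit_orbit_poly_degree[of i'] by simp
    thus ?thesis using Suc ij(1) j dp(1) by simp
  qed (simp add: dp)
  have "degree (?p - ?q) = degree ?p" using degree_add_eq_left[of "- ?q" ?p] dq by simp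
  hence "monic (?p - ?q)" using dp(2) dq by (simp add: coeff_eq_0)
  moreover have "poly (of_int_poly (?p - ?q)) c = 0"
    using ij(2) by (simp add: hom_distribs poly_crit_orbit)
  ultimately show ?thesis unfolding algebraic_int_altdef_ipoly by blast
qed

text \<open>Height 0 persists along the orbit, so \<open>ht\<close> is at most B on it; the orbit
  stays in one field S, so its degrees are at most the length of E. Northcott's theorem
  applies.\<close>

lemma preperiodic_if_canonical_height_0:
  fixes c :: "'a::field_char_0"
  assumes alg: "\<And>x::'a. algebraic x"
    and hh: "\<And>x. hh (x\<^sup>2 + c) = 2 * hh x" "\<And>x. \<bar>hh x - ht x\<bar> \<le> B" and 0: "hh \<alpha> = 0"
  shows "preperiodic (unicritical_quadratic c) \<alpha>"
proof -
  obtain S E where SE: "conj_family S E" "{\<alpha>, c} \<subseteq> S" using conj_family_exists[OF alg, of "{\<alpha>, c}"] by auto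
  interpret sfield S using SE by (simp add: conj_family_sfield)
  let ?o = "\<lambda>n. ((\<lambda>x. x\<^sup>2 + c) ^^ n) \<alpha>"
  have S: "?o n \<in> S" for n using SE(2) by (induction n) (auto intro: add power)
  have h0: "hh (?o n) = 0" for n using 0 by (induction n) (simp_all add: hh)
  have "range ?o \<subseteq> {x. degree (min_int_poly x) \<le> length E \<and> ht x \<le> B}"
  proof (intro subsetI CollectI conjI)
    fix x assume "x \<in> range ?o"
    then obtain n where n: "x = ?o n" by auto
    show "degree (min_int_poly x) \<le> length E"
      by (rule conj_family_height(2)[OF SE(1) _ alg]) (use S n in simp)
    show "ht x \<le> B" using hh(2)[of "?o n"] h0[of n] n by simp
  qed
  hence "finite (range ?o)" using northcott[OF alg] finite_subset by blast
  thus ?thesis by (simp add: preperiodic_iff)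
qed

section \<open>Indices of additive subgroups\<close>

definition add_subgroup :: "'a::field_char_0 set \<Rightarrow> bool" where
  "add_subgroup A \<longleftrightarrow> 0 \<in> A \<and> (\<forall>x\<in>A. \<forall>y\<in>A. x + y \<in> A) \<and> (\<forall>x\<in>A. - x \<in> A)"

definition cosets :: "'a::field_char_0 set \<Rightarrow> 'a set \<Rightarrow> 'a set set" where
  "cosets A B = (\<lambda>x. (+) x ` B) ` A"

text \<open>\<open>card\<close> of an infinite set is 0, so finiteness of the coset space is carried
  along separately.\<close>

definition idx :: "'a::field_char_0 set \<Rightarrow> 'a set \<Rightarrow> nat" where
  "idx A B = card (cosets A B)"

lemma add_subgroup_diff: "add_subgroup A \<Longrightarrow> x \<in> A \<Longrightarrow> y \<in> A \<Longrightarrow> x - y \<in> A"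
  unfolding add_subgroup_def by (metis add_uminus_conv_diff)

lemma coset_eq_iff:
  assumes "add_subgroup B"
  shows "(+) x ` B = (+) y ` B \<longleftrightarrow> x - y \<in> B"
proof
  assume eq: "(+) x ` B = (+) y ` B"
  have "x + 0 \<in> (+) x ` B" using assms by (intro imageI) (simp add: add_subgroup_def)
  then obtain b where "b \<in> B" "x + 0 = y + b" unfolding eq by blast
  thus "x - y \<in> B" by (simp add: algebra_simps)
next
  have sub: "(+) x ` B \<subseteq> (+) y ` B" if "x - y \<in> B" for x y
  proof
    fix z assume "z \<in> (+) x ` B"
    then obtain b where "b \<in> B" "z = x + b" by blast
    hence "(x - y) + b \<in> B" "z = y + ((x - y) + b)" using that assms by (auto simp: add_subgroup_def)
    thus "z \<in> (+) y ` B" by blast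
  qed
  assume "x - y \<in> B"
  moreover from this have "- (x - y) \<in> B" using assms unfolding add_subgroup_def by blast
  hence "y - x \<in> B" by simp
  ultimately show "(+) x ` B = (+) y ` B" using sub by blast
qed

text \<open>The map f is compared on classes: it has to respect and reflect congruence modulo the
  subgroups and to reach every class.\<close>

lemma idx_map:
  assumes B: "add_subgroup B" and B': "add_subgroup B'"
    and f: "\<And>x. x \<in> A \<Longrightarrow> f x \<in> A'"
    and iff: "\<And>x y. x \<in> A \<Longrightarrow> y \<in> A \<Longrightarrow> f x - f y \<in> B' \<longleftrightarrow> x - y \<in> B"
    and surj: "\<And>y. y \<in> A' \<Longrightarrow> \<exists>x\<in>A. y - f x \<in> B'"
  shows "idx A B = idx A' B'" and "finite (cosets A B) \<longleftrightarrow> finite (cosets A' B')"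
proof -
  define r where "r = (\<lambda>c. SOME x. x \<in> A \<and> (+) x ` B = c)"
  have r: "r c \<in> A \<and> (+) (r c) ` B = c" if "c \<in> cosets A B" for c
    unfolding r_def by (rule someI_ex) (use that in \<open>auto simp: cosets_def\<close>)
  define g where "g = (\<lambda>c. (+) (f (r c)) ` B')"
  have "bij_betw g (cosets A B) (cosets A' B')"
    unfolding bij_betw_def
  proof
    show "inj_on g (cosets A B)"
    proof (rule inj_onI)
      fix c d assume cd: "c \<in> cosets A B" "d \<in> cosets A B" "g c = g d"
      hence "r c - r d \<in> B" using r iff by (simp add: g_def coset_eq_iff[OF B'])
      hence "(+) (r c) ` B = (+) (r d) ` B" by (simp add: coset_eq_iff[OF B])
      thus "c = d" using r cd by simp
    qed
    show "g ` cosets A B = cosets A' B'"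
    proof
      show "g ` cosets A B \<subseteq> cosets A' B'" using r f by (auto simp: g_def cosets_def)
      show "cosets A' B' \<subseteq> g ` cosets A B"
      proof
        fix e assume "e \<in> cosets A' B'"
        then obtain y where y: "y \<in> A'" "e = (+) y ` B'" by (auto simp: cosets_def)
        obtain x where x: "x \<in> A" "y - f x \<in> B'" using surj[OF y(1)] by blast
        define c where "c = (+) x ` B"
        have c: "c \<in> cosets A B" using x by (auto simp: c_def cosets_def)
        have "x - r c \<in> B" using r[OF c] by (simp add: c_def coset_eq_iff[OF B, symmetric])
        hence "f x - f (r c) \<in> B'" using iff x r[OF c] by simp
        hence "(y - f x) + (f x - f (r c)) \<in> B'" using x(2) B' unfolding add_subgroup_def by blast
        hence "e = g c" unfolding y g_def by (simp add: coset_eq_iff[OF B'])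
        thus "e \<in> g ` cosets A B" using c by blast
      qed
    qed
  qed
  thus "idx A B = idx A' B'" "finite (cosets A B) \<longleftrightarrow> finite (cosets A' B')"
    using bij_betw_same_card bij_betw_finite unfolding idx_def by blast+
qed

lemma idx_tower:
  assumes A: "add_subgroup A" and B: "add_subgroup B" and C: "add_subgroup C" and sub: "C \<subseteq> B" "B \<subseteq> A"
    and fin: "finite (cosets A B)" "finite (cosets B C)"
  shows "finite (cosets A C)" and "idx A C = idx A B * idx B C"
proof -
  define r where "r = (\<lambda>c. SOME x. x \<in> A \<and> (+) x ` B = c)"
  have r: "r c \<in> A \<and> (+) (r c) ` B = c" if "c \<in> cosets A B" for c
    unfolding r_def by (rule someI_ex) (use that in \<open>auto simp: cosets_def\<close>)
  have eq: "(+) a ` ((+) b ` C) = (+) (a + b) ` C" for a b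
    by (simp add: image_image add.assoc)
  define g where "g = (\<lambda>(c, d). (+) (r c) ` d)"
  have "bij_betw g (cosets A B \<times> cosets B C) (cosets A C)"
    unfolding bij_betw_def
  proof
    show "inj_on g (cosets A B \<times> cosets B C)"
    proof (rule inj_onI, clarify)
      fix c d c' d' assume cd: "c \<in> cosets A B" "d \<in> cosets B C" "c' \<in> cosets A B" "d' \<in> cosets B C"
        and g: "g (c, d) = g (c', d')"
      obtain b b' where b: "b \<in> B" "d = (+) b ` C" "b' \<in> B" "d' = (+) b' ` C" using cd by (auto simp: cosets_def)
      have *: "(r c + b) - (r c' + b') \<in> C" using g by (simp add: g_def b eq coset_eq_iff[OF C])
      have "((r c + b) - (r c' + b')) - (b - b') \<in> B"
        by (rule add_subgroup_diff[OF B subsetD[OF sub(1) *] add_subgroup_diff[OF B b(1) b(3)]])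
      hence "r c - r c' \<in> B" by (simp add: algebra_simps)
      hence "c = c'" using r cd by (metis coset_eq_iff[OF B])
      moreover from this * have "b - b' \<in> C" by simp
      hence "d = d'" by (simp add: b coset_eq_iff[OF C])
      ultimately show "c = c' \<and> d = d'" by simp
    qed
    show "g ` (cosets A B \<times> cosets B C) = cosets A C"
    proof
      show "g ` (cosets A B \<times> cosets B C) \<subseteq> cosets A C"
      proof clarify
        fix c d assume cd: "c \<in> cosets A B" "d \<in> cosets B C"
        then obtain b where b: "b \<in> B" "d = (+) b ` C" by (auto simp: cosets_def)
        have "r c + b \<in> A" using r[OF cd(1)] b sub A by (auto simp: add_subgroup_def)
        thus "g (c, d) \<in> cosets A C" by (auto simp: g_def b eq cosets_def)
      qed
      show "cosets A C \<subseteq> g ` (cosets A B \<times> cosets B C)"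
      proof
        fix e assume "e \<in> cosets A C"
        then obtain a where a: "a \<in> A" "e = (+) a ` C" by (auto simp: cosets_def)
        define c where "c = (+) a ` B"
        have c: "c \<in> cosets A B" using a by (auto simp: c_def cosets_def)
        have "a - r c \<in> B" using r[OF c] by (simp add: c_def coset_eq_iff[OF B, symmetric])
        hence "(+) (a - r c) ` C \<in> cosets B C" by (auto simp: cosets_def)
        moreover have "e = g (c, (+) (a - r c) ` C)" by (simp add: g_def a eq)
        ultimately show "e \<in> g ` (cosets A B \<times> cosets B C)" using c by blast
      qed
    qed
  qed
  thus "finite (cosets A C)" "idx A C = idx A B * idx B C"
    using fin by (auto simp: idx_def bij_betw_finite[symmetric] card_cartesian_product dest!: bij_betw_same_card[symmetric])
qed

lemma finite_cosets_mono:
  assumes "add_subgroup B" "add_subgroup C" "C \<subseteq> B" "finite (cosets A C)"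
  shows "finite (cosets A B)"
proof -
  have "cosets A B \<subseteq> (\<lambda>c. \<Union>u\<in>c. (+) u ` B) ` cosets A C"
  proof
    fix e assume "e \<in> cosets A B"
    then obtain a where a: "a \<in> A" "e = (+) a ` B" by (auto simp: cosets_def)
    have "(+) u ` B = e" if "u \<in> (+) a ` C" for u
    proof -
      have "u - a \<in> B" using that assms(3) by auto
      thus ?thesis using a by (simp add: coset_eq_iff[OF assms(1)])
    qed
    moreover have "a + 0 \<in> (+) a ` C" using assms(2) by (intro imageI) (simp add: add_subgroup_def)
    ultimately have "(\<Union>u\<in>(+) a ` C. (+) u ` B) = e" by blast
    thus "e \<in> (\<lambda>c. \<Union>u\<in>c. (+) u ` B) ` cosets A C"
      using a(1) unfolding cosets_def by (intro image_eqI[OF sym]) auto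
  qed
  thus ?thesis using assms(4) finite_surj by blast
qed

lemma finite_cosets_subset: "finite (cosets A C) \<Longrightarrow> B \<subseteq> A \<Longrightarrow> finite (cosets B C)"
  unfolding cosets_def by (meson finite_subset image_mono)

lemma idx_pos: "finite (cosets A B) \<Longrightarrow> x \<in> A \<Longrightarrow> idx A B > 0"
  unfolding idx_def cosets_def by (auto simp: card_gt_0_iff)

lemma cosets_self: "add_subgroup A \<Longrightarrow> cosets A A = {(+) 0 ` A}"
proof -
  assume A: "add_subgroup A"
  have 0: "0 \<in> A" using A by (simp add: add_subgroup_def)
  have "(+) x ` A = (+) 0 ` A" if "x \<in> A" for x using that by (simp only: coset_eq_iff[OF A]) simp
  thus ?thesis unfolding cosets_def using 0 by blast
qed

lemma idx_self: "add_subgroup A \<Longrightarrow> idx A A = 1"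
  by (simp add: idx_def cosets_self)

lemma idx_eq_1:
  assumes "add_subgroup A" "add_subgroup B" "finite (cosets A B)" "idx A B = 1"
  shows "A \<subseteq> B"
proof
  fix a assume a: "a \<in> A"
  obtain c where c: "cosets A B = {c}" using assms(4) card_1_singletonE unfolding idx_def by metis
  have "(+) a ` B \<in> cosets A B" "(+) 0 ` B \<in> cosets A B"
    using a assms(1) unfolding cosets_def add_subgroup_def by blast+
  hence "(+) a ` B = (+) 0 ` B" using c by simp
  thus "a \<in> B" using coset_eq_iff[OF assms(2), of a 0] by simp
qed

lemma idx_scale:
  assumes "t \<noteq> 0" "add_subgroup B"
  shows "idx ((*) t ` A) ((*) t ` B) = idx A B" "finite (cosets ((*) t ` A) ((*) t ` B)) \<longleftrightarrow> finite (cosets A B)"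
proof -
  have B': "add_subgroup ((*) t ` B)"
    using assms(2) unfolding add_subgroup_def
    by (auto simp: distrib_left[symmetric] image_iff simp flip: mult_minus_right)
  have iff: "t * x - t * y \<in> (*) t ` B \<longleftrightarrow> x - y \<in> B" for x y
    using assms(1) by (auto simp: right_diff_distrib[symmetric])
  have "idx A B = idx ((*) t ` A) ((*) t ` B) \<and> (finite (cosets A B) \<longleftrightarrow> finite (cosets ((*) t ` A) ((*) t ` B)))"
  proof (intro conjI)
    note m = idx_map[OF assms(2) B', of A "(*) t" "(*) t ` A"]
    have "t * x - t * x \<in> (*) t ` B" for x using B' by (simp add: add_subgroup_def)
    hence s: "\<exists>x\<in>A. y - t * x \<in> (*) t ` B" if "y \<in> (*) t ` A" for y using that by blast
    show "idx A B = idx ((*) t ` A) ((*) t ` B)" by (rule m(1)) (simp_all only: iff s imageI)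
    show "finite (cosets A B) \<longleftrightarrow> finite (cosets ((*) t ` A) ((*) t ` B))" by (rule m(2)) (simp_all only: iff s imageI)
  qed
  thus "idx ((*) t ` A) ((*) t ` B) = idx A B" "finite (cosets ((*) t ` A) ((*) t ` B)) \<longleftrightarrow> finite (cosets A B)"
    by auto
qed

section \<open>Ideals\<close>

inductive_set iprod :: "'a::field_char_0 set \<Rightarrow> 'a set \<Rightarrow> 'a set" for A B where
  mult: "a \<in> A \<Longrightarrow> b \<in> B \<Longrightarrow> a * b \<in> iprod A B"
| add: "x \<in> iprod A B \<Longrightarrow> y \<in> iprod A B \<Longrightarrow> x + y \<in> iprod A B"

lemma iprod_subsetI:
  assumes "\<And>a b. a \<in> A \<Longrightarrow> b \<in> B \<Longrightarrow> a * b \<in> C" "\<And>x y. x \<in> C \<Longrightarrow> y \<in> C \<Longrightarrow> x + y \<in> C"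
  shows "iprod A B \<subseteq> C"
proof
  fix x assume "x \<in> iprod A B"
  thus "x \<in> C" by induction (use assms in auto)
qed

lemma iprod_mono: "A \<subseteq> A' \<Longrightarrow> B \<subseteq> B' \<Longrightarrow> iprod A B \<subseteq> iprod A' B'"
  by (rule iprod_subsetI) (auto intro: iprod.intros)

lemma iprod_commute: "iprod A B = iprod B A"
proof -
  have "iprod A B \<subseteq> iprod B A" for A B :: "'a set"
  proof (rule iprod_subsetI)
    fix a b assume "a \<in> A" "b \<in> B"
    hence "b * a \<in> iprod B A" by (intro iprod.mult)
    thus "a * b \<in> iprod B A" by (simp add: mult.commute)
  qed (rule iprod.add)
  thus ?thesis by blast
qed

lemma iprod_assoc: "iprod (iprod A B) C = iprod A (iprod B C)"
proof -
  have sub: "iprod (iprod A B) C \<subseteq> iprod A (iprod B C)" for A B C :: "'a set"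
  proof (rule iprod_subsetI)
    fix x c assume "x \<in> iprod A B" and c: "c \<in> C"
    thus "x * c \<in> iprod A (iprod B C)"
    proof (induction x)
      case (mult a b)
      have "a * (b * c) \<in> iprod A (iprod B C)" using mult by (intro iprod.mult)
      thus ?case by (simp add: mult.assoc)
    next
      case (add x y)
      thus ?case by (simp add: distrib_right iprod.add)
    qed
  qed (rule iprod.add)
  have "iprod A (iprod B C) = iprod (iprod C B) A" by (metis iprod_commute)
  also have "\<dots> \<subseteq> iprod C (iprod B A)" by (rule sub)
  also have "\<dots> = iprod (iprod A B) C" by (metis iprod_commute)
  finally show ?thesis using sub by blast
qed

lemma iprod_left_commute: "iprod A (iprod B C) = iprod B (iprod A C)"
  by (metis iprod_assoc iprod_commute)

text \<open>A substitute for the Dedekind axioms: s and t lie in the inverse of the fractional ideal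
  (1, a/b), and s + t (a/b) = 1 shows that this ideal is invertible; in addition, nonzero principal
  ideals have finite index.\<close>

locale int_ring = sring \<O> for \<O> :: "'a::field_char_0 set" +
  assumes invertible2: "a \<in> \<O> \<Longrightarrow> b \<in> \<O> \<Longrightarrow> b \<noteq> 0 \<Longrightarrow>
      \<exists>s t. s \<in> \<O> \<and> t \<in> \<O> \<and> s * (a / b) \<in> \<O> \<and> t * (a / b) \<in> \<O> \<and> s + t * (a / b) = 1"
    and finite_quotient: "b \<in> \<O> \<Longrightarrow> b \<noteq> 0 \<Longrightarrow> finite (cosets \<O> ((*) b ` \<O>))"
begin

definition idl :: "'a set \<Rightarrow> bool" where
  "idl A \<longleftrightarrow> A \<subseteq> \<O> \<and> 0 \<in> A \<and> (\<forall>x\<in>A. \<forall>y\<in>A. x + y \<in> A) \<and> (\<forall>r\<in>\<O>. \<forall>x\<in>A. r * x \<in> A)"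

definition prm :: "'a set \<Rightarrow> bool" where
  "prm P \<longleftrightarrow> idl P \<and> P \<noteq> {0} \<and> 1 \<notin> P \<and> (\<forall>a\<in>\<O>. \<forall>b\<in>\<O>. a * b \<in> P \<longrightarrow> a \<in> P \<or> b \<in> P)"

lemma idl_sub: "idl A \<Longrightarrow> A \<subseteq> \<O>" and idl_0: "idl A \<Longrightarrow> 0 \<in> A"
  and idl_add: "idl A \<Longrightarrow> x \<in> A \<Longrightarrow> y \<in> A \<Longrightarrow> x + y \<in> A"
  and idl_mult: "idl A \<Longrightarrow> r \<in> \<O> \<Longrightarrow> x \<in> A \<Longrightarrow> r * x \<in> A"
  by (auto simp: idl_def)

lemma idl_mult': "idl A \<Longrightarrow> r \<in> \<O> \<Longrightarrow> x \<in> A \<Longrightarrow> x * r \<in> A"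
  using idl_mult[of A r x] by (simp add: mult.commute)

lemma idl_minus: "idl A \<Longrightarrow> x \<in> A \<Longrightarrow> - x \<in> A"
  using idl_mult[of A "-1" x] minus[of 1] by simp

lemma idl_add_subgroup: "idl A \<Longrightarrow> add_subgroup A"
  by (simp add: add_subgroup_def idl_0 idl_add idl_minus)

lemma idl_O: "idl \<O>" by (auto simp: idl_def add mult)

lemma add_subgroup_O: "add_subgroup \<O>" by (rule idl_add_subgroup[OF idl_O])

lemma idl_eq_O: "idl A \<Longrightarrow> 1 \<in> A \<Longrightarrow> A = \<O>"
  using idl_mult[of A _ 1] idl_sub[of A] by auto

lemma idl_principal: "c \<in> \<O> \<Longrightarrow> idl ((*) c ` \<O>)"
  unfolding idl_def
  by (auto simp: mult distrib_left[symmetric] add intro!: imageI image_eqI[of 0 _ 0])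

lemma principal_mem: "c \<in> (*) c ` \<O>"
  by (rule image_eqI[of _ _ 1]) auto

lemma idl_scale: "c \<in> \<O> \<Longrightarrow> idl A \<Longrightarrow> idl ((*) c ` A)"
  unfolding idl_def
  by (auto simp: mult distrib_left[symmetric] add intro!: imageI image_eqI[of 0 _ 0])

lemma principal_subset: "idl A \<Longrightarrow> c \<in> A \<Longrightarrow> (*) c ` \<O> \<subseteq> A"
  by (auto intro: idl_mult')

lemma iprod_sub: "A \<subseteq> \<O> \<Longrightarrow> idl B \<Longrightarrow> iprod A B \<subseteq> B"
  by (rule iprod_subsetI) (auto intro: idl_mult idl_add)

lemma idl_iprod:
  assumes "idl A" "idl B" shows "idl (iprod A B)"
proof -
  have "iprod A B \<subseteq> \<O>" using iprod_sub[OF idl_sub[OF assms(1)] assms(2)] idl_sub[OF assms(2)] by blast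
  moreover have "0 * 0 \<in> iprod A B" using assms by (intro iprod.mult idl_0)
  moreover have "r * x \<in> iprod A B" if r: "r \<in> \<O>" and x: "x \<in> iprod A B" for r x
    using x
  proof induction
    case (mult a b)
    have "(r * a) * b \<in> iprod A B" using mult r assms by (intro iprod.mult idl_mult)
    thus ?case by (simp add: mult.assoc)
  next
    case (add x y)
    thus ?case by (simp add: distrib_left iprod.add)
  qed
  ultimately show ?thesis unfolding idl_def by (auto intro: iprod.add)
qed

lemma iprod_O: "idl A \<Longrightarrow> iprod \<O> A = A"
proof
  assume A: "idl A"
  show "iprod \<O> A \<subseteq> A" by (rule iprod_sub[OF _ A]) simp
  show "A \<subseteq> iprod \<O> A"
  proof
    fix a assume "a \<in> A"
    hence "1 * a \<in> iprod \<O> A" by (intro iprod.mult) simp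
    thus "a \<in> iprod \<O> A" by simp
  qed
qed

lemma iprod_principal: "c \<in> \<O> \<Longrightarrow> idl A \<Longrightarrow> iprod ((*) c ` \<O>) A = (*) c ` A"
proof
  assume c: "c \<in> \<O>" and A: "idl A"
  show "iprod ((*) c ` \<O>) A \<subseteq> (*) c ` A"
  proof (rule iprod_subsetI)
    fix x a assume "x \<in> (*) c ` \<O>" and a: "a \<in> A"
    then obtain y where y: "y \<in> \<O>" "x = c * y" by blast
    have "y * a \<in> A" by (rule idl_mult[OF A y(1) a])
    thus "x * a \<in> (*) c ` A" unfolding y(2) mult.assoc by (rule imageI)
  next
    fix x y assume "x \<in> (*) c ` A" "y \<in> (*) c ` A"
    thus "x + y \<in> (*) c ` A" by (rule idl_add[OF idl_scale[OF c A]])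
  qed
  show "(*) c ` A \<subseteq> iprod ((*) c ` \<O>) A"
    using iprod.mult[OF principal_mem] by blast
qed

lemma iprod_nz:
  assumes "a \<in> A" "a \<noteq> 0" "b \<in> B" "b \<noteq> 0" shows "iprod A B \<noteq> {0}"
proof
  assume "iprod A B = {0}"
  hence "a * b = 0" using iprod.mult[OF assms(1,3)] by blast
  thus False using assms(2,4) by simp
qed

lemma nz_elem: "idl A \<Longrightarrow> A \<noteq> {0} \<Longrightarrow> \<exists>c\<in>A. c \<noteq> 0"
  using idl_0 by blast

lemma iprod_nz': "idl A \<Longrightarrow> idl B \<Longrightarrow> A \<noteq> {0} \<Longrightarrow> B \<noteq> {0} \<Longrightarrow> iprod A B \<noteq> {0}"
  using nz_elem iprod_nz by metis

lemma finite_quotient_idl: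
  assumes "idl A" "A \<noteq> {0}" shows "finite (cosets \<O> A)"
proof -
  obtain c where c: "c \<in> A" "c \<noteq> 0" using nz_elem[OF assms] by blast
  hence cO: "c \<in> \<O>" using idl_sub assms by blast
  show ?thesis
    by (rule finite_cosets_mono[OF idl_add_subgroup[OF assms(1)] idl_add_subgroup[OF idl_principal[OF cO]]
          principal_subset[OF assms(1) c(1)] finite_quotient[OF cO c(2)]])
qed

text \<open>An ideal above A is recovered from its set of cosets modulo A, a subset of the finite
  quotient.\<close>

lemma finite_idl_above:
  assumes "idl A" "A \<noteq> {0}" shows "finite {B. idl B \<and> A \<subseteq> B}"
proof (rule finite_imageD)
  have "(\<lambda>B. cosets B A) ` {B. idl B \<and> A \<subseteq> B} \<subseteq> Pow (cosets \<O> A)"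
    by (auto simp: cosets_def dest: idl_sub)
  thus "finite ((\<lambda>B. cosets B A) ` {B. idl B \<and> A \<subseteq> B})"
    using finite_quotient_idl[OF assms] finite_subset by blast
  have sub: "B \<subseteq> C" if "idl B" "idl C" "A \<subseteq> C" "cosets B A = cosets C A" for B C
  proof
    fix b assume "b \<in> B"
    hence "(+) b ` A \<in> cosets C A" using that(4) by (auto simp: cosets_def)
    then obtain c where c: "c \<in> C" "(+) b ` A = (+) c ` A" by (auto simp: cosets_def)
    hence "b - c \<in> C" using coset_eq_iff[OF idl_add_subgroup[OF assms(1)]] that(3) by blast
    hence "b - c + c \<in> C" using c that(2) idl_add by blast
    thus "b \<in> C" by simp
  qed
  show "inj_on (\<lambda>B. cosets B A) {B. idl B \<and> A \<subseteq> B}"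
    by (rule inj_onI) (use sub in blast)
qed

text \<open>Only finitely many ideals contain A, so there is a maximal one without 1, and it is
  prime by the usual argument.\<close>

lemma prime_above:
  assumes "idl A" "A \<noteq> {0}" "1 \<notin> A"
  shows "\<exists>P. prm P \<and> A \<subseteq> P"
proof -
  let ?X = "{B. idl B \<and> A \<subseteq> B \<and> 1 \<notin> B}"
  have "finite ?X" by (rule finite_subset[OF _ finite_idl_above[OF assms(1,2)]]) blast
  moreover have "A \<in> ?X" using assms by blast
  ultimately have "\<exists>M\<in>?X. A \<subseteq> M \<and> (\<forall>B\<in>?X. M \<subseteq> B \<longrightarrow> M = B)"
    by (rule finite_has_maximal2)
  then obtain M where M: "M \<in> ?X" "A \<subseteq> M" and mx: "\<forall>B\<in>?X. M \<subseteq> B \<longrightarrow> M = B"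
    by (elim bexE conjE)
  have Mi: "idl M" using M by blast
  have "a \<in> M \<or> b \<in> M" if ab: "a \<in> \<O>" "b \<in> \<O>" "a * b \<in> M" for a b
  proof (rule ccontr)
    assume n: "\<not> (a \<in> M \<or> b \<in> M)"
    define J where "J = {m + a * r | m r. m \<in> M \<and> r \<in> \<O>}"
    have J: "idl J"
      unfolding idl_def
    proof (intro conjI ballI)
      show "J \<subseteq> \<O>" using idl_sub[OF Mi] ab by (auto simp: J_def intro!: add mult)
      show "0 \<in> J" unfolding J_def using idl_0[OF Mi] by (intro CollectI exI[of _ 0]) simp
      fix x y assume "x \<in> J" "y \<in> J"
      then obtain m r m' r' where "m \<in> M" "r \<in> \<O>" "m' \<in> M" "r' \<in> \<O>" "x = m + a * r" "y = m' + a * r'"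
        unfolding J_def by blast
      thus "x + y \<in> J" unfolding J_def using idl_add[OF Mi, of m m'] add[of r r']
        by (intro CollectI exI[of _ "m + m'"] exI[of _ "r + r'"]) (simp add: algebra_simps)
    next
      fix s x assume "s \<in> \<O>" "x \<in> J"
      then obtain m r where "s \<in> \<O>" "m \<in> M" "r \<in> \<O>" "x = m + a * r" unfolding J_def by blast
      thus "s * x \<in> J" unfolding J_def using idl_mult[OF Mi, of s m] mult[of s r]
        by (intro CollectI exI[of _ "s * m"] exI[of _ "s * r"]) (simp add: algebra_simps)
    qed
    have MJ: "M \<subseteq> J"
    proof
      fix m assume "m \<in> M" thus "m \<in> J" unfolding J_def by (intro CollectI exI[of _ m] exI[of _ 0]) simp
    qed
    have aJ: "a \<in> J" unfolding J_def using idl_0[OF Mi] by (intro CollectI exI[of _ 0] exI[of _ 1]) simp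
    have "1 \<in> J"
    proof (rule ccontr)
      assume "1 \<notin> J"
      hence "J \<in> ?X" using J MJ M(2) by blast
      hence "M = J" using mx MJ by blast
      thus False using aJ n by blast
    qed
    then obtain m r where mr: "m \<in> M" "r \<in> \<O>" "1 = m + a * r" unfolding J_def by blast
    have "b = b * m + r * (a * b)" using arg_cong[OF mr(3), of "\<lambda>x. b * x"] by (simp add: algebra_simps)
    also have "\<dots> \<in> M" by (rule idl_add[OF Mi idl_mult[OF Mi ab(2) mr(1)] idl_mult[OF Mi mr(2) ab(3)]])
    finally show False using n by blast
  qed
  hence "prm M" using M assms(2) idl_0[OF assms(1)] unfolding prm_def by blast
  thus ?thesis using M by blast
qed

section \<open>Local generators and invertibility of ideals\<close>

lemma prm_idl: "prm P \<Longrightarrow> idl P" by (simp add: prm_def)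

text \<open>The localisation at P is a valuation ring: in s + t (a/b) = 1 the two summands cannot
  both lie in P, and one outside P serves as r.\<close>

lemma comparable:
  assumes P: "prm P" and ab: "a \<in> \<O>" "b \<in> \<O>"
  shows "\<exists>r\<in>\<O>. r \<notin> P \<and> (r * a \<in> (*) b ` \<O> \<or> r * b \<in> (*) a ` \<O>)"
proof (cases "b = 0")
  case True
  have "1 * b \<in> (*) a ` \<O>" using True by (intro image_eqI[of _ _ 0]) auto
  thus ?thesis using P by (intro bexI[of _ 1]) (auto simp: prm_def)
next
  case False
  then obtain s t where st: "s \<in> \<O>" "t \<in> \<O>" "s * (a / b) \<in> \<O>" "t * (a / b) \<in> \<O>" "s + t * (a / b) = 1"
    using invertible2 ab by blast
  show ?thesis
  proof (cases "s \<in> P")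
    case sP: True
    have "t * (a / b) \<notin> P"
    proof
      assume "t * (a / b) \<in> P"
      hence "s + t * (a / b) \<in> P" using sP idl_add prm_idl[OF P] by blast
      thus False using st P by (simp add: prm_def)
    qed
    moreover have "t * (a / b) * b \<in> (*) a ` \<O>" using st False by (intro image_eqI[of _ _ t]) auto
    ultimately show ?thesis using st by blast
  next
    case False
    moreover have "s * a \<in> (*) b ` \<O>" using st \<open>b \<noteq> 0\<close> by (intro image_eqI[of _ _ "s * (a / b)"]) auto
    ultimately show ?thesis using st by blast
  qed
qed

lemma principal_trans:
  "r \<in> \<O> \<Longrightarrow> x \<in> (*) g ` \<O> \<Longrightarrow> r * x \<in> (*) g ` \<O>"
  by (auto intro!: image_eqI[of _ _ "r * _"] simp: mult.left_commute mult)

lemma local_generator: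
  assumes P: "prm P" and G: "finite G" "G \<noteq> {}" "G \<subseteq> \<O>"
  shows "\<exists>g\<in>G. \<exists>r\<in>\<O>. r \<notin> P \<and> (\<forall>h\<in>G. r * h \<in> (*) g ` \<O>)"
  using G
proof (induction G rule: finite_ne_induct)
  case (singleton x)
  show ?case using P principal_mem[of x] by (intro bexI[of _ x] bexI[of _ 1]) (auto simp: prm_def)
next
  case (insert x F)
  then obtain g r where gr: "g \<in> F" "r \<in> \<O>" "r \<notin> P" "\<forall>h\<in>F. r * h \<in> (*) g ` \<O>" by auto
  obtain q where q: "q \<in> \<O>" "q \<notin> P" "q * x \<in> (*) g ` \<O> \<or> q * g \<in> (*) x ` \<O>"
    using comparable[OF P, of x g] insert.prems gr by blast
  have rq: "q * r \<in> \<O>" "q * r \<notin> P" using gr q P mult unfolding prm_def by blast+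
  from q(3) show ?case
  proof
    assume "q * x \<in> (*) g ` \<O>"
    hence "r * (q * x) \<in> (*) g ` \<O>" by (rule principal_trans[OF gr(2)])
    hence 1: "q * r * x \<in> (*) g ` \<O>" by (simp only: mult_ac)
    have 2: "q * r * h \<in> (*) g ` \<O>" if "h \<in> F" for h
      unfolding mult.assoc by (rule principal_trans[OF q(1)]) (use gr(4) that in blast)
    from 1 2 have "\<forall>h\<in>insert x F. q * r * h \<in> (*) g ` \<O>" by blast
    thus ?thesis using gr(1) rq by blast
  next
    assume qg: "q * g \<in> (*) x ` \<O>"
    have 1: "q * r * h \<in> (*) x ` \<O>" if hF: "h \<in> F" for h
    proof -
      have "r * h \<in> (*) g ` \<O>" using gr(4) hF by blast
      then obtain y where y: "r * h = g * y" "y \<in> \<O>" by (elim imageE)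
      have "q * r * h = q * (r * h)" by (simp only: mult.assoc)
      also have "\<dots> = y * (q * g)" unfolding y(1) by (simp only: mult_ac)
      finally have eq: "q * r * h = y * (q * g)" .
      show ?thesis unfolding eq by (rule principal_trans[OF y(2) qg])
    qed
    have "q * r * x = x * (q * r)" by (rule mult.commute)
    hence 2: "q * r * x \<in> (*) x ` \<O>" by (rule image_eqI[OF _ rq(1)])
    from 1 2 have "\<forall>h\<in>insert x F. q * r * h \<in> (*) x ` \<O>" by blast
    thus ?thesis using rq by blast
  qed
qed

text \<open>A contains a nonzero c and has finitely many cosets modulo c, so it is generated by c
  and finitely many representatives; \<open>local_generator\<close> applies to these.\<close>

lemma local_generator_idl:
  assumes P: "prm P" and A: "idl A" "A \<noteq> {0}"
  shows "\<exists>g\<in>A. g \<noteq> 0 \<and> (\<exists>r\<in>\<O>. r \<notin> P \<and> (\<forall>a\<in>A. r * a \<in> (*) g ` \<O>))"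
proof -
  obtain c where c: "c \<in> A" "c \<noteq> 0" using nz_elem[OF A] by blast
  have cO: "c \<in> \<O>" using idl_sub A c by blast
  let ?C = "(*) c ` \<O>"
  have gC: "add_subgroup ?C" by (rule idl_add_subgroup[OF idl_principal[OF cO]])
  have "finite (cosets A ?C)" by (rule finite_cosets_subset[OF finite_quotient[OF cO c(2)] idl_sub[OF A(1)]])
  then obtain G where G: "finite G" "G \<subseteq> A" "cosets A ?C = (\<lambda>x. (+) x ` ?C) ` G"
    unfolding cosets_def using finite_subset_image[of "(\<lambda>x. (+) x ` ?C) ` A" "\<lambda>x. (+) x ` ?C" A] by auto
  have "insert c G \<subseteq> \<O>" using G idl_sub[OF A(1)] cO by blast
  then obtain g r where gr: "g \<in> insert c G" "r \<in> \<O>" "r \<notin> P" "\<forall>h\<in>insert c G. r * h \<in> (*) g ` \<O>"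
    using local_generator[OF P, of "insert c G"] G(1) by auto
  have gO: "g \<in> \<O>" using gr(1) \<open>insert c G \<subseteq> \<O>\<close> by blast
  have "r * a \<in> (*) g ` \<O>" if a: "a \<in> A" for a
  proof -
    have "(+) a ` ?C \<in> cosets A ?C" using a by (auto simp: cosets_def)
    then obtain h where h: "h \<in> G" "(+) a ` ?C = (+) h ` ?C" unfolding G(3) by blast
    hence "a - h \<in> ?C" by (simp add: coset_eq_iff[OF gC])
    then obtain y where y: "y \<in> \<O>" "a - h = c * y" by blast
    have "a = h + c * y" using y(2) by (simp add: algebra_simps)
    hence "r * a = r * h + y * (r * c)" by (simp add: algebra_simps)
    also have "\<dots> \<in> (*) g ` \<O>"
      by (rule idl_add[OF idl_principal[OF gO] _ principal_trans[OF y(1)]]) (use gr(4) h(1) in blast)+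
    finally show ?thesis .
  qed
  moreover have "g \<noteq> 0"
  proof
    assume "g = 0"
    hence "r * c = 0" using gr(4) by auto
    hence "r = 0" using c by simp
    thus False using gr(3) idl_0[OF prm_idl[OF P]] by simp
  qed
  moreover have "g \<in> A" using gr(1) c G by blast
  ultimately show ?thesis using gr(2,3) by blast
qed

text \<open>Let B consist of the multipliers of A into (c), and J of the multipliers of c into A B;
  the claim is that J contains 1. Otherwise J lies in a prime P. A local generator g of A at P, with
  its multiplier r, puts r c / g into B, hence r c into A B and r into J, although r is outside
  P.\<close>

theorem idl_invertible:
  assumes A: "idl A" "A \<noteq> {0}"
  shows "\<exists>B c. idl B \<and> B \<noteq> {0} \<and> c \<in> \<O> \<and> c \<noteq> 0 \<and> iprod A B = (*) c ` \<O>"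
proof -
  obtain c where c: "c \<in> A" "c \<noteq> 0" using nz_elem[OF A] by blast
  have cO: "c \<in> \<O>" using idl_sub A c by blast
  let ?C = "(*) c ` \<O>"
  note idlC = idl_principal[OF cO]
  define B where "B = {y \<in> \<O>. \<forall>a\<in>A. y * a \<in> ?C}"
  have B: "idl B" unfolding idl_def B_def
    by (auto simp: distrib_right mult.assoc intro: add mult idl_add[OF idlC] idl_mult[OF idlC] idl_0[OF idlC])
  have cB: "c \<in> B" unfolding B_def using cO idl_sub[OF A(1)] by auto
  have sub: "iprod A B \<subseteq> ?C"
  proof (rule iprod_subsetI)
    fix a b assume "a \<in> A" "b \<in> B"
    hence "b * a \<in> ?C" unfolding B_def by blast
    thus "a * b \<in> ?C" by (simp only: mult.commute)
  qed (rule idl_add[OF idlC])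
  define J where "J = {j \<in> \<O>. j * c \<in> iprod A B}"
  have AB: "idl (iprod A B)" by (rule idl_iprod[OF A(1) B])
  have J: "idl J" unfolding idl_def J_def
    by (auto simp: distrib_right mult.assoc intro: add mult idl_add[OF AB] idl_mult[OF AB] idl_0[OF AB])
  have cJ: "c \<in> J" unfolding J_def using cO iprod.mult[OF c(1) cB] by simp
  have "1 \<in> J"
  proof (rule ccontr)
    assume "1 \<notin> J"
    then obtain P where P: "prm P" "J \<subseteq> P" using prime_above[OF J] cJ c by auto
    obtain g r where g: "g \<in> A" "g \<noteq> 0" "r \<in> \<O>" "r \<notin> P" "\<forall>a\<in>A. r * a \<in> (*) g ` \<O>"
      using local_generator_idl[OF P(1) A] by blast
    define y where "y = r * c / g"
    have "y \<in> B" unfolding B_def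
    proof (intro CollectI conjI ballI)
      obtain z where "z \<in> \<O>" "r * c = g * z" using g(5) c(1) by blast
      thus "y \<in> \<O>" using g(2) by (simp add: y_def)
      fix a assume "a \<in> A"
      then obtain z where "z \<in> \<O>" "r * a = g * z" using g(5) by blast
      moreover from this have "y * a = c * z" using g(2) by (simp add: y_def field_simps)
      ultimately show "y * a \<in> ?C" by blast
    qed
    hence "g * y \<in> iprod A B" using g by (intro iprod.mult)
    hence "r \<in> J" using g by (simp add: J_def y_def)
    thus False using P g by blast
  qed
  hence "c \<in> iprod A B" by (simp add: J_def)
  hence "?C \<subseteq> iprod A B" using principal_subset[OF AB] by blast
  thus ?thesis using sub B cB c cO by (intro exI[of _ B] exI[of _ c]) auto
qed

lemma scale_subset_cancel: "c \<noteq> 0 \<Longrightarrow> (*) c ` A \<subseteq> (*) c ` (B::'a set) \<Longrightarrow> A \<subseteq> B"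
  by (auto simp: image_subset_iff image_iff)

lemma iprod_cancel:
  assumes A: "idl A" "A \<noteq> {0}" and BC: "idl B" "idl C" "iprod A B \<subseteq> iprod A C"
  shows "B \<subseteq> C"
proof -
  obtain D c where D: "idl D" "c \<in> \<O>" "c \<noteq> 0" "iprod A D = (*) c ` \<O>" using idl_invertible[OF A] by blast
  have "iprod D (iprod A B) \<subseteq> iprod D (iprod A C)" by (rule iprod_mono[OF subset_refl BC(3)])
  hence "iprod (iprod A D) B \<subseteq> iprod (iprod A D) C" by (metis iprod_assoc iprod_commute)
  hence "(*) c ` B \<subseteq> (*) c ` C" unfolding D(4) using iprod_principal[OF D(2)] BC by simp
  thus ?thesis using scale_subset_cancel D(3) by blast
qed

lemma contain_divides:
  assumes A: "idl A" and B: "idl B" "B \<noteq> {0}" and sub: "A \<subseteq> B"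
  shows "\<exists>C. idl C \<and> A = iprod B C"
proof -
  obtain D c where D: "idl D" "c \<in> \<O>" "c \<noteq> 0" "iprod B D = (*) c ` \<O>" using idl_invertible[OF B] by blast
  have AD: "idl (iprod A D)" by (rule idl_iprod[OF A D(1)])
  have sAD: "iprod A D \<subseteq> (*) c ` \<O>" unfolding D(4)[symmetric] using sub by (intro iprod_mono) auto
  define C where "C = {y \<in> \<O>. c * y \<in> iprod A D}"
  have C: "idl C" unfolding idl_def C_def
    by (auto simp: distrib_left mult.left_commute intro: add mult idl_add[OF AD] idl_mult[OF AD] idl_0[OF AD])
  have cC: "(*) c ` C = iprod A D" using sAD by (auto simp: C_def)
  have cO: "(*) c ` \<O> \<noteq> {0}" using principal_mem[of c] D(3) by blast
  have "iprod ((*) c ` \<O>) (iprod B C) = iprod B (iprod ((*) c ` \<O>) C)" by (rule iprod_left_commute)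
  also have "\<dots> = iprod B (iprod A D)" using iprod_principal[OF D(2) C] cC by simp
  also have "\<dots> = iprod ((*) c ` \<O>) A" unfolding D(4)[symmetric] by (metis iprod_assoc iprod_commute)
  finally have eq: "iprod ((*) c ` \<O>) (iprod B C) = iprod ((*) c ` \<O>) A" .
  have "iprod B C = A"
    using iprod_cancel[OF idl_principal[OF D(2)] cO] idl_iprod[OF B(1) C] A eq by blast
  thus ?thesis using C by blast
qed

text \<open>Write P = M C. If M is not inside P then C is, so P is contained in M P, and cancelling
  P leaves \<O> inside M.\<close>

lemma prm_maximal:
  assumes P: "prm P" and M: "idl M" "P \<subseteq> M"
  shows "M = P \<or> M = \<O>"
proof -
  have Mnz: "M \<noteq> {0}" using assms idl_0[OF prm_idl[OF P]] by (auto simp: prm_def)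
  obtain C where C: "idl C" "P = iprod M C" using contain_divides[OF prm_idl[OF P] M(1) Mnz M(2)] by blast
  show ?thesis
  proof (cases "M \<subseteq> P")
    case False
    then obtain m where m: "m \<in> M" "m \<notin> P" by blast
    have "C \<subseteq> P"
    proof
      fix x assume "x \<in> C"
      hence "m * x \<in> P" using C(2) m iprod.mult by metis
      thus "x \<in> P" using P m idl_sub[OF M(1)] idl_sub[OF C(1)] \<open>x \<in> C\<close> unfolding prm_def by blast
    qed
    hence "iprod M C \<subseteq> iprod M P" by (intro iprod_mono) auto
    hence "iprod P \<O> \<subseteq> iprod P M"
      using C(2) iprod_O[OF prm_idl[OF P]] by (metis iprod_commute)
    moreover have "P \<noteq> {0}" using P by (simp add: prm_def)
    ultimately have "\<O> \<subseteq> M" using iprod_cancel[OF prm_idl[OF P] _ idl_O M(1)] by blast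
    thus ?thesis using idl_sub[OF M(1)] by blast
  qed (use M in blast)
qed

text \<open>No ideal lies strictly between P A and A, so any y in A outside P A generates A modulo P
  A, and x |-> x y identifies \<O>/P with A/PA.\<close>

lemma idx_iprod_prm:
  assumes P: "prm P" and A: "idl A" "A \<noteq> {0}"
  shows "idx A (iprod P A) = idx \<O> P"
proof -
  have iP: "idl P" and Pnz: "P \<noteq> {0}" and P1: "1 \<notin> P" using P by (auto simp: prm_def)
  have PA: "idl (iprod P A)" by (rule idl_iprod[OF iP A(1)])
  have "\<not> A \<subseteq> iprod P A"
  proof
    assume "A \<subseteq> iprod P A"
    hence "iprod A \<O> \<subseteq> iprod A P" using iprod_O[OF A(1)] by (metis iprod_commute)
    hence "\<O> \<subseteq> P" by (rule iprod_cancel[OF A idl_O iP])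
    thus False using P1 one by blast
  qed
  then obtain y where y: "y \<in> A" "y \<notin> iprod P A" by blast
  have yO: "y \<in> \<O>" using y idl_sub[OF A(1)] by blast
  define Q where "Q = {x \<in> \<O>. x * y \<in> iprod P A}"
  have Q: "idl Q" unfolding idl_def Q_def
    by (auto simp: distrib_right mult.assoc intro: add mult idl_add[OF PA] idl_mult[OF PA] idl_0[OF PA])
  have "P \<subseteq> Q" unfolding Q_def using y idl_sub[OF iP] by (auto intro: iprod.mult)
  moreover have "1 \<notin> Q" using y by (simp add: Q_def)
  ultimately have QP: "Q = P" using prm_maximal[OF P Q] by auto
  define E where "E = {o' * y + z | o' z. o' \<in> \<O> \<and> z \<in> iprod P A}"
  have E: "idl E" unfolding idl_def
  proof (intro conjI ballI)
    show "E \<subseteq> \<O>" using idl_sub[OF PA] yO by (auto simp: E_def intro!: add mult)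
    show "0 \<in> E" unfolding E_def using idl_0[OF PA] by (intro CollectI exI[of _ 0]) simp
    fix u v assume "u \<in> E" "v \<in> E"
    then obtain m r m' r' where "m \<in> \<O>" "r \<in> iprod P A" "m' \<in> \<O>" "r' \<in> iprod P A" "u = m * y + r" "v = m' * y + r'"
      unfolding E_def by blast
    thus "u + v \<in> E" unfolding E_def using idl_add[OF PA, of r r'] add[of m m']
      by (intro CollectI exI[of _ "m + m'"] exI[of _ "r + r'"]) (simp add: algebra_simps)
  next
    fix s x assume "s \<in> \<O>" "x \<in> E"
    then obtain m r where "s \<in> \<O>" "m \<in> \<O>" "r \<in> iprod P A" "x = m * y + r" unfolding E_def by blast
    thus "s * x \<in> E" unfolding E_def using idl_mult[OF PA, of s r] mult[of s m]
      by (intro CollectI exI[of _ "s * m"] exI[of _ "s * r"]) (simp add: algebra_simps)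
  qed
  have yE: "y \<in> E" unfolding E_def using idl_0[OF PA] by (intro CollectI exI[of _ 1] exI[of _ 0]) simp
  have PAE: "iprod P A \<subseteq> E"
  proof
    fix z assume "z \<in> iprod P A"
    thus "z \<in> E" unfolding E_def by (intro CollectI exI[of _ 0] exI[of _ z]) simp
  qed
  have EA: "E \<subseteq> A"
    using iprod_sub[OF idl_sub[OF iP] A(1)] y(1) unfolding E_def by (auto intro!: idl_add[OF A(1)] idl_mult[OF A(1)])
  obtain C where C: "idl C" "E = iprod A C" using contain_divides[OF E A EA] by blast
  have "P \<subseteq> C"
    by (rule iprod_cancel[OF A iP C(1)]) (use PAE C iprod_commute in metis)
  hence "C = P \<or> C = \<O>" by (rule prm_maximal[OF P C(1)])
  moreover have "C \<noteq> P" using C yE y by (metis iprod_commute)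
  ultimately have EA': "E = A" using C iprod_O[OF A(1)] by (metis iprod_commute)
  have "idx \<O> P = idx A (iprod P A)"
  proof (rule idx_map(1)[OF idl_add_subgroup[OF iP] idl_add_subgroup[OF PA], where f = "\<lambda>x. x * y"])
    fix x assume "x \<in> \<O>" thus "x * y \<in> A" using y idl_mult[OF A(1)] by blast
  next
    fix x x' assume x: "x \<in> \<O>" "x' \<in> \<O>"
    have "x - x' \<in> Q \<longleftrightarrow> (x - x') * y \<in> iprod P A" using x diff by (simp add: Q_def)
    thus "x * y - x' * y \<in> iprod P A \<longleftrightarrow> x - x' \<in> P" unfolding QP by (simp add: left_diff_distrib)
  next
    fix z assume "z \<in> A"
    hence "z \<in> E" using EA' by simp
    then obtain m r where "m \<in> \<O>" "r \<in> iprod P A" "z = m * y + r" unfolding E_def by blast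
    thus "\<exists>x\<in>\<O>. z - x * y \<in> iprod P A" by (intro bexI[of _ m]) simp_all
  qed
  thus ?thesis ..
qed

section \<open>Valuations and the prime factorisation of the index\<close>

primrec ipow :: "'a set \<Rightarrow> nat \<Rightarrow> 'a set" where
  "ipow P 0 = \<O>"
| "ipow P (Suc n) = iprod (ipow P n) P"

lemma idl_ipow: "idl P \<Longrightarrow> idl (ipow P n)"
  by (induction n) (auto intro: idl_O idl_iprod)

lemma O_nz: "\<O> \<noteq> {0}"
proof
  assume "\<O> = {0}"
  hence "(1::'a) = 0" using one by blast
  thus False by simp
qed

lemma ipow_nz: "idl P \<Longrightarrow> P \<noteq> {0} \<Longrightarrow> ipow P n \<noteq> {0}"
  by (induction n) (use O_nz in \<open>simp_all add: iprod_nz' idl_ipow\<close>)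

lemma ipow_add: "idl P \<Longrightarrow> ipow P (m + n) = iprod (ipow P m) (ipow P n)"
proof (induction n)
  case 0 thus ?case using iprod_O[OF idl_ipow] by (simp add: iprod_commute)
next
  case (Suc n) thus ?case by (simp add: iprod_assoc)
qed

lemma idl_idx:
  assumes A: "idl A" "A \<noteq> {0}" and B: "idl B" "A \<subseteq> B"
  shows "idx \<O> A = idx \<O> B * idx B A"
proof (rule idx_tower(2)[OF add_subgroup_O idl_add_subgroup[OF B(1)] idl_add_subgroup[OF A(1)] B(2) idl_sub[OF B(1)]])
  have "B \<noteq> {0}" using A B idl_0[OF A(1)] by blast
  thus "finite (cosets \<O> B)" by (rule finite_quotient_idl[OF B(1)])
  show "finite (cosets B A)" by (rule finite_cosets_subset[OF finite_quotient_idl[OF A] idl_sub[OF B(1)]])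
qed

lemma idx_O_pos: "idl A \<Longrightarrow> A \<noteq> {0} \<Longrightarrow> idx \<O> A > 0"
  by (rule idx_pos[OF finite_quotient_idl one])

lemma idx_prm_ge_2: "prm P \<Longrightarrow> idx \<O> P \<ge> 2"
proof -
  assume P: "prm P"
  hence iP: "idl P" "P \<noteq> {0}" by (auto simp: prm_def)
  have "1 \<notin> P" using P by (simp add: prm_def)
  hence "idx \<O> P \<noteq> 1"
    using idx_eq_1[OF add_subgroup_O idl_add_subgroup[OF iP(1)] finite_quotient_idl[OF iP]] one by blast
  thus ?thesis using idx_O_pos[OF iP] by linarith
qed

lemma factor_out_prm:
  assumes P: "prm P" and A: "idl A" "A \<noteq> {0}" "A \<subseteq> P"
  shows "\<exists>C. idl C \<and> C \<noteq> {0} \<and> A = iprod P C \<and> idx \<O> A = idx \<O> P * idx \<O> C \<and> idx \<O> C < idx \<O> A"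
proof -
  have iP: "idl P" "P \<noteq> {0}" using P by (auto simp: prm_def)
  obtain C where C: "idl C" "A = iprod P C" using contain_divides[OF A(1) iP A(3)] by blast
  have Cnz: "C \<noteq> {0}"
  proof
    assume "C = {0}"
    hence "A \<subseteq> {0}" unfolding C(2) by (intro iprod_subsetI) auto
    thus False using A idl_0 by blast
  qed
  have "A \<subseteq> C" unfolding C(2) by (rule iprod_sub[OF idl_sub[OF iP(1)] C(1)])
  hence "idx \<O> A = idx \<O> C * idx C A" by (rule idl_idx[OF A(1,2) C(1)])
  hence eq: "idx \<O> A = idx \<O> P * idx \<O> C" using idx_iprod_prm[OF P C(1) Cnz] C(2) by simp
  moreover have "idx \<O> C < idx \<O> A"
    unfolding eq using idx_prm_ge_2[OF P] idx_O_pos[OF C(1) Cnz] by simp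
  ultimately show ?thesis using C Cnz by blast
qed

lemma prm_decomposition:
  assumes P: "prm P" and A: "idl A" "A \<noteq> {0}"
  shows "\<exists>k B. idl B \<and> B \<noteq> {0} \<and> A = iprod (ipow P k) B \<and> \<not> B \<subseteq> P"
  using A
proof (induction "idx \<O> A" arbitrary: A rule: less_induct)
  case (less A)
  show ?case
  proof (cases "A \<subseteq> P")
    case False
    thus ?thesis using less.prems iprod_O by (intro exI[of _ 0] exI[of _ A]) simp
  next
    case True
    from factor_out_prm[OF P less.prems True] obtain C where
      C: "idl C" "C \<noteq> {0}" "A = iprod P C" "idx \<O> C < idx \<O> A" by blast
    obtain k B where "idl B" "B \<noteq> {0}" "C = iprod (ipow P k) B" "\<not> B \<subseteq> P" using less.hyps[OF C(4,1,2)] by blast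
    moreover from this have "A = iprod (ipow P (Suc k)) B"
      unfolding C(3) by (simp add: iprod_assoc iprod_left_commute iprod_commute)
    ultimately show ?thesis by blast
  qed
qed

text \<open>The exponent of P in A; that the greatest k exists for nonzero A is part of
  \<open>vp_eqI\<close> together with \<open>prm_decomposition\<close>.\<close>

definition vp :: "'a set \<Rightarrow> 'a set \<Rightarrow> nat" where
  "vp P A = (GREATEST k. A \<subseteq> ipow P k)"

lemma vp_eqI:
  assumes P: "prm P" and B: "idl B" "\<not> B \<subseteq> P" and A: "A = iprod (ipow P k) B"
  shows "vp P A = k" and "A \<subseteq> ipow P j \<longleftrightarrow> j \<le> k"
proof -
  have iP: "idl P" "P \<noteq> {0}" using P by (auto simp: prm_def)
  have iff: "A \<subseteq> ipow P j \<longleftrightarrow> j \<le> k" for j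
  proof
    assume "j \<le> k"
    then obtain l where "k = j + l" using le_Suc_ex by blast
    hence "A = iprod (iprod (ipow P l) B) (ipow P j)"
      unfolding A by (simp add: ipow_add[OF iP(1)] iprod_assoc iprod_commute iprod_left_commute)
    thus "A \<subseteq> ipow P j"
      using iprod_sub[OF idl_sub[OF idl_iprod[OF idl_ipow[OF iP(1)] B(1)]] idl_ipow[OF iP(1)]] by simp
  next
    assume sub: "A \<subseteq> ipow P j"
    show "j \<le> k"
    proof (rule ccontr)
      assume "\<not> j \<le> k"
      then obtain l where "j = k + Suc l" by (metis add_Suc_right less_imp_Suc_add not_le)
      hence "iprod (ipow P k) B \<subseteq> iprod (ipow P k) (ipow P (Suc l))"
        using sub unfolding A by (simp only: ipow_add[OF iP(1)])
      hence "B \<subseteq> ipow P (Suc l)"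
        by (rule iprod_cancel[OF idl_ipow[OF iP(1)] ipow_nz[OF iP] B(1) idl_ipow[OF iP(1)]])
      also have "\<dots> \<subseteq> P" using iprod_sub[OF idl_sub[OF idl_ipow[OF iP(1)]] iP(1)] by simp
      finally show False using B by blast
    qed
  qed
  thus "A \<subseteq> ipow P j \<longleftrightarrow> j \<le> k" .
  show "vp P A = k" unfolding vp_def iff by (rule Greatest_equality) auto
qed

lemma vp_subset_iff:
  assumes "prm P" "idl A" "A \<noteq> {0}"
  shows "A \<subseteq> ipow P j \<longleftrightarrow> j \<le> vp P A"
proof -
  obtain k B where "idl B" "A = iprod (ipow P k) B" "\<not> B \<subseteq> P" using prm_decomposition[OF assms] by blast
  thus ?thesis using vp_eqI[OF assms(1)] by metis
qed

lemma vp_iprod: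
  assumes P: "prm P" and A: "idl A" "A \<noteq> {0}" and B: "idl B" "B \<noteq> {0}"
  shows "vp P (iprod A B) = vp P A + vp P B"
proof -
  obtain k C where C: "idl C" "A = iprod (ipow P k) C" "\<not> C \<subseteq> P" using prm_decomposition[OF P A] by blast
  obtain l D where D: "idl D" "B = iprod (ipow P l) D" "\<not> D \<subseteq> P" using prm_decomposition[OF P B] by blast
  have "\<not> iprod C D \<subseteq> P"
  proof
    assume sub: "iprod C D \<subseteq> P"
    obtain c d where cd: "c \<in> C" "c \<notin> P" "d \<in> D" "d \<notin> P" using C D by blast
    hence "c * d \<in> P" using sub iprod.mult by blast
    thus False using P cd idl_sub[OF C(1)] idl_sub[OF D(1)] unfolding prm_def by blast
  qed
  moreover have "iprod A B = iprod (ipow P (k + l)) (iprod C D)"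
    unfolding C(2) D(2) ipow_add[OF prm_idl[OF P]]
    by (simp add: iprod_assoc iprod_left_commute[of C])
  ultimately have "vp P (iprod A B) = k + l" using vp_eqI(1)[OF P idl_iprod[OF C(1) D(1)]] by blast
  moreover have "vp P A = k" "vp P B = l" using vp_eqI(1)[OF P] C D by blast+
  ultimately show ?thesis by simp
qed

lemma vp_0_iff: "prm P \<Longrightarrow> idl A \<Longrightarrow> A \<noteq> {0} \<Longrightarrow> vp P A = 0 \<longleftrightarrow> \<not> A \<subseteq> P"
  using vp_subset_iff[of P A 1] iprod_O[of P] by (auto simp: prm_def)

lemma vp_self:
  assumes "prm P" shows "vp P P = 1"
proof (rule vp_eqI(1)[OF assms idl_O])
  show "\<not> \<O> \<subseteq> P" using assms one unfolding prm_def by blast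
  show "P = iprod (ipow P 1) \<O>" using iprod_O[OF prm_idl[OF assms]] by (simp add: iprod_commute)
qed

lemma vp_other:
  assumes "prm P" "prm Q" "P \<noteq> Q" shows "vp Q P = 0"
proof -
  have "\<not> P \<subseteq> Q"
  proof
    assume "P \<subseteq> Q"
    hence "Q = \<O>" using prm_maximal[OF assms(1) prm_idl[OF assms(2)]] assms(3) by blast
    thus False using assms(2) by (auto simp: prm_def)
  qed
  thus ?thesis using vp_0_iff[OF assms(2) prm_idl[OF assms(1)]] assms(1) by (auto simp: prm_def)
qed

text \<open>Peel off one prime P at a time, which divides the index by \<open>idx \<O> P\<close>.
  The set T may contain further primes, which contribute exponent 0; this lets T stay fixed during
  the induction.\<close>

theorem idx_prime_factorization:
  assumes "idl A" "A \<noteq> {0}" "finite T" "\<And>P. prm P \<Longrightarrow> A \<subseteq> P \<Longrightarrow> P \<in> T" "\<And>P. P \<in> T \<Longrightarrow> prm P"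
  shows "idx \<O> A = (\<Prod>P\<in>T. idx \<O> P ^ vp P A)"
  using assms
proof (induction "idx \<O> A" arbitrary: A rule: less_induct)
  case (less A)
  show ?case
  proof (cases "1 \<in> A")
    case True
    hence A: "A = \<O>" using idl_eq_O less.prems by blast
    have "vp P A = 0" if PT: "P \<in> T" for P
    proof -
      have "1 \<notin> P" using less.prems(5)[OF PT] by (simp add: prm_def)
      hence "\<not> A \<subseteq> P" using True by blast
      thus ?thesis using vp_0_iff[OF less.prems(5)[OF PT] less.prems(1,2)] by blast
    qed
    thus ?thesis using idx_self[OF add_subgroup_O] A by simp
  next
    case False
    then obtain P where P: "prm P" "A \<subseteq> P" using prime_above less.prems by blast
    have PT: "P \<in> T" using P less.prems by blast
    obtain C where C: "idl C" "C \<noteq> {0}" "A = iprod P C" "idx \<O> A = idx \<O> P * idx \<O> C" "idx \<O> C < idx \<O> A"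
      using factor_out_prm[OF P(1) less.prems(1,2) P(2)] by blast
    have AC: "A \<subseteq> C" unfolding C(3) by (rule iprod_sub[OF idl_sub[OF prm_idl[OF P(1)]] C(1)])
    have IH: "idx \<O> C = (\<Prod>P\<in>T. idx \<O> P ^ vp P C)"
    proof (rule less.hyps[OF C(5,1,2) less.prems(3)])
      fix P assume "prm P" "C \<subseteq> P"
      with AC show "P \<in> T" by (intro less.prems(4)) blast+
    qed (rule less.prems(5))
    have "(\<Prod>Q\<in>T. idx \<O> Q ^ vp Q A) = (\<Prod>Q\<in>T. (if Q = P then idx \<O> P else 1) * idx \<O> Q ^ vp Q C)"
    proof (rule prod.cong[OF refl])
      fix Q assume Q: "Q \<in> T"
      have "vp Q A = vp Q P + vp Q C"
        unfolding C(3) using P(1) by (intro vp_iprod[OF less.prems(5)[OF Q] _ _ C(1,2)]) (auto simp: prm_def)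
      moreover have "vp Q P = (if Q = P then 1 else 0)"
        using vp_self[OF P(1)] vp_other[OF P(1) less.prems(5)[OF Q]] by auto
      ultimately show "idx \<O> Q ^ vp Q A = (if Q = P then idx \<O> P else 1) * idx \<O> Q ^ vp Q C" by simp
    qed
    also have "\<dots> = idx \<O> P * idx \<O> C"
    proof -
      have "(\<Prod>Q\<in>T. if Q = P then idx \<O> P else 1) = idx \<O> P"
        using PT less.prems(3) by (simp only: prod.delta if_True)
      thus ?thesis unfolding prod.distrib IH by (simp only:)
    qed
    finally show ?thesis using C(4) by simp
  qed
qed

end

section \<open>Number fields as subsets of the ambient field\<close>

lemma ambient_simps [simp]:
  "carrier (ambient :: 'a::field_char_0 ring) = UNIV"
  "monoid.mult (ambient :: 'a::field_char_0 ring) = (*)"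
  "ring.add (ambient :: 'a::field_char_0 ring) = (+)"
  "monoid.one (ambient :: 'a::field_char_0 ring) = 1"
  "ring.zero (ambient :: 'a::field_char_0 ring) = 0"
  by (simp_all add: ring_of_type_algebra_def fun_eq_iff)

lemma field_ambient: "field (ambient :: 'a::field_char_0 ring)" by (rule field_from_type_algebra)

lemma ring_ambient: "ring (ambient :: 'a::field_char_0 ring)" by (rule ring_from_type_algebra)

lemma ambient_a_inv [simp]: "\<ominus>\<^bsub>(ambient :: 'a::field_char_0 ring)\<^esub> x = - x"
proof -
  interpret field "ambient :: 'a ring" by (rule field_ambient)
  show ?thesis by (rule minus_equality) simp_all
qed

lemma ambient_m_inv [simp]: "x \<noteq> 0 \<Longrightarrow> inv\<^bsub>(ambient :: 'a::field_char_0 ring)\<^esub> x = inverse x"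
proof -
  assume "x \<noteq> 0"
  interpret field "ambient :: 'a ring" by (rule field_ambient)
  show ?thesis by (rule comm_inv_char) (simp_all add: \<open>x \<noteq> 0\<close>)
qed

lemma sfield_if_subfield:
  assumes "subfield L (ambient :: 'a::field_char_0 ring)"
  shows "sfield L"
proof -
  interpret field "ambient :: 'a ring" by (rule field_ambient)
  have sr: "subring L ambient" by (rule subfieldE(1)[OF assms])
  have inv': "inverse x \<in> L" if "x \<in> L" for x
  proof (cases "x = 0")
    case False
    hence "inv\<^bsub>ambient\<^esub> x \<in> L" using subfield_m_inv(1)[OF assms, of x] that by simp
    thus ?thesis using False by simp
  qed (use that in simp)
  show ?thesis
    using subringE[OF sr] inv' by unfold_locales auto
qed

lemma subfield_if_sfield:
  assumes "sfield (L :: 'a::field_char_0 set)"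
  shows "subfield L ambient"
proof -
  interpret field "ambient :: 'a ring" by (rule field_ambient)
  interpret s: sfield L by fact
  have "subring L ambient" by (rule subringI) (simp_all add: s.add s.mult s.minus)
  thus ?thesis by (rule subfieldI') (use s.inverse in auto)
qed

lemma generate_field_eq:
  assumes "sfield T" "H \<subseteq> T" "\<And>S. sfield S \<Longrightarrow> H \<subseteq> S \<Longrightarrow> T \<subseteq> S"
  shows "generate_field (ambient :: 'a::field_char_0 ring) H = T"
proof
  interpret field "ambient :: 'a ring" by (rule field_ambient)
  interpret s: sfield T by fact
  show "generate_field ambient H \<subseteq> T"
  proof
    fix x assume "x \<in> generate_field ambient H"
    thus "x \<in> T" by (induction rule: generate_field.induct) (use assms(2) in \<open>auto intro: s.add s.mult s.minus s.inverse\<close>)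
  qed
  show "T \<subseteq> generate_field ambient H"
    by (rule assms(3)[OF sfield_if_subfield[OF generate_field_is_subfield]]) (auto intro: generate_field.incl)
qed

section \<open>Finite dimension over the rationals and algebraicity\<close>

lemma combine_ambient:
  "length Ks = length Us \<Longrightarrow> ring.combine (ambient :: 'a::field_char_0 ring) Ks Us = (\<Sum>i<length Us. Ks ! i * Us ! i)"
proof -
  interpret field "ambient :: 'a ring" by (rule field_ambient)
  show "length Ks = length Us \<Longrightarrow> combine Ks Us = (\<Sum>i<length Us. Ks ! i * Us ! i)"
  proof (induction Ks Us rule: list_induct2)
    case (Cons k Ks u Us)
    thus ?case by (simp add: sum.lessThan_Suc_shift del: sum.lessThan_Suc)
  qed simp
qed

text \<open>Finite dimension in the form of integer relations. The number n is uniform over all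
  families in L, which later bounds the length of lists independent modulo a prime.\<close>

lemma number_field_relation:
  assumes "number_field (L :: 'a::field_char_0 set)"
  shows "\<exists>n. \<forall>w. (\<forall>i\<le>n. w i \<in> L) \<longrightarrow> (\<exists>c::nat\<Rightarrow>int. (\<exists>i\<le>n. c i \<noteq> 0) \<and> (\<Sum>i\<le>n. of_int (c i) * w i) = 0)"
proof -
  note ra = ring_ambient[where 'a = 'a]
  have Q: "subfield \<rat> (ambient :: 'a ring)" by (rule subfield_if_sfield[OF sfield_Rats])
  obtain n where n: "ring.dimension ambient n \<rat> L"
    using assms by (auto simp: number_field_def ring.finite_dimension_def[OF ra])
  have "\<exists>c::nat\<Rightarrow>int. (\<exists>i\<le>n. c i \<noteq> 0) \<and> (\<Sum>i\<le>n. of_int (c i) * w i) = 0" if w: "\<forall>i\<le>n. w i \<in> L" for w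
  proof -
    define Us where "Us = map w [0..<Suc n]"
    have len: "length Us = Suc n" by (simp add: Us_def)
    have "set Us \<subseteq> L" using w by (auto simp: Us_def)
    hence dep: "\<not> ring.independent ambient \<rat> Us"
      using ring.independent_length_le_dimension[OF ra Q n, of Us] len by auto
    obtain Ks where Ks: "length Ks = length Us" "ring.combine ambient Ks Us = 0" "set Ks \<subseteq> \<rat>" "set Ks \<noteq> {0}"
      by (rule ring.dependent_imp_non_trivial_combine[OF ra Q _ dep]) simp_all
    define P where "P = (\<Sum>i\<le>n. monom (Ks ! i) i)"
    have cP: "coeff P i = (if i \<le> n then Ks ! i else 0)" for i
      by (simp add: P_def coeff_sum coeff_monom)
    have inQ: "Ks ! i \<in> \<rat>" if "i \<le> n" for i using Ks(1,3) len that nth_mem[of i Ks] by auto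
    hence "polyover \<rat> P" by (simp add: polyover_def cP)
    then obtain m G where mG: "m > (0::int)" "smult (of_int m) P = of_int_poly G" using clear_denominators by blast
    have cG: "of_int (coeff G i) = of_int m * Ks ! i" if "i \<le> n" for i
      using arg_cong[OF mG(2), of "\<lambda>p. coeff p i"] that by (simp add: cP)
    have "(\<Sum>i<length Us. Ks ! i * Us ! i) = 0" using combine_ambient[OF Ks(1)] Ks(2) by simp
    moreover have "{..<length Us} = {..n}" unfolding len by auto
    ultimately have s0: "(\<Sum>i\<le>n. Ks ! i * Us ! i) = 0" by simp
    have "(\<Sum>i\<le>n. of_int (coeff G i) * w i) = (\<Sum>i\<le>n. of_int m * (Ks ! i * Us ! i))"
    proof (rule sum.cong[OF refl])
      fix i assume "i \<in> {..n}"
      moreover from this have "Us ! i = w i" by (simp add: Us_def del: upt_Suc)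
      ultimately show "of_int (coeff G i) * w i = of_int m * (Ks ! i * Us ! i)" by (simp add: cG mult.assoc)
    qed
    hence "(\<Sum>i\<le>n. of_int (coeff G i) * w i) = 0" unfolding sum_distrib_left[symmetric] s0 by simp
    moreover have "\<exists>i\<le>n. coeff G i \<noteq> 0"
    proof -
      have "set Ks \<noteq> {}" using Ks(1) len by auto
      hence "\<not> set Ks \<subseteq> {0}" using Ks(4) subset_singletonD by metis
      then obtain k where "k \<in> set Ks" "k \<noteq> 0" by blast
      then obtain i where i: "i \<le> n" "Ks ! i \<noteq> 0" using Ks(1) len by (auto simp: in_set_conv_nth less_Suc_eq_le)
      hence "(of_int (coeff G i) :: 'a) \<noteq> 0" using cG[of i] mG(1) by simp
      thus ?thesis using i(1) by auto
    qed
    ultimately show ?thesis by blast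
  qed
  thus ?thesis by blast
qed

lemma algebraic_iff_multiple:
  "algebraic (x::'a::field_char_0) \<longleftrightarrow> (\<exists>m::int. m \<noteq> 0 \<and> algebraic_int (of_int m * x))"
proof
  assume x: "algebraic x"
  let ?F = "min_int_poly x"
  have "algebraic_int (lead_coeff (of_int_poly ?F) * x)"
    by (rule algebraic_int_lead_times_root[OF aipoly_of_int_poly min_int_poly_root[OF x] refl])
  thus "\<exists>m::int. m \<noteq> 0 \<and> algebraic_int (of_int m * x)"
    using min_int_poly_lead[OF x] by (intro exI[of _ "lead_coeff ?F"]) (simp add: of_int_hom.degree_map_poly_hom min_int_poly_nz[OF x])
next
  assume "\<exists>m::int. m \<noteq> 0 \<and> algebraic_int (of_int m * x)"
  then obtain m p where m: "m \<noteq> (0::int)" and p: "poly (of_int_poly p) (of_int m * x) = 0" "monic p"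
    unfolding algebraic_int_altdef_ipoly by blast
  have pnz: "p \<noteq> 0" using p(2) by auto
  define q where "q = pcompose p [:0, m:]"
  have "q \<noteq> 0" unfolding q_def using pnz m by (subst pcompose_eq_0_iff) auto
  moreover have "poly (of_int_poly q) x = 0"
    using p(1) by (simp add: q_def of_int_hom.map_poly_pcompose poly_pcompose of_int_hom.map_poly_pCons_hom mult.commute)
  ultimately show "algebraic x" by (intro algebraicI'[of "of_int_poly q"]) auto
qed

lemma number_field_algebraic:
  assumes L: "number_field (L :: 'a::field_char_0 set)" and y: "y \<in> L"
  shows "algebraic y"
proof -
  have sf: "sfield L" using L sfield_if_subfield by (auto simp: number_field_def)
  obtain n where n: "\<And>w. \<forall>i\<le>n. w i \<in> L \<Longrightarrow> \<exists>c::nat\<Rightarrow>int. (\<exists>i\<le>n. c i \<noteq> 0) \<and> (\<Sum>i\<le>n. of_int (c i) * w i) = 0"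
    using number_field_relation[OF L] by blast
  have "\<forall>i\<le>n. y ^ i \<in> L" using sring.power[OF sfield.axioms(1)[OF sf] y] by blast
  then obtain c :: "nat \<Rightarrow> int" where c: "\<exists>i\<le>n. c i \<noteq> 0" "(\<Sum>i\<le>n. of_int (c i) * y ^ i) = 0" using n by blast
  define p where "p = (\<Sum>i\<le>n. monom (c i) i)"
  have cp: "coeff p i = (if i \<le> n then c i else 0)" for i by (simp add: p_def coeff_sum coeff_monom)
  have pnz: "p \<noteq> 0" using c(1) cp by (metis coeff_0)
  have dp: "degree p \<le> n" by (rule degree_le) (simp add: cp)
  have "poly (of_int_poly p) y = (\<Sum>i\<le>degree p. of_int (coeff p i) * y ^ i)"
    by (simp add: poly_altdef of_int_hom.degree_map_poly_hom)
  also have "\<dots> = (\<Sum>i\<le>n. of_int (coeff p i) * y ^ i)"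
    by (rule sum.mono_neutral_left) (use dp in \<open>auto simp: coeff_eq_0\<close>)
  finally have "poly (of_int_poly p) y = 0" using c(2) by (simp add: cp)
  thus ?thesis using pnz by (intro algebraicI'[of "of_int_poly p"]) auto
qed

text \<open>One integer M scales all coefficients to algebraic integers. The new leading coefficient
  l makes l x integral, and dividing by the algebraic number l keeps x algebraic.\<close>

lemma algebraic_if_root_algebraic_coeffs:
  fixes p :: "'a::field_char_0 poly"
  assumes p: "p \<noteq> 0" "poly p x = 0" and alg: "\<And>i. algebraic (coeff p i)"
  shows "algebraic x"
proof -
  have "\<forall>i. \<exists>m::int. m \<noteq> 0 \<and> algebraic_int (of_int m * coeff p i)" using alg algebraic_iff_multiple by blast
  then obtain m :: "nat \<Rightarrow> int" where m: "\<And>i. m i \<noteq> 0" "\<And>i. algebraic_int (of_int (m i) * coeff p i)" by metis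
  define M where "M = (\<Prod>i\<le>degree p. m i)"
  have M0: "M \<noteq> 0" using m(1) by (simp add: M_def)
  have "algebraic_int (of_int M * coeff p i)" for i
  proof (cases "i \<le> degree p")
    case True
    hence "M = (\<Prod>j\<in>{..degree p} - {i}. m j) * m i" unfolding M_def by (subst prod.remove[of _ i]) auto
    hence "of_int M * coeff p i = of_int (\<Prod>j\<in>{..degree p} - {i}. m j) * (of_int (m i) * coeff p i)" by simp
    also have "algebraic_int \<dots>" by (intro algebraic_int_mult m algebraic_int_of_int)
    finally show ?thesis .
  qed (simp add: coeff_eq_0)
  hence ai: "aipoly (smult (of_int M) p)" by (simp add: aipoly_def)
  define l where "l = lead_coeff (smult (of_int M) p)"
  have lx: "algebraic_int (l * x)" by (rule algebraic_int_lead_times_root[OF ai _ l_def]) (simp add: p)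
  have l0: "l \<noteq> 0" using p M0 by (simp add: l_def)
  have "algebraic_int l" using ai by (simp add: aipoly_def l_def)
  hence "algebraic (inverse l)" using algebraic_inverse algebraic_int_imp_algebraic by blast
  then obtain k where k: "k \<noteq> (0::int)" "algebraic_int (of_int k * inverse l)" using algebraic_iff_multiple by blast
  have "of_int k * x = (of_int k * inverse l) * (l * x)" using l0 by simp
  hence "algebraic_int (of_int k * x)" using k(2) lx algebraic_int_mult by metis
  thus ?thesis using k(1) algebraic_iff_multiple by blast
qed

lemma algebraic_closure_algebraic:
  fixes K :: "'a::field_char_0 set"
  assumes K: "number_field K" and cl: "algebraic_closure (ambient :: 'a ring) K"
  shows "algebraic (x :: 'a)"
proof -
  note ra = ring_ambient[where 'a = 'a]
  have da: "domain (ambient :: 'a ring)" using field_ambient by (rule field.axioms)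
  have sfK: "subfield K ambient" using K by (simp add: number_field_def)
  obtain p where p: "p \<in> carrier (univ_poly ambient K)" "p \<noteq> []" "ring.eval ambient p x = 0"
    by (rule domain.algebraicE[OF da subfieldE(1)[OF sfK] _ algebraic_closure.algebraic_extension[OF cl]]) simp_all
  \<comment> \<open>Polynomials here are coefficient lists with the leading coefficient first, hence
    \<open>rev\<close>.\<close>
  have ev: "ring.eval ambient p x = poly (Poly (rev p)) x" for p
  proof (induction p)
    case (Cons a p)
    have "x [^]\<^bsub>ambient\<^esub> (n::nat) = x ^ n" for n by (induction n) (simp_all add: nat_pow_def)
    thus ?case using Cons by (simp add: ring.eval.simps[OF ra] Poly_append poly_monom mult.commute)
  qed (simp add: ring.eval.simps[OF ra])
  have pp: "polynomial\<^bsub>ambient\<^esub> K p" using p(1) by (simp add: univ_poly_def)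
  show ?thesis
  proof (rule algebraic_if_root_algebraic_coeffs)
    show "poly (Poly (rev p)) x = 0" using p(3) ev by simp
    show "Poly (rev p) \<noteq> 0"
    proof
      assume "Poly (rev p) = 0"
      then obtain n where "rev p = replicate n 0" by (auto simp: Poly_eq_0)
      hence "hd p = 0" using p(2) by (metis hd_in_set in_set_replicate set_rev)
      thus False using pp p(2) by (simp add: polynomial_def)
    qed
    fix i
    have "set p \<subseteq> K" using pp by (auto simp: polynomial_def)
    have "coeff (Poly (rev p)) i = 0 \<or> coeff (Poly (rev p)) i \<in> set p"
      using nth_mem[of i "rev p"] by (simp add: nth_default_def)
    moreover have "algebraic (0::'a)" by (intro algebraic_int_imp_algebraic) simp
    ultimately show "algebraic (coeff (Poly (rev p)) i)"
      using \<open>set p \<subseteq> K\<close> number_field_algebraic[OF K] by (metis subsetD)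
  qed
qed

section \<open>Rings of integers\<close>

definition ints :: "'a::field_char_0 set \<Rightarrow> 'a set" where
  "ints L = {x \<in> L. algebraic_int x}"

lemma sring_ints: "sring L \<Longrightarrow> sring (ints L)"
proof -
  assume "sring L"
  then interpret sring L .
  show ?thesis by unfold_locales (auto simp: ints_def add mult minus)
qed

text \<open>Kronecker's trick. In F = (T - x) Q the quotient Q has integral coefficients, and
  comparing coefficients shows that x Q has them too. A Bezout relation among the coefficients of
  the primitive F then reads 1 = s + t x, with s and t integer combinations of coefficients of
  Q.\<close>

lemma kronecker_invertible:
  assumes L: "sfield L" and x: "x \<in> L" "algebraic x"
  shows "\<exists>s t. s \<in> ints L \<and> t \<in> ints L \<and> s * x \<in> ints L \<and> t * x \<in> ints L \<and> s + t * x = 1"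
proof -
  interpret sfield L by fact
  let ?F = "min_int_poly x"
  have "\<exists>Q. polyover L Q \<and> of_int_poly ?F = [:- x, 1:] * Q"
  proof -
    have 1: "polyover L [:- x, 1:]" using x minus by (simp add: polyover_pCons)
    obtain q r where qr: "polyover L q" "of_int_poly ?F = [:- x, 1:] * q + r" "r = 0 \<or> degree r < degree [:- x, 1:]"
      using polyover_divmod[OF 1 _ polyover_of_int_poly[of ?F]] by auto
    have "degree r = 0" using qr(3) by auto
    then obtain c where c: "r = [:c:]" by (elim degree_eq_zeroE)
    have "poly r x = 0" using min_int_poly_root[OF x(2)] arg_cong[OF qr(2), of "\<lambda>p. poly p x"] by simp
    thus ?thesis using qr c by auto
  qed
  then obtain Q where Q: "polyover L Q" "of_int_poly ?F = [:- x, 1:] * Q" by blast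
  have "aipoly Q" by (rule aipoly_divide_linear[of x]) (simp only: Q(2)[symmetric] aipoly_of_int_poly)
  hence aiQ: "algebraic_int (coeff Q j)" for j by (simp add: aipoly_def)
  have cF: "of_int (coeff ?F j) = (case j of 0 \<Rightarrow> 0 | Suc k \<Rightarrow> coeff Q k) - x * coeff Q j" for j
    using arg_cong[OF Q(2), of "\<lambda>p. coeff p j"] by (simp add: coeff_pCons split: nat.splits)
  have aixQ: "algebraic_int (x * coeff Q j)" for j
  proof -
    have "x * coeff Q j = (case j of 0 \<Rightarrow> 0 | Suc k \<Rightarrow> coeff Q k) - of_int (coeff ?F j)" using cF[of j] by simp
    also have "algebraic_int \<dots>" using aiQ by (intro algebraic_int_diff algebraic_int_of_int) (simp split: nat.split)
    finally show ?thesis .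
  qed
  have QL: "coeff Q j \<in> L" for j using Q(1) by (simp add: polyover_def)
  obtain f where f: "(\<Sum>j\<le>degree ?F. f j * coeff ?F j) = 1" using primitive_bezout[OF min_int_poly_content[OF x(2)]] by blast
  \<comment> \<open>The coefficients of T Q, so that the j-th coefficient of F is
    \<open>q' j - x * coeff Q j\<close>.\<close>
  define q' where "q' j = (case j of 0 \<Rightarrow> 0 | Suc k \<Rightarrow> coeff Q k)" for j
  define s where "s = (\<Sum>j\<le>degree ?F. of_int (f j) * q' j)"
  define t where "t = - (\<Sum>j\<le>degree ?F. of_int (f j) * coeff Q j)"
  have q'L: "q' j \<in> L" "algebraic_int (q' j)" "algebraic_int (x * q' j)" for j
    using QL aiQ aixQ by (auto simp: q'_def split: nat.split)
  have "s + t * x = (\<Sum>j\<le>degree ?F. of_int (f j) * (q' j - x * coeff Q j))"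
    by (simp add: s_def t_def sum_distrib_left right_diff_distrib sum_subtractf mult_ac)
  also have "\<dots> = of_int (\<Sum>j\<le>degree ?F. f j * coeff ?F j)"
    unfolding of_int_sum of_int_mult cF q'_def ..
  finally have st: "s + t * x = 1" by (simp add: f)
  have "s \<in> L" "t \<in> L" unfolding s_def t_def by (intro sum mult minus of_int q'L QL)+
  moreover have "algebraic_int s" unfolding s_def by (intro algebraic_int_sum algebraic_int_mult algebraic_int_of_int q'L)
  moreover have "algebraic_int t" unfolding t_def
    by (intro algebraic_int_minus algebraic_int_sum algebraic_int_mult algebraic_int_of_int aiQ)
  moreover have "algebraic_int (s * x)"
  proof -
    have "s * x = (\<Sum>j\<le>degree ?F. of_int (f j) * (x * q' j))" by (simp add: s_def sum_distrib_left mult_ac)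
    also have "algebraic_int \<dots>" by (intro algebraic_int_sum algebraic_int_mult algebraic_int_of_int q'L)
    finally show ?thesis .
  qed
  moreover have "algebraic_int (t * x)"
  proof -
    have "t * x = - (\<Sum>j\<le>degree ?F. of_int (f j) * (x * coeff Q j))" by (simp add: t_def sum_distrib_left mult_ac)
    also have "algebraic_int \<dots>" by (intro algebraic_int_minus algebraic_int_sum algebraic_int_mult algebraic_int_of_int aixQ)
    finally show ?thesis .
  qed
  ultimately show ?thesis using st x by (auto simp: ints_def intro: mult)
qed

lemma divides_integer:
  assumes L: "sfield L" and u: "u \<in> L" "algebraic u" "u \<noteq> 0"
  shows "\<exists>N y. N > (0::int) \<and> y \<in> ints L \<and> u * y = of_int N"
proof -
  interpret sfield L by fact
  have "algebraic (inverse u)" using u algebraic_inverse by blast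
  then obtain m where m: "m \<noteq> (0::int)" "algebraic_int (of_int m * inverse u)" using algebraic_iff_multiple by blast
  have "algebraic_int (of_int \<bar>m\<bar> * inverse u)" using m(2) by (cases "m \<ge> 0") auto
  moreover have "of_int \<bar>m\<bar> * inverse u \<in> L" using u by (intro mult inverse) auto
  ultimately show ?thesis using m(1) u(3)
    by (intro exI[of _ "\<bar>m\<bar>"] exI[of _ "of_int \<bar>m\<bar> * inverse u"]) (auto simp: ints_def field_simps)
qed

text \<open>An integral basis is avoided by taking a longest list of integers of L that is
  independent modulo p. Lengths are bounded, because an integer relation between n + 1 elements can
  be made primitive and is then nontrivial modulo p. By maximality every element is congruent modulo
  p to a combination of the list with coefficients in {0..<p}.\<close>

lemma finite_quotient_prime:
  fixes L :: "'a::field_char_0 set" and p :: int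
  assumes L: "number_field L" and p: "Factorial_Ring.prime p"
  shows "finite (cosets (ints L) ((*) (of_int p) ` ints L))"
proof -
  have sf: "sfield L" using L sfield_if_subfield by (auto simp: number_field_def)
  interpret sfield L by (rule sf)
  interpret I: sring "ints L" by (rule sring_ints) (rule sring_axioms)
  let ?O = "ints L" and ?pO = "(*) (of_int p) ` ints L"
  have gp: "add_subgroup ?pO"
    unfolding add_subgroup_def
  proof (intro conjI ballI)
    show "0 \<in> ?pO" by (rule image_eqI[of _ _ 0]) simp_all
    fix x assume "x \<in> ?pO"
    then obtain a where a: "a \<in> ?O" "x = of_int p * a" by blast
    show "- x \<in> ?pO" by (rule image_eqI[of _ _ "- a"]) (simp_all add: a I.minus)
    fix y assume "y \<in> ?pO"
    then obtain b where b: "b \<in> ?O" "y = of_int p * b" by blast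
    show "x + y \<in> ?pO" by (rule image_eqI[of _ _ "a + b"]) (simp_all add: a b I.add distrib_left)
  qed
  have scale: "of_int k * x \<in> ?pO" if "x \<in> ?pO" for k x
  proof -
    from that obtain a where "a \<in> ?O" "x = of_int p * a" by blast
    thus ?thesis by (intro image_eqI[of _ _ "of_int k * a"]) (simp_all add: I.mult)
  qed
  define ind where "ind ws \<longleftrightarrow> set ws \<subseteq> ?O \<and> (\<forall>c::nat\<Rightarrow>int. (\<Sum>i<length ws. of_int (c i) * ws ! i) \<in> ?pO \<longrightarrow> (\<forall>i<length ws. p dvd c i))" for ws
  obtain n where n: "\<And>w. \<forall>i\<le>n. w i \<in> L \<Longrightarrow> \<exists>c::nat\<Rightarrow>int. (\<exists>i\<le>n. c i \<noteq> 0) \<and> (\<Sum>i\<le>n. of_int (c i) * w i) = 0"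
    using number_field_relation[OF L] by blast
  have bound: "length ws \<le> n" if ws: "ind ws" for ws
  proof (rule ccontr)
    assume "\<not> length ws \<le> n"
    hence len: "n < length ws" by simp
    have "\<forall>i\<le>n. ws ! i \<in> L" using ws len by (auto simp: ind_def ints_def subset_iff)
    then obtain c :: "nat \<Rightarrow> int" where c: "\<exists>i\<le>n. c i \<noteq> 0" "(\<Sum>i\<le>n. of_int (c i) * ws ! i) = 0" using n by blast
    define P where "P = (\<Sum>i\<le>n. monom (c i) i)"
    have cP: "coeff P i = (if i \<le> n then c i else 0)" for i by (simp add: P_def coeff_sum coeff_monom)
    have Pnz: "P \<noteq> 0" using c(1) cP by (metis coeff_0)
    \<comment> \<open>Dividing by the content leaves a relation, since the ambient field has
      characteristic 0, and now p cannot divide all coefficients.\<close>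
    define c' where "c' = coeff (primitive_part P)"
    have cc: "coeff P i = content P * c' i" for i
      unfolding c'_def by (metis coeff_smult content_times_primitive_part)
    have c'0: "c' i = 0" if "i > n" for i using cc[of i] that Pnz by (simp add: cP)
    have "of_int (content P) * (\<Sum>i\<le>n. of_int (c' i) * ws ! i) = (\<Sum>i\<le>n. of_int (content P * c' i) * ws ! i)"
      by (simp add: sum_distrib_left mult.assoc)
    also have "\<dots> = 0" using c(2) by (simp add: cc[symmetric] cP)
    finally have "(\<Sum>i\<le>n. of_int (c' i) * ws ! i) = 0" using Pnz by simp
    moreover have "(\<Sum>i<length ws. of_int (c' i) * ws ! i) = (\<Sum>i\<le>n. of_int (c' i) * ws ! i)"
      by (rule sum.mono_neutral_right) (use len c'0 in auto)
    ultimately have "(\<Sum>i<length ws. of_int (c' i) * ws ! i) \<in> ?pO" using gp by (simp add: add_subgroup_def)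
    hence "p dvd c' i" for i using ws len c'0[of i] unfolding ind_def by (cases "i < length ws") auto
    hence "[:p:] dvd primitive_part P" unfolding c'_def by (simp add: const_poly_dvd_iff)
    hence "p dvd content (primitive_part P)" by (simp add: const_poly_dvd_iff_dvd_content)
    hence "p dvd 1" using Pnz by simp
    thus False using p not_prime_unit by blast
  qed
  have "ind []" by (simp add: ind_def)
  hence "\<exists>ws. ind ws \<and> (\<forall>vs. ind vs \<longrightarrow> length vs \<le> length ws)"
    using ex_has_greatest_nat[of ind "[]" length "Suc n"] bound by (auto simp: less_Suc_eq_le)
  then obtain ws where ws: "ind ws" "\<And>vs. ind vs \<Longrightarrow> length vs \<le> length ws" by blast
  define F where "F = {xs. set xs \<subseteq> {0..<p} \<and> length xs = length ws}"
  have finF: "finite F" unfolding F_def by (rule finite_lists_length_eq) simp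
  have "cosets ?O ?pO \<subseteq> (\<lambda>xs. (+) (\<Sum>i<length ws. of_int (xs ! i) * ws ! i) ` ?pO) ` F"
  proof
    fix e assume "e \<in> cosets ?O ?pO"
    then obtain y where y: "y \<in> ?O" "e = (+) y ` ?pO" by (auto simp: cosets_def)
    have "\<not> ind (ws @ [y])" using ws(2)[of "ws @ [y]"] by auto
    moreover have "set (ws @ [y]) \<subseteq> ?O" using ws(1) y by (auto simp: ind_def)
    ultimately obtain c :: "nat \<Rightarrow> int" where c: "(\<Sum>i<length (ws @ [y]). of_int (c i) * (ws @ [y]) ! i) \<in> ?pO"
        "\<exists>i<length (ws @ [y]). \<not> p dvd c i" unfolding ind_def by blast
    define S where "S = (\<Sum>i<length ws. of_int (c i) * ws ! i)"
    define k where "k = c (length ws)"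
    have "(\<Sum>i<length ws. of_int (c i) * (ws @ [y]) ! i) = S"
      unfolding S_def by (rule sum.cong) (auto simp: nth_append)
    hence Sk: "S + of_int k * y \<in> ?pO" using c(1) by (simp add: k_def)
    have pk: "\<not> p dvd k"
    proof
      assume "p dvd k"
      then obtain l where "k = p * l" by (elim dvdE)
      hence "of_int k * y \<in> ?pO" using y by (intro image_eqI[of _ _ "of_int l * y"]) (simp_all add: I.mult)
      hence "S + of_int k * y - of_int k * y \<in> ?pO" by (rule add_subgroup_diff[OF gp Sk])
      hence "S \<in> ?pO" by simp
      hence "\<forall>i<length ws. p dvd c i" using ws(1) unfolding ind_def S_def by blast
      thus False using c(2) \<open>p dvd k\<close> by (auto simp: k_def less_Suc_eq)
    qed
    hence "coprime k p" using p by (metis coprime_commute prime_imp_coprime)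
    then obtain u v where uv: "u * k + v * p = 1" using bezout_int[of k p] by auto
    \<comment> \<open>u inverts k modulo p, which solves the relation for y.\<close>
    define xs where "xs = map (\<lambda>i. (- u * c i) mod p) [0..<length ws]"
    have p0: "p > 0" using p by (simp add: prime_gt_0_int)
    have "xs \<in> F" unfolding F_def xs_def using p0 by auto
    moreover have "y - (\<Sum>i<length ws. of_int (xs ! i) * ws ! i) \<in> ?pO"
    proof -
      have xsi: "of_int (xs ! i) = (- of_int u * of_int (c i) - of_int p * of_int ((- u * c i) div p) :: 'a)" if "i < length ws" for i
      proof -
        have "xs ! i = - u * c i - p * ((- u * c i) div p)" using that by (simp add: xs_def minus_mult_div_eq_mod)
        thus ?thesis by simp
      qed
      have "(\<Sum>i<length ws. of_int (xs ! i) * ws ! i) =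
          (\<Sum>i<length ws. - of_int u * (of_int (c i) * ws ! i) - of_int p * (of_int ((- u * c i) div p) * ws ! i))"
        by (rule sum.cong[OF refl]) (simp add: xsi algebra_simps)
      also have "\<dots> = - of_int u * S - of_int p * (\<Sum>i<length ws. of_int ((- u * c i) div p) * ws ! i)"
        by (simp only: sum_subtractf sum_distrib_left S_def)
      finally have eq: "y - (\<Sum>i<length ws. of_int (xs ! i) * ws ! i) =
          of_int u * (S + of_int k * y) + of_int p * (of_int v * y + (\<Sum>i<length ws. of_int ((- u * c i) div p) * ws ! i))"
        using arg_cong[OF uv, of "\<lambda>z. of_int z * y"] by (simp add: algebra_simps)
      have "(\<Sum>i<length ws. of_int ((- u * c i) div p) * ws ! i) \<in> ?O"
        using ws(1) by (intro I.sum I.mult I.of_int) (auto simp: ind_def subset_iff)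
      hence "of_int p * (of_int v * y + (\<Sum>i<length ws. of_int ((- u * c i) div p) * ws ! i)) \<in> ?pO"
        using y by (intro imageI I.add I.mult I.of_int)
      thus ?thesis unfolding eq using scale[OF Sk, of u] gp unfolding add_subgroup_def by blast
    qed
    hence "e = (+) (\<Sum>i<length ws. of_int (xs ! i) * ws ! i) ` ?pO" unfolding y(2) by (simp only: coset_eq_iff[OF gp])
    ultimately show "e \<in> (\<lambda>xs. (+) (\<Sum>i<length ws. of_int (xs ! i) * ws ! i) ` ?pO) ` F" by blast
  qed
  thus ?thesis using finF finite_surj by blast
qed

lemma add_subgroup_sring: "sring S \<Longrightarrow> add_subgroup S"
  by (simp add: add_subgroup_def sring.add sring.minus sring.zero)

lemma add_subgroup_scale: "add_subgroup B \<Longrightarrow> add_subgroup ((*) t ` B)"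
  unfolding add_subgroup_def
proof (intro conjI ballI)
  assume B: "0 \<in> B \<and> (\<forall>x\<in>B. \<forall>y\<in>B. x + y \<in> B) \<and> (\<forall>x\<in>B. - x \<in> B)"
  show "0 \<in> (*) t ` B" by (rule image_eqI[of _ _ 0]) (use B in simp_all)
  fix x assume "x \<in> (*) t ` B"
  then obtain a where a: "a \<in> B" "x = t * a" by blast
  show "- x \<in> (*) t ` B" by (rule image_eqI[of _ _ "- a"]) (use a B in simp_all)
  fix y assume "y \<in> (*) t ` B"
  then obtain b where b: "b \<in> B" "y = t * b" by blast
  show "x + y \<in> (*) t ` B" by (rule image_eqI[of _ _ "a + b"]) (use a b B in \<open>simp_all add: distrib_left\<close>)
qed

lemma finite_quotient_int:
  fixes L :: "'a::field_char_0 set" and N :: nat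
  assumes L: "number_field L" and N: "N > 0"
  shows "finite (cosets (ints L) ((*) (of_nat N) ` ints L))"
  using N
proof (induction N rule: less_induct)
  case (less N)
  have sf: "sfield L" using L sfield_if_subfield by (auto simp: number_field_def)
  interpret I: sring "ints L" by (rule sring_ints) (rule sfield.axioms(1)[OF sf])
  have g: "add_subgroup (ints L)" by (rule add_subgroup_sring[OF I.sring_axioms])
  show ?case
  proof (cases "N = 1")
    case True
    have "finite (cosets (ints L) (ints L))" by (simp add: cosets_self[OF g])
    thus ?thesis using True by simp
  next
    case False
    then obtain p where p: "Factorial_Ring.prime p" "p dvd N" using prime_factor_nat by blast
    then obtain M where M: "N = p * M" by (elim dvdE)
    have pM: "M > 0" "M < N" using M less.prems prime_gt_1_nat[OF p(1)] by auto
    have 1: "finite (cosets (ints L) ((*) (of_nat p) ` ints L))"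
      using finite_quotient_prime[OF L, of "int p"] p(1) by simp
    have "finite (cosets ((*) (of_nat p) ` ints L) ((*) (of_nat p) ` (*) (of_nat M) ` ints L))"
      using less.IH[OF pM(2,1)] idx_scale(2)[of "of_nat p" "(*) (of_nat M) ` ints L" "ints L"]
        add_subgroup_scale[OF g, of "of_nat M"] prime_gt_0_nat[OF p(1)] by simp
    moreover have eq: "(*) (of_nat p) ` (*) (of_nat M) ` ints L = (*) (of_nat N) ` ints L"
      by (simp add: image_image M mult.assoc)
    ultimately have 2: "finite (cosets ((*) (of_nat p) ` ints L) ((*) (of_nat N) ` ints L))" by simp
    have s1: "(*) (of_nat p) ` ints L \<subseteq> ints L" by (auto intro: I.mult)
    have s2: "(*) (of_nat N) ` ints L \<subseteq> (*) (of_nat p) ` ints L"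
      unfolding eq[symmetric] by (intro image_mono) (auto intro: I.mult)
    show ?thesis
      by (rule idx_tower(1)[OF g add_subgroup_scale[OF g] add_subgroup_scale[OF g] s2 s1 1 2])
  qed
qed

lemma int_ring_ints:
  assumes L: "number_field (L :: 'a::field_char_0 set)"
  shows "int_ring (ints L)"
proof -
  have sf: "sfield L" using L sfield_if_subfield by (auto simp: number_field_def)
  interpret sfield L by (rule sf)
  interpret I: sring "ints L" by (rule sring_ints) (rule sring_axioms)
  have sub: "x \<in> L" if "x \<in> ints L" for x using that by (simp add: ints_def)
  show ?thesis
  proof
    fix a b assume "a \<in> ints L" "b \<in> ints L" "b \<noteq> 0"
    hence "a / b \<in> L" using sub divide by blast
    thus "\<exists>s t. s \<in> ints L \<and> t \<in> ints L \<and> s * (a / b) \<in> ints L \<and> t * (a / b) \<in> ints L \<and> s + t * (a / b) = 1"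
      using kronecker_invertible[OF sf] number_field_algebraic[OF L] by blast
  next
    fix b assume b: "b \<in> ints L" "b \<noteq> 0"
    obtain N y where N: "N > (0::int)" "y \<in> ints L" "b * y = of_int N"
      using divides_integer[OF sf sub[OF b(1)] number_field_algebraic[OF L sub[OF b(1)]] b(2)] by blast
    have g: "add_subgroup (ints L)" by (rule add_subgroup_sring[OF I.sring_axioms])
    have "(*) (of_nat (nat N)) ` ints L \<subseteq> (*) b ` ints L"
    proof
      fix z assume "z \<in> (*) (of_nat (nat N)) ` ints L"
      then obtain w where "w \<in> ints L" "z = of_int N * w" using N(1) by (auto simp: of_nat_nat)
      hence "z = b * (y * w)" "y * w \<in> ints L" using N by (simp_all add: mult.assoc[symmetric] I.mult)
      thus "z \<in> (*) b ` ints L" by blast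
    qed
    thus "finite (cosets (ints L) ((*) b ` ints L))"
      by (rule finite_cosets_mono[OF add_subgroup_scale[OF g] add_subgroup_scale[OF g]])
         (use finite_quotient_int[OF L, of "nat N"] N in simp)
  qed
qed

section \<open>The index of the denominator ideal\<close>

text \<open>Extracts the rate of exponential growth from an inequality that holds up to constants;
  \<open>idx_denominator\<close> compares two indices in this way.\<close>

lemma dominated_powers_le:
  fixes u v :: nat
  assumes "\<And>k. k \<ge> k0 \<Longrightarrow> u ^ k * b \<le> C * v ^ k" "b > 0" "v > 0"
  shows "u \<le> v"
proof (rule ccontr)
  assume n: "\<not> u \<le> v"
  hence "1 < real u / real v" using assms(3) by simp
  then obtain k1 where k1: "real C / real b < (real u / real v) ^ k1" using real_arch_pow by blast
  define k where "k = max k0 k1"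
  have "(real u / real v) ^ k1 \<le> (real u / real v) ^ k"
    using n assms(3) by (intro power_increasing) (auto simp: k_def field_simps)
  hence "real C / real b < (real u / real v) ^ k" using k1 by linarith
  hence "real C * real v ^ k < real u ^ k * real b" using assms(2,3) by (simp add: power_divide field_simps)
  hence "real (C * v ^ k) < real (u ^ k * b)" by simp
  hence "C * v ^ k < u ^ k * b" by (simp only: of_nat_less_iff)
  thus False using assms(1)[of k] by (simp add: k_def)
qed

lemma idx_Ints_multiple:
  assumes "a > (0::int)"
  shows "idx (\<int> :: 'a::field_char_0 set) ((*) (of_int a) ` \<int>) = nat a"
    and "finite (cosets (\<int> :: 'a::field_char_0 set) ((*) (of_int a) ` \<int>))"
proof -
  have "sring (\<int> :: 'a set)" by unfold_locales auto
  hence g: "add_subgroup ((*) (of_int a) ` \<int> :: 'a set)" by (intro add_subgroup_scale add_subgroup_sring)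
  have mem: "(of_int m :: 'a) \<in> (*) (of_int a) ` \<int> \<longleftrightarrow> a dvd m" for m
  proof
    assume "(of_int m :: 'a) \<in> (*) (of_int a) ` \<int>"
    then obtain l where "(of_int m :: 'a) = of_int a * of_int l" by (auto elim!: Ints_cases)
    hence "(of_int m :: 'a) = of_int (a * l)" by simp
    hence "m = a * l" by (simp only: of_int_eq_iff)
    thus "a dvd m" by simp
  next
    assume "a dvd m"
    then obtain l where "m = a * l" by (elim dvdE)
    thus "(of_int m :: 'a) \<in> (*) (of_int a) ` \<int>" by (intro image_eqI[of _ _ "of_int l"]) simp_all
  qed
  have eq: "(+) (of_int i :: 'a) ` ((*) (of_int a) ` \<int>) = (+) (of_int j) ` ((*) (of_int a) ` \<int>) \<longleftrightarrow> a dvd i - j" for i j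
    unfolding coset_eq_iff[OF g] using mem[of "i - j"] by simp
  have "bij_betw (\<lambda>i. (+) (of_int i :: 'a) ` ((*) (of_int a) ` \<int>)) {0..<a} (cosets \<int> ((*) (of_int a) ` \<int>))"
    unfolding bij_betw_def
  proof
    show "inj_on (\<lambda>i. (+) (of_int i :: 'a) ` ((*) (of_int a) ` \<int>)) {0..<a}"
    proof (rule inj_onI)
      fix i j assume ij: "i \<in> {0..<a}" "j \<in> {0..<a}"
        "(+) (of_int i :: 'a) ` ((*) (of_int a) ` \<int>) = (+) (of_int j) ` ((*) (of_int a) ` \<int>)"
      hence "a dvd i - j" using eq by blast
      moreover have "\<bar>i - j\<bar> < a" using ij by auto
      ultimately show "i = j" by (metis dvd_imp_le_int abs_of_pos assms eq_iff_diff_eq_0 not_le)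
    qed
    show "(\<lambda>i. (+) (of_int i :: 'a) ` ((*) (of_int a) ` \<int>)) ` {0..<a} = cosets \<int> ((*) (of_int a) ` \<int>)"
    proof
      show "cosets (\<int> :: 'a set) ((*) (of_int a) ` \<int>) \<subseteq> (\<lambda>i. (+) (of_int i :: 'a) ` ((*) (of_int a) ` \<int>)) ` {0..<a}"
      proof
        fix e assume "e \<in> cosets (\<int> :: 'a set) ((*) (of_int a) ` \<int>)"
        then obtain m where m: "e = (+) (of_int m) ` ((*) (of_int a) ` \<int>)" by (auto simp: cosets_def elim!: Ints_cases)
        have "a dvd m - m mod a" by (simp add: minus_mod_eq_mult_div)
        hence "e = (+) (of_int (m mod a)) ` ((*) (of_int a) ` \<int>)" unfolding m using eq by blast
        moreover have "m mod a \<in> {0..<a}" using assms by simp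
        ultimately show "e \<in> (\<lambda>i. (+) (of_int i :: 'a) ` ((*) (of_int a) ` \<int>)) ` {0..<a}" by blast
      qed
    qed (auto simp: cosets_def)
  qed
  thus "idx (\<int> :: 'a set) ((*) (of_int a) ` \<int>) = nat a" "finite (cosets (\<int> :: 'a set) ((*) (of_int a) ` \<int>))"
    using bij_betw_same_card[of _ "{0..<a}"] bij_betw_finite[of _ "{0..<a}"] unfolding idx_def by fastforce+
qed

lemma min_int_poly_pderiv:
  assumes "algebraic (x::'a::field_char_0)"
  shows "poly (pderiv (of_int_poly (min_int_poly x))) x \<noteq> 0"
proof
  let ?F = "min_int_poly x"
  assume "poly (pderiv (of_int_poly ?F)) x = 0"
  hence "poly (of_int_poly (pderiv ?F)) x = 0" by (simp add: of_int_hom.map_poly_pderiv)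
  hence "?F dvd pderiv ?F" by (rule min_int_poly_dvd[OF assms])
  moreover have "pderiv ?F \<noteq> 0" using min_int_poly_degree[OF assms] by (simp add: pderiv_eq_0_iff)
  ultimately have "degree ?F \<le> degree (pderiv ?F)" by (intro dvd_imp_degree_le)
  thus False using min_int_poly_degree[OF assms] by (simp add: degree_pderiv)
qed

lemma algebraic_int_sum_mset:
  "(\<And>r. r \<in># N \<Longrightarrow> algebraic_int (f r)) \<Longrightarrow> algebraic_int (\<Sum>r\<in>#N. f r :: 'a::field_char_0)"
proof (induction N)
  case (add r N)
  have "algebraic_int (f r + (\<Sum>r\<in>#N. f r))" using add by (intro algebraic_int_add) simp_all
  thus ?case by simp
qed simp

text \<open>The groups Z + Z x + ... + Z x^k and, below, R + R x + ... + R x^k. Their growth in k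
  detects the leading coefficient of the minimal polynomial of x and, for the integers R, the index
  of the denominator ideal of x.\<close>

definition int_span :: "'a::field_char_0 \<Rightarrow> nat \<Rightarrow> 'a set" where
  "int_span x k = (\<lambda>p. poly (of_int_poly p) x) ` {p::int poly. degree p \<le> k}"

definition ring_span :: "'a::field_char_0 set \<Rightarrow> 'a \<Rightarrow> nat \<Rightarrow> 'a set" where
  "ring_span R x k = (\<lambda>p. poly p x) ` {p. polyover R p \<and> degree p \<le> k}"

lemma add_subgroup_int_span: "add_subgroup (int_span x k)"
  unfolding add_subgroup_def
proof (intro conjI ballI)
  show "0 \<in> int_span x k" unfolding int_span_def by (rule image_eqI[of _ _ 0]) simp_all
  fix y assume "y \<in> int_span x k"
  then obtain p where p: "degree p \<le> k" "y = poly (of_int_poly p) x" by (auto simp: int_span_def)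
  show "- y \<in> int_span x k" unfolding int_span_def by (rule image_eqI[of _ _ "- p"]) (simp_all add: p hom_distribs)
  fix z assume "z \<in> int_span x k"
  then obtain q where q: "degree q \<le> k" "z = poly (of_int_poly q) x" by (auto simp: int_span_def)
  show "y + z \<in> int_span x k" unfolding int_span_def
    by (rule image_eqI[of _ _ "p + q"]) (simp_all add: p q hom_distribs degree_add_le)
qed

lemma int_span_mono: "j \<le> k \<Longrightarrow> int_span x j \<subseteq> int_span x k"
  unfolding int_span_def by (intro image_mono) auto

lemma add_subgroup_ring_span: "sring R \<Longrightarrow> add_subgroup (ring_span R x k)"
  unfolding add_subgroup_def
proof (intro conjI ballI)
  assume "sring R"
  then interpret sring R .
  show "0 \<in> ring_span R x k" unfolding ring_span_def by (rule image_eqI[of _ _ 0]) simp_all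
  fix y assume "y \<in> ring_span R x k"
  then obtain p where p: "polyover R p" "degree p \<le> k" "y = poly p x" by (auto simp: ring_span_def)
  show "- y \<in> ring_span R x k" unfolding ring_span_def
    by (rule image_eqI[of _ _ "- p"]) (simp_all add: p polyover_minus)
  fix z assume "z \<in> ring_span R x k"
  then obtain q where q: "polyover R q" "degree q \<le> k" "z = poly q x" by (auto simp: ring_span_def)
  show "y + z \<in> ring_span R x k" unfolding ring_span_def
    by (rule image_eqI[of _ _ "p + q"]) (simp_all add: p q polyover_add degree_add_le)
qed

lemma ring_span_mono: "j \<le> k \<Longrightarrow> ring_span R x j \<subseteq> ring_span R x k"
  unfolding ring_span_def by (intro image_mono) auto

lemma int_span_subset_ring_span: "sring R \<Longrightarrow> int_span x k \<subseteq> ring_span R x k"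
  unfolding int_span_def ring_span_def
  by (auto simp: of_int_hom.degree_map_poly_hom sring.polyover_of_int_poly)

lemma of_int_poly_monom: "of_int_poly (monom m k) = monom (of_int m) k"
  by (rule poly_eqI) simp

lemma degree_drop: "degree p \<le> Suc k \<Longrightarrow> coeff p (Suc k) = 0 \<Longrightarrow> degree p \<le> k"
  by (metis degree_0 le_SucE le_zero_eq leading_coeff_0_iff zero_le)

text \<open>The map d |-> d x^(k+1) identifies the quotient with R/D. If e x^(k+1) = q(x) with q
  integral of degree at most k, multiplying by e^k gives a monic integral equation for e x;
  conversely, if e x is integral, e x^(k+1) = (e x) x^k has lower degree.\<close>

lemma ring_span_step:
  fixes L :: "'a::field_char_0 set"
  assumes L: "sring L" and x: "x \<in> L"
  defines "R \<equiv> ints L"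
  defines "D \<equiv> {d \<in> R. d * x \<in> R}"
  shows "idx (ring_span R x (Suc k)) (ring_span R x k) = idx R D"
    and "finite (cosets R D) \<Longrightarrow> finite (cosets (ring_span R x (Suc k)) (ring_span R x k))"
proof -
  interpret L: sring L by fact
  interpret sring R unfolding R_def by (rule sring_ints[OF L])
  have gD: "add_subgroup D" unfolding D_def add_subgroup_def
    by (auto simp: add minus distrib_right)
  have iff: "d * x ^ Suc k - d' * x ^ Suc k \<in> ring_span R x k \<longleftrightarrow> d - d' \<in> D" if d: "d \<in> R" "d' \<in> R" for d d'
  proof
    define e where "e = d - d'"
    have eR: "e \<in> R" using d diff by (simp add: e_def)
    have eq: "d * x ^ Suc k - d' * x ^ Suc k = e * x ^ Suc k" by (simp add: e_def left_diff_distrib)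
    {
      assume "d - d' \<in> D"
      hence ex: "e * x \<in> R" by (simp add: D_def e_def)
      have "e * x ^ Suc k = poly (monom (e * x) k) x" by (simp add: poly_monom)
      thus "d * x ^ Suc k - d' * x ^ Suc k \<in> ring_span R x k"
        unfolding eq ring_span_def using ex by (intro image_eqI) (auto simp: polyover_monom degree_monom_le)
    }
    assume "d * x ^ Suc k - d' * x ^ Suc k \<in> ring_span R x k"
    then obtain q where q: "polyover R q" "degree q \<le> k" "e * x ^ Suc k = poly q x"
      unfolding eq ring_span_def by auto
    define h where "h = monom 1 (Suc k) - (\<Sum>j\<le>k. monom (coeff q j * e ^ (k - j)) j)"
    have ch: "coeff h i = (if i = Suc k then 1 else if i \<le> k then - (coeff q i * e ^ (k - i)) else 0)" for i
      by (auto simp: h_def coeff_sum coeff_monom)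
    have deg: "degree h = Suc k" by (rule antisym) (auto simp: ch intro!: degree_le le_degree)
    have "algebraic_int (e * x)"
    proof (rule algebraic_int_root_aipoly)
      have "algebraic_int (coeff q i)" "algebraic_int e" for i
        using q(1) eR by (auto simp: polyover_def R_def ints_def)
      thus "aipoly h" unfolding aipoly_def ch by (auto intro!: algebraic_int_mult algebraic_int_power)
      show "monic h" by (simp add: deg ch)
      have "(\<Sum>j\<le>k. coeff q j * e ^ (k - j) * (e * x) ^ j) = (\<Sum>j\<le>k. e ^ k * (coeff q j * x ^ j))"
      proof (rule sum.cong[OF refl])
        fix j assume "j \<in> {..k}"
        hence "e ^ k = e ^ (k - j) * e ^ j" by (simp add: power_add[symmetric])
        thus "coeff q j * e ^ (k - j) * (e * x) ^ j = e ^ k * (coeff q j * x ^ j)" by (simp add: power_mult_distrib mult_ac)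
      qed
      also have "\<dots> = e ^ k * (\<Sum>j\<le>k. coeff q j * x ^ j)" by (simp add: sum_distrib_left)
      also have "(\<Sum>j\<le>k. coeff q j * x ^ j) = poly q x"
        unfolding poly_altdef by (rule sum.mono_neutral_right) (use q(2) in \<open>auto simp: coeff_eq_0\<close>)
      also have "e ^ k * poly q x = (e * x) ^ Suc k" by (simp add: q(3)[symmetric] power_mult_distrib mult_ac)
      finally show "poly h (e * x) = 0" by (simp add: h_def poly_sum poly_monom del: power_Suc)
    qed
    thus "d - d' \<in> D" using eR x unfolding D_def e_def[symmetric] R_def ints_def by (auto intro: L.mult)
  qed
  have f: "d * x ^ Suc k \<in> ring_span R x (Suc k)" if "d \<in> R" for d
    unfolding ring_span_def using that
    by (intro image_eqI[of _ _ "monom d (Suc k)"]) (auto simp: poly_monom polyover_monom degree_monom_le)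
  have surj: "\<exists>d\<in>R. y - d * x ^ Suc k \<in> ring_span R x k" if y: "y \<in> ring_span R x (Suc k)" for y
  proof -
    obtain p where p: "polyover R p" "degree p \<le> Suc k" "y = poly p x" using y by (auto simp: ring_span_def)
    define d where "d = coeff p (Suc k)"
    have dR: "d \<in> R" using p by (simp add: d_def polyover_def)
    define p' where "p' = p - monom d (Suc k)"
    have "degree p' \<le> Suc k" unfolding p'_def using p(2) by (intro degree_diff_le degree_monom_le)
    hence "degree p' \<le> k" by (rule degree_drop) (simp add: p'_def d_def)
    moreover have "polyover R p'" unfolding p'_def by (intro polyover_diff polyover_monom dR p)
    moreover have "y - d * x ^ Suc k = poly p' x" by (simp add: p'_def p poly_monom)
    ultimately show ?thesis using dR unfolding ring_span_def by blast
  qed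
  note m = idx_map[OF gD add_subgroup_ring_span[OF sring_axioms, of x k], of R "\<lambda>d. d * x ^ Suc k" "ring_span R x (Suc k)", OF f iff surj]
  show "idx (ring_span R x (Suc k)) (ring_span R x k) = idx R D" using m(1) by simp
  show "finite (cosets R D) \<Longrightarrow> finite (cosets (ring_span R x (Suc k)) (ring_span R x k))" using m(2) by simp
qed

text \<open>Once k + 1 reaches the degree of F, m x^(k+1) reduces to lower powers exactly when a
  divides m: in one direction a multiple of F is subtracted, in the other a polynomial with leading
  coefficient m vanishes at x and is a multiple of F.\<close>

lemma int_span_step:
  fixes x :: "'a::field_char_0"
  assumes alg: "algebraic x" and k: "degree (min_int_poly x) \<le> Suc k"
  defines "a \<equiv> lead_coeff (min_int_poly x)"
  shows "idx (int_span x (Suc k)) (int_span x k) = nat a"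
    and "finite (cosets (int_span x (Suc k)) (int_span x k))"
proof -
  let ?F = "min_int_poly x" and ?Z = "\<int> :: 'a set"
  have a: "a > 0" unfolding a_def by (rule min_int_poly_lead[OF alg])
  have "sring ?Z" by unfold_locales auto
  hence g: "add_subgroup ((*) (of_int a) ` ?Z)" by (intro add_subgroup_scale add_subgroup_sring)
  have key: "of_int m * x ^ Suc k \<in> int_span x k \<longleftrightarrow> a dvd m" for m
  proof
    assume "a dvd m"
    then obtain l where l: "m = a * l" by (elim dvdE)
    define p where "p = monom m (Suc k) - ?F * monom l (Suc k - degree ?F)"
    have "degree p \<le> Suc k" unfolding p_def
    proof (rule degree_diff_le[OF degree_monom_le])
      have "degree (?F * monom l (Suc k - degree ?F)) \<le> degree ?F + (Suc k - degree ?F)"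
        by (rule order_trans[OF degree_mult_le add_left_mono[OF degree_monom_le]])
      thus "degree (?F * monom l (Suc k - degree ?F)) \<le> Suc k" using k by simp
    qed
    moreover have "coeff p (Suc k) = 0"
    proof -
      have "coeff (?F * monom l (Suc k - degree ?F)) (Suc k) = coeff (monom l (Suc k - degree ?F) * ?F) (Suc k)"
        by (simp only: mult.commute)
      also have "\<dots> = l * coeff ?F (degree ?F)" using k by (simp add: coeff_monom_mult)
      finally have "coeff (?F * monom l (Suc k - degree ?F)) (Suc k) = l * coeff ?F (degree ?F)" .
      thus ?thesis by (simp add: p_def l a_def)
    qed
    ultimately have "degree p \<le> k" by (rule degree_drop)
    moreover have "of_int m * x ^ Suc k = poly (of_int_poly p) x"
      by (simp add: p_def hom_distribs min_int_poly_root[OF alg] poly_monom of_int_poly_monom)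
    ultimately show "of_int m * x ^ Suc k \<in> int_span x k" unfolding int_span_def by blast
  next
    assume "of_int m * x ^ Suc k \<in> int_span x k"
    then obtain p where p: "degree p \<le> k" "of_int m * x ^ Suc k = poly (of_int_poly p) x" by (auto simp: int_span_def)
    define G where "G = monom m (Suc k) - p"
    have "poly (of_int_poly G) x = 0" using p(2) by (simp add: G_def hom_distribs poly_monom of_int_poly_monom)
    hence "?F dvd G" by (rule min_int_poly_dvd[OF alg])
    then obtain H where H: "G = ?F * H" by (elim dvdE)
    have cG: "coeff G (Suc k) = m" using p(1) by (simp add: G_def coeff_eq_0)
    show "a dvd m"
    proof (cases "m = 0")
      case False
      have "degree G = Suc k"
      proof (rule antisym)
        show "degree G \<le> Suc k" unfolding G_def using p(1) by (intro degree_diff_le degree_monom_le) simp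
        show "Suc k \<le> degree G" using cG False by (intro le_degree) simp
      qed
      hence "m = lead_coeff ?F * lead_coeff H" using cG H by (metis lead_coeff_mult)
      thus ?thesis by (simp add: a_def)
    qed simp
  qed
  have iff: "y * x ^ Suc k - y' * x ^ Suc k \<in> int_span x k \<longleftrightarrow> y - y' \<in> (*) (of_int a) ` ?Z" if y: "y \<in> ?Z" "y' \<in> ?Z" for y y'
  proof -
    obtain m m' where m: "y = of_int m" "y' = of_int m'" using y by (auto elim!: Ints_cases)
    have "y * x ^ Suc k - y' * x ^ Suc k = of_int (m - m') * x ^ Suc k" by (simp add: m left_diff_distrib)
    hence "y * x ^ Suc k - y' * x ^ Suc k \<in> int_span x k \<longleftrightarrow> a dvd m - m'"
      using key[of "m - m'"] by (simp only:)
    also have "\<dots> \<longleftrightarrow> y - y' \<in> (*) (of_int a) ` ?Z"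
    proof
      assume "a dvd m - m'"
      then obtain l where l: "m - m' = a * l" by (elim dvdE)
      show "y - y' \<in> (*) (of_int a) ` ?Z"
      proof (rule image_eqI)
        show "y - y' = of_int a * of_int l" using arg_cong[OF l, of "of_int :: int \<Rightarrow> 'a"] by (simp add: m)
      qed simp
    next
      assume "y - y' \<in> (*) (of_int a) ` ?Z"
      then obtain l where "y - y' = of_int a * of_int l" by (auto elim!: Ints_cases)
      hence "(of_int (m - m') :: 'a) = of_int (a * l)" by (simp add: m)
      hence "m - m' = a * l" by (simp only: of_int_eq_iff)
      thus "a dvd m - m'" by simp
    qed
    finally show ?thesis .
  qed
  have f: "y * x ^ Suc k \<in> int_span x (Suc k)" if y: "y \<in> ?Z" for y
  proof -
    obtain m where m: "y = of_int m" using y by (auto elim!: Ints_cases)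
    show ?thesis unfolding int_span_def m
      by (rule image_eqI[of _ _ "monom m (Suc k)"])
        (simp_all add: poly_monom of_int_poly_monom degree_monom_le del: power_Suc)
  qed
  have surj: "\<exists>d\<in>?Z. y - d * x ^ Suc k \<in> int_span x k" if y: "y \<in> int_span x (Suc k)" for y
  proof -
    obtain p where p: "degree p \<le> Suc k" "y = poly (of_int_poly p) x" using y by (auto simp: int_span_def)
    define p' where "p' = p - monom (coeff p (Suc k)) (Suc k)"
    have "degree p' \<le> Suc k" unfolding p'_def using p(1) by (intro degree_diff_le degree_monom_le)
    hence "degree p' \<le> k" by (rule degree_drop) (simp add: p'_def)
    moreover have "y - of_int (coeff p (Suc k)) * x ^ Suc k = poly (of_int_poly p') x"
      by (simp add: p'_def p hom_distribs poly_monom of_int_poly_monom)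
    ultimately show ?thesis unfolding int_span_def by (intro bexI[of _ "of_int (coeff p (Suc k))"]) auto
  qed
  note m = idx_map[OF g add_subgroup_int_span[of x k], of ?Z "\<lambda>d. d * x ^ Suc k" "int_span x (Suc k)", OF f iff surj]
  show "idx (int_span x (Suc k)) (int_span x k) = nat a" using m(1) idx_Ints_multiple(1)[OF a, where 'a = 'a] by simp
  show "finite (cosets (int_span x (Suc k)) (int_span x k))" using m(2) idx_Ints_multiple(2)[OF a, where 'a = 'a] by simp
qed

lemma minpoly_over_Rats:
  fixes x :: "'a::field_char_0"
  assumes alg: "algebraic x"
  shows "minpoly_over \<rat> x (smult (inverse (of_int (lead_coeff (min_int_poly x)))) (of_int_poly (min_int_poly x)))"
proof -
  let ?F = "min_int_poly x"
  interpret Q: sfield "\<rat> :: 'a set" by (rule sfield_Rats)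
  define a where "a = lead_coeff ?F"
  have a0: "a > 0" unfolding a_def by (rule min_int_poly_lead[OF alg])
  have Fnz: "?F \<noteq> 0" by (rule min_int_poly_nz[OF alg])
  define g where "g = smult (inverse (of_int a)) (of_int_poly ?F :: 'a poly)"
  have gS: "polyover \<rat> g" unfolding g_def by (intro Q.polyover_smult Q.polyover_of_int_poly) simp
  have gm: "monic g" using a0 Fnz by (simp add: g_def a_def)
  show ?thesis
    unfolding minpoly_over_def a_def[symmetric] g_def[symmetric]
  proof (intro conjI allI impI gS gm)
    show "poly g x = 0" by (simp add: g_def min_int_poly_root[OF alg])
    fix p assume p: "polyover \<rat> p \<and> poly p x = 0"
    then obtain c G where cG: "c > (0::int)" "smult (of_int c) p = of_int_poly G" using clear_denominators by blast
    have "poly (of_int_poly G) x = 0" unfolding cG(2)[symmetric] using p by simp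
    hence "?F dvd G" by (rule min_int_poly_dvd[OF alg])
    then obtain H where H: "G = ?F * H" by (elim dvdE)
    have "smult (of_int c) p = of_int_poly ?F * of_int_poly H" unfolding cG(2) H by (simp add: hom_distribs)
    from arg_cong[OF this, of "smult (inverse (of_int c))"]
    have "p = smult (inverse (of_int c)) (of_int_poly ?F * of_int_poly H)" using cG(1) by simp
    also have "of_int_poly ?F = smult (of_int a) g" using a0 by (simp add: g_def)
    finally have "p = g * smult (inverse (of_int c) * of_int a) (of_int_poly H)" by (simp add: mult_ac)
    moreover have "polyover \<rat> (smult (inverse (of_int c) * of_int a) (of_int_poly H :: 'a poly))"
      by (intro Q.polyover_smult Q.polyover_of_int_poly) simp
    ultimately show "\<exists>q. polyover \<rat> q \<and> p = g * q" by blast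
  qed
qed

text \<open>Trace duality: \<open>F'(x)\<close> times an integer \<open>\<tau>\<close> is \<open>\<Sum> Tr(\<tau> q\<^sub>j) x\<^sup>j\<close>, where \<open>q\<^sub>j\<close> are the coefficients of
  \<open>F / (T - x)\<close>; the traces are rational and integral.\<close>
lemma integers_in_int_span:
  fixes x :: "'a::field_char_0"
  assumes alg: "\<And>y::'a. algebraic y"
  defines "L \<equiv> adjoin \<rat> x"
  shows "\<exists>N>0. (*) (of_int N) ` ints L \<subseteq> int_span x (degree (min_int_poly x) - 1)"
proof -
  let ?F = "min_int_poly x"
  let ?G = "of_int_poly ?F :: complex poly"
  interpret Q: sfield "\<rat> :: 'a set" by (rule sfield_Rats)
  have sL: "sfield L" unfolding L_def
    using Q.sring_adjoin Q.subset_adjoin alg by (intro sfield_if_algebraic)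
  interpret L: sfield L by (rule sL)
  have xL: "x \<in> L" unfolding L_def by (rule Q.in_adjoin)
  define a where "a = lead_coeff ?F"
  have a0: "a > 0" unfolding a_def by (rule min_int_poly_lead[OF alg])
  have Fnz: "?F \<noteq> 0" by (rule min_int_poly_nz[OF alg])
  define \<phi> where "\<phi> = (\<lambda>y::'a. of_rat (inv_into UNIV of_rat y) :: complex)"
  have fam0: "conj_family (\<rat> :: 'a set) [\<phi>]" unfolding \<phi>_def by (rule conj_family_Rats)
  interpret h: hom_sfield "\<rat> :: 'a set" \<phi> using conj_family_hom[OF fam0, of 0] by simp
  define g where "g = smult (inverse (of_int a)) (of_int_poly ?F :: 'a poly)"
  have g: "minpoly_over \<rat> x g" unfolding g_def a_def by (rule minpoly_over_Rats[OF alg])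
  hence gS: "polyover \<rat> g" and gm: "monic g" by (auto simp: minpoly_over_def)
  have mg: "map_poly \<phi> g = smult (inverse (of_int a)) ?G"
    by (rule poly_eqI) (simp add: g_def h.hom_mult h.hom_inverse)
  define M where "M = proots ?G"
  have Gnz: "?G \<noteq> 0" using Fnz by simp
  have split: "map_poly \<phi> g = (\<Prod>r\<in>#M. [:- r, 1:])"
  proof -
    have "?G = smult (of_int a) (\<Prod>r\<in>#M. [:- r, 1:])"
      using complex_poly_decompose_multiset[of ?G] by (simp add: M_def a_def of_int_hom.degree_map_poly_hom)
    thus ?thesis unfolding mg using a0 by simp
  qed
  have root: "poly (map_poly \<phi> g) r = 0" if "r \<in># M" for r
    using that Gnz by (simp add: mg M_def)
  define \<sigma> where "\<sigma> r = hom_ext \<rat> x \<phi> r" for r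
  have hs: "hom_sfield L (\<sigma> r)" if "r \<in># M" for r
    using h.hom_on_hom_ext[OF g root[OF that]] sL
    by (simp add: hom_sfield_def hom_sring_def hom_sring_axioms_def \<sigma>_def L_def sfield_def)
  have \<sigma>x: "\<sigma> r x = r" if "r \<in># M" for r unfolding \<sigma>_def by (rule h.hom_ext_gen[OF g root[OF that]])
  have trace: "(\<Sum>r\<in>#M. \<sigma> r y) \<in> \<rat>" if y: "y \<in> L" for y
  proof -
    obtain p where p: "polyover \<rat> p" "y = poly p x" using y by (auto simp: L_def adjoin_def)
    have "(\<Sum>r\<in>#M. \<sigma> r y) = (\<Sum>r\<in>#M. poly (map_poly \<phi> p) r)"
      by (rule arg_cong[of _ _ sum_mset], rule image_mset_cong) (simp add: \<sigma>_def p h.hom_ext_poly[OF g root])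
    also have "\<dots> = poly_trace (map_poly \<phi> g) (map_poly \<phi> p)" by (rule poly_trace[OF split])
    also have "\<dots> = \<phi> (poly_trace g p)" by (rule h.hom_poly_trace[OF gS gm p(1), symmetric])
    also have "\<dots> \<in> \<rat>" by (simp add: \<phi>_def)
    finally show ?thesis .
  qed
  obtain Q where Q: "polyover L Q" "of_int_poly ?F = [:- x, 1:] * Q"
  proof -
    have 1: "polyover L [:- x, 1:]" using xL L.minus by (simp add: L.polyover_pCons)
    obtain q r where qr: "polyover L q" "of_int_poly ?F = [:- x, 1:] * q + r" "r = 0 \<or> degree r < degree [:- x, 1:]"
      using L.polyover_divmod[OF 1 _ L.polyover_of_int_poly[of ?F]] by auto
    have "degree r = 0" using qr(3) by auto
    then obtain c where c: "r = [:c:]" by (elim degree_eq_zeroE)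
    have "poly r x = 0" using min_int_poly_root[OF alg[of x]] arg_cong[OF qr(2), of "\<lambda>p. poly p x"] by simp
    hence "r = 0" using c by simp
    thus ?thesis using that qr by simp
  qed
  have Qnz: "Q \<noteq> 0"
  proof
    assume "Q = 0"
    hence "(of_int_poly ?F :: 'a poly) = 0" using Q(2) by simp
    thus False using Fnz by simp
  qed
  have "degree (of_int_poly ?F :: 'a poly) = Suc (degree Q)" unfolding Q(2) using Qnz by (subst degree_mult_eq) auto
  hence dQ: "degree Q = degree ?F - 1" by (simp add: of_int_hom.degree_map_poly_hom)
  have "aipoly Q" by (rule aipoly_divide_linear[of x]) (simp only: Q(2)[symmetric] aipoly_of_int_poly)
  hence aiQ: "algebraic_int (coeff Q j)" for j by (simp add: aipoly_def)
  have Qx: "poly Q x \<noteq> 0"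
  proof -
    have "poly (pderiv (of_int_poly ?F)) x = poly Q x" unfolding Q(2) pderiv_mult by (simp add: pderiv_pCons)
    thus ?thesis using min_int_poly_pderiv[OF alg[of x]] by simp
  qed
  have "size M > 0"
    using min_int_poly_degree[OF alg[of x]] by (simp add: M_def size_proots_complex of_int_hom.degree_map_poly_hom)
  then obtain r0 where r0: "r0 \<in># M" by (metis gr0_implies_Suc multi_member_split size_eq_Suc_imp_elem)
  \<comment> \<open>The multiplicity of \<open>r0\<close> as a root is carried along as one more
    factor of N.\<close>
  define \<mu> where "\<mu> = count M r0"
  have \<mu>: "\<mu> > 0" using r0 by (simp add: \<mu>_def)
  have key: "of_nat \<mu> * (\<tau> * poly Q x) \<in> int_span x (degree ?F - 1)" if \<tau>: "\<tau> \<in> ints L" for \<tau>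
  proof -
    have \<tau>L: "\<tau> \<in> L" "algebraic_int \<tau>" using \<tau> by (auto simp: ints_def)
    have QL: "coeff Q j \<in> L" for j using Q(1) by (simp add: polyover_def)
    have "(\<Sum>r\<in>#M. \<sigma> r (\<tau> * coeff Q j)) \<in> \<int>" for j
    proof (rule rational_algebraic_int_is_int)
      have "algebraic_int (\<sigma> r (\<tau> * coeff Q j))" if "r \<in># M" for r
        by (rule hom_sfield.hom_algebraic_int[OF hs[OF that] algebraic_int_mult[OF \<tau>L(2) aiQ] L.mult[OF \<tau>L(1) QL]])
      thus "algebraic_int (\<Sum>r\<in>#M. \<sigma> r (\<tau> * coeff Q j))" by (rule algebraic_int_sum_mset)
      show "(\<Sum>r\<in>#M. \<sigma> r (\<tau> * coeff Q j)) \<in> \<rat>" by (rule trace[OF L.mult[OF \<tau>L(1) QL]])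
    qed
    hence "\<forall>j. \<exists>m. (\<Sum>r\<in>#M. \<sigma> r (\<tau> * coeff Q j)) = of_int m" by (auto elim!: Ints_cases)
    then obtain m where m: "\<And>j. (\<Sum>r\<in>#M. \<sigma> r (\<tau> * coeff Q j)) = of_int (m j)" by metis
    define H where "H = (\<Sum>j\<le>degree Q. monom (m j) j)"
    have dH: "degree H \<le> degree ?F - 1" unfolding H_def dQ[symmetric]
      by (intro degree_sum_le) (auto intro: order_trans[OF degree_monom_le])
    interpret s: hom_sfield L "\<sigma> r0" by (rule hs[OF r0])
    have Hx: "poly (of_int_poly H) y = (\<Sum>j\<le>degree Q. of_int (m j) * y ^ j)" for y :: "'b::field_char_0"
      by (simp add: H_def of_int_poly_hom.hom_sum of_int_poly_monom poly_sum poly_monom)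
    have "\<sigma> r0 (poly (of_int_poly H) x) = poly (of_int_poly H) r0"
      using s.hom_poly[of "of_int_poly H" x] xL \<sigma>x[OF r0] by simp
    also have "\<dots> = (\<Sum>j\<le>degree Q. (\<Sum>r\<in>#M. \<sigma> r (\<tau> * coeff Q j)) * r0 ^ j)" unfolding Hx m ..
    also have "\<dots> = (\<Sum>r\<in>#M. \<Sum>j\<le>degree Q. \<sigma> r (\<tau> * coeff Q j) * r0 ^ j)"
    proof -
      have "(\<Sum>j\<in>J. (\<Sum>r\<in>#N. f r j) * r0 ^ j) = (\<Sum>r\<in>#N. \<Sum>j\<in>J. f r j * r0 ^ j)" for N J and f :: "complex \<Rightarrow> nat \<Rightarrow> complex"
        by (induction N) (simp_all add: distrib_right sum.distrib)
      thus ?thesis .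
    qed
    \<comment> \<open>For r different from r0, r0 is a root of the image of F = (T - x) Q but not of
      T - r, hence of the image of Q under \<open>\<sigma> r\<close>; only r = r0 survives.\<close>
    also have "\<dots> = (\<Sum>r\<in>#M. if r = r0 then \<sigma> r0 (\<tau> * poly Q x) else 0)"
    proof (rule arg_cong[of _ _ sum_mset], rule image_mset_cong)
      fix r assume r: "r \<in># M"
      interpret t: hom_sfield L "\<sigma> r" by (rule hs[OF r])
      have "(\<Sum>j\<le>degree Q. \<sigma> r (\<tau> * coeff Q j) * r0 ^ j) = \<sigma> r \<tau> * (\<Sum>j\<le>degree Q. \<sigma> r (coeff Q j) * r0 ^ j)"
        by (simp add: t.hom_mult \<tau>L QL sum_distrib_left mult_ac)
      also have "(\<Sum>j\<le>degree Q. \<sigma> r (coeff Q j) * r0 ^ j) = poly (map_poly (\<sigma> r) Q) r0"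
      proof -
        have "poly (map_poly (\<sigma> r) Q) r0 = (\<Sum>j\<le>degree (map_poly (\<sigma> r) Q). coeff (map_poly (\<sigma> r) Q) j * r0 ^ j)"
          by (simp only: poly_altdef)
        also have "\<dots> = (\<Sum>j\<le>degree Q. coeff (map_poly (\<sigma> r) Q) j * r0 ^ j)"
          by (rule sum.mono_neutral_left) (use degree_map_poly_le[of "\<sigma> r" Q] in \<open>auto simp: coeff_eq_0 simp del: t.coeff_map_hom\<close>)
        finally show ?thesis by simp
      qed
      also have "\<sigma> r \<tau> * poly (map_poly (\<sigma> r) Q) r0 = (if r = r0 then \<sigma> r0 (\<tau> * poly Q x) else 0)"
      proof (cases "r = r0")
        case True
        have "poly (map_poly (\<sigma> r) Q) r0 = \<sigma> r (poly Q x)" using t.hom_poly[OF Q(1) xL] \<sigma>x[OF r] True by simp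
        thus ?thesis using True t.hom_mult[OF \<tau>L(1) L.poly_in[OF Q(1) xL]] by simp
      next
        case False
        have "?G = map_poly (\<sigma> r) ([:- x, 1:] * Q)" unfolding Q(2)[symmetric] by simp
        also have "\<dots> = map_poly (\<sigma> r) [:- x, 1:] * map_poly (\<sigma> r) Q"
          using xL L.minus by (intro t.map_hom_mult Q(1)) (simp add: L.polyover_pCons)
        also have "map_poly (\<sigma> r) [:- x, 1:] = [:- r, 1:]"
          by (rule poly_eqI) (simp add: coeff_pCons t.hom_minus xL \<sigma>x[OF r] split: nat.split)
        finally have "poly ?G r0 = poly [:- r, 1:] r0 * poly (map_poly (\<sigma> r) Q) r0" by (simp only: poly_mult)
        hence "poly ?G r0 = (r0 - r) * poly (map_poly (\<sigma> r) Q) r0" by simp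
        moreover have "poly ?G r0 = 0" using r0 Gnz by (simp add: M_def)
        ultimately show ?thesis using False by simp
      qed
      finally show "(\<Sum>j\<le>degree Q. \<sigma> r (\<tau> * coeff Q j) * r0 ^ j) = (if r = r0 then \<sigma> r0 (\<tau> * poly Q x) else 0)" .
    qed
    also have "\<dots> = of_nat \<mu> * \<sigma> r0 (\<tau> * poly Q x)"
    proof -
      have "(\<Sum>r\<in>#N. if r = r0 then c else 0) = of_nat (count N r0) * c" for N and c :: complex
        by (induction N) (simp_all add: algebra_simps)
      thus ?thesis by (simp add: \<mu>_def)
    qed
    also have "\<dots> = \<sigma> r0 (of_nat \<mu> * (\<tau> * poly Q x))"
      using L.mult[OF \<tau>L(1) L.poly_in[OF Q(1) xL]] by (simp add: s.hom_mult)
    finally have "\<sigma> r0 (poly (of_int_poly H) x - of_nat \<mu> * (\<tau> * poly Q x)) = 0"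
      using L.mult[OF L.of_nat L.mult[OF \<tau>L(1) L.poly_in[OF Q(1) xL]], of \<mu>]
      by (simp add: s.hom_diff L.poly_in xL)
    moreover have "poly (of_int_poly H) x - of_nat \<mu> * (\<tau> * poly Q x) \<in> L"
      by (intro L.diff L.mult L.of_nat \<tau>L L.poly_in Q xL L.polyover_of_int_poly)
    ultimately have "poly (of_int_poly H) x = of_nat \<mu> * (\<tau> * poly Q x)" by (simp add: s.hom_eq_0_iff)
    thus ?thesis unfolding int_span_def using dH by (intro image_eqI[of _ _ H]) auto
  qed
  define u where "u = of_nat \<mu> * poly Q x"
  have u: "u \<in> L" "u \<noteq> 0" unfolding u_def using Qx \<mu> by (auto intro!: L.mult L.poly_in Q xL)
  obtain N y where N: "N > (0::int)" "y \<in> ints L" "u * y = of_int N" using divides_integer[OF sL u(1) alg u(2)] by blast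
  interpret I: sring "ints L" by (rule sring_ints[OF L.sring_axioms])
  have "of_int N * \<tau> \<in> int_span x (degree ?F - 1)" if "\<tau> \<in> ints L" for \<tau>
  proof -
    have eq: "of_int N * \<tau> = of_nat \<mu> * ((y * \<tau>) * poly Q x)" unfolding N(3)[symmetric] u_def by (simp add: mult_ac)
    show ?thesis unfolding eq by (rule key[OF I.mult[OF N(2) that]])
  qed
  thus ?thesis using N(1) by blast
qed

text \<open>Let I_k and J_k be the spans of 1, ..., x^k over the integers of L and over Z. Relative
  to N times the integers of L, the index of I_k grows like W^k and that of J_k like a^k. As J_k has
  bounded index in I_k, uniformly in k, the two rates agree.\<close>

theorem idx_denominator:
  fixes x :: "'a::field_char_0"
  assumes alg: "\<And>y::'a. algebraic y"
  defines "L \<equiv> adjoin \<rat> x"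
  assumes nf: "number_field L"
  shows "idx (ints L) {d \<in> ints L. d * x \<in> ints L} = nat (lead_coeff (min_int_poly x))"
proof -
  let ?O = "ints L" and ?F = "min_int_poly x"
  define D where "D = {d \<in> ?O. d * x \<in> ?O}"
  define W where "W = idx ?O D"
  define a where "a = nat (lead_coeff ?F)"
  define n where "n = degree ?F - 1"
  have a0: "a > 0" using min_int_poly_lead[OF alg[of x]] by (simp add: a_def)
  have dn: "degree ?F = Suc n" using min_int_poly_degree[OF alg[of x]] by (simp add: n_def)
  have sL: "sfield L" using nf sfield_if_subfield by (auto simp: number_field_def)
  interpret L: sfield L by (rule sL)
  interpret int_ring ?O by (rule int_ring_ints[OF nf])
  interpret Q: sfield "\<rat> :: 'a set" by (rule sfield_Rats)
  have xL: "x \<in> L" unfolding L_def by (rule Q.in_adjoin)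
  obtain N where N: "N > (0::int)" "(*) (of_int N) ` ?O \<subseteq> int_span x n"
    using integers_in_int_span[of x, OF alg] unfolding L_def n_def by blast
  let ?J = "int_span x" and ?I = "ring_span ?O x" and ?N = "(`) ((*) (of_int N :: 'a))"
  have N0: "(of_int N :: 'a) \<noteq> 0" using N(1) by simp
  have gJ: "add_subgroup (?J k)" for k by (rule add_subgroup_int_span)
  have gI: "add_subgroup (?I k)" for k by (rule add_subgroup_ring_span[OF sring_axioms])
  have gN: "add_subgroup A \<Longrightarrow> add_subgroup (?N A)" for A by (rule add_subgroup_scale)
  have I0: "?I 0 = ?O"
  proof
    show "?I 0 \<subseteq> ?O"
    proof
      fix y assume "y \<in> ?I 0"
      then obtain p where p: "polyover ?O p" "degree p = 0" "y = poly p x" by (auto simp: ring_span_def)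
      then obtain c where "p = [:c:]" by (elim degree_eq_zeroE)
      thus "y \<in> ?O" using p by (metis polyover_def coeff_pCons_0 poly_const_conv)
    qed
    show "?O \<subseteq> ?I 0"
    proof
      fix y assume "y \<in> ?O"
      thus "y \<in> ?I 0" unfolding ring_span_def by (intro image_eqI[of _ _ "[:y:]"]) (simp_all add: polyover_pCons)
    qed
  qed
  have IO: "?O \<subseteq> ?I k" for k using ring_span_mono[of 0 k ?O x] I0 by simp
  have finD: "finite (cosets ?O D)"
  proof -
    obtain m where m: "m \<noteq> (0::int)" "algebraic_int (of_int m * x)" using alg[of x] algebraic_iff_multiple by blast
    have mD: "of_int m \<in> D" unfolding D_def using m(2) xL by (simp add: ints_def L.mult)
    have "idl D" unfolding idl_def D_def by (auto simp: distrib_right mult.assoc intro: add mult)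
    moreover have "D \<noteq> {0}" using mD m(1) by auto
    ultimately show ?thesis by (rule finite_quotient_idl)
  qed
  have finN: "finite (cosets ?O (?N ?O))" by (rule finite_quotient) (use N(1) in simp_all)
  define c where "c = idx ?O (?N ?O)"
  have c0: "c > 0" unfolding c_def by (rule idx_pos[OF finN one])
  have NO: "?N ?O \<subseteq> ?O" by (auto intro: mult)
  have A1: "finite (cosets (?I k) ?O) \<and> idx (?I k) ?O = W ^ k" for k
  proof (induction k)
    case 0
    show ?case using idx_self[OF add_subgroup_O] cosets_self[OF add_subgroup_O] by (simp add: I0)
  next
    case (Suc k)
    note st = ring_span_step[OF L.sring_axioms xL, of k, folded D_def]
    note tw = idx_tower[OF gI[of "Suc k"] gI[of k] add_subgroup_O IO[of k] ring_span_mono[of k "Suc k"]]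
    show ?case using tw st(2)[OF finD] Suc st(1) by (simp add: W_def)
  qed
  have A2: "finite (cosets (?I k) (?N ?O))" "idx (?I k) (?N ?O) = W ^ k * c" for k
    using idx_tower[OF gI[of k] add_subgroup_O gN[OF add_subgroup_O] NO IO[of k] _ finN] A1[of k] by (simp_all add: c_def)
  have A3: "finite (cosets (?J (k + j)) (?J k)) \<and> idx (?J (k + j)) (?J k) = a ^ j" if k: "k \<ge> n" for k j
  proof (induction j)
    case 0
    show ?case using idx_self[OF gJ] cosets_self[OF gJ] by simp
  next
    case (Suc j)
    have d: "degree ?F \<le> Suc (k + j)" using k dn by simp
    note st = int_span_step[OF alg d]
    note tw = idx_tower[OF gJ[of "Suc (k + j)"] gJ[of "k + j"] gJ[of k] int_span_mono int_span_mono]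
    show ?case using tw st Suc by (simp add: a_def)
  qed
  have NJ: "?N ?O \<subseteq> ?J k" if "k \<ge> n" for k using N(2) int_span_mono[OF that] by blast
  have JI: "?J k \<subseteq> ?I k" for k by (rule int_span_subset_ring_span[OF sring_axioms])
  have finNN: "finite (cosets (?I k) (?N (?N ?O)))" for k
  proof -
    have "finite (cosets (?N ?O) (?N (?N ?O)))" using idx_scale(2)[OF N0 gN[OF add_subgroup_O], of ?O] finN by simp
    thus ?thesis
      by (intro idx_tower(1)[OF gI gN[OF add_subgroup_O] gN[OF gN[OF add_subgroup_O]] image_mono[OF NO] _ A2(1)])
         (use NO IO[of k] in blast)
  qed
  have finJNJ: "finite (cosets (?J k) (?N (?J k)))" if "k \<ge> n" for k
    by (rule finite_cosets_subset[OF finite_cosets_mono[OF gN[OF gJ] gN[OF gN[OF add_subgroup_O]] image_mono[OF NJ[OF that]] finNN] JI])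
  \<comment> \<open>Constant for k >= n: the index of N J_k in J_(k+1) is \<open>a * \<nu> k\<close>
    through J_k, and \<open>\<nu> (Suc k) * a\<close> through N J_(k+1).\<close>
  define \<nu> where "\<nu> k = idx (?J k) (?N (?J k))" for k
  have NJJ: "?N (?J k) \<subseteq> ?J k" for k
  proof
    fix y assume "y \<in> ?N (?J k)"
    then obtain p where p: "degree p \<le> k" "y = of_int N * poly (of_int_poly p) x" by (auto simp: int_span_def)
    show "y \<in> ?J k" unfolding int_span_def
      by (rule image_eqI[of _ _ "smult N p"]) (simp_all add: p hom_distribs order_trans[OF degree_smult_le])
  qed
  have \<nu>_step: "\<nu> (Suc k) = \<nu> k" if k: "k \<ge> n" for k
  proof -
    have s: "finite (cosets (?J (Suc k)) (?J k))" "idx (?J (Suc k)) (?J k) = a" using A3[OF k, of 1] by simp_all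
    have "idx (?J (Suc k)) (?N (?J k)) = a * \<nu> k"
      using idx_tower(2)[OF gJ gJ gN[OF gJ] NJJ int_span_mono s(1) finJNJ[OF k]] s(2) by (simp add: \<nu>_def)
    moreover have "idx (?J (Suc k)) (?N (?J k)) = \<nu> (Suc k) * a"
    proof -
      have "finite (cosets (?N (?J (Suc k))) (?N (?J k)))" "idx (?N (?J (Suc k))) (?N (?J k)) = a"
        using idx_scale[OF N0 gJ[of k], of "?J (Suc k)"] s by simp_all
      thus ?thesis using idx_tower(2)[OF gJ gN[OF gJ] gN[OF gJ] image_mono[OF int_span_mono] NJJ finJNJ] k
        by (simp add: \<nu>_def)
    qed
    ultimately show ?thesis using a0 by simp
  qed
  have \<nu>: "\<nu> (n + j) = \<nu> n" for j by (induction j) (simp_all add: \<nu>_step)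
  define e where "e = idx (?J n) (?N ?O)"
  have finJN: "finite (cosets (?J n) (?N ?O))" by (rule finite_cosets_subset[OF A2(1) JI])
  have "0 \<in> ?J n" using gJ by (simp add: add_subgroup_def)
  hence e0: "e > 0" unfolding e_def by (rule idx_pos[OF finJN])
  have main: "W ^ (n + j) * c = idx (?I (n + j)) (?J (n + j)) * a ^ j * e" for j
  proof -
    let ?k = "n + j"
    have f1: "finite (cosets (?I ?k) (?J ?k))"
      by (rule finite_cosets_mono[OF gJ gN[OF add_subgroup_O] NJ A2(1)]) simp
    have f2: "finite (cosets (?J ?k) (?N ?O))" by (rule finite_cosets_subset[OF A2(1) JI])
    have "idx (?J ?k) (?N ?O) = a ^ j * e"
      using idx_tower(2)[OF gJ gJ gN[OF add_subgroup_O] NJ int_span_mono _ finJN, of ?k] A3[of n j] by (simp add: e_def)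
    moreover have "idx (?I ?k) (?N ?O) = idx (?I ?k) (?J ?k) * idx (?J ?k) (?N ?O)"
      by (rule idx_tower(2)[OF gI gJ gN[OF add_subgroup_O] NJ JI f1 f2]) simp
    ultimately show ?thesis using A2(2)[of ?k] by (simp add: mult_ac)
  qed
  have theta1: "idx (?I (n + j)) (?J (n + j)) \<ge> 1" for j
  proof -
    have "0 \<in> ?I (n + j)" using gI by (simp add: add_subgroup_def)
    moreover have "finite (cosets (?I (n + j)) (?J (n + j)))"
      by (rule finite_cosets_mono[OF gJ gN[OF add_subgroup_O] NJ A2(1)]) simp
    ultimately have "idx (?I (n + j)) (?J (n + j)) > 0" by (intro idx_pos)
    thus ?thesis by simp
  qed
  \<comment> \<open>N times a coefficient lies in J_n, so N I_k lies in J_(k+n); after scaling by N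
    this bounds the index of J_k in I_k.\<close>
  have theta2: "idx (?I (n + j)) (?J (n + j)) \<le> a ^ n * \<nu> n" for j
  proof -
    let ?k = "n + j"
    have NI: "?N (?I ?k) \<subseteq> ?J (?k + n)"
    proof
      fix y assume "y \<in> ?N (?I ?k)"
      then obtain p where p: "polyover ?O p" "degree p \<le> ?k" "y = of_int N * poly p x" by (auto simp: ring_span_def)
      have "\<forall>i. \<exists>q. degree q \<le> n \<and> of_int N * coeff p i = poly (of_int_poly q) x"
      proof
        fix i
        have "of_int N * coeff p i \<in> ?J n" using N(2) p(1) by (auto simp: polyover_def)
        thus "\<exists>q. degree q \<le> n \<and> of_int N * coeff p i = poly (of_int_poly q) x" by (auto simp: int_span_def)
      qed
      then obtain q where q: "\<And>i. degree (q i) \<le> n" "\<And>i. of_int N * coeff p i = poly (of_int_poly (q i)) x" by metis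
      define P where "P = (\<Sum>i\<le>degree p. q i * monom 1 i)"
      have "degree P \<le> ?k + n" unfolding P_def
      proof (rule degree_sum_le)
        fix i assume i: "i \<in> {..degree p}"
        have "degree (q i * monom 1 i) \<le> n + i"
          by (rule order_trans[OF degree_mult_le add_mono[OF q(1) degree_monom_le]])
        thus "degree (q i * monom 1 i) \<le> ?k + n" using i p(2) by simp
      qed simp
      moreover have "y = poly (of_int_poly P) x"
        by (simp add: p(3) poly_altdef[of p] P_def sum_distrib_left of_int_poly_hom.hom_sum poly_sum hom_distribs
            of_int_poly_monom poly_monom q(2)[symmetric] mult.assoc)
      ultimately show "y \<in> ?J (?k + n)" unfolding int_span_def by blast
    qed
    have f1: "finite (cosets (?J (?k + n)) (?J ?k))" "idx (?J (?k + n)) (?J ?k) = a ^ n" using A3[of ?k n] by simp_all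
    have f2: "finite (cosets (?J ?k) (?N (?J ?k)))" by (rule finJNJ) simp
    note tw = idx_tower[OF gJ gJ gN[OF gJ] NJJ int_span_mono[of ?k "?k + n"] f1(1) f2]
    have "idx (?I ?k) (?J ?k) = idx (?N (?I ?k)) (?N (?J ?k))" using idx_scale(1)[OF N0 gJ] by simp
    also have "\<dots> \<le> idx (?J (?k + n)) (?N (?J ?k))"
      unfolding idx_def using tw(1) NI by (intro card_mono) (auto simp: cosets_def)
    also have "\<dots> = a ^ n * \<nu> n" using tw(2) f1(2) \<nu>[of j] by (simp add: \<nu>_def)
    finally show ?thesis .
  qed
  have "W \<le> a"
  proof (rule dominated_powers_le[of n])
    fix k assume "k \<ge> n"
    then obtain j where j: "k = n + j" using le_Suc_ex by blast
    have "W ^ k * c \<le> (a ^ n * \<nu> n) * a ^ j * e" unfolding j main by (intro mult_right_mono theta2) simp_all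
    also have "\<dots> = (\<nu> n * e) * a ^ k" by (simp add: j power_add mult_ac)
    finally show "W ^ k * c \<le> (\<nu> n * e) * a ^ k" .
  qed (use c0 a0 in auto)
  moreover have "a \<le> W"
  proof (rule dominated_powers_le[of n])
    fix k assume "k \<ge> n"
    then obtain j where j: "k = n + j" using le_Suc_ex by blast
    have "1 * a ^ j * e \<le> W ^ k * c" unfolding j main by (intro mult_right_mono theta1) simp_all
    hence "a ^ n * (a ^ j * e) \<le> a ^ n * (W ^ k * c)" by (intro mult_left_mono) simp_all
    thus "a ^ k * e \<le> (a ^ n * c) * W ^ k" by (simp add: j power_add mult_ac)
  next
    show "e > 0" by (rule e0)
  next
    have "D \<subseteq> ?O" by (auto simp: D_def)
    show "W > 0" unfolding W_def by (rule idx_pos[OF finD one])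
  qed
  ultimately show ?thesis by (simp add: W_def D_def a_def)
qed

section \<open>Places\<close>

lemma integers_of_simps [simp]:
  "carrier (integers_of (L :: 'a::field_char_0 set)) = ints L"
  "monoid.mult (integers_of L) = (*)"
  "ring.add (integers_of L) = (+)"
  "monoid.one (integers_of L) = 1"
  "ring.zero (integers_of L) = 0"
  by (simp_all add: integers_of_def ints_def)

lemma cring_integers_of:
  assumes "sring (ints (L :: 'a::field_char_0 set))"
  shows "cring (integers_of L)"
proof -
  interpret sring "ints L" by fact
  show ?thesis
  proof (rule cringI)
    show "abelian_group (integers_of L)"
    proof (rule abelian_groupI)
      fix x assume "x \<in> carrier (integers_of L)"
      thus "\<exists>y\<in>carrier (integers_of L). y \<oplus>\<^bsub>integers_of L\<^esub> x = \<zero>\<^bsub>integers_of L\<^esub>"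
        by (intro bexI[of _ "- x"]) (simp_all add: minus)
    qed (simp_all add: add algebra_simps)
    show "comm_monoid (integers_of L)" by (rule comm_monoidI) (simp_all add: mult mult_ac)
  qed (simp add: distrib_right)
qed

lemma a_inv_integers_of:
  assumes "sring (ints (L :: 'a::field_char_0 set))" "x \<in> ints L"
  shows "\<ominus>\<^bsub>integers_of L\<^esub> x = - x"
proof -
  interpret sring "ints L" by fact
  interpret cring "integers_of L" by (rule cring_integers_of[OF assms(1)])
  show ?thesis by (rule minus_equality) (use assms minus in simp_all)
qed

section \<open>Places of a number field in terms of ideals as plain sets\<close>

context
  fixes L :: "'a::field_char_0 set"
  assumes L: "int_ring (ints L)"
begin

interpretation int_ring "ints L" by (rule L)

lemma ideal_integers_of: "ideal I (integers_of L) \<longleftrightarrow> idl I"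
proof
  assume "ideal I (integers_of L)"
  then interpret i: ideal I "integers_of L" .
  have "I \<subseteq> ints L" "0 \<in> I" "\<And>x y. x \<in> I \<Longrightarrow> y \<in> I \<Longrightarrow> x + y \<in> I"
    "\<And>r x. x \<in> I \<Longrightarrow> r \<in> ints L \<Longrightarrow> r * x \<in> I"
    using i.a_subset additive_subgroup.zero_closed[OF i.is_additive_subgroup]
      additive_subgroup.a_closed[OF i.is_additive_subgroup] i.I_l_closed by (simp_all only: integers_of_simps)
  thus "idl I" unfolding idl_def by simp
next
  assume I: "idl I"
  interpret R: cring "integers_of L" by (rule cring_integers_of[OF sring_axioms])
  show "ideal I (integers_of L)"
  proof (rule idealI[OF R.ring_axioms])
    show "subgroup I (add_monoid (integers_of L))"
    proof (rule subgroup.intro)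
      fix x assume x: "x \<in> I"
      have "inv\<^bsub>add_monoid (integers_of L)\<^esub> x = - x"
        using a_inv_integers_of[OF sring_axioms, of x] x idl_sub[OF I] by (auto simp: a_inv_def)
      thus "inv\<^bsub>add_monoid (integers_of L)\<^esub> x \<in> I" using idl_minus[OF I x] by simp
    qed (use I in \<open>simp_all add: idl_sub idl_add idl_0\<close>)
  qed (use I in \<open>simp_all add: idl_mult idl_mult'\<close>)
qed

lemma finite_places_eq: "finite_places L = {P. prm P}"
proof -
  have "primeideal P (integers_of L) \<longleftrightarrow> idl P \<and> 1 \<notin> P \<and> (\<forall>a\<in>ints L. \<forall>b\<in>ints L. a * b \<in> P \<longrightarrow> a \<in> P \<or> b \<in> P)" for P
  proof
    assume "primeideal P (integers_of L)"
    then interpret p: primeideal P "integers_of L" .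
    have "idl P" using p.ideal_axioms ideal_integers_of by blast
    thus "idl P \<and> 1 \<notin> P \<and> (\<forall>a\<in>ints L. \<forall>b\<in>ints L. a * b \<in> P \<longrightarrow> a \<in> P \<or> b \<in> P)"
      using p.I_notcarr p.I_prime idl_eq_O[of P] by auto
  next
    assume P: "idl P \<and> 1 \<notin> P \<and> (\<forall>a\<in>ints L. \<forall>b\<in>ints L. a * b \<in> P \<longrightarrow> a \<in> P \<or> b \<in> P)"
    show "primeideal P (integers_of L)"
      by (rule primeidealI) (use P one in \<open>auto simp: ideal_integers_of cring_integers_of sring_axioms\<close>)
  qed
  thus ?thesis unfolding finite_places_def prm_def by auto
qed

lemma ideal_prod_integers_of: "ideal_prod (integers_of L) A B = iprod A B"
proof
  show "ideal_prod (integers_of L) A B \<subseteq> iprod A B"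
  proof
    fix x assume "x \<in> ideal_prod (integers_of L) A B"
    thus "x \<in> iprod A B" by induction (auto intro: iprod.intros)
  qed
  show "iprod A B \<subseteq> ideal_prod (integers_of L) A B"
    using ideal_prod.prod[of _ A _ B "integers_of L"] ideal_prod.sum[of _ "integers_of L" A B]
    by (intro iprod_subsetI) (simp_all only: integers_of_simps)
qed

lemma ideal_power_integers_of: "P [^]\<^bsub>ideals_set (integers_of L)\<^esub> k = ipow P k"
  by (induction k) (simp_all add: nat_pow_def ideals_set_def ideal_prod_integers_of)

lemma place_norm_eq: "place_norm L P = idx (ints L) P"
proof -
  have "a_rcosets\<^bsub>integers_of L\<^esub> P = cosets (ints L) P"
    unfolding A_RCOSETS_def' a_r_coset_def' cosets_def by (auto simp: add.commute image_def)
  thus ?thesis by (simp add: place_norm_def FactRing_def idx_def)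
qed

lemma int_ord_eq:
  assumes "prm P" "x \<in> ints L"
  shows "int_ord L P x = vp P ((*) x ` ints L)"
proof -
  have "x \<in> ipow P k \<longleftrightarrow> (*) x ` ints L \<subseteq> ipow P k" for k
    using principal_subset[OF idl_ipow[OF prm_idl[OF assms(1)]]] principal_mem[of x] by blast
  thus ?thesis by (simp add: int_ord_def vp_def ideal_power_integers_of)
qed

text \<open>From x = a / b follows a D = b (x D), an identity between products of integral ideals;
  so the exponents of a and b differ by as much as those of x D and D, whatever the
  fraction.\<close>

lemma place_ord_eq:
  assumes alg: "\<And>y::'a. algebraic y" and sL: "sfield L" and P: "prm P" and x: "x \<in> L" "x \<noteq> 0"
  defines "D \<equiv> {d \<in> ints L. d * x \<in> ints L}"
  shows "place_ord L P x = int (vp P ((*) x ` D)) - int (vp P D)"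
    and "idl D" "D \<noteq> {0}" "idl ((*) x ` D)" "(*) x ` D \<noteq> {0}"
proof -
  interpret F: sfield L by (rule sL)
  show D: "idl D" unfolding idl_def D_def by (auto simp: distrib_right mult.assoc intro: add mult)
  obtain m where m: "m \<noteq> (0::int)" "algebraic_int (of_int m * x)" using alg[of x] algebraic_iff_multiple by blast
  have mO: "of_int m \<in> ints L" "of_int m * x \<in> ints L" using m(2) x(1) by (auto simp: ints_def intro: F.mult)
  have mD: "of_int m \<in> D" unfolding D_def using mO by simp
  show Dnz: "D \<noteq> {0}" using mD m(1) by auto
  have "x * d \<in> ints L" if "d \<in> D" for d using that by (simp add: D_def mult.commute)
  thus xD: "idl ((*) x ` D)"
    unfolding idl_def
  proof (intro conjI ballI)
    show "0 \<in> (*) x ` D" using idl_0[OF D] by (intro image_eqI[of _ _ 0]) simp_all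
    fix y assume "y \<in> (*) x ` D"
    then obtain a where a: "a \<in> D" "y = x * a" by blast
    {
      fix z assume "z \<in> (*) x ` D"
      then obtain b where b: "b \<in> D" "z = x * b" by blast
      show "y + z \<in> (*) x ` D"
        by (rule image_eqI[of _ _ "a + b"]) (simp_all add: a b distrib_left idl_add[OF D])
    next
      fix r assume "r \<in> ints L"
      thus "r * y \<in> (*) x ` D"
        by (intro image_eqI[of _ _ "r * a"]) (simp_all add: a idl_mult[OF D] mult.left_commute)
    }
  qed blast
  have "x * of_int m \<in> (*) x ` D" using mD by blast
  moreover have "x * of_int m \<noteq> 0" using m(1) x(2) by simp
  ultimately show xDnz: "(*) x ` D \<noteq> {0}" by blast
  have val: "int (int_ord L P a) - int (int_ord L P b) = int (vp P ((*) x ` D)) - int (vp P D)"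
    if ab: "a \<in> ints L" "b \<in> ints L" "a \<noteq> 0" "b \<noteq> 0" "x = a / b" for a b
  proof -
    have nz: "(*) a ` ints L \<noteq> {0}" "(*) b ` ints L \<noteq> {0}"
      using principal_mem[of a] principal_mem[of b] ab(3,4) by blast+
    have ax: "a = b * x" using ab by simp
    have "iprod ((*) a ` ints L) D = (*) a ` D" by (rule iprod_principal[OF ab(1) D])
    also have "\<dots> = (*) b ` ((*) x ` D)" 
      unfolding image_image ax by (rule image_cong) (simp_all add: mult.assoc)
    also have "\<dots> = iprod ((*) b ` ints L) ((*) x ` D)" by (rule iprod_principal[OF ab(2) xD, symmetric])
    finally have "vp P (iprod ((*) a ` ints L) D) = vp P (iprod ((*) b ` ints L) ((*) x ` D))" by (rule arg_cong)
    hence "vp P ((*) a ` ints L) + vp P D = vp P ((*) b ` ints L) + vp P ((*) x ` D)"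
      by (simp only: vp_iprod[OF P idl_principal[OF ab(1)] nz(1) D Dnz] vp_iprod[OF P idl_principal[OF ab(2)] nz(2) xD xDnz])
    thus ?thesis by (simp add: int_ord_eq P ab)
  qed
  have ex: "\<exists>a b. a \<in> ints L \<and> b \<in> ints L \<and> a \<noteq> 0 \<and> b \<noteq> 0 \<and> x = a / b"
    using mO m(1) x(2) by (intro exI[of _ "of_int m * x"] exI[of _ "of_int m"]) simp
  show "place_ord L P x = int (vp P ((*) x ` D)) - int (vp P D)"
    unfolding place_ord_def integers_of_simps
  proof (rule the_equality)
    show "\<exists>a b. a \<in> ints L \<and> b \<in> ints L \<and> a \<noteq> 0 \<and> b \<noteq> 0 \<and> x = a / b \<and>
       int (vp P ((*) x ` D)) - int (vp P D) = int (int_ord L P a) - int (int_ord L P b)"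
      using ex val by metis
    fix n assume "\<exists>a b. a \<in> ints L \<and> b \<in> ints L \<and> a \<noteq> 0 \<and> b \<noteq> 0 \<and> x = a / b \<and> n = int (int_ord L P a) - int (int_ord L P b)"
    thus "n = int (vp P ((*) x ` D)) - int (vp P D)" using val by blast
  qed
qed

text \<open>The ideals D and x D are coprime, as s + t x = 1 with s and t in D. So the places where
  x has absolute value above 1 are exactly those dividing D, each with the exponent of D, and
  multiplicativity of the index assembles them.\<close>

lemma sum_finite_places:
  assumes alg: "\<And>y::'a. algebraic y" and sL: "sfield L" and x: "x \<in> L"
  defines "D \<equiv> {d \<in> ints L. d * x \<in> ints L}"
  shows "(\<Sum>P \<in> {P \<in> finite_places L. finite_abs L P x > 1}. ln (max 1 (finite_abs L P x))) = ln (real (idx (ints L) D))"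
proof (cases "x = 0")
  case True
  have "D = ints L" unfolding D_def True using zero by auto
  hence "idx (ints L) D = 1" using idx_self[OF add_subgroup_O] by simp
  moreover have "{P \<in> finite_places L. finite_abs L P x > 1} = {}" by (simp add: finite_abs_def True)
  ultimately show ?thesis by (simp only: sum.empty) simp
next
  case False
  note po = place_ord_eq[OF alg sL _ x False, folded D_def]
  have abs: "finite_abs L P x = real (idx (ints L) P) powr (int (vp P D) - int (vp P ((*) x ` D)))" if "prm P" for P
    unfolding finite_abs_def using po(1)[OF that] False by (simp add: place_norm_eq)
  have D: "idl D" "D \<noteq> {0}" "idl ((*) x ` D)" "(*) x ` D \<noteq> {0}" if "prm P" for P using po(2-)[OF that] by auto
  obtain s t where st: "s \<in> ints L" "t \<in> ints L" "s * x \<in> ints L" "t * x \<in> ints L" "s + t * x = 1"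
    using kronecker_invertible[OF sL x alg] by blast
  have co: "vp P D = 0 \<or> vp P ((*) x ` D) = 0" if P: "prm P" for P
  proof (rule ccontr)
    assume "\<not> ?thesis"
    hence "D \<subseteq> P" "(*) x ` D \<subseteq> P" using vp_0_iff[OF P] D[OF P] by auto
    moreover have "s \<in> D" "t \<in> D" using st by (auto simp: D_def)
    ultimately have "s \<in> P" "x * t \<in> P" by blast+
    hence "s + x * t \<in> P" using idl_add[OF prm_idl[OF P]] by blast
    hence "1 \<in> P" using st(5) by (simp add: mult.commute)
    thus False using P by (simp add: prm_def)
  qed
  have abs': "finite_abs L P x > 1 \<longleftrightarrow> D \<subseteq> P"
    "D \<subseteq> P \<Longrightarrow> ln (max 1 (finite_abs L P x)) = ln (real (idx (ints L) P ^ vp P D))" if P: "prm P" for P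
  proof -
    have N: "real (idx (ints L) P) > 1" using idx_prm_ge_2[OF P] by simp
    have iff: "D \<subseteq> P \<longleftrightarrow> vp P D \<noteq> 0" using vp_0_iff[OF P D(1,2)[OF P]] by simp
    show 1: "finite_abs L P x > 1 \<longleftrightarrow> D \<subseteq> P"
    proof
      assume DP: "D \<subseteq> P"
      hence "finite_abs L P x = real (idx (ints L) P) powr real (vp P D)" using co[OF P] iff abs[OF P] by auto
      thus "finite_abs L P x > 1" using N DP iff by (simp add: powr_realpow)
    next
      assume "finite_abs L P x > 1"
      hence "1 < real (idx (ints L) P) powr (int (vp P D) - int (vp P ((*) x ` D)))" by (simp only: abs[OF P])
      moreover have "real (idx (ints L) P) powr (int 0 - int v) \<le> 1" for v
      proof -
        have "real (idx (ints L) P) powr (int 0 - int v) \<le> real (idx (ints L) P) powr 0"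
          using N by (intro powr_mono) simp_all
        thus ?thesis using N by simp
      qed
      ultimately have "vp P D \<noteq> 0" by (metis not_le)
      thus "D \<subseteq> P" unfolding iff .
    qed
    assume DP: "D \<subseteq> P"
    hence "finite_abs L P x = real (idx (ints L) P) powr real (vp P D)" using co[OF P] iff abs[OF P] by auto
    thus "ln (max 1 (finite_abs L P x)) = ln (real (idx (ints L) P ^ vp P D))"
      using 1 DP N by (simp add: powr_realpow)
  qed
  define T where "T = {P. prm P \<and> D \<subseteq> P}"
  have eqT: "{P \<in> finite_places L. finite_abs L P x > 1} = T" unfolding finite_places_eq T_def using abs'(1) by blast
  have Dany: "idl D \<and> D \<noteq> {0}"
  proof (cases "\<exists>P. prm P")
    case True thus ?thesis using D by blast
  next
    case False
    obtain m where m: "m \<noteq> (0::int)" "algebraic_int (of_int m * x)" using alg[of x] algebraic_iff_multiple by blast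
    interpret F: sfield L by (rule sL)
    have "of_int m \<in> D" unfolding D_def using m(2) x by (auto simp: ints_def intro: F.mult)
    moreover have "idl D" unfolding idl_def D_def by (auto simp: distrib_right mult.assoc intro: add mult)
    ultimately show ?thesis using m(1) by auto
  qed
  have fin: "finite T" by (rule finite_subset[OF _ finite_idl_above[of D]]) (use Dany in \<open>auto simp: T_def prm_idl\<close>)
  have "(\<Sum>P\<in>T. ln (max 1 (finite_abs L P x))) = (\<Sum>P\<in>T. ln (real (idx (ints L) P ^ vp P D)))"
    using abs'(2) by (intro sum.cong) (auto simp: T_def)
  also have "\<dots> = ln (\<Prod>P\<in>T. real (idx (ints L) P ^ vp P D))"
  proof (rule ln_prod[symmetric, OF fin])
    fix P assume "P \<in> T"
    hence "idx (ints L) P \<ge> 2" using idx_prm_ge_2 by (simp add: T_def)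
    thus "real (idx (ints L) P ^ vp P D) \<noteq> 0" by simp
  qed
  also have "(\<Prod>P\<in>T. real (idx (ints L) P ^ vp P D)) = real (\<Prod>P\<in>T. idx (ints L) P ^ vp P D)"
    by (simp only: of_nat_prod)
  also have "(\<Prod>P\<in>T. idx (ints L) P ^ vp P D) = idx (ints L) D"
    by (rule idx_prime_factorization[symmetric]) (use Dany fin in \<open>auto simp: T_def\<close>)
  finally show ?thesis unfolding eqT .
qed

end

section \<open>The field generated by one element\<close>

lemma sfield_adjoin_Rats:
  assumes alg: "\<And>y::'a::field_char_0. algebraic y"
  shows "sfield (adjoin \<rat> (x::'a))"
proof -
  interpret Q: sfield "\<rat> :: 'a set" by (rule sfield_Rats)
  show ?thesis by (rule sfield_if_algebraic[OF Q.sring_adjoin Q.subset_adjoin alg])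
qed

lemma generate_field_singleton:
  assumes alg: "\<And>y::'a::field_char_0. algebraic y"
  shows "generate_field ambient {x::'a} = adjoin \<rat> x"
proof (rule generate_field_eq[OF sfield_adjoin_Rats[OF alg]])
  interpret Q: sfield "\<rat> :: 'a set" by (rule sfield_Rats)
  show "{x} \<subseteq> adjoin \<rat> x" using Q.in_adjoin by simp
  fix S :: "'a set" assume S: "sfield S" "{x} \<subseteq> S"
  interpret S: sfield S by (rule S(1))
  show "adjoin \<rat> x \<subseteq> S" using S(2) S.Rats S.sring_axioms by (intro Q.adjoin_subset) auto
qed

lemma adjoin_Rats_dimension:
  assumes alg: "\<And>y::'a::field_char_0. algebraic y"
  shows "number_field (adjoin \<rat> (x::'a))" and "nf_degree (adjoin \<rat> x) = degree (min_int_poly x)"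
proof -
  interpret A: field "ambient :: 'a ring" by (rule field_ambient)
  interpret Q: sfield "\<rat> :: 'a set" by (rule sfield_Rats)
  have sQ: "subfield (\<rat> :: 'a set) ambient" by (rule subfield_if_sfield[OF sfield_Rats])
  define g where "g = smult (inverse (of_int (lead_coeff (min_int_poly x)))) (of_int_poly (min_int_poly x) :: 'a poly)"
  have g: "minpoly_over \<rat> x g" unfolding g_def by (rule minpoly_over_Rats[OF alg])
  hence gS: "polyover \<rat> g" "monic g" "poly g x = 0" by (auto simp: minpoly_over_def)
  define d where "d = degree g"
  have "lead_coeff (min_int_poly x) > 0" by (rule min_int_poly_lead[OF alg])
  hence d: "d = degree (min_int_poly x)" by (simp add: d_def g_def of_int_hom.degree_map_poly_hom)
  define Us where "Us = map (\<lambda>i. x ^ i) [0..<d]"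
  \<comment> \<open>The factor y absorbs one power of x per step of the induction;
    \<open>combine\<close> ignores surplus coefficients, hence \<open>take n\<close>.\<close>
  have combine_powers: "A.combine Ks (map (\<lambda>i. y * x ^ i) [0..<n]) = y * poly (Poly (take n Ks)) x" for Ks y n
  proof (induction Ks arbitrary: y n)
    case (Cons k Ks)
    show ?case
    proof (cases n)
      case (Suc l)
      have "map (\<lambda>i. y * x ^ i) [0..<n] = y * x ^ 0 # map (\<lambda>i. y * x ^ i) (map Suc [0..<l])"
        unfolding Suc map_Suc_upt by (simp only: upt_rec[of 0 "Suc l"]) simp
      hence "map (\<lambda>i. y * x ^ i) [0..<n] = y # map (\<lambda>i. (y * x) * x ^ i) [0..<l]"
        by (simp add: o_def mult.assoc)
      thus ?thesis using Cons[of "y * x" l] by (simp add: Suc algebra_simps)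
    qed simp
  qed simp
  have comb: "A.combine Ks Us = poly (Poly (take d Ks)) x" for Ks
    using combine_powers[of Ks 1 d] by (simp add: Us_def)
  have pS: "polyover \<rat> (Poly (take d Ks))" if "set Ks \<subseteq> \<rat>" for Ks :: "'a list"
  proof -
    have "nth_default 0 (take d Ks) i \<in> \<rat>" for i
    proof (cases "i < length (take d Ks)")
      case True
      hence "nth_default 0 (take d Ks) i = Ks ! i" "Ks ! i \<in> set Ks" by (simp_all add: nth_default_def)
      thus ?thesis using that by auto
    next
      case False
      hence "nth_default 0 (take d Ks) i = 0" by (intro nth_default_beyond) (simp only: not_less)
      thus ?thesis by simp
    qed
    thus ?thesis by (simp add: polyover_def)
  qed
  have "A.independent \<rat> Us"
  proof (rule A.trivial_combine_imp_independent[OF sQ])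
    fix Ks assume Ks: "set Ks \<subseteq> \<rat>" "A.combine Ks Us = \<zero>\<^bsub>ambient\<^esub>"
    define p where "p = Poly (take d Ks)"
    have p: "polyover \<rat> p" "poly p x = 0" using pS[OF Ks(1)] comb[of Ks] Ks(2) by (simp_all add: p_def)
    then obtain q where q: "p = g * q" using g unfolding minpoly_over_def by blast
    have "p = 0"
    proof (rule ccontr)
      assume nz: "p \<noteq> 0"
      hence "d \<le> degree p" using q gS(2) by (auto simp: degree_mult_eq d_def)
      moreover have "degree p < length (take d Ks)"
      proof (rule ccontr)
        assume "\<not> ?thesis"
        hence "nth_default 0 (take d Ks) (degree p) = 0" by (intro nth_default_beyond) (simp only: not_less)
        hence "coeff p (degree p) = 0" by (simp only: p_def coeff_Poly_eq)
        thus False using nz by simp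
      qed
      ultimately show False by simp
    qed
    then obtain k where "take d Ks = replicate k 0" by (auto simp: p_def Poly_eq_0)
    moreover have "length Us = d" by (simp add: Us_def)
    ultimately show "set (take (length Us) Ks) \<subseteq> {\<zero>\<^bsub>ambient\<^esub>}" by auto
  qed simp
  hence "A.dimension (length Us) \<rat> (A.Span \<rat> Us)" by (rule A.dimension_independent)
  moreover have "A.Span \<rat> Us = adjoin \<rat> x"
  proof -
    have "A.Span \<rat> Us = {A.combine Ks Us | Ks. length Ks = length Us \<and> set Ks \<subseteq> \<rat>}"
      by (rule A.Span_eq_combine_set_length_version[OF sQ]) simp
    also have "\<dots> = adjoin \<rat> x"
    proof
      show "{A.combine Ks Us | Ks. length Ks = length Us \<and> set Ks \<subseteq> \<rat>} \<subseteq> adjoin \<rat> x"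
        unfolding adjoin_def using comb pS by blast
      show "adjoin \<rat> x \<subseteq> {A.combine Ks Us | Ks. length Ks = length Us \<and> set Ks \<subseteq> \<rat>}"
      proof
        fix y assume "y \<in> adjoin \<rat> x"
        then obtain p where p: "polyover \<rat> p" "y = poly p x" by (auto simp: adjoin_def)
        obtain q r where qr: "polyover \<rat> r" "p = g * q + r" "r = 0 \<or> degree r < degree g"
          using Q.polyover_divmod[OF gS(1,2) p(1)] by auto
        define Ks where "Ks = map (coeff r) [0..<d]"
        have "Poly (take d Ks) = r"
        proof (rule poly_eqI)
          fix i show "coeff (Poly (take d Ks)) i = coeff r i"
            using qr(3) by (auto simp: Ks_def nth_default_def d_def coeff_eq_0)
        qed
        hence "A.combine Ks Us = y" using comb[of Ks] qr(2) gS(3) p(2) by simp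
        moreover have "length Ks = length Us" "set Ks \<subseteq> \<rat>" using qr(1) by (auto simp: Ks_def Us_def polyover_def)
        ultimately show "y \<in> {A.combine Ks Us | Ks. length Ks = length Us \<and> set Ks \<subseteq> \<rat>}" by blast
      qed
    qed
    finally show ?thesis .
  qed
  moreover have "length Us = d" by (simp add: Us_def)
  ultimately have dim: "A.dimension d \<rat> (adjoin \<rat> x)" by simp
  show "number_field (adjoin \<rat> x)" unfolding number_field_def
    using subfield_if_sfield[OF sfield_adjoin_Rats[OF alg]] A.finite_dimensionI[OF dim] by blast
  show "nf_degree (adjoin \<rat> x) = degree (min_int_poly x)" unfolding nf_degree_def
    using A.dimI[OF sQ dim] by (simp add: d over_def)
qed

lemma sum_proots_simple:
  fixes p :: "complex poly" and f :: "complex \<Rightarrow> real"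
  assumes "p \<noteq> 0" "\<And>r. poly p r = 0 \<Longrightarrow> poly (pderiv p) r \<noteq> 0"
  shows "(\<Sum>r\<in>#proots p. f r) = (\<Sum>r | poly p r = 0. f r)"
proof -
  have "count (proots p) r = (if poly p r = 0 then 1 else 0)" for r
  proof (cases "poly p r = 0")
    case True
    hence "order r p = Suc (order r (pderiv p))" by (rule order_pderiv[OF assms(1)])
    moreover have "order r (pderiv p) = 0" using assms(2)[OF True] by (intro order_0I)
    ultimately show ?thesis using True assms(1) by simp
  qed (use assms(1) in \<open>simp add: order_0I\<close>)
  hence "proots p = mset_set {r. poly p r = 0}"
    using poly_roots_finite[OF assms(1)] by (intro multiset_eqI) simp
  thus ?thesis by (simp add: sum_unfold_sum_mset)
qed

text \<open>An embedding is determined by the image of x, a root of the minimal polynomial, and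
  every root occurs. The roots are simple, so the multiset of roots is the set of images.\<close>

lemma sum_complex_embeddings:
  fixes f :: "complex \<Rightarrow> real"
  assumes alg: "\<And>y::'a::field_char_0. algebraic y"
  shows "(\<Sum>\<sigma> \<in> complex_embeddings (adjoin \<rat> (x::'a)). f (\<sigma> x)) = (\<Sum>r\<in>#proots (of_int_poly (min_int_poly x)). f r)"
proof -
  let ?L = "adjoin \<rat> x" and ?F = "min_int_poly x"
  interpret Q: sfield "\<rat> :: 'a set" by (rule sfield_Rats)
  have sL: "sfield ?L" by (rule sfield_adjoin_Rats[OF alg])
  interpret L: sfield ?L by (rule sL)
  have xL: "x \<in> ?L" by (rule Q.in_adjoin)
  have emb: "\<sigma> \<in> complex_embeddings ?L \<longleftrightarrow> hom_on ?L \<sigma> \<and> \<sigma> \<in> extensional ?L" for \<sigma>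
  proof
    assume s: "\<sigma> \<in> complex_embeddings ?L"
    hence h: "\<sigma> \<in> Ring.ring_hom (ambient\<lparr>carrier := ?L\<rparr>) ambient" and e: "\<sigma> \<in> extensional ?L"
      by (auto simp: complex_embeddings_def)
    have "\<sigma> (0 + 0) = \<sigma> 0 + \<sigma> 0" using ring_hom_add[OF h, of 0 0] by simp
    hence "\<sigma> 0 = 0" by simp
    moreover have "\<sigma> 1 = 1" using ring_hom_one[OF h] by simp
    ultimately show "hom_on ?L \<sigma> \<and> \<sigma> \<in> extensional ?L"
      unfolding hom_on_def using ring_hom_add[OF h] ring_hom_mult[OF h] e by simp
  next
    assume "hom_on ?L \<sigma> \<and> \<sigma> \<in> extensional ?L"
    thus "\<sigma> \<in> complex_embeddings ?L"
      unfolding complex_embeddings_def hom_on_def by (auto intro!: Ring.ring_hom_memI)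
  qed
  have hs: "hom_sfield ?L \<sigma>" if "hom_on ?L \<sigma>" for \<sigma> :: "'a \<Rightarrow> complex"
    using that sL by (simp add: hom_sfield_def hom_sring_def hom_sring_axioms_def sfield_def)
  define \<phi> where "\<phi> = (\<lambda>y::'a. of_rat (inv_into UNIV of_rat y) :: complex)"
  have fam0: "conj_family (\<rat> :: 'a set) [\<phi>]" unfolding \<phi>_def by (rule conj_family_Rats)
  interpret h: hom_sfield "\<rat> :: 'a set" \<phi> using conj_family_hom[OF fam0, of 0] by simp
  have \<phi>: "\<sigma> q = \<phi> q" if "hom_on ?L \<sigma>" "q \<in> \<rat>" for \<sigma> q
  proof -
    interpret s: hom_sfield ?L \<sigma> by (rule hs[OF that(1)])
    show ?thesis using that(2) by (elim Rats_cases) simp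
  qed
  have bij: "bij_betw (\<lambda>\<sigma>. \<sigma> x) (complex_embeddings ?L) {r. poly (of_int_poly ?F) r = 0}"
    unfolding bij_betw_def
  proof
    show "inj_on (\<lambda>\<sigma>. \<sigma> x) (complex_embeddings ?L)"
    proof (rule inj_onI)
      fix \<sigma> \<tau> assume st: "\<sigma> \<in> complex_embeddings ?L" "\<tau> \<in> complex_embeddings ?L" "\<sigma> x = \<tau> x"
      hence h: "hom_on ?L \<sigma>" "hom_on ?L \<tau>" and e: "\<sigma> \<in> extensional ?L" "\<tau> \<in> extensional ?L" unfolding emb by auto
      interpret s: hom_sfield ?L \<sigma> by (rule hs[OF h(1)])
      interpret t: hom_sfield ?L \<tau> by (rule hs[OF h(2)])
      show "\<sigma> = \<tau>"
      proof (rule extensionalityI[OF e])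
        fix y assume "y \<in> ?L"
        then obtain p where p: "polyover \<rat> p" "y = poly p x" by (auto simp: adjoin_def)
        have pL: "polyover ?L p" using p(1) L.Rats by (auto simp: polyover_def)
        have "map_poly \<sigma> p = map_poly \<tau> p"
          by (rule poly_eqI) (use p(1) \<phi>[OF h(1)] \<phi>[OF h(2)] in \<open>simp add: polyover_def\<close>)
        thus "\<sigma> y = \<tau> y" using s.hom_poly[OF pL xL] t.hom_poly[OF pL xL] st(3) p(2) by simp
      qed
    qed
    show "(\<lambda>\<sigma>. \<sigma> x) ` complex_embeddings ?L = {r. poly (of_int_poly ?F) r = 0}"
    proof
      show "(\<lambda>\<sigma>. \<sigma> x) ` complex_embeddings ?L \<subseteq> {r. poly (of_int_poly ?F) r = 0}"
      proof
        fix r assume "r \<in> (\<lambda>\<sigma>. \<sigma> x) ` complex_embeddings ?L"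
        then obtain \<sigma> where s: "hom_on ?L \<sigma>" "r = \<sigma> x" unfolding emb image_iff Bex_def by blast
        interpret s: hom_sfield ?L \<sigma> by (rule hs[OF s(1)])
        show "r \<in> {r. poly (of_int_poly ?F) r = 0}"
          using s.hom_poly[of "of_int_poly ?F" x] xL min_int_poly_root[OF alg] s(2) by simp
      qed
      show "{r. poly (of_int_poly ?F) r = 0} \<subseteq> (\<lambda>\<sigma>. \<sigma> x) ` complex_embeddings ?L"
      proof
        fix r :: complex assume "r \<in> {r. poly (of_int_poly ?F) r = 0}"
        hence r: "poly (of_int_poly ?F) r = 0" by simp
        note g = minpoly_over_Rats[OF alg[of x]]
        have r': "poly (map_poly \<phi> (smult (inverse (of_int (lead_coeff ?F))) (of_int_poly ?F))) r = 0"
        proof -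
          have "map_poly \<phi> (smult (inverse (of_int (lead_coeff ?F))) (of_int_poly ?F)) = smult (inverse (of_int (lead_coeff ?F))) (of_int_poly ?F)"
            by (rule poly_eqI) (simp add: h.hom_mult h.hom_inverse)
          thus ?thesis using r by simp
        qed
        note he = h.hom_on_hom_ext[OF g r'] and hx = h.hom_ext_gen[OF g r']
        have "restrict (hom_ext \<rat> x \<phi> r) ?L \<in> complex_embeddings ?L"
          unfolding emb using he by (auto simp: hom_on_def L.add L.mult)
        moreover have "r = restrict (hom_ext \<rat> x \<phi> r) ?L x" using hx xL by simp
        ultimately show "r \<in> (\<lambda>\<sigma>. \<sigma> x) ` complex_embeddings ?L" by blast
      qed
    qed
  qed
  have "(\<Sum>\<sigma> \<in> complex_embeddings ?L. f (\<sigma> x)) = (\<Sum>r | poly (of_int_poly ?F) r = 0. f r)"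
    by (rule sum.reindex_bij_betw[OF bij])
  also have "\<dots> = (\<Sum>r\<in>#proots (of_int_poly ?F). f r)"
  proof (rule sum_proots_simple[symmetric])
    show "(of_int_poly ?F :: complex poly) \<noteq> 0" using min_int_poly_nz[OF alg[of x]] by simp
    fix r :: complex assume r: "poly (of_int_poly ?F) r = 0"
    note u = min_int_poly_unique[OF min_int_poly_irreducible[OF alg] min_int_poly_lead[OF alg] r]
    show "poly (pderiv (of_int_poly ?F)) r \<noteq> 0" using min_int_poly_pderiv[OF u(2)] u(1) by simp
  qed
  finally show ?thesis .
qed

theorem weil_height_eq_ht:
  assumes alg: "\<And>y::'a::field_char_0. algebraic y"
  shows "weil_height (x::'a) = ht x"
proof -
  let ?L = "adjoin \<rat> x" and ?F = "min_int_poly x"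
  note nf = adjoin_Rats_dimension[OF alg, of x]
  interpret Q: sfield "\<rat> :: 'a set" by (rule sfield_Rats)
  have xL: "x \<in> ?L" by (rule Q.in_adjoin)
  have a: "lead_coeff ?F > 0" by (rule min_int_poly_lead[OF alg])
  have "(\<Sum>P \<in> {P \<in> finite_places ?L. finite_abs ?L P x > 1}. ln (max 1 (finite_abs ?L P x))) = ln (real_of_int (lead_coeff ?F))"
    using sum_finite_places[OF int_ring_ints[OF nf(1)] alg sfield_adjoin_Rats[OF alg] xL] idx_denominator[OF alg nf(1)] a
    by simp
  moreover have "log_mahler (of_int_poly ?F) = ln (real_of_int (lead_coeff ?F)) + (\<Sum>r\<in>#proots (of_int_poly ?F). ln (max 1 (cmod r)))"
    using a by (simp add: log_mahler_def of_int_hom.degree_map_poly_hom)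
  ultimately show ?thesis
    unfolding weil_height_def height_via_def generate_field_singleton[OF alg] ht_def nf(2)
      sum_complex_embeddings[OF alg, where f = "\<lambda>r. ln (max 1 (cmod r))"]
    by simp
qed

section \<open>Congruences modulo 2\<close>

text \<open>Congruence modulo 2 in the ring of all algebraic integers, so that numbers from
  different fields can be compared; x and y themselves may have denominators.\<close>

definition cong2 :: "'a::field_char_0 \<Rightarrow> 'a \<Rightarrow> bool" where
  "cong2 x y \<longleftrightarrow> (\<exists>w. algebraic_int w \<and> x - y = 2 * w)"

lemma cong2I: "algebraic_int w \<Longrightarrow> x - y = 2 * w \<Longrightarrow> cong2 x y"
  unfolding cong2_def by blast

lemma cong2_refl [simp]: "cong2 x x" by (rule cong2I[of 0]) auto

lemma cong2_sym: "cong2 x y \<Longrightarrow> cong2 y x"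
proof -
  assume "cong2 x y"
  then obtain w where "algebraic_int w" "x - y = 2 * w" by (auto simp: cong2_def)
  thus ?thesis by (intro cong2I[of "- w"]) (auto simp: algebra_simps)
qed

lemma cong2_trans [trans]: "cong2 x y \<Longrightarrow> cong2 y z \<Longrightarrow> cong2 x z"
proof -
  assume "cong2 x y" "cong2 y z"
  then obtain v w where "algebraic_int v" "x - y = 2 * v" "algebraic_int w" "y - z = 2 * w" by (auto simp: cong2_def)
  thus ?thesis by (intro cong2I[of "v + w"]) (auto simp: algebra_simps)
qed

lemma cong2_add: "cong2 x y \<Longrightarrow> cong2 x' y' \<Longrightarrow> cong2 (x + x') (y + y')"
proof -
  assume "cong2 x y" "cong2 x' y'"
  then obtain v w where "algebraic_int v" "x - y = 2 * v" "algebraic_int w" "x' - y' = 2 * w" by (auto simp: cong2_def)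
  thus ?thesis by (intro cong2I[of "v + w"]) (auto simp: algebra_simps)
qed

lemma cong2_scale: "algebraic_int a \<Longrightarrow> cong2 x y \<Longrightarrow> cong2 (a * x) (a * y)"
proof -
  assume a: "algebraic_int a" and "cong2 x y"
  then obtain w where "algebraic_int w" "x - y = 2 * w" by (auto simp: cong2_def)
  thus ?thesis using a by (intro cong2I[of "a * w"]) (auto simp: right_diff_distrib[symmetric])
qed

lemma cong2_mult:
  assumes "algebraic_int x" "algebraic_int y'" "cong2 x y" "cong2 x' y'"
  shows "cong2 (x * x') (y * y')"
proof -
  have "cong2 (x * x') (x * y')" by (rule cong2_scale[OF assms(1,4)])
  also have "cong2 (x * y') (y * y')" using cong2_scale[OF assms(2,3)] by (simp add: mult.commute)
  finally show ?thesis .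
qed

lemma cong2_power: "algebraic_int x \<Longrightarrow> algebraic_int y \<Longrightarrow> cong2 x y \<Longrightarrow> cong2 (x ^ n) (y ^ n)"
  by (induction n) (auto intro!: cong2_mult)

lemma cong2_sum: "(\<And>i. i \<in> I \<Longrightarrow> cong2 (f i) (g i)) \<Longrightarrow> cong2 (sum f I) (sum g I)"
  by (induction I rule: infinite_finite_induct) (auto intro: cong2_add)

lemma cong2_square_add:
  assumes "algebraic_int x" "algebraic_int y" shows "cong2 ((x + y)\<^sup>2) (x\<^sup>2 + y\<^sup>2)"
  by (rule cong2I[of "x * y"]) (use assms in \<open>auto simp: power2_eq_square algebra_simps\<close>)

lemma cong2_frobenius_add:
  assumes x: "algebraic_int x" and y: "algebraic_int y"
  shows "cong2 ((x + y) ^ 2 ^ m) (x ^ 2 ^ m + y ^ 2 ^ m)"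
proof (induction m)
  case (Suc m)
  have "cong2 (((x + y) ^ 2 ^ m)\<^sup>2) ((x ^ 2 ^ m + y ^ 2 ^ m)\<^sup>2)"
    using Suc x y by (intro cong2_power) auto
  also have "cong2 \<dots> ((x ^ 2 ^ m)\<^sup>2 + (y ^ 2 ^ m)\<^sup>2)" using x y by (intro cong2_square_add) auto
  finally show ?case by (simp add: power_mult[symmetric] mult.commute)
qed simp

lemma cong2_frobenius_sum:
  assumes "\<And>i. i \<in> I \<Longrightarrow> algebraic_int (f i)"
  shows "cong2 ((\<Sum>i\<in>I. f i) ^ 2 ^ m) (\<Sum>i\<in>I. f i ^ 2 ^ m)"
  using assms
proof (induction I rule: infinite_finite_induct)
  case (insert i I)
  have "cong2 ((f i + sum f I) ^ 2 ^ m) (f i ^ 2 ^ m + (sum f I) ^ 2 ^ m)"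
    using insert by (intro cong2_frobenius_add algebraic_int_sum) auto
  also have "cong2 \<dots> (f i ^ 2 ^ m + (\<Sum>i\<in>I. f i ^ 2 ^ m))" using insert by (intro cong2_add) auto
  finally show ?case using insert by simp
qed (simp_all add: zero_power)

section \<open>Frobenius on the ring of integers of an unramified field\<close>

text \<open>Let A consist of the integers y with y x divisible by 2; it contains 2 and x. If A were
  proper, a prime P above it would divide 2 exactly once, 2 O = P B, and any b in B outside P would
  satisfy x b in P B = 2 O, that is b in A.\<close>

lemma unramified_reduced:
  assumes K: "number_field K" and unr: "unramified_above K 2" and x: "x \<in> ints K" and sq: "cong2 (x\<^sup>2) 0"
  shows "cong2 x (0::'a::field_char_0)"
proof -
  interpret int_ring "ints K" by (rule int_ring_ints[OF K])
  have sK: "sfield K" using K sfield_if_subfield by (auto simp: number_field_def)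
  interpret F: sfield K by (rule sK)
  have two: "(2::'a) \<in> ints K" using of_nat[of 2] by simp
  define A where "A = {y \<in> ints K. y * x \<in> (*) 2 ` ints K}"
  have mem: "y \<in> (*) 2 ` ints K" if y: "y \<in> ints K" "cong2 y 0" for y
  proof -
    obtain w where w: "algebraic_int w" "y = 2 * w" using y(2) by (auto simp: cong2_def)
    have "y \<in> K" using y(1) by (simp add: ints_def)
    hence "y / of_nat 2 \<in> K" by (intro F.divide F.of_nat)
    hence "w \<in> ints K" using w by (simp add: ints_def)
    thus ?thesis using w(2) by blast
  qed
  note i2 = idl_principal[OF two]
  have A: "idl A" unfolding idl_def
    using x idl_0[OF i2] idl_add[OF i2] idl_mult[OF i2] by (auto simp: A_def distrib_right mult.assoc add mult)
  have A2: "2 \<in> A" unfolding A_def using two x by auto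
  hence A0: "A \<noteq> {0}" by auto
  have xA: "x \<in> A" using x mem[OF mult[OF x x]] sq by (simp add: A_def power2_eq_square)
  have "1 \<in> A"
  proof (rule ccontr)
    assume "1 \<notin> A"
    then obtain P where P: "prm P" "A \<subseteq> P" using prime_above[OF A A0] by blast
    have n2: "(*) 2 ` ints K \<noteq> {0}"
    proof
      assume "(*) 2 ` ints K = {0::'a}"
      moreover have "2 * 1 \<in> (*) (2::'a) ` ints K" using one by blast
      ultimately show False by simp
    qed
    obtain k B where B: "idl B" "(*) 2 ` ints K = iprod (ipow P k) B" "\<not> B \<subseteq> P"
      using prm_decomposition[OF P(1) i2 n2] by blast
    have "P \<in> finite_places K" using P(1) finite_places_eq[OF int_ring_axioms] by simp
    hence "int_ord K P 2 = 1" using unr P(2) A2 by (auto simp: unramified_above_def ramification_index_def)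
    hence "vp P ((*) 2 ` ints K) = 1" using int_ord_eq[OF int_ring_axioms P(1) two] by simp
    hence k: "k = 1" using vp_eqI(1)[OF P(1) B(1,3,2)] by simp
    obtain b where b: "b \<in> B" "b \<notin> P" using B(3) by blast
    have "x * b \<in> iprod P B" using xA P(2) b(1) by (intro iprod.mult) auto
    also have "iprod P B = (*) 2 ` ints K" using B(2) k iprod_O[OF prm_idl[OF P(1)]] by simp
    finally have "b \<in> A" using idl_sub[OF B(1)] b(1) by (auto simp: A_def mult.commute)
    thus False using b(2) P(2) by blast
  qed
  then obtain w where "w \<in> ints K" "x = 2 * w" by (auto simp: A_def)
  thus ?thesis by (intro cong2I[of w]) (simp_all add: ints_def)
qed

lemma finite_cong2_classes:
  assumes K: "number_field (K :: 'a::field_char_0 set)"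
  shows "\<exists>cl :: 'a \<Rightarrow> 'a set. finite (cl ` ints K) \<and> (\<forall>x\<in>ints K. \<forall>y\<in>ints K. cl x = cl y \<longrightarrow> cong2 x y)"
    and "\<exists>T. finite T \<and> T \<subseteq> ints K \<and> (\<forall>x\<in>ints K. \<exists>t\<in>T. cong2 x t)"
proof -
  interpret int_ring "ints K" by (rule int_ring_ints[OF K])
  have two: "(2::'a) \<in> ints K" using of_nat[of 2] by simp
  define cl where "cl x = (+) x ` ((*) (2::'a) ` ints K)" for x
  have "finite (cosets (ints K) ((*) 2 ` ints K))" by (rule finite_quotient[OF two]) simp
  hence fin: "finite (cl ` ints K)" by (simp add: cosets_def cl_def)
  have cl: "cong2 x y" if "cl x = cl y" for x y
  proof -
    have "x - y \<in> (*) 2 ` ints K" using that coset_eq_iff[OF idl_add_subgroup[OF idl_principal[OF two]]] by (simp add: cl_def)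
    thus ?thesis by (auto simp: cong2_def ints_def)
  qed
  show "\<exists>cl :: 'a \<Rightarrow> 'a set. finite (cl ` ints K) \<and> (\<forall>x\<in>ints K. \<forall>y\<in>ints K. cl x = cl y \<longrightarrow> cong2 x y)"
    using fin cl by blast
  obtain T where T: "finite T" "T \<subseteq> ints K" "cl ` ints K = cl ` T"
    using finite_subset_image[OF fin, of cl "ints K"] by auto
  have "\<exists>t\<in>T. cong2 x t" if "x \<in> ints K" for x
  proof -
    have "cl x \<in> cl ` T" using that T(3) by blast
    thus ?thesis using cl by blast
  qed
  thus "\<exists>T. finite T \<and> T \<subseteq> ints K \<and> (\<forall>x\<in>ints K. \<exists>t\<in>T. cong2 x t)" using T by blast
qed

text \<open>Squaring is injective modulo 2 by \<open>unramified_reduced\<close>, and there are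
  finitely many classes, so two iterates of squaring agree on representatives; cancelling the
  smaller one leaves a power of Frobenius that is the identity.\<close>

lemma frobenius_period:
  assumes K: "number_field (K :: 'a::field_char_0 set)" and unr: "unramified_above K 2"
  shows "\<exists>m>0. \<forall>x\<in>ints K. cong2 (x ^ 2 ^ m) x"
proof -
  have "sring K" using K sfield_if_subfield by (auto simp: number_field_def sfield_def)
  then interpret sring "ints K" by (rule sring_ints)
  have ai: "x \<in> ints K \<Longrightarrow> algebraic_int x" for x by (simp add: ints_def)
  have inj2: "cong2 x y" if xy: "x \<in> ints K" "y \<in> ints K" "cong2 (x\<^sup>2) (y\<^sup>2)" for x y
  proof -
    obtain w where w: "algebraic_int w" "x\<^sup>2 - y\<^sup>2 = 2 * w" using xy(3) by (auto simp: cong2_def)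
    have "(x - y)\<^sup>2 = (x\<^sup>2 - y\<^sup>2) - 2 * (y * (x - y))" by (simp add: power2_eq_square algebra_simps)
    hence "(x - y)\<^sup>2 - 0 = 2 * (w - y * (x - y))" using w(2) by (simp add: algebra_simps)
    moreover have "algebraic_int (w - y * (x - y))" using w(1) ai[OF xy(1)] ai[OF xy(2)] by auto
    ultimately have "cong2 ((x - y)\<^sup>2) 0" by (intro cong2I)
    hence "cong2 (x - y) 0" by (rule unramified_reduced[OF K unr diff[OF xy(1,2)]])
    thus ?thesis by (simp add: cong2_def)
  qed
  have inj: "cong2 x y" if "x \<in> ints K" "y \<in> ints K" "cong2 (x ^ 2 ^ i) (y ^ 2 ^ i)" for x y i
    using that
  proof (induction i)
    case (Suc i)
    have "cong2 ((x ^ 2 ^ i)\<^sup>2) ((y ^ 2 ^ i)\<^sup>2)" using Suc.prems(3) by (simp add: power_mult[symmetric] mult.commute)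
    hence "cong2 (x ^ 2 ^ i) (y ^ 2 ^ i)" by (rule inj2[OF power[OF Suc.prems(1)] power[OF Suc.prems(2)]])
    thus ?case using Suc by blast
  qed simp
  obtain cl :: "'a \<Rightarrow> 'a set" where cl: "finite (cl ` ints K)" "\<And>x y. x \<in> ints K \<Longrightarrow> y \<in> ints K \<Longrightarrow> cl x = cl y \<Longrightarrow> cong2 x y"
    using finite_cong2_classes(1)[OF K] by blast
  obtain T where T: "finite T" "T \<subseteq> ints K" "\<And>x. x \<in> ints K \<Longrightarrow> \<exists>t\<in>T. cong2 x t"
    using finite_cong2_classes(2)[OF K] by blast
  define \<Phi> where "\<Phi> i = restrict (\<lambda>t. cl (t ^ 2 ^ i)) T" for i :: nat
  have "range \<Phi> \<subseteq> (\<Pi>\<^sub>E t\<in>T. cl ` ints K)" using T(2) by (auto simp: \<Phi>_def intro!: power imageI)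
  moreover have "finite (\<Pi>\<^sub>E t\<in>T. cl ` ints K)" using T(1) cl(1) by (intro finite_PiE)
  ultimately have "finite (range \<Phi>)" by (rule finite_subset)
  hence "\<not> inj \<Phi>" using finite_imageD infinite_UNIV_nat by blast
  then obtain k l where kl: "k \<noteq> l" "\<Phi> k = \<Phi> l" unfolding inj_def by blast
  define i j where "i = min k l" and "j = max k l"
  have ij: "i < j" "\<Phi> i = \<Phi> j" using kl by (auto simp: i_def j_def min_def max_def)
  have "cong2 (x ^ 2 ^ (j - i)) x" if x: "x \<in> ints K" for x
  proof -
    obtain t where t: "t \<in> T" "cong2 x t" using T(3)[OF x] by blast
    have tK: "t \<in> ints K" using t T(2) by blast
    have "cl (t ^ 2 ^ i) = cl (t ^ 2 ^ j)" using fun_cong[OF ij(2), of t] t(1) by (simp add: \<Phi>_def)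
    hence ct: "cong2 (t ^ 2 ^ i) (t ^ 2 ^ j)" by (rule cl(2)[OF power[OF tK] power[OF tK]])
    have xt: "cong2 (x ^ 2 ^ n) (t ^ 2 ^ n)" for n by (rule cong2_power[OF ai[OF x] ai[OF tK] t(2)])
    have "cong2 (x ^ 2 ^ j) (x ^ 2 ^ i)"
      using cong2_trans[OF xt[of j] cong2_trans[OF cong2_sym[OF ct] cong2_sym[OF xt[of i]]]] .
    moreover have "x ^ 2 ^ j = (x ^ 2 ^ (j - i)) ^ 2 ^ i"
      using ij(1) by (simp add: power_mult[symmetric] power_add[symmetric])
    ultimately have "cong2 ((x ^ 2 ^ (j - i)) ^ 2 ^ i) (x ^ 2 ^ i)" by simp
    thus ?thesis by (rule inj[OF power[OF x] x])
  qed
  thus ?thesis using ij(1) by (intro exI[of _ "j - i"]) simp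
qed

text \<open>Modulo 2 the map x^2 + c is injective on a finite set, since squaring is, so 0 is purely
  periodic of some period n. The product of n with the period of Frobenius serves both
  conditions.\<close>

lemma critical_orbit_period:
  assumes K: "number_field (K :: 'a::field_char_0 set)" and unr: "unramified_above K 2" and c: "c \<in> ints K"
  shows "\<exists>m>0. (\<forall>x\<in>ints K. cong2 (x ^ 2 ^ m) x) \<and> cong2 (((\<lambda>x. x\<^sup>2 + c) ^^ m) 0) 0"
proof -
  have "sring K" using K sfield_if_subfield by (auto simp: number_field_def sfield_def)
  then interpret sring "ints K" by (rule sring_ints)
  have ai: "x \<in> ints K \<Longrightarrow> algebraic_int x" for x by (simp add: ints_def)
  let ?f = "\<lambda>x. x\<^sup>2 + c"
  obtain m where m: "m > 0" "\<And>x. x \<in> ints K \<Longrightarrow> cong2 (x ^ 2 ^ m) x" using frobenius_period[OF K unr] by blast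
  have inj: "cong2 x y" if xy: "x \<in> ints K" "y \<in> ints K" "cong2 (?f x) (?f y)" for x y
  proof -
    have "cong2 (x\<^sup>2) (y\<^sup>2)" using xy(3) by (simp add: cong2_def)
    hence "cong2 ((x\<^sup>2) ^ 2 ^ (m - 1)) ((y\<^sup>2) ^ 2 ^ (m - 1))" by (rule cong2_power[OF algebraic_int_power[OF ai[OF xy(1)]] algebraic_int_power[OF ai[OF xy(2)]]])
    moreover have "(v\<^sup>2) ^ 2 ^ (m - 1) = v ^ 2 ^ m" for v :: 'a
      using m(1) by (simp add: power_mult[symmetric] power_Suc[symmetric] del: power_Suc)
    ultimately have "cong2 (x ^ 2 ^ m) (y ^ 2 ^ m)" by simp
    thus ?thesis by (rule cong2_trans[OF cong2_sym[OF m(2)[OF xy(1)]] cong2_trans[OF _ m(2)[OF xy(2)]]])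
  qed
  have fO: "(?f ^^ n) x \<in> ints K" if "x \<in> ints K" for n x
    by (induction n) (use that c in \<open>auto intro: add power\<close>)
  have injn: "cong2 x y" if "x \<in> ints K" "y \<in> ints K" "cong2 ((?f ^^ n) x) ((?f ^^ n) y)" for x y n
    using that(3)
  proof (induction n)
    case (Suc n)
    have "cong2 ((?f ^^ n) x) ((?f ^^ n) y)" by (rule inj[OF fO[OF that(1)] fO[OF that(2)]]) (use Suc.prems in simp)
    thus ?case by (rule Suc.IH)
  qed simp
  have fcong: "cong2 ((?f ^^ n) x) ((?f ^^ n) y)" if "x \<in> ints K" "y \<in> ints K" "cong2 x y" for x y n
  proof (induction n)
    case (Suc n)
    have "cong2 (((?f ^^ n) x)\<^sup>2) (((?f ^^ n) y)\<^sup>2)" by (rule cong2_power[OF ai[OF fO[OF that(1)]] ai[OF fO[OF that(2)]] Suc])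
    thus ?case by (simp add: cong2_add)
  qed (use that in simp)
  obtain cl :: "'a \<Rightarrow> 'a set" where cl: "finite (cl ` ints K)" "\<And>x y. x \<in> ints K \<Longrightarrow> y \<in> ints K \<Longrightarrow> cl x = cl y \<Longrightarrow> cong2 x y"
    using finite_cong2_classes(1)[OF K] by blast
  define \<Phi> where "\<Phi> i = cl ((?f ^^ i) 0)" for i :: nat
  have "range \<Phi> \<subseteq> cl ` ints K" using fO[OF zero] by (auto simp: \<Phi>_def)
  hence "finite (range \<Phi>)" using cl(1) by (rule finite_subset)
  hence "\<not> inj \<Phi>" using finite_imageD infinite_UNIV_nat by blast
  then obtain k l where kl: "k \<noteq> l" "\<Phi> k = \<Phi> l" unfolding inj_def by blast
  define i j where "i = min k l" and "j = max k l"
  have ij: "i < j" "\<Phi> i = \<Phi> j" using kl by (auto simp: i_def j_def min_def max_def)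
  define n where "n = j - i"
  have n: "n > 0" using ij(1) by (simp add: n_def)
  have "cong2 ((?f ^^ j) 0) ((?f ^^ i) 0)" using cl(2)[OF fO[OF zero] fO[OF zero]] ij(2) cong2_sym by (auto simp: \<Phi>_def)
  moreover have "(?f ^^ j) 0 = (?f ^^ i) ((?f ^^ n) 0)"
  proof -
    have "j = i + n" using ij(1) by (simp add: n_def)
    thus ?thesis by (simp add: funpow_add)
  qed
  ultimately have per: "cong2 ((?f ^^ n) 0) 0" using injn[OF fO[OF zero] zero] by simp
  have "cong2 ((?f ^^ (n * l)) 0) 0" for l
  proof (induction l)
    case (Suc l)
    have "cong2 ((?f ^^ n) ((?f ^^ (n * l)) 0)) ((?f ^^ n) 0)" by (rule fcong[OF fO[OF zero] zero Suc])
    also have "cong2 \<dots> 0" by (rule per)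
    finally show ?case by (simp add: funpow_add)
  qed simp
  moreover have "cong2 (x ^ 2 ^ (m * l)) x" if x: "x \<in> ints K" for x l
  proof (induction l)
    case (Suc l)
    have "cong2 ((x ^ 2 ^ (m * l)) ^ 2 ^ m) (x ^ 2 ^ m)" by (rule cong2_power[OF ai[OF power[OF x]] ai[OF x] Suc])
    also have "cong2 \<dots> x" by (rule m(2)[OF x])
    finally show ?case by (simp add: power_mult[symmetric] power_add[symmetric] add.commute)
  qed simp
  ultimately have "(\<forall>x\<in>ints K. cong2 (x ^ 2 ^ (m * n)) x) \<and> cong2 ((?f ^^ (m * n)) 0) 0"
    by (metis mult.commute)
  thus ?thesis using m(1) n by (intro exI[of _ "m * n"]) simp
qed

section \<open>Frobenius on odd cyclotomic extensions\<close>

text \<open>Embeddings of fields are injective, so a monic integer equation can be pulled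
  back.\<close>

lemma (in hom_sfield) algebraic_int_if_hom:
  assumes "x \<in> S" "algebraic_int (\<phi> x)"
  shows "algebraic_int x"
proof -
  obtain p where p: "poly (of_int_poly p) (\<phi> x) = 0" "monic p"
    using assms(2) unfolding algebraic_int_altdef_ipoly by blast
  have "\<phi> (poly (of_int_poly p) x) = 0" using p(1) hom_poly[of "of_int_poly p" x] assms(1) by simp
  hence "poly (of_int_poly p) x = 0" using assms(1) by (simp add: hom_eq_0_iff poly_in)
  thus ?thesis using p(2) unfolding algebraic_int_altdef_ipoly by blast
qed

lemma complex_monic_split: "monic p \<Longrightarrow> p = (\<Prod>r\<in>#proots p. [:- r, 1 :: complex:])"
  using complex_poly_decompose_multiset[of p] by simp

lemma monic_root_factors_aipoly:
  assumes "\<And>r. r \<in># M \<Longrightarrow> algebraic_int r"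
  shows "aipoly (\<Prod>r\<in>#M. [:- r, 1 :: 'a::field_char_0:])"
  using assms by (induction M) (auto intro!: aipoly_diff aipoly_smult aipoly_pCons)

lemma root_of_unity_algebraic_int: "z ^ n = 1 \<Longrightarrow> n > 0 \<Longrightarrow> algebraic_int (z :: 'a::field_char_0)"
  by (rule algebraic_int_root[of 1 "monom 1 n"]) (simp_all add: poly_monom degree_monom_eq)

text \<open>Over the complex numbers g splits and its roots are roots of unity, so the image of g
  has integral coefficients; integrality is then pulled back along \<phi>.\<close>

lemma cyclotomic_factor_aipoly:
  assumes K: "hom_sfield K (\<phi> :: 'a::field_char_0 \<Rightarrow> complex)" and n: "n > 0"
    and g: "polyover K g" "monic g" "polyover K h" "monom 1 n - 1 = g * h"
  shows "aipoly g"
proof -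
  interpret hom_sfield K \<phi> by (rule K)
  have "monom 1 n - 1 = map_poly \<phi> (monom 1 n - 1)"
    by (rule poly_eqI) (auto simp: coeff_monom coeff_1 hom_diff hom_minus)
  also have "\<dots> = map_poly \<phi> g * map_poly \<phi> h"
    unfolding g(4) by (rule map_hom_mult[OF g(1,3)])
  finally have eq: "monom 1 n - 1 = map_poly \<phi> g * map_poly \<phi> h" .
  have "algebraic_int r" if "r \<in># proots (map_poly \<phi> g)" for r
  proof -
    have "map_poly \<phi> g \<noteq> 0"
    proof
      assume "map_poly \<phi> g = 0"
      thus False using monic_map_hom[OF g(2)] by (simp del: coeff_map_hom)
    qed
    hence "poly (map_poly \<phi> g) r = 0" using that by simp
    hence "poly (monom 1 n - 1) r = 0" by (simp only: eq poly_mult mult_zero_left)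
    hence "r ^ n = 1" by (simp add: poly_monom)
    thus ?thesis by (rule root_of_unity_algebraic_int[OF _ n])
  qed
  hence "aipoly (\<Prod>r\<in>#proots (map_poly \<phi> g). [:- r, 1:])" by (rule monic_root_factors_aipoly)
  hence "aipoly (map_poly \<phi> g)" by (subst complex_monic_split[OF monic_map_hom[OF g(2)]])
  hence "algebraic_int (\<phi> (coeff g i))" for i by (simp add: aipoly_def)
  thus ?thesis unfolding aipoly_def using g(1) algebraic_int_if_hom unfolding polyover_def by blast
qed

text \<open>A basis of K is placed into a field with a conjugate family, which then contains K; a
  member of the family restricts to K.\<close>

lemma number_field_complex_hom:
  assumes alg: "\<And>x::'a::field_char_0. algebraic x" and K: "number_field (K :: 'a set)"
  shows "\<exists>\<phi> :: 'a \<Rightarrow> complex. hom_sfield K \<phi>"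
proof -
  interpret A: field "ambient :: 'a ring" by (rule field_ambient)
  have sQ: "subfield (\<rat> :: 'a set) ambient" by (rule subfield_if_sfield[OF sfield_Rats])
  have sK: "sfield K" using K sfield_if_subfield by (auto simp: number_field_def)
  obtain d where "A.dimension d \<rat> K" using K by (auto simp: number_field_def A.finite_dimension_def)
  then obtain Us where Us: "length Us = d" "A.Span \<rat> Us = K" using A.exists_base[OF sQ] by metis
  obtain S E where SE: "conj_family S E" "set Us \<subseteq> S" using conj_family_exists[OF alg, of "set Us"] by auto
  interpret S: sfield S by (rule conj_family_sfield[OF SE(1)])
  have "K \<subseteq> S"
  proof
    fix y assume "y \<in> K"
    hence "y \<in> {A.combine Ks Us | Ks. length Ks = length Us \<and> set Ks \<subseteq> \<rat>}"
      using Us(2) A.Span_eq_combine_set_length_version[OF sQ, of Us] by simp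
    then obtain Ks where Ks: "length Ks = length Us" "set Ks \<subseteq> \<rat>" "y = A.combine Ks Us" by blast
    have "Ks ! i \<in> S" "Us ! i \<in> S" if i: "i < length Us" for i
    proof -
      have "Ks ! i \<in> set Ks" "Us ! i \<in> set Us" using i Ks(1) by simp_all
      thus "Ks ! i \<in> S" "Us ! i \<in> S" using Ks(2) SE(2) S.Rats by blast+
    qed
    thus "y \<in> S" unfolding Ks(3) combine_ambient[OF Ks(1)] by (intro S.sum S.mult) auto
  qed
  moreover have "hom_sfield S (E ! 0)" using SE(1) by (intro conj_family_hom) (auto simp: conj_family_def)
  ultimately have "hom_on K (E ! 0)" using hom_on_subset by (auto simp: hom_sfield_def hom_sring_def hom_sring_axioms_def)
  thus ?thesis using sK by (auto simp: hom_sfield_def hom_sring_def hom_sring_axioms_def sfield_def)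
qed

text \<open>The powers z^(n-1-i) and z^(i+1) are dual up to the factor n: for conjugates r and r0 of
  z the sum of r^(n-1-i) r0^(i+1) over i < n is n if r = r0 and 0 otherwise. Hence n \<tau> is the
  sum of the z^(i+1) weighted by the traces of \<tau> z^(n-1-i), and these traces are integers of
  K.\<close>

lemma cyclotomic_integers:
  fixes K :: "'a::field_char_0 set"
  assumes alg: "\<And>x::'a. algebraic x" and \<phi>: "hom_sfield K (\<phi> :: 'a \<Rightarrow> complex)" and n: "n > 0" and zn: "z ^ n = 1"
    and g: "minpoly_over K z g" "polyover K h" "monom 1 n - 1 = g * h"
    and \<tau>: "\<tau> \<in> ints (adjoin K z)"
  shows "\<exists>P. polyover (ints K) P \<and> of_nat n * \<tau> = poly P z"
proof -
  let ?L = "adjoin K z"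
  interpret h: hom_sfield K \<phi> by (rule \<phi>)
  have sL: "sfield ?L" by (rule sfield_if_algebraic[OF h.sring_adjoin _ alg]) (use h.subset_adjoin h.Rats in blast)
  interpret L: sfield ?L by (rule sL)
  have zL: "z \<in> ?L" by (rule h.in_adjoin)
  have gK: "polyover K g" and gm: "monic g" using g(1) by (auto simp: minpoly_over_def)
  define G where "G = map_poly \<phi> g"
  define M where "M = proots G"
  have Gm: "monic G" unfolding G_def by (rule h.monic_map_hom[OF gm])
  hence Gnz: "G \<noteq> 0" by auto
  have split: "map_poly \<phi> g = (\<Prod>r\<in>#M. [:- r, 1:])" unfolding M_def G_def by (rule complex_monic_split[OF Gm[unfolded G_def]])
  have root: "poly (map_poly \<phi> g) r = 0" if "r \<in># M" for r using that Gnz by (simp add: M_def G_def)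
  have FG: "monom 1 n - 1 = G * map_poly \<phi> h"
  proof -
    have "monom 1 n - 1 = map_poly \<phi> (monom 1 n - 1)"
      by (rule poly_eqI) (auto simp: coeff_monom coeff_1 h.hom_diff h.hom_minus)
    also have "\<dots> = G * map_poly \<phi> h"
      unfolding g(3) G_def by (rule h.map_hom_mult[OF gK g(2)])
    finally show ?thesis .
  qed
  have rn: "r ^ n = 1" if "r \<in># M" for r
  proof -
    have "poly (monom 1 n - 1) r = 0" unfolding FG using root[OF that] by (simp add: G_def)
    thus ?thesis by (simp add: poly_monom)
  qed
  define \<sigma> where "\<sigma> r = hom_ext K z \<phi> r" for r
  have hs: "hom_sfield ?L (\<sigma> r)" if "r \<in># M" for r
    using h.hom_on_hom_ext[OF g(1) root[OF that]] sL
    by (simp add: hom_sfield_def hom_sring_def hom_sring_axioms_def \<sigma>_def sfield_def)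
  have \<sigma>z: "\<sigma> r z = r" if "r \<in># M" for r unfolding \<sigma>_def by (rule h.hom_ext_gen[OF g(1) root[OF that]])
  have \<sigma>K: "\<sigma> r y = \<phi> y" if "r \<in># M" "y \<in> K" for r y unfolding \<sigma>_def by (rule h.hom_ext_base[OF g(1) root[OF that(1)] that(2)])
  have trace: "\<exists>t\<in>K. \<phi> t = (\<Sum>r\<in>#M. \<sigma> r y)" if y: "y \<in> ?L" for y
  proof -
    obtain p where p: "polyover K p" "y = poly p z" using y by (auto simp: adjoin_def)
    have "(\<Sum>r\<in>#M. \<sigma> r y) = (\<Sum>r\<in>#M. poly (map_poly \<phi> p) r)"
      by (rule arg_cong[of _ _ sum_mset], rule image_mset_cong) (simp add: \<sigma>_def p h.hom_ext_poly[OF g(1) root])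
    also have "\<dots> = poly_trace (map_poly \<phi> g) (map_poly \<phi> p)" by (rule poly_trace[OF split])
    also have "\<dots> = \<phi> (poly_trace g p)" by (rule h.hom_poly_trace[OF gK gm p(1), symmetric])
    finally show ?thesis using h.poly_trace_in[OF gK p(1)] by (intro bexI[of _ "poly_trace g p"]) simp_all
  qed
  have \<tau>L: "\<tau> \<in> ?L" "algebraic_int \<tau>" using \<tau> by (auto simp: ints_def)
  have zi: "algebraic_int z" by (rule root_of_unity_algebraic_int[OF zn n])
  have "\<exists>t. t \<in> ints K \<and> \<phi> t = (\<Sum>r\<in>#M. \<sigma> r (\<tau> * z ^ (n - Suc i)))" for i
  proof -
    have yL: "\<tau> * z ^ (n - Suc i) \<in> ?L" by (intro L.mult L.power \<tau>L zL)
    obtain t where t: "t \<in> K" "\<phi> t = (\<Sum>r\<in>#M. \<sigma> r (\<tau> * z ^ (n - Suc i)))" using trace[OF yL] by blast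
    have yi: "algebraic_int (\<tau> * z ^ (n - Suc i))" by (intro algebraic_int_mult algebraic_int_power \<tau>L zi)
    have "algebraic_int (\<Sum>r\<in>#M. \<sigma> r (\<tau> * z ^ (n - Suc i)))"
      by (rule algebraic_int_sum_mset, rule hom_sfield.hom_algebraic_int[OF hs yi yL])
    hence "algebraic_int t" using h.algebraic_int_if_hom[OF t(1)] t(2) by simp
    thus ?thesis using t by (auto simp: ints_def)
  qed
  then obtain t where t: "\<And>i. t i \<in> ints K" "\<And>i. \<phi> (t i) = (\<Sum>r\<in>#M. \<sigma> r (\<tau> * z ^ (n - Suc i)))" by metis
  interpret I: sring "ints K" by (rule sring_ints[OF h.sring_axioms])
  define P where "P = (\<Sum>i<n. monom (t i) (Suc i))"
  have Pin: "polyover (ints K) P"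
    unfolding P_def polyover_def coeff_sum coeff_monom using t(1) by (intro allI I.sum) simp
  have Pz: "poly P z = (\<Sum>i<n. t i * z ^ Suc i)" by (simp add: P_def poly_sum poly_monom del: power_Suc)
  have tK: "t i \<in> K" "t i \<in> ?L" for i using t(1)[of i] h.subset_adjoin by (auto simp: ints_def)
  have "M \<noteq> {#}"
  proof
    assume "M = {#}"
    hence "degree G = 0" using split by (simp add: G_def)
    thus False using h.degree_map_hom_monic[OF gm] minpoly_over_degree[OF g(1)] by (simp add: G_def)
  qed
  then obtain r0 where r0: "r0 \<in># M" by blast
  interpret s: hom_sfield ?L "\<sigma> r0" by (rule hs[OF r0])
  \<comment> \<open>The trace sum counts multiplicities; T^n - 1 has only simple roots, so r0 enters
    once.\<close>
  have cnt: "count M r0 = 1"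
  proof -
    have "pderiv (monom 1 n - 1) = pderiv (G * map_poly \<phi> h)" by (simp only: FG)
    hence "pderiv (monom 1 n) = G * pderiv (map_poly \<phi> h) + map_poly \<phi> h * pderiv G"
      by (simp add: pderiv_diff pderiv_mult)
    hence "poly (pderiv (monom 1 n)) r0 = poly (map_poly \<phi> h) r0 * poly (pderiv G) r0"
      using root[OF r0] by (simp add: G_def)
    moreover have "poly (pderiv (monom 1 n)) r0 \<noteq> 0"
    proof -
      have "r0 \<noteq> 0" using rn[OF r0] n by (auto simp: zero_power)
      thus ?thesis using n by (simp add: pderiv_monom poly_monom)
    qed
    ultimately have "poly (pderiv G) r0 \<noteq> 0" by auto
    hence "order r0 (pderiv G) = 0" by (rule order_0I)
    moreover have "order r0 G = Suc (order r0 (pderiv G))" using root[OF r0] by (intro order_pderiv[OF Gnz]) (simp add: G_def)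
    ultimately show ?thesis using Gnz by (simp add: M_def)
  qed
  have "\<sigma> r0 (poly P z) = (\<Sum>i<n. \<phi> (t i) * r0 ^ Suc i)"
    unfolding Pz by (simp add: s.hom_sum s.hom_mult s.hom_power L.mult L.power tK zL \<sigma>z[OF r0] \<sigma>K[OF r0] del: power_Suc)
  also have "\<dots> = (\<Sum>i<n. (\<Sum>r\<in>#M. \<sigma> r (\<tau> * z ^ (n - Suc i))) * r0 ^ Suc i)" by (simp only: t(2))
  also have "\<dots> = (\<Sum>r\<in>#M. \<Sum>i<n. \<sigma> r (\<tau> * z ^ (n - Suc i)) * r0 ^ Suc i)"
  proof -
    have "(\<Sum>j\<in>J. (\<Sum>r\<in>#N. f r j) * r0 ^ Suc j) = (\<Sum>r\<in>#N. \<Sum>j\<in>J. f r j * r0 ^ Suc j)" for N J and f :: "complex \<Rightarrow> nat \<Rightarrow> complex"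
      by (induction N) (simp_all add: distrib_right sum.distrib del: power_Suc)
    thus ?thesis .
  qed
  also have "\<dots> = (\<Sum>r\<in>#M. if r = r0 then of_nat n * \<sigma> r0 \<tau> else 0)"
  proof (rule arg_cong[of _ _ sum_mset], rule image_mset_cong)
    fix r assume r: "r \<in># M"
    interpret t: hom_sfield ?L "\<sigma> r" by (rule hs[OF r])
    have "(\<Sum>i<n. \<sigma> r (\<tau> * z ^ (n - Suc i)) * r0 ^ Suc i) = \<sigma> r \<tau> * r0 * (\<Sum>i<n. r ^ (n - Suc i) * r0 ^ i)"
      by (simp add: t.hom_mult t.hom_power L.power \<tau>L zL \<sigma>z[OF r] sum_distrib_left mult_ac)
    also have "\<dots> = (if r = r0 then of_nat n * \<sigma> r0 \<tau> else 0)"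
    proof (cases "r = r0")
      case True
      have "(\<Sum>i<n. r ^ (n - Suc i) * r0 ^ i) = (\<Sum>i<n. r0 ^ (n - 1))"
        by (rule sum.cong) (simp_all add: True power_add[symmetric])
      also have "\<dots> = of_nat n * r0 ^ (n - 1)" by simp
      also have "\<sigma> r \<tau> * r0 * (of_nat n * r0 ^ (n - 1)) = of_nat n * \<sigma> r0 \<tau> * r0 ^ Suc (n - 1)"
        by (simp add: True mult_ac)
      also have "r0 ^ Suc (n - 1) = 1" using n rn[OF r0] by simp
      finally show ?thesis using True by simp
    next
      case False
      have "(r0 - r) * (\<Sum>i<n. r ^ (n - Suc i) * r0 ^ i) = r0 ^ n - r ^ n" by (rule power_diff_sumr2[symmetric])
      also have "\<dots> = 0" using rn[OF r0] rn[OF r] by simp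
      finally show ?thesis using False by simp
    qed
    finally show "(\<Sum>i<n. \<sigma> r (\<tau> * z ^ (n - Suc i)) * r0 ^ Suc i) = (if r = r0 then of_nat n * \<sigma> r0 \<tau> else 0)" .
  qed
  also have "\<dots> = of_nat (count M r0) * (of_nat n * \<sigma> r0 \<tau>)"
  proof -
    have "(\<Sum>r\<in>#N. if r = r0 then c else 0) = of_nat (count N r0) * c" for N and c :: complex
      by (induction N) (simp_all add: algebra_simps)
    thus ?thesis .
  qed
  also have "\<dots> = \<sigma> r0 (of_nat n * \<tau>)" by (simp add: cnt s.hom_mult \<tau>L)
  finally have eq: "\<sigma> r0 (poly P z) = \<sigma> r0 (of_nat n * \<tau>)" .
  have PL: "poly P z \<in> ?L" unfolding Pz by (intro L.sum L.mult L.power tK zL)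
  have nL: "of_nat n * \<tau> \<in> ?L" by (intro L.mult L.of_nat \<tau>L)
  have "\<sigma> r0 (poly P z - of_nat n * \<tau>) = 0" using eq s.hom_diff[OF PL nL] by simp
  hence "poly P z - of_nat n * \<tau> = 0" using s.hom_eq_0_iff[OF L.diff[OF PL nL]] by simp
  thus ?thesis using Pin by (intro exI[of _ P]) simp
qed

text \<open>Once z^q is known to be a root of the minimal polynomial g of z, the identity of K
  extends by z |-> z^q. On polynomials in z over the integers of K this is the q-th power modulo 2
  by \<open>frob\<close>; since n \<tau> is such a polynomial and n is odd, all integers \<tau> are
  reached.\<close>

lemma cyclotomic_frobenius:
  fixes K :: "'a::field_char_0 set"
  assumes alg: "\<And>x::'a. algebraic x" and K: "number_field K" and n: "odd n" and zn: "z ^ n = 1"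
    and frob: "\<And>x. x \<in> ints K \<Longrightarrow> cong2 (x ^ 2 ^ m) x"
  shows "\<exists>\<sigma> :: 'a \<Rightarrow> 'a. hom_sfield (adjoin K z) \<sigma> \<and> (\<forall>x\<in>K. \<sigma> x = x) \<and>
    (\<forall>\<tau>\<in>ints (adjoin K z). cong2 (\<sigma> \<tau>) (\<tau> ^ 2 ^ m))"
proof -
  let ?L = "adjoin K z" and ?q = "2 ^ m :: nat"
  obtain \<phi> :: "'a \<Rightarrow> complex" where \<phi>: "hom_sfield K \<phi>" using number_field_complex_hom[OF alg K] by blast
  have sK: "sfield K" using K sfield_if_subfield by (auto simp: number_field_def)
  interpret K: sfield K by (rule sK)
  have sL: "sfield ?L" by (rule sfield_if_algebraic[OF K.sring_adjoin _ alg]) (use K.subset_adjoin K.Rats in blast)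
  interpret L: sfield ?L by (rule sL)
  have n0: "n > 0" using n by (rule odd_pos)
  have zi: "algebraic_int z" by (rule root_of_unity_algebraic_int[OF zn n0])
  have F: "polyover K (monom 1 n - 1)" by (intro K.polyover_diff K.polyover_monom K.polyover_1 K.one)
  have degF: "degree (monom 1 n - 1 :: 'a poly) = n" "monic (monom 1 n - 1 :: 'a poly)"
  proof -
    have "degree (- 1 :: 'a poly) < degree (monom (1::'a) n)" using n0 by (simp add: degree_monom_eq)
    hence "degree (monom 1 n + - 1 :: 'a poly) = degree (monom (1::'a) n)" by (rule degree_add_eq_left)
    thus d: "degree (monom 1 n - 1 :: 'a poly) = n" by (simp add: degree_monom_eq)
    show "monic (monom 1 n - 1 :: 'a poly)" unfolding d using n0 by (simp add: coeff_1)
  qed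
  hence Fnz: "(monom 1 n - 1 :: 'a poly) \<noteq> 0" by auto
  have Fz: "poly (monom 1 n - 1) z = 0" by (simp add: poly_monom zn)
  obtain g where g: "minpoly_over K z g" using K.minpoly_over_exists[OF F Fnz Fz] by blast
  then obtain h where h: "polyover K h" "monom 1 n - 1 = g * h" using F Fz unfolding minpoly_over_def by blast
  have gK: "polyover K g" and gm: "monic g" and gz: "poly g z = 0" using g by (auto simp: minpoly_over_def)
  have hm: "monic h" using degF(2) unfolding h(2) lead_coeff_mult gm by simp
  have ag: "aipoly g" by (rule cyclotomic_factor_aipoly[OF \<phi> n0 gK gm h])
  have ah: "aipoly h" by (rule cyclotomic_factor_aipoly[OF \<phi> n0 h(1) hm gK]) (simp add: h(2) mult.commute)
  have pow: "cong2 (poly P z ^ ?q) (poly P (z ^ ?q))" if P: "polyover (ints K) P" for P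
  proof -
    have c: "coeff P i \<in> ints K" for i using P by (simp add: polyover_def)
    hence ci: "algebraic_int (coeff P i)" for i by (simp add: ints_def)
    have "cong2 ((\<Sum>i\<le>degree P. coeff P i * z ^ i) ^ ?q) (\<Sum>i\<le>degree P. (coeff P i * z ^ i) ^ ?q)"
      using ci zi by (intro cong2_frobenius_sum) auto
    also have "cong2 \<dots> (\<Sum>i\<le>degree P. coeff P i * (z ^ ?q) ^ i)"
    proof (rule cong2_sum)
      fix i
      have "cong2 (z ^ (i * ?q) * coeff P i ^ ?q) (z ^ (i * ?q) * coeff P i)"
        using zi by (intro cong2_scale frob c) auto
      thus "cong2 ((coeff P i * z ^ i) ^ ?q) (coeff P i * (z ^ ?q) ^ i)"
        by (simp add: power_mult_distrib power_mult[symmetric] mult.commute)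
    qed
    finally show ?thesis by (simp only: poly_altdef)
  qed
  \<comment> \<open>If z^q were a root of the cofactor h instead, the derivative of T^n - 1 at z^q
    would equal g(z^q) h'(z^q). But g(z^q) is congruent to g(z)^q = 0 modulo 2, and so the odd
    number n would be divisible by 2.\<close>
  have gq: "poly g (z ^ ?q) = 0"
  proof (rule ccontr)
    assume nz: "poly g (z ^ ?q) \<noteq> 0"
    have zq: "(z ^ ?q) ^ n = 1" using zn by (simp add: power_mult[symmetric] mult.commute) (simp add: power_mult)
    have "poly (monom 1 n - 1) (z ^ ?q) = 0" using zq by (simp add: poly_monom)
    hence hz: "poly h (z ^ ?q) = 0" using nz unfolding h(2) by simp
    have "pderiv (monom 1 n - 1) = pderiv (g * h)" by (simp only: h(2))
    hence "pderiv (monom 1 n) = g * pderiv h + h * pderiv g" by (simp add: pderiv_diff pderiv_mult)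
    hence "poly (pderiv (monom 1 n)) (z ^ ?q) = poly g (z ^ ?q) * poly (pderiv h) (z ^ ?q)" using hz by simp
    hence eq: "of_nat n * (z ^ ?q) ^ (n - 1) = poly g (z ^ ?q) * poly (pderiv h) (z ^ ?q)"
      by (simp add: pderiv_monom poly_monom)
    have "polyover (ints K) g" using gK ag by (auto simp: polyover_def aipoly_def ints_def)
    hence "cong2 (poly g z ^ ?q) (poly g (z ^ ?q))" by (rule pow)
    hence "cong2 (poly g (z ^ ?q)) 0" using gz cong2_sym by (simp add: zero_power)
    then obtain w where w: "algebraic_int w" "poly g (z ^ ?q) = 2 * w" by (auto simp: cong2_def)
    have "of_nat n = of_nat n * (z ^ ?q) ^ (n - 1) * z ^ ?q"
      using zq n0 power_Suc2[of "z ^ ?q" "n - 1"] by (simp add: mult.assoc)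
    also have "\<dots> = 2 * (w * poly (pderiv h) (z ^ ?q) * z ^ ?q)" unfolding eq w(2) by (simp add: mult_ac)
    finally have "(of_nat n :: 'a) - 0 = 2 * (w * poly (pderiv h) (z ^ ?q) * z ^ ?q)" by simp
    moreover have "aipoly (pderiv h)" using ah by (auto simp: aipoly_def coeff_pderiv simp del: of_nat_Suc)
    ultimately have "cong2 (of_nat n :: 'a) 0"
      using w(1) zi by (intro cong2I) (auto intro!: algebraic_int_mult algebraic_int_power aipoly_poly)
    then obtain v where v: "algebraic_int v" "(of_nat n :: 'a) = 2 * v" by (auto simp: cong2_def)
    have "v = of_nat n / of_nat 2" using v(2) by simp
    also have "\<dots> \<in> \<rat>" by (intro Rats_divide Rats_of_nat)
    finally have "v \<in> \<int>" using rational_algebraic_int_is_int[OF v(1)] by blast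
    then obtain k where "v = of_int k" by (elim Ints_cases)
    hence "(of_int (int n) :: 'a) = of_int (2 * k)" using v(2) by simp
    hence "int n = 2 * k" by (simp only: of_int_eq_iff)
    thus False using n by presburger
  qed
  have i: "hom_sring K (\<lambda>x. x)" by unfold_locales (simp add: hom_on_def)
  have id: "map_poly (\<lambda>x. x) p = p" for p :: "'a poly" by (rule poly_eqI) (simp add: coeff_map_poly)
  have gq': "poly (map_poly (\<lambda>x. x) g) (z ^ ?q) = 0" using gq by (simp only: id)
  define \<sigma> where "\<sigma> = hom_ext K z (\<lambda>x. x) (z ^ ?q)"
  have hs: "hom_sfield ?L \<sigma>"
    using hom_sring.hom_on_hom_ext[OF i g gq'] sL
    by (simp add: hom_sfield_def hom_sring_def hom_sring_axioms_def \<sigma>_def sfield_def)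
  interpret s: hom_sfield ?L \<sigma> by (rule hs)
  have \<sigma>K: "\<sigma> x = x" if "x \<in> K" for x unfolding \<sigma>_def by (rule hom_sring.hom_ext_base[OF i g gq' that])
  have \<sigma>p: "\<sigma> (poly p z) = poly p (z ^ ?q)" if "polyover K p" for p
    using hom_sring.hom_ext_poly[OF i g gq' that] by (simp only: \<sigma>_def id)
  have "cong2 (\<sigma> \<tau>) (\<tau> ^ ?q)" if \<tau>: "\<tau> \<in> ints ?L" for \<tau>
  proof -
    have \<tau>L: "\<tau> \<in> ?L" "algebraic_int \<tau>" using \<tau> by (auto simp: ints_def)
    have \<sigma>\<tau>: "algebraic_int (\<sigma> \<tau>)" by (rule s.hom_algebraic_int[OF \<tau>L(2,1)])
    obtain P where P: "polyover (ints K) P" "of_nat n * \<tau> = poly P z"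
      using cyclotomic_integers[OF alg \<phi> n0 zn g h \<tau>] by blast
    have PK: "polyover K P" using P(1) by (auto simp: polyover_def ints_def)
    have n1: "cong2 (of_nat n) (1::'a)"
    proof -
      obtain k where "n = 2 * k + 1" using n by (elim oddE)
      thus ?thesis by (intro cong2I[of "of_int (int k)"]) (simp_all del: of_int_of_nat_eq, simp)
    qed
    have "cong2 (\<sigma> \<tau>) (of_nat n * \<sigma> \<tau>)"
      using cong2_scale[OF \<sigma>\<tau> cong2_sym[OF n1]] by (simp add: mult.commute)
    also have "of_nat n * \<sigma> \<tau> = \<sigma> (poly P z)" using \<tau>L by (simp add: P(2)[symmetric] s.hom_mult)
    also have "\<dots> = poly P (z ^ ?q)" by (rule \<sigma>p[OF PK])
    also have "cong2 \<dots> (poly P z ^ ?q)" by (rule cong2_sym[OF pow[OF P(1)]])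
    also have "poly P z ^ ?q = of_nat n ^ ?q * \<tau> ^ ?q" by (simp add: P(2)[symmetric] power_mult_distrib)
    also have "cong2 \<dots> (\<tau> ^ ?q)"
    proof -
      have "cong2 (of_nat n ^ ?q) (1 ^ ?q :: 'a)"
        using algebraic_int_of_int[of "int n"] by (intro cong2_power n1) (auto simp del: algebraic_int_of_int)
      thus ?thesis using cong2_scale[OF algebraic_int_power[OF \<tau>L(2), of ?q], of "of_nat n ^ ?q" 1] by (simp add: mult.commute)
    qed
    finally show ?thesis .
  qed
  thus ?thesis using hs \<sigma>K by blast
qed

section \<open>The difference of the two orbits\<close>

text \<open>Squaring produces only cross terms divisible by 2, so modulo 2 each iterate is a pure
  power plus a constant. The degree bound on R later allows denominators to be cleared by a 2^m-th
  power.\<close>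

lemma iterate_poly_mod_2:
  fixes c :: "'a::field_char_0"
  assumes c: "algebraic_int c"
  defines "f \<equiv> \<lambda>x. x\<^sup>2 + c"
  shows "\<exists>R. aipoly R \<and> degree R \<le> 2 ^ m \<and> (\<forall>x. (f ^^ m) x = x ^ 2 ^ m + (f ^^ m) 0 + 2 * poly R x)"
proof (induction m)
  case 0
  show ?case by (intro exI[of _ 0]) simp
next
  case (Suc m)
  then obtain R where R: "aipoly R" "degree R \<le> 2 ^ m" "\<And>x. (f ^^ m) x = x ^ 2 ^ m + (f ^^ m) 0 + 2 * poly R x" by blast
  define a where "a = (f ^^ m) 0"
  have a: "algebraic_int a" unfolding a_def f_def by (induction m) (auto intro: c)
  define T where "T = monom (1::'a) (2 ^ m)"
  \<comment> \<open>Half of what remains of (T + a + 2 R)^2 after T^2 + a^2 is removed.\<close>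
  define R' where "R' = smult a T + (smult 2 (T * R) + (smult (2 * a) R + smult 2 (R * R)))"
  have two: "algebraic_int (2::'a)" using algebraic_int_of_int[of 2] by simp
  have "aipoly R'" unfolding R'_def T_def
    by (intro aipoly_add aipoly_smult aipoly_mult aipoly_monom algebraic_int_mult two a algebraic_int_1 R(1))
  moreover have "degree R' \<le> 2 ^ Suc m"
  proof -
    have T: "degree T \<le> 2 ^ m" unfolding T_def by (rule degree_monom_le)
    have "degree (T * R) \<le> 2 ^ Suc m" "degree (R * R) \<le> 2 ^ Suc m"
      using order_trans[OF degree_mult_le[of T R]] order_trans[OF degree_mult_le[of R R]] T R(2) by simp_all
    moreover have "degree T \<le> 2 ^ Suc m" "degree R \<le> 2 ^ Suc m" using T R(2) by simp_all
    ultimately show ?thesis unfolding R'_def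
      by (intro degree_add_le order_trans[OF degree_smult_le])
  qed
  moreover have "(f ^^ Suc m) x = x ^ 2 ^ Suc m + (f ^^ Suc m) 0 + 2 * poly R' x" for x
  proof -
    have "(f ^^ Suc m) x = (x ^ 2 ^ m + a + 2 * poly R x)\<^sup>2 + c" using R(3)[of x] by (simp add: f_def a_def)
    also have "\<dots> = (x ^ 2 ^ m)\<^sup>2 + (a\<^sup>2 + c) + 2 * poly R' x"
      by (simp add: R'_def T_def poly_monom power2_eq_square algebra_simps)
    also have "a\<^sup>2 + c = (f ^^ Suc m) 0" by (simp add: f_def a_def)
    also have "(x ^ 2 ^ m)\<^sup>2 = x ^ 2 ^ Suc m" by (simp add: power_mult[symmetric] mult.commute)
    finally show ?thesis .
  qed
  ultimately show ?case by blast
qed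

lemma algebraic_int_homogenized:
  assumes d: "algebraic_int d" "algebraic_int (d * x)" and R: "aipoly R" "degree R \<le> q"
  shows "algebraic_int (d ^ q * poly R (x::'a::field_char_0))"
proof -
  have "d ^ q * poly R x = (\<Sum>i\<le>degree R. coeff R i * ((d * x) ^ i * d ^ (q - i)))"
    unfolding poly_altdef sum_distrib_left
  proof (rule sum.cong[OF refl])
    fix i assume "i \<in> {..degree R}"
    hence "d ^ q = d ^ i * d ^ (q - i)" using R(2) by (simp add: power_add[symmetric])
    thus "d ^ q * (coeff R i * x ^ i) = coeff R i * ((d * x) ^ i * d ^ (q - i))"
      by (simp add: power_mult_distrib mult_ac)
  qed
  thus ?thesis using R(1) d by (auto simp: aipoly_def)
qed

lemma kronecker_invertible':
  assumes "algebraic (x::'a::field_char_0)"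
  shows "\<exists>s t. algebraic_int s \<and> algebraic_int t \<and> algebraic_int (s * x) \<and> algebraic_int (t * x) \<and> s + t * x = 1"
proof -
  have "sfield (UNIV :: 'a set)" by unfold_locales auto
  from kronecker_invertible[OF this _ assms] show ?thesis by (auto simp: ints_def)
qed

text \<open>\<open>y - z\<close> is \<open>M\<close> times an integral element of the product of the fractional ideals \<open>(1, y)\<close> and \<open>(1, z)\<close>.\<close>
definition bilinear_multiple :: "'a::field_char_0 \<Rightarrow> 'a \<Rightarrow> 'a \<Rightarrow> bool" where
  "bilinear_multiple M y z \<longleftrightarrow> (\<exists>b. (\<forall>k l. algebraic_int (b k l)) \<and>
     y - z = M * (\<Sum>k\<le>(1::nat). (\<Sum>l\<le>(1::nat). b k l * z ^ l) * y ^ k))"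

text \<open>Multiply y - z by (e0 + e1 y)(d0 + d1 z) = 1: the four numbers e d (y - z), divided by
  M, become the coefficients.\<close>

lemma bilinear_multipleI:
  assumes 1: "e0 + e1 * y = 1" "d0 + d1 * z = 1"
    and w: "\<And>e d. e = e0 \<or> e = e1 \<Longrightarrow> d = d0 \<or> d = d1 \<Longrightarrow> \<exists>w. algebraic_int w \<and> e * d * (y - z) = M * w"
  shows "bilinear_multiple M y z"
proof -
  obtain w00 where w00: "algebraic_int w00" "e0 * d0 * (y - z) = M * w00" using w[of e0 d0] by blast
  obtain w01 where w01: "algebraic_int w01" "e0 * d1 * (y - z) = M * w01" using w[of e0 d1] by blast
  obtain w10 where w10: "algebraic_int w10" "e1 * d0 * (y - z) = M * w10" using w[of e1 d0] by blast
  obtain w11 where w11: "algebraic_int w11" "e1 * d1 * (y - z) = M * w11" using w[of e1 d1] by blast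
  define b where "b = (\<lambda>(k::nat) (l::nat). if k = 0 then if l = 0 then w00 else w01 else if l = 0 then w10 else w11)"
  have "y - z = (e0 + e1 * y) * (d0 + d1 * z) * (y - z)" by (simp only: 1 mult_1)
  also have "\<dots> = e0 * d0 * (y - z) + e0 * d1 * (y - z) * z + (e1 * d0 * (y - z) + e1 * d1 * (y - z) * z) * y"
    by (simp only: distrib_right distrib_left mult_ac add_ac)
  also have "\<dots> = M * (\<Sum>k\<le>(1::nat). (\<Sum>l\<le>(1::nat). b k l * z ^ l) * y ^ k)"
    unfolding w00(2) w01(2) w10(2) w11(2) by (simp add: b_def distrib_left mult_ac)
  finally show ?thesis unfolding bilinear_multiple_def
    by (intro exI[of _ b]) (simp add: b_def w00 w01 w10 w11)
qed

text \<open>With y - z = 2 N E one has y^2 - z^2 = (y - z)(y - z + 2 z) = 4 N (N E^2 + E z), which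
  gains a factor 2. It remains to check that multipliers e and d clearing y^2 + c and z^2 + c clear
  every monomial of N E^2 + E z.\<close>

lemma bilinear_multiple_step:
  fixes y z c :: "'a::field_char_0"
  assumes alg: "\<And>x::'a. algebraic x" and c: "algebraic_int c" and N: "algebraic_int N"
    and yz: "bilinear_multiple (2 * N) y z"
  shows "bilinear_multiple (2 * (2 * N)) (y\<^sup>2 + c) (z\<^sup>2 + c)"
proof -
  obtain e0 e1 where e: "algebraic_int e0" "algebraic_int e1" "algebraic_int (e0 * (y\<^sup>2 + c))" "algebraic_int (e1 * (y\<^sup>2 + c))"
    "e0 + e1 * (y\<^sup>2 + c) = 1" using kronecker_invertible'[OF alg] by blast
  obtain d0 d1 where d: "algebraic_int d0" "algebraic_int d1" "algebraic_int (d0 * (z\<^sup>2 + c))" "algebraic_int (d1 * (z\<^sup>2 + c))"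
    "d0 + d1 * (z\<^sup>2 + c) = 1" using kronecker_invertible'[OF alg] by blast
  \<comment> \<open>A multiplier that clears y^2 also clears y, because (u y)^2 = u (u y^2) is
    integral.\<close>
  have sq: "algebraic_int (u * y\<^sup>2)" "algebraic_int (u * y)" if u: "algebraic_int u" "algebraic_int (u * (y\<^sup>2 + c))" for u y :: 'a
  proof -
    have "u * y\<^sup>2 = u * (y\<^sup>2 + c) - u * c" by (simp add: distrib_left)
    thus 1: "algebraic_int (u * y\<^sup>2)" using u c by auto
    have "(u * y)\<^sup>2 = u * (u * y\<^sup>2)" by (simp add: power2_eq_square mult_ac)
    hence "algebraic_int ((u * y)\<^sup>2)" using 1 u(1) by auto
    thus "algebraic_int (u * y)" by (rule algebraic_int_square_imp)
  qed
  obtain b where b: "\<And>k l. algebraic_int (b k l)" "y - z = 2 * N * (\<Sum>k\<le>(1::nat). (\<Sum>l\<le>(1::nat). b k l * z ^ l) * y ^ k)"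
    using yz unfolding bilinear_multiple_def by blast
  define A where "A = b 0 0 + b 0 1 * z"
  define B where "B = b 1 0 + b 1 1 * z"
  have D: "y = z + 2 * N * (A + B * y)" using b(2) by (simp add: A_def B_def algebra_simps)
  have "\<exists>w. algebraic_int w \<and> e * d * ((y\<^sup>2 + c) - (z\<^sup>2 + c)) = 2 * (2 * N) * w"
    if e: "algebraic_int e" "algebraic_int (e * (y\<^sup>2 + c))" and d: "algebraic_int d" "algebraic_int (d * (z\<^sup>2 + c))" for e d
  proof -
    note ey = sq[OF e] and dz = sq[OF d]
    have dq: "algebraic_int (d * ((p + q * z) * (p' + q' * z)))"
      if "algebraic_int p" "algebraic_int q" "algebraic_int p'" "algebraic_int q'" for p q p' q'
    proof -
      have "d * ((p + q * z) * (p' + q' * z)) = p * p' * d + (p * q' + q * p') * (d * z) + q * q' * (d * z\<^sup>2)"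
        by (simp add: power2_eq_square algebra_simps)
      thus ?thesis by (simp only:) (intro algebraic_int_add algebraic_int_mult that d(1) dz)
    qed
    have AA: "algebraic_int (d * (A * A))" "algebraic_int (d * (A * B))" "algebraic_int (d * (B * B))"
      unfolding A_def B_def by (intro dq b(1))+
    have Az: "algebraic_int (d * (A * z))" "algebraic_int (d * (B * z))"
      using dq[OF b(1) b(1) algebraic_int_0 algebraic_int_1] by (simp_all add: A_def B_def)
    define w where "w = N * (e * (d * (A * A)) + (e * y) * (d * (A * B)) + (e * y) * (d * (A * B)) + (e * y\<^sup>2) * (d * (B * B)))
        + (e * (d * (A * z)) + (e * y) * (d * (B * z)))"
    have "algebraic_int w" unfolding w_def
      by (intro algebraic_int_add algebraic_int_mult[OF N] algebraic_int_mult[OF e(1)] algebraic_int_mult[OF ey(2)]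
          algebraic_int_mult[OF ey(1)] AA Az)
    moreover have "e * d * ((y\<^sup>2 + c) - (z\<^sup>2 + c)) = 2 * (2 * N) * w"
    proof -
      define E where "E = A + B * y"
      have yE: "y - z = 2 * N * E" using D by (simp add: E_def algebra_simps)
      have w: "w = N * (e * d * (E * E)) + e * d * E * z"
        by (simp add: w_def E_def power2_eq_square algebra_simps)
      have "(y\<^sup>2 + c) - (z\<^sup>2 + c) = (y - z) * ((y - z) + 2 * z)" by (simp add: power2_eq_square algebra_simps)
      also have "\<dots> = 2 * (2 * N) * (N * (E * E) + E * z)" unfolding yE by (simp add: algebra_simps)
      finally have "e * d * ((y\<^sup>2 + c) - (z\<^sup>2 + c)) = e * d * (2 * (2 * N) * (N * (E * E) + E * z))" by simp
      also have "\<dots> = 2 * (2 * N) * w" unfolding w by (simp add: algebra_simps)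
      finally show ?thesis .
    qed
    ultimately show ?thesis by blast
  qed
  thus ?thesis by (intro bilinear_multipleI[OF e(5) d(5)]) (use e d in blast)
qed

text \<open>Let Y = f^m(\<alpha>) and q = 2^m, and let the integers u and e make u \<alpha> and e Y
  integral. Then e Y \<sigma>(u) and e \<sigma>(u \<alpha>) are both congruent to e (u \<alpha>)^q
  modulo 2: the first since \<sigma>(u) is congruent to u^q and u^q Y to (u \<alpha>)^q, the second
  since \<sigma> is the q-th power modulo 2.\<close>

lemma bilinear_multiple_frobenius:
  fixes c \<alpha> :: "'a::field_char_0"
  assumes alg: "\<And>x::'a. algebraic x" and c: "algebraic_int c"
    and \<sigma>: "hom_sfield L \<sigma>" and cong: "\<And>\<tau>. \<tau> \<in> ints L \<Longrightarrow> cong2 (\<sigma> \<tau>) (\<tau> ^ 2 ^ m)" and \<alpha>: "\<alpha> \<in> L"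
    and crit: "cong2 (((\<lambda>x. x\<^sup>2 + c) ^^ m) 0) 0"
  shows "bilinear_multiple 2 (((\<lambda>x. x\<^sup>2 + c) ^^ m) \<alpha>) (\<sigma> \<alpha>)"
proof -
  interpret s: hom_sfield L \<sigma> by (rule \<sigma>)
  let ?Y = "((\<lambda>x. x\<^sup>2 + c) ^^ m) \<alpha>" and ?q = "2 ^ m :: nat"
  obtain R where R: "aipoly R" "degree R \<le> ?q" "?Y = \<alpha> ^ ?q + ((\<lambda>x. x\<^sup>2 + c) ^^ m) 0 + 2 * poly R \<alpha>"
    using iterate_poly_mod_2[OF c, of m] by blast
  obtain v where v: "algebraic_int v" "((\<lambda>x. x\<^sup>2 + c) ^^ m) 0 = 2 * v" using crit by (auto simp: cong2_def)
  \<comment> \<open>Absorbs the constant term f^m(0) = 2 v of the iterate.\<close>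
  define R' where "R' = R + [:v:]"
  have R': "aipoly R'" "degree R' \<le> ?q" "?Y - \<alpha> ^ ?q = 2 * poly R' \<alpha>"
    using R v by (auto simp: R'_def intro!: aipoly_add aipoly_pCons degree_add_le)
  obtain e0 e1 where e: "algebraic_int e0" "algebraic_int e1" "algebraic_int (e0 * ?Y)" "algebraic_int (e1 * ?Y)"
    "e0 + e1 * ?Y = 1" using kronecker_invertible'[OF alg] by blast
  obtain s t where st: "s \<in> ints L" "t \<in> ints L" "s * \<alpha> \<in> ints L" "t * \<alpha> \<in> ints L" "s + t * \<alpha> = 1"
    using kronecker_invertible[OF s.sfield_axioms \<alpha> alg] by blast
  have sL: "s \<in> L" "t \<in> L" using st by (auto simp: ints_def)
  have "\<sigma> s + \<sigma> t * \<sigma> \<alpha> = \<sigma> (s + t * \<alpha>)" using sL \<alpha> by (simp add: s.hom_add s.hom_mult s.mult)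
  hence 1: "\<sigma> s + \<sigma> t * \<sigma> \<alpha> = 1" using st(5) by simp
  have "\<exists>w. algebraic_int w \<and> e * \<sigma> u * (?Y - \<sigma> \<alpha>) = 2 * w"
    if e: "algebraic_int e" "algebraic_int (e * ?Y)" and u: "u \<in> ints L" "u * \<alpha> \<in> ints L" for e u
  proof -
    have ui: "algebraic_int u" "u \<in> L" "algebraic_int (u * \<alpha>)" using u by (auto simp: ints_def)
    have "cong2 (e * ?Y * \<sigma> u) (e * ?Y * u ^ ?q)" by (rule cong2_scale[OF e(2) cong[OF u(1)]])
    also have "cong2 \<dots> (e * (u * \<alpha>) ^ ?q)"
    proof (rule cong2I)
      show "algebraic_int (e * (u ^ ?q * poly R' \<alpha>))"
        by (intro algebraic_int_mult[OF e(1)] algebraic_int_homogenized ui R')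
      have "e * ?Y * u ^ ?q - e * (u * \<alpha>) ^ ?q = e * u ^ ?q * (?Y - \<alpha> ^ ?q)"
        by (simp add: power_mult_distrib right_diff_distrib mult_ac)
      also have "\<dots> = 2 * (e * (u ^ ?q * poly R' \<alpha>))" unfolding R'(3) by (simp add: mult_ac)
      finally show "e * ?Y * u ^ ?q - e * (u * \<alpha>) ^ ?q = 2 * (e * (u ^ ?q * poly R' \<alpha>))" .
    qed
    also have "cong2 \<dots> (e * \<sigma> (u * \<alpha>))" by (rule cong2_scale[OF e(1) cong2_sym[OF cong[OF u(2)]]])
    also have "\<sigma> (u * \<alpha>) = \<sigma> u * \<sigma> \<alpha>" using ui \<alpha> by (simp add: s.hom_mult)
    finally have "cong2 (e * ?Y * \<sigma> u) (e * (\<sigma> u * \<sigma> \<alpha>))" .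
    then obtain w where "algebraic_int w" "e * ?Y * \<sigma> u - e * (\<sigma> u * \<sigma> \<alpha>) = 2 * w" by (auto simp: cong2_def)
    thus ?thesis by (intro exI[of _ w]) (simp add: right_diff_distrib mult_ac)
  qed
  thus ?thesis using e st by (intro bilinear_multipleI[OF e(5) 1]) blast
qed

lemma bilinear_multiple_iterate:
  fixes y z c :: "'a::field_char_0"
  assumes alg: "\<And>x::'a. algebraic x" and c: "algebraic_int c" and yz: "bilinear_multiple 2 y z"
  shows "bilinear_multiple (of_int (2 ^ Suc k)) (((\<lambda>x. x\<^sup>2 + c) ^^ k) y) (((\<lambda>x. x\<^sup>2 + c) ^^ k) z)"
proof (induction k)
  case (Suc k)
  have "bilinear_multiple (2 * (2 * of_int (2 ^ k))) ((((\<lambda>x. x\<^sup>2 + c) ^^ k) y)\<^sup>2 + c) ((((\<lambda>x. x\<^sup>2 + c) ^^ k) z)\<^sup>2 + c)"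
    by (rule bilinear_multiple_step[OF alg c algebraic_int_of_int]) (use Suc in simp)
  thus ?case by simp
qed (use yz in simp)

section \<open>The lower bound\<close>

lemma generate_field_insert:
  assumes alg: "\<And>y::'a::field_char_0. algebraic y" and K: "sfield (K :: 'a set)"
  shows "generate_field ambient (insert z K) = adjoin K z"
proof (rule generate_field_eq)
  interpret K: sfield K by (rule K)
  show "sfield (adjoin K z)"
    by (rule sfield_if_algebraic[OF K.sring_adjoin _ alg]) (use K.subset_adjoin K.Rats in blast)
  show "insert z K \<subseteq> adjoin K z" using K.in_adjoin K.subset_adjoin by simp
  fix S :: "'a set" assume S: "sfield S" "insert z K \<subseteq> S"
  show "adjoin K z \<subseteq> S" using S by (intro K.adjoin_subset) (auto simp: sfield_def)
qed

theorem theorem1p4: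
  fixes K :: "'a::field_char_0 set" and c :: 'a
  assumes "number_field K"
    and "algebraic_closure (ambient :: 'a ring) K"
    and "unramified_above K 2"
    and "c \<in> K"
    and "quadratic_PCF c"
  shows "\<exists>C::real. C > 0 \<and>
    (\<forall>\<alpha> \<in> cyc_unr2 K. wandering (unicritical_quadratic c) \<alpha> \<longrightarrow>
       canonical_height (unicritical_quadratic c) \<alpha> \<ge> C)"
proof -
  have alg: "algebraic (x :: 'a)" for x by (rule algebraic_closure_algebraic[OF assms(1,2)])
  have sK: "sfield K" using assms(1) sfield_if_subfield by (auto simp: number_field_def)
  interpret K: sfield K by (rule sK)
  have ci: "algebraic_int c" by (rule algebraic_int_PCF[OF assms(5)])
  define hh where "hh = canonical_height (unicritical_quadratic c)"
  note spec = canonical_height_spec[OF alg ci weil_height_eq_ht[OF alg], folded hh_def]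
  let ?f = "\<lambda>x::'a. x\<^sup>2 + c"
  obtain B where B: "\<And>x. \<bar>hh x - ht x\<bar> \<le> B" using spec(3) by blast
  have hh_iterate: "hh ((?f ^^ k) x) = 2 ^ k * hh x" for k x by (induction k) (simp_all add: spec(2))
  have "c \<in> ints K" using assms(4) ci by (simp add: ints_def)
  then obtain m where m: "m > 0" "\<And>x. x \<in> ints K \<Longrightarrow> cong2 (x ^ 2 ^ m) x" "cong2 ((?f ^^ m) 0) 0"
    using critical_orbit_period[OF assms(1,3)] by blast
  \<comment> \<open>Replacing \<open>ht\<close> by the canonical height at the two points Y and Z
    costs up to 2 B; this k leaves at least 1 after that loss. It does not depend on \<alpha> or on
    the level n.\<close>
  obtain k :: nat where "(2 * B + 1) / ln 2 < real k" using reals_Archimedean2 by blast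
  hence k: "2 * B + 1 \<le> real k * ln 2" by (simp add: field_simps)
  \<comment> \<open>The canonical heights of Y and Z are 2^(k+m) and 2^k times that of
    \<alpha>.\<close>
  define C where "C = 1 / (2 ^ (k + m) + 2 ^ k :: real)"
  have "hh \<alpha> \<ge> C" if \<alpha>: "\<alpha> \<in> cyc_unr2 K" "wandering (unicritical_quadratic c) \<alpha>" for \<alpha>
  proof -
    obtain n z where nz: "odd n" "primitive_root_of_unity n z" "\<alpha> \<in> generate_field ambient (insert z K)"
      using \<alpha>(1) by (auto simp: cyc_unr2_def)
    let ?L = "adjoin K z"
    have \<alpha>L: "\<alpha> \<in> ?L" using nz(3) by (simp add: generate_field_insert[OF alg sK])
    have "z ^ n = 1" using nz(2) by (simp add: primitive_root_of_unity_def)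
    then obtain \<sigma> :: "'a \<Rightarrow> 'a" where \<sigma>: "hom_sfield ?L \<sigma>" "\<And>x. x \<in> K \<Longrightarrow> \<sigma> x = x"
      "\<And>\<tau>. \<tau> \<in> ints ?L \<Longrightarrow> cong2 (\<sigma> \<tau>) (\<tau> ^ 2 ^ m)"
      using cyclotomic_frobenius[OF alg assms(1) nz(1) _ m(2)] by blast
    interpret s: hom_sfield ?L \<sigma> by (rule \<sigma>(1))
    have cL: "c \<in> ?L" "\<sigma> c = c" using assms(4) K.subset_adjoin \<sigma>(2) by auto
    have fL: "(?f ^^ j) x \<in> ?L" if "x \<in> ?L" for j x
      by (induction j) (use that cL in \<open>auto intro: s.add s.power\<close>)
    have f\<sigma>: "(?f ^^ j) (\<sigma> x) = \<sigma> ((?f ^^ j) x)" if x: "x \<in> ?L" for j x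
      by (induction j) (simp_all add: s.hom_add s.hom_power s.power fL[OF x] cL)
    have ht\<sigma>: "ht (\<sigma> x) = ht x" if "x \<in> ?L" for x
      using s.min_int_poly_hom[OF alg that] by (simp add: ht_def)
    \<comment> \<open>Here \<sigma> preserves \<open>ht\<close> and commutes with f, as it fixes c.
      Since hh and \<open>ht\<close> differ by at most B along both orbits, the doubling argument
      makes hh invariant too.\<close>
    have hh\<sigma>: "hh (\<sigma> x) = hh x" if x: "x \<in> ?L" for x
    proof -
      have "2 ^ j * \<bar>hh (\<sigma> x) - hh x\<bar> \<le> 2 * B" for j
      proof -
        have "2 ^ j * \<bar>hh (\<sigma> x) - hh x\<bar> = \<bar>hh ((?f ^^ j) (\<sigma> x)) - hh ((?f ^^ j) x)\<bar>"
          by (simp add: hh_iterate right_diff_distrib[symmetric] abs_mult)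
        also have "\<dots> \<le> 2 * B"
          using B[of "(?f ^^ j) (\<sigma> x)"] B[of "(?f ^^ j) x"] f\<sigma>[OF x, of j] ht\<sigma>[OF fL[OF x, of j]] by simp
        finally show ?thesis .
      qed
      hence "\<bar>hh (\<sigma> x) - hh x\<bar> \<le> 0" by (rule pow2_bounded_nonpos)
      thus ?thesis by simp
    qed
    define Y where "Y = (?f ^^ k) ((?f ^^ m) \<alpha>)"
    define Z where "Z = (?f ^^ k) (\<sigma> \<alpha>)"
    have hY: "hh Y = 2 ^ (k + m) * hh \<alpha>" by (simp add: Y_def hh_iterate power_add)
    have hZ: "hh Z = 2 ^ k * hh \<alpha>" by (simp add: Z_def hh_iterate hh\<sigma>[OF \<alpha>L])
    have "Y \<noteq> Z"
    proof
      assume "Y = Z"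
      hence "2 ^ m * hh \<alpha> = hh \<alpha>" using hY hZ by (simp add: power_add)
      moreover have "(2::real) ^ m > 1" using m(1) by simp
      ultimately have "hh \<alpha> = 0" by auto
      hence "preperiodic (unicritical_quadratic c) \<alpha>" by (rule preperiodic_if_canonical_height_0[OF alg spec(2) B])
      thus False using \<alpha>(2) by simp
    qed
    have "bilinear_multiple (of_int (2 ^ Suc k)) Y Z" unfolding Y_def Z_def
      by (rule bilinear_multiple_iterate[OF alg ci bilinear_multiple_frobenius[OF alg ci \<sigma>(1,3) \<alpha>L m(3)]])
    then obtain b where b: "\<And>i j. algebraic_int (b i j)"
      "Y - Z = of_int (2 ^ Suc k) * (\<Sum>i\<le>(1::nat). (\<Sum>j\<le>(1::nat). b i j * Z ^ j) * Y ^ i)"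
      unfolding bilinear_multiple_def by blast
    have "ln (of_int (2 ^ Suc k)) \<le> ln 2 + ht Y + ht Z"
      by (rule height_inequality[OF alg \<open>Y \<noteq> Z\<close> _ b]) simp
    moreover have "ln (of_int (2 ^ Suc k) :: real) = ln 2 + real k * ln 2"
      by (simp add: ln_mult ln_realpow)
    ultimately have "real k * ln 2 \<le> ht Y + ht Z" by simp
    also have "\<dots> \<le> (2 ^ (k + m) + 2 ^ k) * hh \<alpha> + 2 * B"
      using B[of Y] B[of Z] hY hZ by (simp add: distrib_right)
    finally have "1 \<le> (2 ^ (k + m) + 2 ^ k) * hh \<alpha>" using k by linarith
    moreover have "(2 ^ (k + m) + 2 ^ k :: real) > 0" by (simp add: add_pos_pos)
    ultimately show ?thesis by (simp add: C_def field_simps)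
  qed
  moreover have "C > 0" unfolding C_def by (simp add: add_pos_pos)
  ultimately show ?thesis unfolding hh_def by blast
qed

end
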